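(* (i) If $\Lambda$ is a cyclic non-selfinjective Nakayama algebra of infinite global dimension, then there exists a non-negative integer $k$ such that $\varepsilon^k(\Lambda)$ is not selfinjective and $\varepsilon^{k+1}(\Lambda)$ is a selfinjective Nakayama algebra. (ii) If $\Lambda$ is a cyclic connected Nakayama algebra of finite global dimension, then there exists a non-negative integer $k$ such that $\varepsilon^k(\Lambda)$ is a cyclic connected Nakayama algebra and $\varepsilon^{k+1}(\Lambda)$ is not cyclic; the algebra $\varepsilon^{k+1}(\Lambda)$ is a direct product of components each of which is either a linear Nakayama algebra or semisimple.
   Context: $\mathbb{K}$ is an algebraically closed field; modules are finitely generated right modules. A Nakayama algebra is a bound quiver algebra all of whose indecomposable modules are uniserial; a connected one is linear or cyclic according to whether its quiver is a linearly oriented $\mathbb{A}_n$ or an oriented cycle. Cyclic Nakayama algebra: $\Lambda=\mathbb{K}Q/I$, where $Q$ is the cyclic quiver with vertices $1,\dots,N$ ($N\ge 2$) and arrows $\alpha_i:i\to i+1$ (with $\alpha_N:N\to 1$; indices modulo $N$), and $I$ is generated by an irredundant system of $r\ge1$ relations, each a path of length at least two. (The same definitions are used when a rank one algebra, whose quiver is one loop, arises as a syzygy filtered algebra.) $S_i$ is the simple module at vertex $i$, and $P(S_i)$ its projective cover, which is uniserial with composition factors $S_i,S_{i+1},\dots$ from the top. For simple modules write $\tau S_i:=S_{i+1}$. For a cyclic Nakayama algebra $A$, $\mathcal S(A)$ is the set of isomorphism classes of socles of indecomposable projective $A$-modules and $\mathcal S'(A)=\{\tau S: S\in\mathcal S(A)\}$.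 The syzygy filtered algebra is $\varepsilon(A):=\mathrm{End}_A\big(\bigoplus_{S\in\mathcal S'(A)}P(S)\big)$. Higher syzygy filtered algebras are defined recursively: $\varepsilon^0(\Lambda)=\Lambda$ and $\varepsilon^{n}(\Lambda)=\varepsilon(\varepsilon^{n-1}(\Lambda))$, provided that $\varepsilon^{n-1}(\Lambda)$ is a cyclic Nakayama algebra. *)

theory Defs
  imports
    "HOL-Algebra.QuotRing"
    "HOL-Algebra.Module"
    "HOL-Computational_Algebra.Polynomial"
    "HOL-Library.Extended_Nat"
    "HOL-Library.FuncSet"
    "Graph_Theory.Arc_Walk"
begin

hide_const (open) Multiset.mult Polynomial.smult

section \<open>Associative algebras over a field and their right modules\<close>

text \<open>
  The record \<^type>\<open>module\<close> serves two purposes. For an algebra \<open>A\<close> over the field of type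
  \<open>'k\<close> the operation \<open>c \<odot>\<^bsub>A\<^esub> x\<close> is multiplication by a scalar. For a right \<open>A\<close>-module \<open>M\<close>
  the operation \<open>a \<odot>\<^bsub>M\<^esub> m\<close> is the right action \<open>m \<cdot> a\<close>, and the fields for multiplication and
  one are irrelevant.
\<close>

locale k_algebra = ring A for A :: "('k::field, 'a) module" (structure) +
  assumes scal_closed: "x \<in> carrier A \<Longrightarrow> c \<odot> x \<in> carrier A"
    and scal_add_left: "x \<in> carrier A \<Longrightarrow> (c + d) \<odot> x = c \<odot> x \<oplus> d \<odot> x"
    and scal_add_right: "\<lbrakk>x \<in> carrier A; y \<in> carrier A\<rbrakk> \<Longrightarrow> c \<odot> (x \<oplus> y) = c \<odot> x \<oplus> c \<odot> y"
    and scal_scal: "x \<in> carrier A \<Longrightarrow> (c * d) \<odot> x = c \<odot> (d \<odot> x)"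
    and scal_one: "x \<in> carrier A \<Longrightarrow> 1 \<odot> x = x"
    and scal_mult_left: "\<lbrakk>x \<in> carrier A; y \<in> carrier A\<rbrakk> \<Longrightarrow> c \<odot> (x \<otimes> y) = (c \<odot> x) \<otimes> y"
    and scal_mult_right: "\<lbrakk>x \<in> carrier A; y \<in> carrier A\<rbrakk> \<Longrightarrow> c \<odot> (x \<otimes> y) = x \<otimes> (c \<odot> y)"

definition alg_isomorphic :: "('k::field, 'a) module \<Rightarrow> ('k, 'b) module \<Rightarrow> bool" where
  "alg_isomorphic A B \<longleftrightarrow> k_algebra A \<and> k_algebra B \<and>
     (\<exists>f \<in> ring_iso A B. \<forall>c. \<forall>x \<in> carrier A. f (c \<odot>\<^bsub>A\<^esub> x) = c \<odot>\<^bsub>B\<^esub> f x)"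

definition connected_algebra :: "('k::field, 'a) module \<Rightarrow> bool" where
  "connected_algebra A \<longleftrightarrow> k_algebra A \<and> \<one>\<^bsub>A\<^esub> \<noteq> \<zero>\<^bsub>A\<^esub> \<and>
     (\<forall>e \<in> carrier A. e \<otimes>\<^bsub>A\<^esub> e = e \<and> (\<forall>x \<in> carrier A. e \<otimes>\<^bsub>A\<^esub> x = x \<otimes>\<^bsub>A\<^esub> e) \<longrightarrow> e = \<zero>\<^bsub>A\<^esub> \<or> e = \<one>\<^bsub>A\<^esub>)"

locale right_module = R?: ring A + M?: abelian_group M
  for A :: "('k::field, 'a) module" (structure) and M :: "('a, 'm) module" +
  assumes act_closed: "\<lbrakk>a \<in> carrier A; m \<in> carrier M\<rbrakk> \<Longrightarrow> a \<odot>\<^bsub>M\<^esub> m \<in> carrier M"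
    and act_add_left: "\<lbrakk>a \<in> carrier A; b \<in> carrier A; m \<in> carrier M\<rbrakk>
          \<Longrightarrow> (a \<oplus> b) \<odot>\<^bsub>M\<^esub> m = a \<odot>\<^bsub>M\<^esub> m \<oplus>\<^bsub>M\<^esub> b \<odot>\<^bsub>M\<^esub> m"
    and act_add_right: "\<lbrakk>a \<in> carrier A; m \<in> carrier M; n \<in> carrier M\<rbrakk>
          \<Longrightarrow> a \<odot>\<^bsub>M\<^esub> (m \<oplus>\<^bsub>M\<^esub> n) = a \<odot>\<^bsub>M\<^esub> m \<oplus>\<^bsub>M\<^esub> a \<odot>\<^bsub>M\<^esub> n"
    and act_mult: "\<lbrakk>a \<in> carrier A; b \<in> carrier A; m \<in> carrier M\<rbrakk>
          \<Longrightarrow> (a \<otimes> b) \<odot>\<^bsub>M\<^esub> m = b \<odot>\<^bsub>M\<^esub> (a \<odot>\<^bsub>M\<^esub> m)"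
    and act_one: "m \<in> carrier M \<Longrightarrow> \<one> \<odot>\<^bsub>M\<^esub> m = m"

definition regular_module :: "('k::field, 'a) module \<Rightarrow> ('a, 'a) module" where
  "regular_module A =
     \<lparr>carrier = carrier A, mult = mult A, one = \<one>\<^bsub>A\<^esub>, zero = \<zero>\<^bsub>A\<^esub>, add = add A,
      smult = (\<lambda>a m. m \<otimes>\<^bsub>A\<^esub> a)\<rparr>"

definition fg_module :: "('k::field, 'a) module \<Rightarrow> ('a, 'm) module \<Rightarrow> bool" where
  "fg_module A M \<longleftrightarrow> right_module A M \<and>
     (\<exists>X. finite X \<and> X \<subseteq> carrier M \<and> (\<forall>U. submodule U A M \<and> X \<subseteq> U \<longrightarrow> U = carrier M))"

definition rhom :: "('k::field, 'a) module \<Rightarrow> ('a, 'm) module \<Rightarrow> ('a, 'n) module \<Rightarrow> ('m \<Rightarrow> 'n) set" where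
  "rhom A M N = {f \<in> carrier M \<rightarrow> carrier N.
     (\<forall>x \<in> carrier M. \<forall>y \<in> carrier M. f (x \<oplus>\<^bsub>M\<^esub> y) = f x \<oplus>\<^bsub>N\<^esub> f y) \<and>
     (\<forall>a \<in> carrier A. \<forall>x \<in> carrier M. f (a \<odot>\<^bsub>M\<^esub> x) = a \<odot>\<^bsub>N\<^esub> f x)}"

definition mod_isomorphic :: "('k::field, 'a) module \<Rightarrow> ('a, 'm) module \<Rightarrow> ('a, 'n) module \<Rightarrow> bool" where
  "mod_isomorphic A M N \<longleftrightarrow> (\<exists>f \<in> rhom A M N. bij_betw f (carrier M) (carrier N))"

definition simple_module :: "('k::field, 'a) module \<Rightarrow> ('a, 'm) module \<Rightarrow> bool" where
  "simple_module A M \<longleftrightarrow> right_module A M \<and> carrier M \<noteq> {\<zero>\<^bsub>M\<^esub>} \<and>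
     (\<forall>U. submodule U A M \<longrightarrow> U = {\<zero>\<^bsub>M\<^esub>} \<or> U = carrier M)"

definition socle :: "('k::field, 'a) module \<Rightarrow> ('a, 'm) module \<Rightarrow> 'm set" where
  "socle A M = \<Inter>{U. submodule U A M \<and>
     (\<forall>T. submodule T A M \<and> simple_module A (M\<lparr>carrier := T\<rparr>) \<longrightarrow> T \<subseteq> U)}"

definition uniserial :: "('k::field, 'a) module \<Rightarrow> ('a, 'm) module \<Rightarrow> bool" where
  "uniserial A M \<longleftrightarrow> (\<forall>U V. submodule U A M \<and> submodule V A M \<longrightarrow> U \<subseteq> V \<or> V \<subseteq> U)"

definition indecomposable :: "('k::field, 'a) module \<Rightarrow> ('a, 'm) module \<Rightarrow> bool" where
  "indecomposable A M \<longleftrightarrow> carrier M \<noteq> {\<zero>\<^bsub>M\<^esub>} \<and>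
     (\<forall>U V. submodule U A M \<and> submodule V A M \<and>
        U \<inter> V = {\<zero>\<^bsub>M\<^esub>} \<and> U <+>\<^bsub>M\<^esub> V = carrier M \<longrightarrow> U = {\<zero>\<^bsub>M\<^esub>} \<or> V = {\<zero>\<^bsub>M\<^esub>})"


section \<open>Homological notions\<close>

text \<open>
  A quantifier over all finitely generated modules has to range over modules with elements of one
  fixed type. We take the type \<open>nat \<Rightarrow> 'k\<close>: every finitely generated module over a
  finite-dimensional algebra over \<open>'k\<close> is isomorphic to one with underlying set
  \<open>{v. \<forall>i\<ge>d. v i = 0}\<close>, where \<open>d\<close> is its dimension. Likewise, every finite-dimensional algebra is
  isomorphic to one with elements of this type.
\<close>

definition projective :: "('k::field, 'a) module \<Rightarrow> ('a, 'm) module \<Rightarrow> bool" where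
  "projective A P \<longleftrightarrow> right_module A P \<and>
     (\<forall>(X :: ('a, nat \<Rightarrow> 'k) module) (Y :: ('a, nat \<Rightarrow> 'k) module) g f.
        fg_module A X \<and> fg_module A Y \<and> g \<in> rhom A X Y \<and> g ` carrier X = carrier Y \<and> f \<in> rhom A P Y
        \<longrightarrow> (\<exists>h \<in> rhom A P X. \<forall>p \<in> carrier P. g (h p) = f p))"

definition injective :: "('k::field, 'a) module \<Rightarrow> ('a, 'm) module \<Rightarrow> bool" where
  "injective A E \<longleftrightarrow> right_module A E \<and>
     (\<forall>(X :: ('a, nat \<Rightarrow> 'k) module) (Y :: ('a, nat \<Rightarrow> 'k) module) g f.
        fg_module A X \<and> fg_module A Y \<and> g \<in> rhom A X Y \<and> inj_on g (carrier X) \<and> f \<in> rhom A X E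
        \<longrightarrow> (\<exists>h \<in> rhom A Y E. \<forall>x \<in> carrier X. h (g x) = f x))"

definition selfinjective :: "('k::field, 'a) module \<Rightarrow> bool" where
  "selfinjective A \<longleftrightarrow> injective A (regular_module A)"

definition projective_cover :: "('k::field, 'a) module \<Rightarrow> ('a, 'm) module \<Rightarrow> ('a, 'n) module \<Rightarrow> bool" where
  "projective_cover A P S \<longleftrightarrow> fg_module A P \<and> projective A P \<and>
     (\<exists>f \<in> rhom A P S. f ` carrier P = carrier S \<and>
        (\<forall>U. submodule U A P \<and> U <+>\<^bsub>P\<^esub> a_kernel P S f = carrier P \<longrightarrow> U = carrier P))"

text \<open>An exact sequence \<open>0 \<rightarrow> P n \<rightarrow> \<dots> \<rightarrow> P 0 \<rightarrow> M \<rightarrow> 0\<close>, where \<open>d 0 : P 0 \<rightarrow> M\<close>.\<close>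

definition has_proj_resolution ::
    "('k::field, 'a) module \<Rightarrow> ('a, nat \<Rightarrow> 'k) module \<Rightarrow> nat \<Rightarrow> bool" where
  "has_proj_resolution A M n \<longleftrightarrow>
     (\<exists>(P :: nat \<Rightarrow> ('a, nat \<Rightarrow> 'k) module) d.
        (\<forall>i\<le>n. fg_module A (P i) \<and> projective A (P i)) \<and>
        d 0 \<in> rhom A (P 0) M \<and> d 0 ` carrier (P 0) = carrier M \<and>
        (\<forall>i<n. d (Suc i) \<in> rhom A (P (Suc i)) (P i) \<and>
           d (Suc i) ` carrier (P (Suc i)) = a_kernel (P i) (if i = 0 then M else P (i - 1)) (d i)) \<and>
        inj_on (d n) (carrier (P n)))"

definition proj_dim :: "('k::field, 'a) module \<Rightarrow> ('a, nat \<Rightarrow> 'k) module \<Rightarrow> enat" where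
  "proj_dim A M = Inf {enat n | n. has_proj_resolution A M n}"

definition global_dim :: "('k::field, 'a) module \<Rightarrow> enat" where
  "global_dim A = Sup {proj_dim A M | M :: ('a, nat \<Rightarrow> 'k) module. fg_module A M}"

definition semisimple_algebra :: "('k::field, 'a) module \<Rightarrow> bool" where
  "semisimple_algebra A \<longleftrightarrow> k_algebra A \<and> socle A (regular_module A) = carrier A"


section \<open>Endomorphism algebras and direct products\<close>

definition end_algebra :: "('k::field, 'a) module \<Rightarrow> ('a, 'm) module \<Rightarrow> ('k, 'm \<Rightarrow> 'm) module" where
  "end_algebra A M =
     \<lparr>carrier = rhom A M M \<inter> extensional (carrier M),
      mult = (\<lambda>f g. compose (carrier M) f g),
      one = (\<lambda>m \<in> carrier M. m),
      zero = (\<lambda>m \<in> carrier M. \<zero>\<^bsub>M\<^esub>),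
      add = (\<lambda>f g. \<lambda>m \<in> carrier M. f m \<oplus>\<^bsub>M\<^esub> g m),
      smult = (\<lambda>c f. \<lambda>m \<in> carrier M. (c \<odot>\<^bsub>A\<^esub> \<one>\<^bsub>A\<^esub>) \<odot>\<^bsub>M\<^esub> f m)\<rparr>"

text \<open>
  The componentwise structure on a product; used for direct products of algebras and, with a finite
  index set, for direct sums of modules.
\<close>

definition direct_product :: "'i set \<Rightarrow> ('i \<Rightarrow> ('s, 'm) module) \<Rightarrow> ('s, 'i \<Rightarrow> 'm) module" where
  "direct_product J M =
     \<lparr>carrier = (\<Pi>\<^sub>E i\<in>J. carrier (M i)),
      mult = (\<lambda>f g. \<lambda>i\<in>J. f i \<otimes>\<^bsub>M i\<^esub> g i),
      one = (\<lambda>i\<in>J. \<one>\<^bsub>M i\<^esub>),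
      zero = (\<lambda>i\<in>J. \<zero>\<^bsub>M i\<^esub>),
      add = (\<lambda>f g. \<lambda>i\<in>J. f i \<oplus>\<^bsub>M i\<^esub> g i),
      smult = (\<lambda>s f. \<lambda>i\<in>J. s \<odot>\<^bsub>M i\<^esub> f i)\<rparr>"


section \<open>Bound quiver algebras\<close>

text \<open>
  A quiver is a directed multigraph \<^type>\<open>pre_digraph\<close>. A path is a pair of its starting vertex
  and its list of arrows, read from left to right; \<open>(u, [])\<close> is the trivial path at \<open>u\<close>. Since
  \<open>p q\<close> means first \<open>p\<close>, then \<open>q\<close>, the right module \<open>e\<^sub>u A\<close> is spanned by paths that start at \<open>u\<close>.
\<close>

type_synonym ('v, 'e) path = "'v \<times> 'e list"

definition paths :: "('v, 'e) pre_digraph \<Rightarrow> ('v, 'e) path set" where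
  "paths Q = {(u, p). \<exists>v. pre_digraph.awalk Q u p v}"

definition path_algebra :: "('v, 'e) pre_digraph \<Rightarrow> ('k::field, ('v, 'e) path \<Rightarrow> 'k) module" where
  "path_algebra Q =
     \<lparr>carrier = {f. finite {p. f p \<noteq> 0} \<and> {p. f p \<noteq> 0} \<subseteq> paths Q},
      mult = (\<lambda>f g (u, p). \<Sum>i\<le>length p.
                f (u, take i p) * g (pre_digraph.awlast Q u (take i p), drop i p)),
      one = (\<lambda>(u, p). if u \<in> verts Q \<and> p = [] then 1 else 0),
      zero = (\<lambda>_. 0),
      add = (\<lambda>f g p. f p + g p),
      smult = (\<lambda>c f p. c * f p)\<rparr>"

text \<open>The \<open>m\<close>-th power of the arrow ideal, spanned by the paths of length at least \<open>m\<close>.\<close>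

definition arrow_ideal_power :: "('v, 'e) pre_digraph \<Rightarrow> nat \<Rightarrow> (('v, 'e) path \<Rightarrow> 'k::field) set" where
  "arrow_ideal_power Q m =
     {f \<in> carrier (path_algebra Q). \<forall>u p. f (u, p) \<noteq> 0 \<longrightarrow> m \<le> length p}"

definition admissible :: "('v, 'e) pre_digraph \<Rightarrow> (('v, 'e) path \<Rightarrow> 'k::field) set \<Rightarrow> bool" where
  "admissible Q I \<longleftrightarrow> ideal I (path_algebra Q) \<and> I \<subseteq> arrow_ideal_power Q 2 \<and>
     (\<exists>m\<ge>2. arrow_ideal_power Q m \<subseteq> I)"

definition quotient_algebra :: "('k::field, 'a) module \<Rightarrow> 'a set \<Rightarrow> ('k, 'a set) module" where
  "quotient_algebra A I =
     \<lparr>carrier = carrier (A Quot I), mult = mult (A Quot I), one = one (A Quot I),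
      zero = zero (A Quot I), add = add (A Quot I),
      smult = (\<lambda>c X. \<Union>x\<in>X. I +>\<^bsub>A\<^esub> (c \<odot>\<^bsub>A\<^esub> x))\<rparr>"

abbreviation bound_quiver_algebra ::
    "('v, 'e) pre_digraph \<Rightarrow> (('v, 'e) path \<Rightarrow> 'k) set \<Rightarrow> ('k::field, (('v, 'e) path \<Rightarrow> 'k) set) module" where
  "bound_quiver_algebra Q I \<equiv> quotient_algebra (path_algebra Q) I"

text \<open>
  The simple module at the vertex \<open>u\<close>: the residue class of \<open>f\<close> acts as the coefficient of \<open>f\<close> at
  the trivial path, which does not depend on the representative \<open>f\<close> if \<open>I\<close> lies in the arrow ideal.
\<close>

definition vertex_simple :: "'v \<Rightarrow> ((('v, 'e) path \<Rightarrow> 'k::field) set, 'k) module" where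
  "vertex_simple u =
     \<lparr>carrier = UNIV, mult = (*), one = 1, zero = 0, add = (+),
      smult = (\<lambda>X m. m * (SOME f. f \<in> X) (u, []))\<rparr>"


section \<open>Nakayama algebras\<close>

definition indecomposables_uniserial :: "('k::field, 'a) module \<Rightarrow> bool" where
  "indecomposables_uniserial A \<longleftrightarrow>
     (\<forall>M :: ('a, nat \<Rightarrow> 'k) module. fg_module A M \<and> indecomposable A M \<longrightarrow> uniserial A M)"

definition nakayama_algebra :: "('k::field, 'a) module \<Rightarrow> bool" where
  "nakayama_algebra A \<longleftrightarrow>
     (\<exists>(Q :: (nat, nat) pre_digraph) I. fin_digraph Q \<and> verts Q \<noteq> {} \<and> admissible Q I \<and>
        alg_isomorphic A (bound_quiver_algebra Q I)) \<and>
     indecomposables_uniserial A"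

definition linear_quiver :: "nat \<Rightarrow> (nat, nat) pre_digraph" where
  "linear_quiver n = \<lparr>verts = {..<n}, arcs = {i. Suc i < n}, tail = (\<lambda>i. i), head = Suc\<rparr>"

definition linear_nakayama_algebra :: "('k::field, 'a) module \<Rightarrow> bool" where
  "linear_nakayama_algebra A \<longleftrightarrow>
     (\<exists>n\<ge>1. \<exists>I. admissible (linear_quiver n) I \<and>
        alg_isomorphic A (bound_quiver_algebra (linear_quiver n) I)) \<and>
     indecomposables_uniserial A"

text \<open>The vertices \<open>1, \<dots>, N\<close> are numbered \<open>0, \<dots>, N - 1\<close>, and the arrow \<open>i\<close> starts at \<open>i\<close>.\<close>

definition cyclic_quiver :: "nat \<Rightarrow> (nat, nat) pre_digraph" where
  "cyclic_quiver N =
     \<lparr>verts = {..<N}, arcs = {..<N}, tail = (\<lambda>i. i), head = (\<lambda>i. Suc i mod N)\<rparr>"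

definition path_vector :: "('v, 'e) path \<Rightarrow> ('v, 'e) path \<Rightarrow> 'k::field" where
  "path_vector p = (\<lambda>q. if q = p then 1 else 0)"

definition relation_ideal ::
    "('v, 'e) pre_digraph \<Rightarrow> ('v, 'e) path set \<Rightarrow> (('v, 'e) path \<Rightarrow> 'k::field) set" where
  "relation_ideal Q R = Idl\<^bsub>path_algebra Q\<^esub> (path_vector ` R)"

definition cyclic_algebra ::
    "nat \<Rightarrow> (nat, nat) path set \<Rightarrow> ('k::field, ((nat, nat) path \<Rightarrow> 'k) set) module" where
  "cyclic_algebra N R =
     bound_quiver_algebra (cyclic_quiver N) (relation_ideal (cyclic_quiver N) R)"

text \<open>
  An irredundant system of relations; irredundancy refers to the ideals over the field \<open>'k\<close>.
\<close>

definition cyclic_relations :: "'k::field itself \<Rightarrow> nat \<Rightarrow> (nat, nat) path set \<Rightarrow> bool" where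
  "cyclic_relations _ N R \<longleftrightarrow> finite R \<and> R \<noteq> {} \<and> R \<subseteq> paths (cyclic_quiver N) \<and>
     (\<forall>(u, p) \<in> R. 2 \<le> length p) \<and>
     (\<forall>\<rho> \<in> R. (path_vector \<rho> :: _ \<Rightarrow> 'k) \<notin> relation_ideal (cyclic_quiver N) (R - {\<rho>}))"

definition cyclic_nakayama_of_rank :: "nat \<Rightarrow> ('k::field, 'a) module \<Rightarrow> bool" where
  "cyclic_nakayama_of_rank N A \<longleftrightarrow> 1 \<le> N \<and>
     (\<exists>R. cyclic_relations TYPE('k) N R \<and> alg_isomorphic A (cyclic_algebra N R))"

text \<open>This includes rank one, where the quiver is a loop.\<close>

definition cyclic_nakayama_algebra :: "('k::field, 'a) module \<Rightarrow> bool" where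
  "cyclic_nakayama_algebra A \<longleftrightarrow> (\<exists>N. cyclic_nakayama_of_rank N A)"


section \<open>Syzygy filtered algebras\<close>

text \<open>Isomorphism classes of simple modules are represented by the vertices of the quiver.\<close>

definition socle_vertices :: "'k::field itself \<Rightarrow> nat \<Rightarrow> (nat, nat) path set \<Rightarrow> nat set" where
  "socle_vertices _ N R = (let A = cyclic_algebra N R :: ('k, ((nat, nat) path \<Rightarrow> 'k) set) module in
     {j. j < N \<and> (\<exists>P :: (((nat, nat) path \<Rightarrow> 'k) set, nat \<Rightarrow> 'k) module.
        fg_module A P \<and> projective A P \<and> indecomposable A P \<and>
        mod_isomorphic A (P\<lparr>carrier := socle A P\<rparr>) (vertex_simple j))})"

definition shifted_socle_vertices :: "'k::field itself \<Rightarrow> nat \<Rightarrow> (nat, nat) path set \<Rightarrow> nat set" where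
  "shifted_socle_vertices K N R = (\<lambda>j. Suc j mod N) ` socle_vertices K N R"

text \<open>
  \<open>B\<close> is the syzygy filtered algebra of the cyclic Nakayama algebra \<open>A\<close>. This determines \<open>B\<close> up to
  isomorphism, so it is a relation rather than a function; it never holds if \<open>A\<close> is not a cyclic
  Nakayama algebra.
\<close>

definition is_syzygy_filtered :: "('k::field, 'a) module \<Rightarrow> ('k, 'b) module \<Rightarrow> bool" where
  "is_syzygy_filtered A B \<longleftrightarrow>
     (\<exists>N R (P :: nat \<Rightarrow> (((nat, nat) path \<Rightarrow> 'k) set, nat \<Rightarrow> 'k) module).
        1 \<le> N \<and> cyclic_relations TYPE('k) N R \<and>
        alg_isomorphic A (cyclic_algebra N R) \<and>
        (\<forall>j \<in> shifted_socle_vertices TYPE('k) N R.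
           projective_cover (cyclic_algebra N R) (P j) (vertex_simple j)) \<and>
        alg_isomorphic B
          (end_algebra (cyclic_algebra N R) (direct_product (shifted_socle_vertices TYPE('k) N R) P)))"

definition is_syzygy_filtered_power ::
    "nat \<Rightarrow> ('k::field, 'a) module \<Rightarrow> ('k, nat \<Rightarrow> 'k) module \<Rightarrow> bool" where
  "is_syzygy_filtered_power n L B \<longleftrightarrow>
     (\<exists>A :: ('k, nat \<Rightarrow> 'k) module. alg_isomorphic L A \<and> (is_syzygy_filtered ^^ n) A B)"

end

theory Submission
  imports Defs "HOL-Library.Infinite_Set"
begin

text \<open>
  The theorem is about one monotone function. Number the vertices of the cycle by the natural numbers
  modulo \<open>N\<close>, let \<open>c i\<close> be the length of \<open>P(i)\<close>, and put \<open>F i = i + c i\<close>. Indecomposable modules are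
  intervals: the uniserial module with composition factors \<open>S\<^sub>a, \<dots>, S\<^sub>b\<^sub>-\<^sub>1\<close> is \<open>[a, b)\<close> with \<open>b \<le> F a\<close>, its
  projective cover is \<open>P(a) = [a, F a)\<close>, its first syzygy is \<open>[b, F a)\<close>, and its second syzygy is
  \<open>[F a, F b)\<close>. So taking second syzygies is applying \<open>F\<close> to both ends of an interval.

  Three properties of the algebra can be read off from \<open>F\<close>. It is selfinjective if and only if \<open>c\<close> is
  constant; otherwise \<open>F\<close> takes equal values at two neighbours \<open>i\<close> and \<open>i + 1\<close>, and then \<open>P(i + 1)\<close>, a
  radical of a projective, is not injective (\<open>constant_selfinjective\<close>, \<open>collision_not_selfinjective\<close>,
  \<open>constant_or_collision\<close>). It has finite global dimension if and only if the orbits of \<open>a\<close> and \<open>a + 1\<close>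
  under \<open>F\<close> merge, up to a shift by one step, for all \<open>a\<close> (\<open>finite_global_dim\<close>,
  \<open>infinite_global_dim\<close>). And it is cyclic if and only if \<open>c i \<ge> 2\<close> for all \<open>i\<close>
  (\<open>cyclic_nakayama_if_two\<close>, \<open>not_cyclic_if_one\<close>).

  The socle of \<open>P(i)\<close> is the simple module at \<open>F i - 1\<close>, so \<open>\<epsilon>\<close> keeps the projectives at the vertices
  in the image of \<open>F\<close>. The endomorphism algebra of their sum is \<open>e A e\<close> for the corresponding idempotent
  \<open>e\<close>, and its jump function is the restriction of \<open>F\<close> to the image of \<open>F\<close> (\<open>end_nak\<close>,
  \<open>syzygy_filtered_red\<close>). Merging of orbits is not affected by this restriction, and the rank drops
  whenever \<open>c\<close> is not constant.

  If orbits do not merge, then no \<open>c i\<close> is ever \<open>1\<close> (\<open>orbits_merge_if_one\<close>), so all members of the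
  sequence are cyclic and the rank drops until \<open>c\<close> is constant; the step before is the required \<open>k\<close>
  (\<open>reduction_to_constant\<close>). If orbits merge, then \<open>c\<close> is never constant with a value of at least two
  (\<open>constant_not_merge\<close>), so the rank drops until some \<open>c i\<close> is \<open>1\<close> (\<open>reduction_to_one\<close>). No nonzero
  path leaves such a vertex, and cutting the cycle there splits the algebra into linear Nakayama
  algebras (\<open>linear_components_if_one\<close>).

  All of this is done in coordinates. The locale \<open>nak\<close> describes an algebra by its coefficients at the
  nonzero paths, and two algebras with the same \<open>N\<close> and \<open>c\<close> are isomorphic (\<open>nak_isomorphic\<close>). That every
  finitely generated module is a direct sum of intervals (\<open>fg_decomposition\<close>) is shown by splitting off
  a generator of maximal length.
\<close>

section \<open>Jump functions and their reduction\<close>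

text \<open>
  The vertices of the cycle are unrolled to the natural numbers, so a vertex is a residue class
  modulo the rank \<open>N\<close>, and \<open>c i\<close> is the length of the projective \<open>P(i)\<close>. The composition factors
  of \<open>P(i)\<close> then sit at \<open>i, \<dots>, jump c i - 1\<close>, and \<open>F = jump c\<close> sends the top of \<open>P(i)\<close> to the
  first vertex after its socle.
\<close>

definition jump :: "(nat \<Rightarrow> nat) \<Rightarrow> nat \<Rightarrow> nat" where
  "jump c i = i + c i"

text \<open>
  The successive syzygies of the uniserial module with composition factors at \<open>a, \<dots>, b - 1\<close> begin and
  end at consecutive terms of \<open>a, b, F a, F b, F\<^sup>2 a, F\<^sup>2 b, \<dots>\<close>, and the first equality of consecutive
  terms is the first syzygy that vanishes. With \<open>b = a + 1\<close> the condition says that every simple module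
  has a finite projective resolution.
\<close>

definition orbits_merge :: "(nat \<Rightarrow> nat) \<Rightarrow> bool" where
  "orbits_merge c \<longleftrightarrow> (\<forall>a. \<exists>n. (jump c ^^ n) (Suc a) = (jump c ^^ n) a \<or>
     (jump c ^^ n) (Suc a) = (jump c ^^ Suc n) a)"

text \<open>
  The last condition says that the radical of \<open>P(i)\<close> is a quotient of \<open>P(i + 1)\<close>. Equivalently, the
  jump function is monotone.
\<close>

locale kupisch =
  fixes N :: nat and c :: "nat \<Rightarrow> nat"
  assumes N_pos: "0 < N" and c_pos: "0 < c i" and c_add_N: "c (i + N) = c i"
    and c_step: "c i \<le> Suc (c (Suc i))"
begin

lemma c_add_mult: "c (i + q * N) = c i"
proof (induction q)
  case (Suc q)
  have "c (i + Suc q * N) = c ((i + q * N) + N)" by (simp add: algebra_simps)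
  then show ?case using Suc c_add_N by simp
qed simp

lemma c_mod: "c (i mod N) = c i"
  using c_add_mult[of "i mod N" "i div N"] by simp

lemma jump_Suc_mono: "jump c i \<le> jump c (Suc i)"
  using c_step[of i] by (simp add: jump_def)

lemma jump_mono: "i \<le> j \<Longrightarrow> jump c i \<le> jump c j"
  by (induction rule: dec_induct) (auto intro: order_trans[OF _ jump_Suc_mono])

lemma jump_gt: "i < jump c i"
  using c_pos[of i] by (simp add: jump_def)

lemma jump_add_mult: "jump c (i + q * N) = jump c i + q * N"
  by (simp add: jump_def c_add_mult)

lemma iter_mono: "i \<le> j \<Longrightarrow> (jump c ^^ n) i \<le> (jump c ^^ n) j"
  by (induction n) (auto intro: jump_mono)

lemma iter_add_mult: "(jump c ^^ n) (i + q * N) = (jump c ^^ n) i + q * N"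
  by (induction n) (auto simp: jump_add_mult)

lemma iter_strict: "m < n \<Longrightarrow> (jump c ^^ m) i < (jump c ^^ n) i"
proof (induction n)
  case (Suc n)
  then have "(jump c ^^ m) i \<le> (jump c ^^ n) i" by (auto simp: less_Suc_eq)
  then show ?case using jump_gt[of "(jump c ^^ n) i"] by simp
qed simp

lemma iter_ge: "n + i \<le> (jump c ^^ n) i"
proof (induction n)
  case (Suc n)
  then show ?case using jump_gt[of "(jump c ^^ n) i"] by simp
qed simp

lemma iter_shift: "(jump c ^^ m) ((jump c ^^ n) i) = (jump c ^^ (m + n)) i"
  by (simp add: funpow_add)

text \<open>Merging of neighbouring orbits propagates to all pairs that span a nonzero module.\<close>

lemma orbits_merge_pair:
  assumes "orbits_merge c" "a \<le> b" "b \<le> jump c a"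
  shows "\<exists>n. (jump c ^^ n) b = (jump c ^^ n) a \<or> (jump c ^^ n) b = (jump c ^^ Suc n) a"
proof -
  have "\<exists>n k. (jump c ^^ n) b = (jump c ^^ (n + k)) a"
    using assms(2)
  proof (induction rule: dec_induct)
    case base
    show ?case by (intro exI[of _ 0]) simp
  next
    case (step b)
    then obtain n k where nk: "(jump c ^^ n) b = (jump c ^^ (n + k)) a" by blast
    obtain m d where m: "(jump c ^^ m) (Suc b) = (jump c ^^ (m + d)) b"
      using assms(1) unfolding orbits_merge_def by (metis add.right_neutral add_Suc_right)
    have "(jump c ^^ (n + m)) (Suc b) = (jump c ^^ n) ((jump c ^^ (m + d)) b)"
      by (simp add: m flip: iter_shift)
    also have "\<dots> = (jump c ^^ (m + d)) ((jump c ^^ n) b)"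
      by (simp only: iter_shift add.commute)
    also have "\<dots> = (jump c ^^ (n + m + (d + k))) a"
      by (simp only: nk iter_shift) (simp add: algebra_simps)
    finally show ?case by blast
  qed
  then obtain n k where nk: "(jump c ^^ n) b = (jump c ^^ (n + k)) a" by blast
  have "(jump c ^^ n) b \<le> (jump c ^^ Suc n) a"
    using iter_mono[OF assms(3), of n] by (simp add: funpow_swap1)
  then have "k \<le> 1" using nk iter_strict[of "Suc n" "n + k" a] by (cases "Suc n < n + k") auto
  then have "k = 0 \<or> k = 1" by auto
  then show ?thesis using nk by auto
qed

text \<open>
  If \<open>F j = j + 1\<close>, then no value of \<open>F\<^sup>n\<close> lies strictly between \<open>F\<^sup>n j\<close> and \<open>F\<^sup>n\<^sup>+\<^sup>1 j\<close>. Since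
  the orbit of \<open>j\<close> is eventually periodic modulo \<open>N\<close>, the late members of that orbit are themselves
  values of a fixed power of \<open>F\<close> at translates of \<open>j\<close>, so every other orbit has to run into it.
\<close>

lemma orbits_merge_if_one:
  assumes "c j = 1"
  shows "orbits_merge c"
proof -
  let ?G = "jump c"
  have "\<not> inj (\<lambda>n. (?G ^^ n) j mod N)"
    using N_pos finite_subset[of "range (\<lambda>n. (?G ^^ n) j mod N)" "{..<N}"] range_inj_infinite by fastforce
  then obtain u v' where uv': "u < v'" "(?G ^^ u) j mod N = (?G ^^ v') j mod N"
    by (metis (mono_tags, lifting) injI linorder_neqE_nat)
  define v where "v = v' - u"
  have v: "0 < v" "v' = u + v" using uv' by (auto simp: v_def)
  obtain w where w: "(?G ^^ (u + v)) j = (?G ^^ u) j + w * N"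
  proof -
    have "(?G ^^ u) j \<le> (?G ^^ v') j" using iter_strict[OF uv'(1)] by (simp add: less_imp_le)
    then have "N dvd (?G ^^ v') j - (?G ^^ u) j" using uv'(2) by (metis mod_eq_dvd_iff_nat)
    then show ?thesis using that v(2) \<open>(?G ^^ u) j \<le> (?G ^^ v') j\<close>
      by (metis dvd_def le_add_diff_inverse mult.commute)
  qed
  have per: "(?G ^^ u) (j + (e * w) * N) = (?G ^^ (u + e * v)) j" for e
  proof (induction e)
    case (Suc e)
    have "(?G ^^ (u + Suc e * v)) j = (?G ^^ (e * v)) ((?G ^^ (u + v)) j)"
      by (simp only: iter_shift) (simp add: algebra_simps)
    also have "\<dots> = (?G ^^ (e * v + u)) j + w * N"
      by (simp only: w iter_add_mult iter_shift)
    also have "\<dots> = (?G ^^ u) (j + (e * w) * N) + w * N" using Suc by (simp add: add.commute)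
    also have "\<dots> = (?G ^^ u) (j + (Suc e * w) * N)"
      by (simp only: iter_add_mult) (simp add: algebra_simps)
    finally show ?case by simp
  qed simp
  have gap: "(?G ^^ n) x \<le> (?G ^^ n) (j + q * N) \<or> (?G ^^ Suc n) (j + q * N) \<le> (?G ^^ n) x" for n x q
  proof (cases "x \<le> j + q * N")
    case False
    have "?G (j + q * N) = Suc (j + q * N)" using assms by (simp add: jump_def c_add_mult)
    then have "?G (j + q * N) \<le> x" using False by simp
    then show ?thesis using iter_mono[of "?G (j + q * N)" x n] by (simp add: funpow_swap1)
  qed (simp add: iter_mono)
  have gap': "(?G ^^ n) x \<le> (?G ^^ K) j \<or> (?G ^^ Suc K) j \<le> (?G ^^ n) x" if "u + v \<le> n" "u \<le> K" for n x K
  proof -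
    define e s where "e = (K - u) div v" and "s = (K - u) mod v"
    have "s < v" using v by (simp add: s_def)
    have K: "K = s + (u + e * v)" using that by (simp add: e_def s_def)
    have 1: "(?G ^^ K) j = (?G ^^ (s + u)) (j + (e * w) * N)"
      by (simp only: K per flip: iter_shift)
    have 2: "(?G ^^ Suc K) j = (?G ^^ Suc (s + u)) (j + (e * w) * N)" using 1 by simp
    have 3: "(?G ^^ n) x = (?G ^^ (s + u)) ((?G ^^ (n - (s + u))) x)"
      using that \<open>s < v\<close> by (simp add: iter_shift)
    show ?thesis unfolding 1 2 3 by (rule gap)
  qed
  show ?thesis
    unfolding orbits_merge_def
  proof
    fix a
    define a0 where "a0 = a + j * N"
    have "j \<le> a0" using N_pos by (simp add: a0_def trans_le_add2)
    have "\<exists>m. a0 < (?G ^^ Suc m) j" using iter_ge[of "Suc a0" j] by (intro exI[of _ a0]) simp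
    define m where "m = (LEAST m. a0 < (?G ^^ Suc m) j)"
    have m1: "a0 < (?G ^^ Suc m) j" unfolding m_def by (rule LeastI_ex) fact
    have m2: "(?G ^^ m) j \<le> a0"
    proof (cases m)
      case 0 then show ?thesis using \<open>j \<le> a0\<close> by simp
    next
      case (Suc m')
      then have "m' < (LEAST m. a0 < (?G ^^ Suc m) j)" by (simp only: m_def[symmetric])
      then have "\<not> a0 < (?G ^^ Suc m') j" by (rule not_less_Least)
      then show ?thesis unfolding Suc by (simp only: not_less)
    qed
    define n K where "n = u + v" and "K = n + m"
    have in_orbit: "(?G ^^ n) x = (?G ^^ K) j \<or> (?G ^^ n) x = (?G ^^ Suc K) j"
      if "(?G ^^ m) j \<le> x" "x \<le> (?G ^^ Suc m) j" for x
    proof -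
      have "(?G ^^ K) j \<le> (?G ^^ n) x" using iter_mono[OF that(1), of n] by (simp add: iter_shift K_def)
      moreover have "(?G ^^ n) x \<le> (?G ^^ Suc K) j"
        using iter_mono[OF that(2), of n] unfolding iter_shift K_def by simp
      ultimately show ?thesis using gap'[of n K x] by (auto simp: n_def K_def)
    qed
    have "(?G ^^ n) a0 \<le> (?G ^^ n) (Suc a0)" by (rule iter_mono) simp
    then have "(?G ^^ n) (Suc a0) = (?G ^^ n) a0 \<or> (?G ^^ n) (Suc a0) = (?G ^^ Suc n) a0"
      using in_orbit[of a0] in_orbit[of "Suc a0"] m1 m2 jump_gt[of "(?G ^^ K) j"] by auto
    moreover have "(?G ^^ k) (Suc a0) = (?G ^^ k) (Suc a) + j * N" "(?G ^^ k) a0 = (?G ^^ k) a + j * N" for k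
      using iter_add_mult[of k "Suc a" j] iter_add_mult[of k a j] by (simp_all add: a0_def)
    ultimately show "\<exists>n. (?G ^^ n) (Suc a) = (?G ^^ n) a \<or> (?G ^^ n) (Suc a) = (?G ^^ Suc n) a"
      by (metis add_right_cancel)
  qed
qed

text \<open>
  A periodic function that never decreases is constant, and by \<open>c_step\<close> it decreases by at most one at a
  time. A decrease is a collision of neighbouring values of the jump function.
\<close>

lemma constant_or_collision: "(\<forall>i. c i = c 0) \<or> (\<exists>i. jump c i = jump c (Suc i))"
proof (rule disjCI)
  assume "\<nexists>i. jump c i = jump c (Suc i)"
  then have *: "c i \<le> c (Suc i)" for i
    using jump_Suc_mono[of i] unfolding jump_def
    by (metis add_Suc add_le_cancel_left le_antisym not_less_eq_eq)
  have mono: "i \<le> j \<Longrightarrow> c i \<le> c j" for i j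
    by (induction rule: dec_induct) (auto intro: order_trans[OF _ *])
  show "\<forall>i. c i = c 0"
  proof
    fix i
    have "c i \<le> c (0 + i * N)" using N_pos by (intro mono) simp
    then show "c i = c 0" using mono[of 0 i] c_add_mult[of 0 i] by simp
  qed
qed

lemma constant_not_merge:
  assumes "\<forall>i. c i = c 0" "2 \<le> c 0"
  shows "\<not> orbits_merge c"
proof
  assume "orbits_merge c"
  moreover have "(jump c ^^ n) a = a + n * c 0" for n a
    using assms(1) by (induction n) (auto simp: jump_def)
  ultimately obtain n where "Suc (n * c 0) = n * c 0 \<or> Suc (n * c 0) = Suc n * c 0"
    unfolding orbits_merge_def by (metis add.right_neutral add_Suc add_0)
  then show False using assms(2) by simp
qed

text \<open>
  The reduction restricts the jump function to its image: \<open>targets\<close> is the image modulo \<open>N\<close>, and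
  \<open>nth_lift\<close> numbers its elements in the unrolled picture, so that the restricted function is again
  the jump function of a Kupisch series.
\<close>

definition targets :: "nat set" where "targets = (\<lambda>i. jump c i mod N) ` {..<N}"
definition target_lifts :: "nat set" where "target_lifts = {t. t mod N \<in> targets}"
definition red_rank :: nat where "red_rank = card targets"
definition nth_lift :: "nat \<Rightarrow> nat" where "nth_lift = enumerate target_lifts"
definition lift_index :: "nat \<Rightarrow> nat" where "lift_index t = card {s \<in> target_lifts. s < t}"
definition red_series :: "nat \<Rightarrow> nat" where
  "red_series j = lift_index (jump c (nth_lift j)) - j"

lemma targets_bound: "targets \<subseteq> {..<N}" using N_pos by (auto simp: targets_def)

lemma finite_targets: "finite targets" by (simp add: targets_def)

lemma jump_mod: "jump c (i mod N) mod N = jump c i mod N"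
  unfolding jump_def c_mod by (simp add: mod_simps)

lemma jump_mod_target: "jump c i mod N \<in> targets"
  using N_pos jump_mod[of i, symmetric] by (auto simp: targets_def)

lemma jump_lift: "jump c i \<in> target_lifts"
  by (simp add: target_lifts_def jump_mod_target)

lemma infinite_lifts: "infinite target_lifts"
proof -
  have "\<exists>t\<in>target_lifts. n < t" for n using jump_lift[of n] jump_gt[of n] by blast
  then show ?thesis by (metis infinite_nat_iff_unbounded)
qed

lemma nth_lift_strict: "strict_mono nth_lift"
  using infinite_lifts by (simp add: nth_lift_def strict_mono_def)

lemma nth_lift_less [simp]: "nth_lift i < nth_lift j \<longleftrightarrow> i < j"
  using nth_lift_strict by (rule strict_mono_less)

lemma nth_lift_le [simp]: "nth_lift i \<le> nth_lift j \<longleftrightarrow> i \<le> j"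
  using nth_lift_strict by (rule strict_mono_less_eq)

lemma nth_lift_eq [simp]: "nth_lift i = nth_lift j \<longleftrightarrow> i = j"
  using nth_lift_strict by (rule strict_mono_eq)

lemma range_nth_lift: "range nth_lift = target_lifts"
  using infinite_lifts by (simp add: nth_lift_def range_enumerate)

lemma nth_lift_in: "nth_lift j \<in> target_lifts"
  using range_nth_lift by blast

lemma lift_index_nth [simp]: "lift_index (nth_lift j) = j"
proof -
  have "{s \<in> target_lifts. s < nth_lift j} = nth_lift ` {..<j}"
    unfolding range_nth_lift[symmetric] by auto
  then show ?thesis
    by (simp add: lift_index_def card_image inj_on_def)
qed

lemma nth_lift_index: "t \<in> target_lifts \<Longrightarrow> nth_lift (lift_index t) = t"
  using range_nth_lift by (metis imageE lift_index_nth)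

lemma lifts_below_N: "{s \<in> target_lifts. s < N} = targets"
  using targets_bound by (auto simp: target_lifts_def)

lemma lift_index_add_N: "lift_index (t + N) = lift_index t + red_rank"
proof -
  have eq: "{s \<in> target_lifts. s < t + N} = {s \<in> target_lifts. s < N} \<union> (\<lambda>s. s + N) ` {s \<in> target_lifts. s < t}"
    (is "?A = ?B \<union> ?C")
  proof (intro equalityI subsetI)
    fix s assume s: "s \<in> ?A"
    show "s \<in> ?B \<union> ?C"
    proof (cases "s < N")
      case False
      then have "s = (s - N) + N" by simp
      moreover have "(s - N) mod N = s mod N" using False by (simp add: le_mod_geq)
      ultimately have "s - N \<in> {s \<in> target_lifts. s < t}" "s = (s - N) + N"
        using s False by (auto simp: target_lifts_def)
      then show ?thesis by blast
    qed (use s in auto)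
  qed (use N_pos in \<open>auto simp: target_lifts_def\<close>)
  have "card ?A = card ?B + card ?C" unfolding eq by (rule card_Un_disjoint) auto
  then show ?thesis
    unfolding lift_index_def by (simp add: lifts_below_N red_rank_def card_image)
qed

lemma nth_lift_add_rank: "nth_lift (j + red_rank) = nth_lift j + N"
proof -
  have "nth_lift j + N \<in> target_lifts" using nth_lift_in[of j] by (simp add: target_lifts_def)
  then show ?thesis using nth_lift_index lift_index_add_N[of "nth_lift j"] by fastforce
qed

lemma nth_lift_mod: "nth_lift j mod N \<in> targets"
  using nth_lift_in[of j] by (simp add: target_lifts_def)

lemma nth_lift_jump: "nth_lift (jump red_series j) = jump c (nth_lift j)"
proof -
  have "j \<le> lift_index (jump c (nth_lift j))"
    using jump_gt[of "nth_lift j"] nth_lift_index[OF jump_lift[of "nth_lift j"]]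
    by (metis less_imp_le nth_lift_less)
  then show ?thesis using nth_lift_index[OF jump_lift] by (simp add: jump_def[of red_series] red_series_def)
qed

lemma red_rank_le: "red_rank \<le> N"
  using card_mono[OF _ targets_bound] by (simp add: red_rank_def)

lemma red_rank_pos: "0 < red_rank"
  using N_pos finite_targets by (auto simp: red_rank_def card_gt_0_iff targets_def)

lemma kupisch_red: "kupisch red_rank red_series"
proof
  fix i
  have "nth_lift i < nth_lift (jump red_series i)" using jump_gt by (simp only: nth_lift_jump)
  then show "0 < red_series i" by (simp add: jump_def)
  have "nth_lift (jump red_series (i + red_rank)) = nth_lift (jump red_series i + red_rank)"
    using jump_add_mult[of "nth_lift i" 1] by (simp only: nth_lift_jump nth_lift_add_rank) simp
  then show "red_series (i + red_rank) = red_series i" by (simp add: jump_def)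
  have "nth_lift (jump red_series i) \<le> nth_lift (jump red_series (Suc i))"
    unfolding nth_lift_jump by (intro jump_mono) simp
  then show "red_series i \<le> Suc (red_series (Suc i))" by (simp add: jump_def)
qed (rule red_rank_pos)

lemma nth_lift_iter: "nth_lift ((jump red_series ^^ n) j) = (jump c ^^ n) (nth_lift j)"
  by (induction n) (simp_all add: nth_lift_jump)

text \<open>
  Every orbit of \<open>F\<close> lies in the image of \<open>F\<close> after one step. Hence orbits merge for \<open>F\<close> if and only
  if they merge for its restriction to the image; this lemma and the next give the two directions.
\<close>

lemma red_merge_if_merge:
  assumes "orbits_merge c"
  shows "orbits_merge red_series"
  unfolding orbits_merge_def
proof
  fix j
  have "nth_lift j < nth_lift (jump red_series j)" using jump_gt nth_lift_jump by metis
  then have "nth_lift (Suc j) \<le> nth_lift (jump red_series j)" by simp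
  then obtain n where "(jump c ^^ n) (nth_lift (Suc j)) = (jump c ^^ n) (nth_lift j) \<or>
      (jump c ^^ n) (nth_lift (Suc j)) = (jump c ^^ Suc n) (nth_lift j)"
    using orbits_merge_pair[OF assms, of "nth_lift j" "nth_lift (Suc j)"] nth_lift_jump by auto
  then show "\<exists>n. (jump red_series ^^ n) (Suc j) = (jump red_series ^^ n) j \<or>
      (jump red_series ^^ n) (Suc j) = (jump red_series ^^ Suc n) j"
    unfolding nth_lift_iter[symmetric] nth_lift_eq by blast
qed

lemma merge_if_red_merge:
  assumes "orbits_merge red_series"
  shows "orbits_merge c"
  unfolding orbits_merge_def
proof
  fix a
  interpret red: kupisch red_rank red_series by (rule kupisch_red)
  define j j' where "j = lift_index (jump c a)" and "j' = lift_index (jump c (Suc a))"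
  have j: "nth_lift j = jump c a" "nth_lift j' = jump c (Suc a)"
    by (auto simp: j_def j'_def nth_lift_index jump_lift)
  have "nth_lift j \<le> nth_lift j'" unfolding j by (rule jump_Suc_mono)
  moreover have "nth_lift j' \<le> nth_lift (jump red_series j)"
    unfolding j nth_lift_jump using jump_gt[of a] by (intro jump_mono) simp
  ultimately obtain n where "(jump red_series ^^ n) j' = (jump red_series ^^ n) j \<or>
      (jump red_series ^^ n) j' = (jump red_series ^^ Suc n) j"
    using red.orbits_merge_pair[OF assms, of j j'] by auto
  then have "nth_lift ((jump red_series ^^ n) j') = nth_lift ((jump red_series ^^ n) j) \<or>
      nth_lift ((jump red_series ^^ n) j') = nth_lift ((jump red_series ^^ Suc n) j)"
    by (simp only: nth_lift_eq)
  then have "(jump c ^^ n) (jump c (Suc a)) = (jump c ^^ n) (jump c a) \<or>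
      (jump c ^^ n) (jump c (Suc a)) = (jump c ^^ Suc n) (jump c a)"
    by (simp only: nth_lift_iter j)
  then show "\<exists>n. (jump c ^^ n) (Suc a) = (jump c ^^ n) a \<or> (jump c ^^ n) (Suc a) = (jump c ^^ Suc n) a"
    by (intro exI[of _ "Suc n"]) (simp add: funpow_swap1)
qed

lemma red_rank_less_if_collision:
  assumes "jump c i = jump c (Suc i)"
  shows "red_rank < N"
proof -
  have N: "N \<noteq> 1"
  proof
    assume "N = 1"
    then have "c (Suc i) = c i" using c_add_N[of i] by simp
    then show False using assms by (simp add: jump_def)
  qed
  have "i mod N \<noteq> Suc i mod N" using N N_pos by (auto simp: mod_Suc)
  moreover have "jump c (i mod N) mod N = jump c (Suc i mod N) mod N" using assms by (simp add: jump_mod)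
  ultimately have "\<not> inj_on (\<lambda>i. jump c i mod N) {..<N}"
    using N_pos inj_onD[of "\<lambda>i. jump c i mod N" "{..<N}" "i mod N" "Suc i mod N"] by auto
  then have "red_rank \<noteq> N"
    unfolding red_rank_def targets_def by (metis card_lessThan eq_card_imp_inj_on finite_lessThan)
  then show ?thesis using red_rank_le by simp
qed

end

section \<open>Right modules and their homomorphisms\<close>

context right_module
begin

lemma act_zero_left: assumes "m \<in> carrier M" shows "\<zero> \<odot>\<^bsub>M\<^esub> m = \<zero>\<^bsub>M\<^esub>"
proof -
  have "\<zero> \<odot>\<^bsub>M\<^esub> m \<oplus>\<^bsub>M\<^esub> \<zero> \<odot>\<^bsub>M\<^esub> m = \<zero> \<odot>\<^bsub>M\<^esub> m"
    using act_add_left[of \<zero> \<zero> m] assms act_closed[of \<zero> m] by simp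
  then show ?thesis using assms act_closed[of \<zero> m] by (simp add: M.add.l_cancel_one)
qed

lemma act_zero_right: assumes "a \<in> carrier A" shows "a \<odot>\<^bsub>M\<^esub> \<zero>\<^bsub>M\<^esub> = \<zero>\<^bsub>M\<^esub>"
proof -
  have "a \<odot>\<^bsub>M\<^esub> \<zero>\<^bsub>M\<^esub> \<oplus>\<^bsub>M\<^esub> a \<odot>\<^bsub>M\<^esub> \<zero>\<^bsub>M\<^esub> = a \<odot>\<^bsub>M\<^esub> \<zero>\<^bsub>M\<^esub>"
    using act_add_right[of a "\<zero>\<^bsub>M\<^esub>" "\<zero>\<^bsub>M\<^esub>"] assms act_closed[of a "\<zero>\<^bsub>M\<^esub>"] by simp
  then show ?thesis using assms act_closed[of a "\<zero>\<^bsub>M\<^esub>"] by (simp add: M.add.l_cancel_one)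
qed

lemma act_neg: assumes "a \<in> carrier A" "m \<in> carrier M" shows "(\<ominus> a) \<odot>\<^bsub>M\<^esub> m = \<ominus>\<^bsub>M\<^esub> (a \<odot>\<^bsub>M\<^esub> m)"
proof -
  have "(\<ominus> a) \<odot>\<^bsub>M\<^esub> m \<oplus>\<^bsub>M\<^esub> a \<odot>\<^bsub>M\<^esub> m = \<zero>\<^bsub>M\<^esub>"
    using act_add_left[of "\<ominus> a" a m] assms act_zero_left by (simp add: R.l_neg)
  then show ?thesis using M.minus_equality assms act_closed R.a_inv_closed by metis
qed

lemma minus_add_cancel: "x \<in> carrier M \<Longrightarrow> y \<in> carrier M \<Longrightarrow> (x \<ominus>\<^bsub>M\<^esub> y) \<oplus>\<^bsub>M\<^esub> y = x"
  by (simp add: a_minus_def M.a_assoc M.l_neg)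

lemma submoduleI:
  assumes "U \<subseteq> carrier M" "\<zero>\<^bsub>M\<^esub> \<in> U" "\<And>x y. x \<in> U \<Longrightarrow> y \<in> U \<Longrightarrow> x \<oplus>\<^bsub>M\<^esub> y \<in> U"
    "\<And>a x. a \<in> carrier A \<Longrightarrow> x \<in> U \<Longrightarrow> a \<odot>\<^bsub>M\<^esub> x \<in> U"
  shows "submodule U A M"
proof -
  have "\<ominus>\<^bsub>M\<^esub> x \<in> U" if "x \<in> U" for x
    using act_neg[of \<one> x] act_one[of x] assms(1) assms(4)[of "\<ominus> \<one>" x] that by auto
  then have "subgroup U (add_monoid M)"
    using assms by (intro M.add.subgroupI) (auto simp: a_inv_def)
  then show ?thesis using assms(4) by (simp add: submodule_def submodule_axioms_def)
qed

lemma submoduleD: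
  assumes "submodule U A M"
  shows "U \<subseteq> carrier M" "\<zero>\<^bsub>M\<^esub> \<in> U" "\<And>x y. x \<in> U \<Longrightarrow> y \<in> U \<Longrightarrow> x \<oplus>\<^bsub>M\<^esub> y \<in> U"
    "\<And>a x. a \<in> carrier A \<Longrightarrow> x \<in> U \<Longrightarrow> a \<odot>\<^bsub>M\<^esub> x \<in> U" "\<And>x. x \<in> U \<Longrightarrow> \<ominus>\<^bsub>M\<^esub> x \<in> U"
    "\<And>x y. x \<in> U \<Longrightarrow> y \<in> U \<Longrightarrow> x \<ominus>\<^bsub>M\<^esub> y \<in> U"
proof -
  interpret U: submodule U A M by fact
  show s: "U \<subseteq> carrier M" using U.subset by simp
  show "\<zero>\<^bsub>M\<^esub> \<in> U" using U.one_closed by simp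
  show add: "\<And>x y. x \<in> U \<Longrightarrow> y \<in> U \<Longrightarrow> x \<oplus>\<^bsub>M\<^esub> y \<in> U" using U.m_closed by simp
  show "\<And>a x. a \<in> carrier A \<Longrightarrow> x \<in> U \<Longrightarrow> a \<odot>\<^bsub>M\<^esub> x \<in> U" by simp
  show neg: "\<And>x. x \<in> U \<Longrightarrow> \<ominus>\<^bsub>M\<^esub> x \<in> U" using U.m_inv_closed by (simp add: a_inv_def)
  show "\<And>x y. x \<in> U \<Longrightarrow> y \<in> U \<Longrightarrow> x \<ominus>\<^bsub>M\<^esub> y \<in> U" using add neg by (simp add: a_minus_def)
qed

lemma right_module_sub:
  assumes "submodule U A M"
  shows "right_module A (M\<lparr>carrier := U\<rparr>)"
proof -
  note U = submoduleD[OF assms]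
  have "abelian_group (M\<lparr>carrier := U\<rparr>)"
  proof (rule abelian_groupI; simp)
    fix x assume "x \<in> U"
    then show "\<exists>y\<in>U. y \<oplus>\<^bsub>M\<^esub> x = \<zero>\<^bsub>M\<^esub>" using U by (intro bexI[of _ "\<ominus>\<^bsub>M\<^esub> x"]) (auto simp: M.l_neg subsetD)
  qed (use U(1-3) in \<open>auto simp: M.a_ac subsetD\<close>)
  then show ?thesis
    using U by (intro right_module.intro right_module_axioms.intro R.ring_axioms)
      (auto simp: act_add_left act_add_right act_mult act_one subsetD)
qed

lemma carrier_submodule: "submodule (carrier M) A M"
  by (rule submoduleI) (auto simp: act_closed)

lemma zero_submodule: "submodule {\<zero>\<^bsub>M\<^esub>} A M"
  by (rule submoduleI) (auto simp: act_zero_right)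

end

lemma rhomI:
  assumes "\<And>x. x \<in> carrier M \<Longrightarrow> f x \<in> carrier N"
    "\<And>x y. x \<in> carrier M \<Longrightarrow> y \<in> carrier M \<Longrightarrow> f (x \<oplus>\<^bsub>M\<^esub> y) = f x \<oplus>\<^bsub>N\<^esub> f y"
    "\<And>a x. a \<in> carrier A \<Longrightarrow> x \<in> carrier M \<Longrightarrow> f (a \<odot>\<^bsub>M\<^esub> x) = a \<odot>\<^bsub>N\<^esub> f x"
  shows "f \<in> rhom A M N"
  using assms by (auto simp: rhom_def)

lemma rhomD:
  assumes "f \<in> rhom A M N"
  shows "x \<in> carrier M \<Longrightarrow> f x \<in> carrier N"
    "x \<in> carrier M \<Longrightarrow> y \<in> carrier M \<Longrightarrow> f (x \<oplus>\<^bsub>M\<^esub> y) = f x \<oplus>\<^bsub>N\<^esub> f y"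
    "a \<in> carrier A \<Longrightarrow> x \<in> carrier M \<Longrightarrow> f (a \<odot>\<^bsub>M\<^esub> x) = a \<odot>\<^bsub>N\<^esub> f x"
  using assms by (auto simp: rhom_def)

lemma rhom_comp: "f \<in> rhom A M N \<Longrightarrow> g \<in> rhom A N K \<Longrightarrow> (\<lambda>x. g (f x)) \<in> rhom A M K"
  by (auto simp: rhom_def Pi_iff)

lemma rhom_zero:
  assumes "right_module A M" "right_module A N" "f \<in> rhom A M N"
  shows "f \<zero>\<^bsub>M\<^esub> = \<zero>\<^bsub>N\<^esub>"
proof -
  interpret M: right_module A M by fact
  interpret N: right_module A N by fact
  have "f (\<zero>\<^bsub>A\<^esub> \<odot>\<^bsub>M\<^esub> \<zero>\<^bsub>M\<^esub>) = \<zero>\<^bsub>A\<^esub> \<odot>\<^bsub>N\<^esub> f \<zero>\<^bsub>M\<^esub>" using rhomD(3)[OF assms(3)] by simp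
  then show ?thesis using rhomD(1)[OF assms(3)] by (simp add: M.act_zero_left N.act_zero_left)
qed

lemma rhom_neg:
  assumes "right_module A M" "right_module A N" "f \<in> rhom A M N" "x \<in> carrier M"
  shows "f (\<ominus>\<^bsub>M\<^esub> x) = \<ominus>\<^bsub>N\<^esub> f x"
proof -
  interpret M: right_module A M by fact
  interpret N: right_module A N by fact
  have "f (\<ominus>\<^bsub>A\<^esub> \<one>\<^bsub>A\<^esub> \<odot>\<^bsub>M\<^esub> x) = \<ominus>\<^bsub>A\<^esub> \<one>\<^bsub>A\<^esub> \<odot>\<^bsub>N\<^esub> f x" using rhomD(3)[OF assms(3)] assms(4) by simp
  then show ?thesis using rhomD(1)[OF assms(3)] assms(4)
    by (simp add: M.act_neg N.act_neg M.act_one N.act_one)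
qed

lemma rhom_minus:
  assumes "right_module A M" "right_module A N" "f \<in> rhom A M N" "x \<in> carrier M" "y \<in> carrier M"
  shows "f (x \<ominus>\<^bsub>M\<^esub> y) = f x \<ominus>\<^bsub>N\<^esub> f y"
proof -
  interpret M: right_module A M by fact
  show ?thesis using assms by (simp add: a_minus_def rhomD(2) rhom_neg)
qed

lemma rhom_inj_iff:
  assumes "right_module A M" "right_module A N" "f \<in> rhom A M N"
  shows "inj_on f (carrier M) \<longleftrightarrow> (\<forall>x\<in>carrier M. f x = \<zero>\<^bsub>N\<^esub> \<longrightarrow> x = \<zero>\<^bsub>M\<^esub>)"
proof
  interpret M: right_module A M by fact
  interpret N: right_module A N by fact
  show "inj_on f (carrier M) \<Longrightarrow> \<forall>x\<in>carrier M. f x = \<zero>\<^bsub>N\<^esub> \<longrightarrow> x = \<zero>\<^bsub>M\<^esub>"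
    using rhom_zero[OF assms] by (metis inj_onD M.M.zero_closed)
  assume *: "\<forall>x\<in>carrier M. f x = \<zero>\<^bsub>N\<^esub> \<longrightarrow> x = \<zero>\<^bsub>M\<^esub>"
  show "inj_on f (carrier M)"
  proof (rule inj_onI)
    fix x y assume xy: "x \<in> carrier M" "y \<in> carrier M" "f x = f y"
    then have "f (x \<ominus>\<^bsub>M\<^esub> y) = \<zero>\<^bsub>N\<^esub>"
      using rhom_minus[OF assms] rhomD(1)[OF assms(3)] by (simp add: N.M.r_neg a_minus_def)
    then have "x \<ominus>\<^bsub>M\<^esub> y = \<zero>\<^bsub>M\<^esub>" using * xy by simp
    then show "x = y" using xy M.minus_add_cancel[of x y] by simp
  qed
qed

lemma rhom_vimage_submodule:
  assumes "right_module A M" "right_module A N" "f \<in> rhom A M N" "submodule U A N"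
  shows "submodule {x \<in> carrier M. f x \<in> U} A M"
proof -
  interpret M: right_module A M by fact
  interpret N: right_module A N by fact
  note U = N.submoduleD[OF assms(4)]
  show ?thesis
    by (rule M.submoduleI) (use U rhomD[OF assms(3)] rhom_zero[OF assms(1-3)] in \<open>auto simp: M.act_closed\<close>)
qed

lemma rhom_image_submodule:
  assumes "right_module A M" "right_module A N" "f \<in> rhom A M N" "submodule U A M"
  shows "submodule (f ` U) A N"
proof -
  interpret M: right_module A M by fact
  interpret N: right_module A N by fact
  note U = M.submoduleD[OF assms(4)] and f = rhomD[OF assms(3)]
  show ?thesis
  proof (rule N.submoduleI)
    show "f ` U \<subseteq> carrier N" using U(1) f(1) by auto
    show "\<zero>\<^bsub>N\<^esub> \<in> f ` U" using rhom_zero[OF assms(1-3)] U(2) by force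
    fix x y assume "x \<in> f ` U" "y \<in> f ` U"
    then obtain x' y' where "x = f x'" "y = f y'" "x' \<in> U" "y' \<in> U" by auto
    then show "x \<oplus>\<^bsub>N\<^esub> y \<in> f ` U" using f(2)[of x' y'] U(1,3) by (metis imageI subsetD)
  next
    fix a x assume "a \<in> carrier A" "x \<in> f ` U"
    then obtain x' where "x = f x'" "x' \<in> U" by auto
    then show "a \<odot>\<^bsub>N\<^esub> x \<in> f ` U" using f(3)[of a x'] U(1,4) \<open>a \<in> carrier A\<close> by (metis imageI subsetD)
  qed
qed

lemma a_kernel_iff: "x \<in> a_kernel M N f \<longleftrightarrow> x \<in> carrier M \<and> f x = \<zero>\<^bsub>N\<^esub>"
  by (simp add: a_kernel_def kernel_def)

lemma kernel_submodule:
  assumes "right_module A M" "right_module A N" "f \<in> rhom A M N"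
  shows "submodule (a_kernel M N f) A M"
proof -
  interpret N: right_module A N by fact
  have "a_kernel M N f = {x \<in> carrier M. f x \<in> {\<zero>\<^bsub>N\<^esub>}}" by (auto simp: a_kernel_iff)
  then show ?thesis using rhom_vimage_submodule[OF assms N.zero_submodule] by simp
qed

lemma rhom_inv:
  assumes "right_module A M" "right_module A N" "f \<in> rhom A M N" "bij_betw f (carrier M) (carrier N)"
  shows "inv_into (carrier M) f \<in> rhom A N M"
proof -
  interpret M: right_module A M by fact
  interpret N: right_module A N by fact
  note f = rhomD[OF assms(3)]
  let ?g = "inv_into (carrier M) f"
  have g: "?g y \<in> carrier M" "f (?g y) = y" if "y \<in> carrier N" for y
    using that assms(4) by (auto simp: bij_betw_def inv_into_into f_inv_into_f)
  have gf: "?g (f x) = x" if "x \<in> carrier M" for x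
    using that assms(4) by (auto simp: bij_betw_def)
  show ?thesis
  proof (rule rhomI)
    fix x y assume "x \<in> carrier N" "y \<in> carrier N"
    then have "f (?g x \<oplus>\<^bsub>M\<^esub> ?g y) = x \<oplus>\<^bsub>N\<^esub> y" using f(2) g by simp
    then show "?g (x \<oplus>\<^bsub>N\<^esub> y) = ?g x \<oplus>\<^bsub>M\<^esub> ?g y"
      using gf[of "?g x \<oplus>\<^bsub>M\<^esub> ?g y"] g \<open>x \<in> _\<close> \<open>y \<in> _\<close> by simp
  next
    fix a x assume "a \<in> carrier A" "x \<in> carrier N"
    then have "f (a \<odot>\<^bsub>M\<^esub> ?g x) = a \<odot>\<^bsub>N\<^esub> x" using f(3) g by simp
    then show "?g (a \<odot>\<^bsub>N\<^esub> x) = a \<odot>\<^bsub>M\<^esub> ?g x"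
      using gf[of "a \<odot>\<^bsub>M\<^esub> ?g x"] g \<open>x \<in> _\<close> \<open>a \<in> _\<close> M.act_closed by simp
  qed (use g in simp)
qed

section \<open>Algebras with Nakayama coordinates\<close>

text \<open>
  Finitely generated modules are represented by arrays of scalars with a row index and a position.
  Since the homological notions quantify over modules with elements of type \<open>nat \<Rightarrow> 'k\<close>, an array is
  encoded as a function on \<open>nat\<close>, with \<open>co\<close> reading and \<open>mk\<close> writing its entries.
\<close>

definition co :: "(nat \<Rightarrow> 'k) \<Rightarrow> nat \<Rightarrow> nat \<Rightarrow> 'k" where
  "co v k t = v (prod_encode (k, t))"

definition mk :: "(nat \<Rightarrow> nat \<Rightarrow> 'k) \<Rightarrow> nat \<Rightarrow> 'k" where
  "mk f n = (case prod_decode n of (k, t) \<Rightarrow> f k t)"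

lemma co_mk [simp]: "co (mk f) k t = f k t"
  by (simp add: co_def mk_def)

lemma co_eqI: "(\<And>k t. co v k t = co w k t) \<Longrightarrow> v = w"
  unfolding co_def by (metis prod_decode_inverse ext surj_pair)

lemma co_zero [simp]: "co (\<lambda>_. z) k t = z" by (simp add: co_def)
lemma co_add [simp]: "co (\<lambda>n. v n + w n) k t = co v k t + co w k t" by (simp add: co_def)

text \<open>
  The coordinate \<open>f i l\<close> is the coefficient at the path of length \<open>l\<close> that starts at the vertex \<open>i\<close>
  modulo \<open>N\<close>; the paths of length at least \<open>c i\<close> are zero in the algebra.
\<close>

definition coords :: "nat \<Rightarrow> (nat \<Rightarrow> nat) \<Rightarrow> (nat \<Rightarrow> nat \<Rightarrow> 'k::zero) set" where
  "coords N c = {f. \<forall>i l. f (i + N) l = f i l \<and> (c i \<le> l \<longrightarrow> f i l = 0)}"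

lemma mod_add_cancel: "(a + m) mod n = (b + m) mod n \<longleftrightarrow> a mod n = b mod (n::nat)"
  unfolding nat_mod_eq_iff by (simp add: add_ac)

text \<open>
  Coordinates with respect to the basis of nonzero paths. Everything below is proved from these
  coordinates alone, so that it applies equally to bound quiver algebras, to endomorphism algebras
  and to the concrete algebras that serve as members of the sequence \<open>\<epsilon>\<^sup>n(\<Lambda>)\<close>.
\<close>

locale nak = kupisch N c + k_algebra A for N c and A :: "('k::field, 'a) module" (structure) +
  fixes cf :: "'a \<Rightarrow> nat \<Rightarrow> nat \<Rightarrow> 'k"
  assumes cf_bij: "bij_betw cf (carrier A) (coords N c)"
    and cf_add: "\<lbrakk>x \<in> carrier A; y \<in> carrier A\<rbrakk> \<Longrightarrow> cf (x \<oplus> y) i l = cf x i l + cf y i l"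
    and cf_mult: "\<lbrakk>x \<in> carrier A; y \<in> carrier A\<rbrakk> \<Longrightarrow>
       cf (x \<otimes> y) i l = (if l < c i then \<Sum>m\<le>l. cf x i m * cf y (i + m) (l - m) else 0)"
    and cf_one: "cf \<one> i l = (if l = 0 then 1 else 0)"
    and cf_scal: "x \<in> carrier A \<Longrightarrow> cf (s \<odot> x) i l = s * cf x i l"

lemma triangle_swap:
  fixes g :: "nat \<Rightarrow> nat \<Rightarrow> 'k::comm_monoid_add"
  shows "(\<Sum>u\<le>t. \<Sum>s\<le>u. g s u) = (\<Sum>s\<le>t. \<Sum>m\<le>t - s. g s (s + m))"
proof -
  have "(\<Sum>s\<le>t. \<Sum>m\<le>t - s. g s (s + m)) = (\<Sum>(s, m)\<in>{(s, m). s + m \<le> t}. g s (s + m))"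
    unfolding sum.Sigma[OF finite_atMost ballI, OF finite_atMost]
    by (rule sum.cong) auto
  also have "\<dots> = (\<Sum>u\<le>t. \<Sum>s\<le>u. g s u)"
    unfolding sum.triangle_reindex_eq by simp
  finally show ?thesis by simp
qed

text \<open>
  The interval modules. The direct sum over \<open>k \<in> J\<close> of uniserial modules with composition factors at
  \<open>p k, \<dots>, q k - 1\<close> consists of the arrays whose row \<open>k\<close> is supported there. A path of length \<open>l\<close>
  from \<open>t\<close> moves an entry from the position \<open>t\<close> to \<open>t + l\<close>, and entries moved to \<open>q k\<close> or beyond are
  lost. It is a module over the algebra as soon as no row is longer than \<open>P(p k)\<close>.
\<close>

definition im :: "('a \<Rightarrow> nat \<Rightarrow> nat \<Rightarrow> 'k::field) \<Rightarrow> nat set \<Rightarrow> (nat \<Rightarrow> nat) \<Rightarrow> (nat \<Rightarrow> nat) \<Rightarrow> ('a, nat \<Rightarrow> 'k) module" where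
  "im cf J p q = \<lparr>carrier = {v. \<forall>k t. co v k t \<noteq> 0 \<longrightarrow> k \<in> J \<and> p k \<le> t \<and> t < q k},
     mult = (\<lambda>v w. v), one = (\<lambda>_. 0), zero = (\<lambda>_. 0), add = (\<lambda>v w n. v n + w n),
     smult = (\<lambda>r v. mk (\<lambda>k t. if k \<in> J \<and> t < q k then \<Sum>s\<le>t. co v k s * cf r s (t - s) else 0))\<rparr>"

text \<open>
  Cutting the support down is at the same time the inclusion of submodules, the projection to
  quotients, and hence every canonical map between interval modules.
\<close>

definition im_res :: "nat set \<Rightarrow> (nat \<Rightarrow> nat) \<Rightarrow> (nat \<Rightarrow> nat) \<Rightarrow> (nat \<Rightarrow> 'k::zero) \<Rightarrow> nat \<Rightarrow> 'k" where
  "im_res J p q v = mk (\<lambda>k t. if k \<in> J \<and> p k \<le> t \<and> t < q k then co v k t else 0)"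

lemma im_simps [simp]:
  "zero (im cf J p q) = (\<lambda>_. 0)"
  "add (im cf J p q) = (\<lambda>v w n. v n + w n)"
  "co (r \<odot>\<^bsub>im cf J p q\<^esub> v) k t = (if k \<in> J \<and> t < q k then \<Sum>s\<le>t. co v k s * cf r s (t - s) else 0)"
  by (simp_all add: im_def)

lemma im_carrier: "v \<in> carrier (im cf J p q) \<longleftrightarrow> (\<forall>k t. co v k t \<noteq> 0 \<longrightarrow> k \<in> J \<and> p k \<le> t \<and> t < q k)"
  by (simp add: im_def)

context nak
begin

lemma cf_coords: "x \<in> carrier A \<Longrightarrow> cf x \<in> coords N c"
  using cf_bij by (auto simp: bij_betw_def)

lemma cf_add_N: "x \<in> carrier A \<Longrightarrow> cf x (i + N) l = cf x i l"
  using cf_coords by (auto simp: coords_def)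

lemma cf_trunc: "x \<in> carrier A \<Longrightarrow> c i \<le> l \<Longrightarrow> cf x i l = 0"
  using cf_coords by (auto simp: coords_def)

lemma cf_add_mult: "x \<in> carrier A \<Longrightarrow> cf x (i + q * N) l = cf x i l"
proof (induction q)
  case (Suc q)
  have "cf x (i + Suc q * N) l = cf x ((i + q * N) + N) l" by (simp add: algebra_simps)
  then show ?case using Suc cf_add_N by simp
qed simp

lemma cf_mod: "x \<in> carrier A \<Longrightarrow> cf x (i mod N) l = cf x i l"
  using cf_add_mult[of x "i mod N" "i div N"] by simp

lemma cf_cong: "x \<in> carrier A \<Longrightarrow> i mod N = j mod N \<Longrightarrow> cf x i l = cf x j l"
  using cf_mod by metis

lemma cf_eqI:
  assumes "x \<in> carrier A" "y \<in> carrier A" "\<And>i l. i < N \<Longrightarrow> l < c i \<Longrightarrow> cf x i l = cf y i l"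
  shows "x = y"
proof -
  have "cf x i l = cf y i l" for i l
  proof (cases "l < c i")
    case True
    have "cf x (i mod N) l = cf y (i mod N) l" using assms(3) N_pos True by (simp add: c_mod)
    then show ?thesis using assms(1,2) by (simp add: cf_mod)
  qed (use assms cf_trunc in simp)
  then have "cf x = cf y" by blast
  then show ?thesis using cf_bij assms(1,2) by (auto simp: bij_betw_def inj_on_def)
qed

lemma cf_zero: "cf \<zero> i l = 0"
proof -
  have "cf \<zero> i l + cf \<zero> i l = cf \<zero> i l + 0"
    unfolding cf_add[OF zero_closed zero_closed, symmetric] by simp
  then show ?thesis by (rule add_left_imp_eq)
qed

lemma cf_neg: "x \<in> carrier A \<Longrightarrow> cf (\<ominus> x) i l = - cf x i l"
  using cf_add[of "\<ominus> x" x i l] by (simp add: l_neg cf_zero eq_neg_iff_add_eq_0)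

lemma cf_minus: "x \<in> carrier A \<Longrightarrow> y \<in> carrier A \<Longrightarrow> cf (x \<ominus> y) i l = cf x i l - cf y i l"
  by (simp add: a_minus_def cf_add cf_neg)

definition el :: "(nat \<Rightarrow> nat \<Rightarrow> 'k) \<Rightarrow> 'a" where "el f = inv_into (carrier A) cf f"

lemma el_closed: "f \<in> coords N c \<Longrightarrow> el f \<in> carrier A"
  using cf_bij by (auto simp: el_def bij_betw_def inv_into_into)

lemma cf_el: "f \<in> coords N c \<Longrightarrow> cf (el f) = f"
  using cf_bij by (auto simp: el_def bij_betw_def f_inv_into_f)

text \<open>
  The basis element of the path of length \<open>l\<close> from \<open>i\<close>.
\<close>

definition xx :: "nat \<Rightarrow> nat \<Rightarrow> 'a" where
  "xx i l = el (\<lambda>i' l'. if i' mod N = i mod N \<and> l' = l \<and> l < c i then 1 else 0)"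

text \<open>
  The element of \<open>e\<^sub>l\<^sub>o A\<close> with the coefficients of a given row whose positions start at \<open>lo\<close>.
\<close>

definition rho :: "nat \<Rightarrow> (nat \<Rightarrow> 'k) \<Rightarrow> 'a" where
  "rho lo v = el (\<lambda>i l. if i mod N = lo mod N \<and> l < c lo then v (lo + l) else 0)"

lemma c_cong: "i mod N = j mod N \<Longrightarrow> c i = c j"
  using c_mod by metis

lemma xx_closed [simp]: "xx i l \<in> carrier A"
  and cf_xx: "cf (xx i l) i' l' = (if i' mod N = i mod N \<and> l' = l \<and> l < c i then 1 else 0)"
proof -
  have "(\<lambda>i' l'. if i' mod N = i mod N \<and> l' = l \<and> l < c i then 1 else 0::'k) \<in> coords N c"
    unfolding coords_def by (auto dest: c_cong)
  then show "xx i l \<in> carrier A" "cf (xx i l) i' l' = (if i' mod N = i mod N \<and> l' = l \<and> l < c i then 1 else 0)"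
    by (simp_all add: xx_def el_closed cf_el)
qed

lemma rho_closed [simp]: "rho lo v \<in> carrier A"
  and cf_rho: "cf (rho lo v) i l = (if i mod N = lo mod N \<and> l < c lo then v (lo + l) else 0)"
proof -
  have "(\<lambda>i l. if i mod N = lo mod N \<and> l < c lo then v (lo + l) else 0) \<in> coords N c"
    unfolding coords_def by (auto dest: c_cong)
  then show "rho lo v \<in> carrier A" "cf (rho lo v) i l = (if i mod N = lo mod N \<and> l < c lo then v (lo + l) else 0)"
    by (simp_all add: rho_def el_closed cf_el)
qed

lemma cf_xx_left:
  assumes "a \<in> carrier A"
  shows "cf (xx j m \<otimes> a) i l = (if i mod N = j mod N \<and> m \<le> l \<and> l < c i then cf a (i + m) (l - m) else 0)"
proof (cases "i mod N = j mod N \<and> m \<le> l \<and> l < c i")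
  case True
  then have "m < c j" using c_cong[of i j] by simp
  then have "(\<Sum>p\<le>l. cf (xx j m) i p * cf a (i + p) (l - p)) = (\<Sum>p\<le>l. if p = m then cf a (i + p) (l - p) else 0)"
    using True by (intro sum.cong) (auto simp: cf_xx)
  then show ?thesis using True assms by (simp add: cf_mult)
next
  case False
  then show ?thesis using assms by (auto simp: cf_mult cf_xx intro!: sum.neutral)
qed

lemma cf_xx_right:
  assumes "a \<in> carrier A"
  shows "cf (a \<otimes> xx j m) i l = (if (i + l) mod N = (j + m) mod N \<and> m \<le> l \<and> l < c i then cf a i (l - m) else 0)"
proof (cases "m \<le> l \<and> l < c i")
  case True
  have *: "(i + (l - m)) mod N = j mod N \<longleftrightarrow> (i + l) mod N = (j + m) mod N"
  proof -
    have "(i + (l - m)) mod N = j mod N \<longleftrightarrow> (i + (l - m) + m) mod N = (j + m) mod N"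
      by (rule mod_add_cancel[symmetric])
    then show ?thesis using True by simp
  qed
  have m: "m < c (i + (l - m))"
  proof -
    obtain d where "l = m + d" using True le_Suc_ex by blast
    then show ?thesis using True jump_mono[of i "i + d"] by (simp add: jump_def)
  qed
  have "(\<Sum>p\<le>l. cf a i p * cf (xx j m) (i + p) (l - p)) =
      (\<Sum>p\<le>l. if p = l - m then (if (i + l) mod N = (j + m) mod N then cf a i (l - m) else 0) else 0)"
  proof (rule sum.cong, simp)
    fix p assume "p \<in> {..l}"
    then show "cf a i p * cf (xx j m) (i + p) (l - p) =
        (if p = l - m then (if (i + l) mod N = (j + m) mod N then cf a i (l - m) else 0) else 0)"
      using True * m by (auto simp: cf_xx dest: c_cong)
  qed
  then show ?thesis using True assms by (simp add: cf_mult)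
next
  case False
  then show ?thesis using assms by (auto simp: cf_mult cf_xx intro!: sum.neutral)
qed

lemma xx_mult: "xx i l \<otimes> xx (i + l) m = xx i (l + m)"
proof (rule cf_eqI)
  fix i' l' assume "i' < N" "l' < c i'"
  have *: "m < c (i + l)" if "l + m < c i"
    using that jump_mono[of i "i + l"] by (simp add: jump_def)
  show "cf (xx i l \<otimes> xx (i + l) m) i' l' = cf (xx i (l + m)) i' l'"
    using \<open>l' < c i'\<close> * mod_add_cong[of i' N i l l] by (auto simp: cf_xx_left cf_xx c_cong[of i' i])
qed simp_all

lemma im_abelian_group: "abelian_group (im cf J p q)"
proof (rule abelian_groupI)
  fix v assume "v \<in> carrier (im cf J p q)"
  then show "\<exists>w\<in>carrier (im cf J p q). w \<oplus>\<^bsub>im cf J p q\<^esub> v = \<zero>\<^bsub>im cf J p q\<^esub>"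
    by (intro bexI[of _ "\<lambda>n. - v n"]) (auto simp: im_carrier co_def)
next
  fix v w assume vw: "v \<in> carrier (im cf J p q)" "w \<in> carrier (im cf J p q)"
  have "co v k t \<noteq> 0 \<or> co w k t \<noteq> 0" if "co v k t + co w k t \<noteq> 0" for k t using that by auto
  then show "v \<oplus>\<^bsub>im cf J p q\<^esub> w \<in> carrier (im cf J p q)"
    using vw unfolding im_carrier by simp blast
qed (auto simp: im_carrier add_ac)

lemma im_right_module:
  assumes "\<And>k. k \<in> J \<Longrightarrow> q k \<le> jump c (p k)"
  shows "right_module A (im cf J p q)"
proof (intro right_module.intro right_module_axioms.intro ring_axioms im_abelian_group)
  let ?M = "im cf J p q"
  fix a b v w
  {
    assume "a \<in> carrier A" "v \<in> carrier ?M"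
    show "a \<odot>\<^bsub>?M\<^esub> v \<in> carrier ?M"
      unfolding im_carrier
    proof (intro allI impI)
      fix k t assume *: "co (a \<odot>\<^bsub>?M\<^esub> v) k t \<noteq> 0"
      then have k: "k \<in> J" "t < q k" "(\<Sum>s\<le>t. co v k s * cf a s (t - s)) \<noteq> 0" by (auto split: if_splits)
      then obtain s where "s \<le> t" "co v k s \<noteq> 0" by (metis (no_types, lifting) atMost_iff mult_zero_left sum.neutral)
      then have "p k \<le> t" using \<open>v \<in> _\<close> unfolding im_carrier by force
      then show "k \<in> J \<and> p k \<le> t \<and> t < q k" using k by simp
    qed
  }
  {
    assume "a \<in> carrier A" "b \<in> carrier A" "v \<in> carrier ?M"
    then show "(a \<oplus> b) \<odot>\<^bsub>?M\<^esub> v = a \<odot>\<^bsub>?M\<^esub> v \<oplus>\<^bsub>?M\<^esub> b \<odot>\<^bsub>?M\<^esub> v"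
      by (intro co_eqI) (simp add: cf_add sum.distrib algebra_simps)
  }
  {
    show "a \<odot>\<^bsub>?M\<^esub> (v \<oplus>\<^bsub>?M\<^esub> w) = a \<odot>\<^bsub>?M\<^esub> v \<oplus>\<^bsub>?M\<^esub> a \<odot>\<^bsub>?M\<^esub> w"
      by (intro co_eqI) (simp add: sum.distrib algebra_simps)
  }
  {
    assume a: "a \<in> carrier A" and b: "b \<in> carrier A" and v: "v \<in> carrier ?M"
    show "(a \<otimes> b) \<odot>\<^bsub>?M\<^esub> v = b \<odot>\<^bsub>?M\<^esub> (a \<odot>\<^bsub>?M\<^esub> v)"
    proof (rule co_eqI)
      fix k t
      show "co ((a \<otimes> b) \<odot>\<^bsub>?M\<^esub> v) k t = co (b \<odot>\<^bsub>?M\<^esub> (a \<odot>\<^bsub>?M\<^esub> v)) k t"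
      proof (cases "k \<in> J \<and> t < q k")
        case True
        have "(\<Sum>s\<le>t. co v k s * cf (a \<otimes> b) s (t - s)) =
            (\<Sum>s\<le>t. \<Sum>m\<le>t - s. co v k s * cf a s m * cf b (s + m) (t - (s + m)))"
        proof (rule sum.cong, simp)
          fix s assume "s \<in> {..t}"
          show "co v k s * cf (a \<otimes> b) s (t - s) = (\<Sum>m\<le>t - s. co v k s * cf a s m * cf b (s + m) (t - (s + m)))"
          proof (cases "co v k s = 0")
            case False
            then have "p k \<le> s" using v unfolding im_carrier by blast
            then have "t < jump c s" using assms[of k] True jump_mono[of "p k" s] by simp
            then have "t - s < c s" using \<open>s \<in> {..t}\<close> by (simp add: jump_def)
            then show ?thesis using a b by (simp add: cf_mult sum_distrib_left mult.assoc)
          qed simp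
        qed
        also have "\<dots> = (\<Sum>u\<le>t. \<Sum>s\<le>u. co v k s * cf a s (u - s) * cf b u (t - u))"
          by (subst triangle_swap) simp
        also have "\<dots> = (\<Sum>u\<le>t. co (a \<odot>\<^bsub>?M\<^esub> v) k u * cf b u (t - u))"
          using True by (intro sum.cong) (auto simp: sum_distrib_right)
        finally show ?thesis using True by simp
      qed auto
    qed
  }
  {
    assume v: "v \<in> carrier ?M"
    show "\<one> \<odot>\<^bsub>?M\<^esub> v = v"
    proof (rule co_eqI)
      fix k t
      have "(\<Sum>s\<le>t. co v k s * cf \<one> s (t - s)) = (\<Sum>s\<le>t. if s = t then co v k s else 0)"
        by (intro sum.cong) (auto simp: cf_one)
      then show "co (\<one> \<odot>\<^bsub>?M\<^esub> v) k t = co v k t" using v unfolding im_carrier by auto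
    qed
  }
qed

lemma im_res_hom:
  assumes "\<And>k. k \<in> J \<Longrightarrow> k \<in> J' \<Longrightarrow> p' k \<le> p k \<and> q' k \<le> q k"
  shows "im_res J' p' q' \<in> rhom A (im cf J p q) (im cf J' p' q')"
proof (rule rhomI)
  fix v assume "v \<in> carrier (im cf J p q)"
  show "im_res J' p' q' v \<in> carrier (im cf J' p' q')" by (auto simp: im_carrier im_res_def)
next
  fix v w
  show "im_res J' p' q' (v \<oplus>\<^bsub>im cf J p q\<^esub> w) = im_res J' p' q' v \<oplus>\<^bsub>im cf J' p' q'\<^esub> im_res J' p' q' w"
    by (intro co_eqI) (simp add: im_res_def)
next
  fix a v assume v: "v \<in> carrier (im cf J p q)"
  show "im_res J' p' q' (a \<odot>\<^bsub>im cf J p q\<^esub> v) = a \<odot>\<^bsub>im cf J' p' q'\<^esub> im_res J' p' q' v"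
  proof (rule co_eqI)
    fix k t
    show "co (im_res J' p' q' (a \<odot>\<^bsub>im cf J p q\<^esub> v)) k t = co (a \<odot>\<^bsub>im cf J' p' q'\<^esub> im_res J' p' q' v) k t"
    proof (cases "k \<in> J' \<and> t < q' k")
      case True
      have sum: "(\<Sum>s\<le>t. co (im_res J' p' q' v) k s * cf a s (t - s)) = (\<Sum>s\<le>t. co v k s * cf a s (t - s))"
      proof (rule sum.cong, simp)
        fix s assume s: "s \<in> {..t}"
        have "co (im_res J' p' q' v) k s = co v k s"
        proof (cases "co v k s = 0")
          case False
          then have "k \<in> J" "p k \<le> s" using v unfolding im_carrier by blast+
          then show ?thesis using True s assms[of k] by (auto simp: im_res_def)
        qed (simp add: im_res_def)
        then show "co (im_res J' p' q' v) k s * cf a s (t - s) = co v k s * cf a s (t - s)" by simp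
      qed
      show ?thesis
      proof (cases "k \<in> J \<and> p k \<le> t")
        case T2: True
        then show ?thesis using True assms[of k] sum by (auto simp: im_res_def)
      next
        case False
        then have "co v k s = 0" if "s \<le> t" for s using v that unfolding im_carrier by force
        then have "(\<Sum>s\<le>t. co v k s * cf a s (t - s)) = 0" by simp
        then show ?thesis using True sum by (simp add: im_res_def)
      qed
    qed (auto simp: im_res_def)
  qed
qed

end

section \<open>Interval modules and finite generation\<close>

definition gen :: "nat \<Rightarrow> nat \<Rightarrow> nat \<Rightarrow> 'k::zero_neq_one" where
  "gen k t = mk (\<lambda>k' t'. if k' = k \<and> t' = t then 1 else 0)"

lemma co_gen [simp]: "co (gen k t) k' t' = (if k' = k \<and> t' = t then 1 else 0)"
  by (simp add: gen_def)

lemma gen_in_im: "k \<in> J \<Longrightarrow> p k \<le> t \<Longrightarrow> t < q k \<Longrightarrow> gen k t \<in> carrier (im cf J p q)"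
  by (simp add: im_carrier)

lemma rhom_add:
  assumes "right_module A M" "f \<in> rhom A L M" "g \<in> rhom A L M"
  shows "(\<lambda>x. f x \<oplus>\<^bsub>M\<^esub> g x) \<in> rhom A L M"
proof -
  interpret M: right_module A M by fact
  note f = rhomD[OF assms(2)] and g = rhomD[OF assms(3)]
  show ?thesis
    by (rule rhomI) (simp_all add: f g M.M.a_ac M.act_add_right)
qed

lemma rhom_zero_map:
  assumes "right_module A M"
  shows "(\<lambda>x. \<zero>\<^bsub>M\<^esub>) \<in> rhom A L M"
proof -
  interpret M: right_module A M by fact
  show ?thesis by (rule rhomI) (simp_all add: M.act_zero_right)
qed

lemma equalizer_submodule:
  assumes "right_module A L" "right_module A M" "f \<in> rhom A L M" "g \<in> rhom A L M"
  shows "submodule {x \<in> carrier L. f x = g x} A L"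
proof -
  interpret L: right_module A L by fact
  interpret M: right_module A M by fact
  note f = rhomD[OF assms(3)] and g = rhomD[OF assms(4)]
  show ?thesis
    by (rule L.submoduleI) (auto simp: f g L.act_closed rhom_zero[OF assms(1,2,3)] rhom_zero[OF assms(1,2,4)])
qed

context nak
begin

text \<open>
  An element fixed by the idempotent at \<open>i\<close>; such elements correspond to homomorphisms from \<open>P(i)\<close>.
\<close>

abbreviation homogeneous :: "('a, 'm) module \<Rightarrow> nat \<Rightarrow> 'm \<Rightarrow> bool" where
  "homogeneous M i z \<equiv> z \<in> carrier M \<and> xx i 0 \<odot>\<^bsub>M\<^esub> z = z"

definition sc :: "('a, 'm) module \<Rightarrow> 'k \<Rightarrow> 'm \<Rightarrow> 'm" where
  "sc M s m = (s \<odot> \<one>) \<odot>\<^bsub>M\<^esub> m"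

lemma one_scal_mult: "a \<in> carrier A \<Longrightarrow> (s \<odot> \<one>) \<otimes> a = s \<odot> a" "a \<in> carrier A \<Longrightarrow> a \<otimes> (s \<odot> \<one>) = s \<odot> a"
  using scal_mult_left[of \<one> a s] scal_mult_right[of a \<one> s] by simp_all

lemma sc_simps:
  assumes "right_module A M" "m \<in> carrier M"
  shows "sc M s m \<in> carrier M" "a \<in> carrier A \<Longrightarrow> (s \<odot> a) \<odot>\<^bsub>M\<^esub> m = sc M s (a \<odot>\<^bsub>M\<^esub> m)"
    "a \<in> carrier A \<Longrightarrow> a \<odot>\<^bsub>M\<^esub> sc M s m = sc M s (a \<odot>\<^bsub>M\<^esub> m)"
    "n \<in> carrier M \<Longrightarrow> sc M s (m \<oplus>\<^bsub>M\<^esub> n) = sc M s m \<oplus>\<^bsub>M\<^esub> sc M s n"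
    "sc M (s + s') m = sc M s m \<oplus>\<^bsub>M\<^esub> sc M s' m" "sc M s (sc M s' m) = sc M (s * s') m"
    "sc M 1 m = m" "sc M 0 m = \<zero>\<^bsub>M\<^esub>"
proof -
  interpret M: right_module A M by fact
  have cl: "s \<odot> \<one> \<in> carrier A" for s by (simp add: scal_closed)
  show "sc M s m \<in> carrier M" using assms cl by (simp add: sc_def M.act_closed)
  show "a \<in> carrier A \<Longrightarrow> (s \<odot> a) \<odot>\<^bsub>M\<^esub> m = sc M s (a \<odot>\<^bsub>M\<^esub> m)"
    using M.act_mult[of a "s \<odot> \<one>" m] assms cl by (simp add: sc_def one_scal_mult)
  show "a \<in> carrier A \<Longrightarrow> a \<odot>\<^bsub>M\<^esub> sc M s m = sc M s (a \<odot>\<^bsub>M\<^esub> m)"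
    using M.act_mult[of a "s \<odot> \<one>" m] M.act_mult[of "s \<odot> \<one>" a m] assms cl by (simp add: sc_def one_scal_mult)
  show "n \<in> carrier M \<Longrightarrow> sc M s (m \<oplus>\<^bsub>M\<^esub> n) = sc M s m \<oplus>\<^bsub>M\<^esub> sc M s n"
    using assms cl by (simp add: sc_def M.act_add_right)
  show add: "sc M (s + s') m = sc M s m \<oplus>\<^bsub>M\<^esub> sc M s' m" for s s'
    using assms cl by (simp add: sc_def scal_add_left M.act_add_left)
  have "(s' \<odot> \<one>) \<otimes> (s \<odot> \<one>) = (s * s') \<odot> \<one>"
    using cl by (simp add: one_scal_mult scal_scal)
  then show "sc M s (sc M s' m) = sc M (s * s') m"
    using M.act_mult[of "s' \<odot> \<one>" "s \<odot> \<one>" m] assms cl by (simp add: sc_def)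
  show "sc M 1 m = m" using assms by (simp add: sc_def scal_one M.act_one)
  have c0: "sc M 0 m \<in> carrier M" using assms cl by (simp add: sc_def M.act_closed)
  show "sc M 0 m = \<zero>\<^bsub>M\<^esub>" using add[of 0 0] c0 by (simp add: M.M.add.l_cancel_one')
qed

lemma sc_im:
  assumes "\<And>k. k \<in> J \<Longrightarrow> q k \<le> jump c (p k)" "v \<in> carrier (im cf J p q)"
  shows "co (sc (im cf J p q) s v) k t = s * co v k t"
proof -
  have "(\<Sum>u\<le>t. co v k u * cf (s \<odot> \<one>) u (t - u)) = (\<Sum>u\<le>t. if u = t then s * co v k t else 0)"
    by (intro sum.cong) (auto simp: cf_scal cf_one)
  then show ?thesis using assms(2) unfolding im_carrier by (auto simp: sc_def)
qed

lemma sum_single_le: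
  fixes f :: "nat \<Rightarrow> 'k"
  assumes "\<And>s. s \<le> t \<Longrightarrow> s \<noteq> u \<Longrightarrow> f s = 0"
  shows "(\<Sum>s\<le>t. f s) = (if u \<le> t then f u else 0)"
proof -
  have "(\<Sum>s\<le>t. f s) = (\<Sum>s\<le>t. if s = u then f u else 0)"
    by (rule sum.cong) (auto simp: assms)
  then show ?thesis by simp
qed

lemma act_gen:
  assumes "k \<in> J"
  shows "co (a \<odot>\<^bsub>im cf J p q\<^esub> gen k u) k' t = (if k' = k \<and> u \<le> t \<and> t < q k then cf a u (t - u) else 0)"
proof -
  have "(\<Sum>s\<le>t. co (gen k u) k' s * cf a s (t - s)) = (if u \<le> t then co (gen k u) k' u * cf a u (t - u) else 0)"
    by (rule sum_single_le) simp
  then show ?thesis using assms by auto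
qed

lemma gen_homogeneous:
  assumes "k \<in> J" "p k \<le> u" "u < q k"
  shows "homogeneous (im cf J p q) u (gen k u)"
proof
  show "gen k u \<in> carrier (im cf J p q)" using assms by (rule gen_in_im)
  show "xx u 0 \<odot>\<^bsub>im cf J p q\<^esub> gen k u = gen k u"
    using assms c_pos[of u] by (intro co_eqI) (auto simp del: im_simps(3) simp: act_gen cf_xx)
qed

lemma xx_act_gen:
  assumes "k \<in> J" "p k \<le> u" "u + m < q k" "q k \<le> jump c (p k)"
  shows "xx u m \<odot>\<^bsub>im cf J p q\<^esub> gen k u = gen k (u + m)"
proof -
  have "m < c u" using assms jump_mono[of "p k" u] by (simp add: jump_def)
  then show ?thesis using assms
    by (intro co_eqI) (auto simp del: im_simps(3) simp: act_gen cf_xx)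
qed

lemma rho_add: "rho lo (\<lambda>t. v t + w t) = rho lo v \<oplus> rho lo w"
  by (rule cf_eqI) (simp_all add: cf_rho cf_add)

lemma cf_rho_mult:
  assumes "a \<in> carrier A"
  shows "cf (rho lo v \<otimes> a) lo l = (if l < c lo then \<Sum>m\<le>l. v (lo + m) * cf a (lo + m) (l - m) else 0)"
  using assms by (auto simp: cf_mult cf_rho intro!: sum.cong)

lemma homogeneous_act_eqI:
  assumes "right_module A M" "homogeneous M lo z" "a \<in> carrier A" "b \<in> carrier A" "\<And>l. l < c lo \<Longrightarrow> cf a lo l = cf b lo l"
  shows "a \<odot>\<^bsub>M\<^esub> z = b \<odot>\<^bsub>M\<^esub> z"
proof -
  interpret M: right_module A M by fact
  have "xx lo 0 \<otimes> a = xx lo 0 \<otimes> b"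
  proof (rule cf_eqI)
    fix i l assume "i < N" "l < c i"
    then show "cf (xx lo 0 \<otimes> a) i l = cf (xx lo 0 \<otimes> b) i l"
      using assms(3-5) cf_cong[of a i lo l] cf_cong[of b i lo l] c_cong[of i lo] by (auto simp: cf_xx_left)
  qed (use assms in auto)
  then have "a \<odot>\<^bsub>M\<^esub> (xx lo 0 \<odot>\<^bsub>M\<^esub> z) = b \<odot>\<^bsub>M\<^esub> (xx lo 0 \<odot>\<^bsub>M\<^esub> z)"
    using M.act_mult[of "xx lo 0" a z] M.act_mult[of "xx lo 0" b z] assms by simp
  then show ?thesis using assms by simp
qed

text \<open>
  The condition under which the homomorphism from \<open>P(lo)\<close> determined by \<open>z\<close> factors through its
  quotient of length \<open>n\<close>.
\<close>

definition killed_from :: "('a, 'm) module \<Rightarrow> nat \<Rightarrow> 'm \<Rightarrow> nat \<Rightarrow> bool" where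
  "killed_from M lo z n \<longleftrightarrow> (\<forall>a\<in>carrier A. (\<forall>l<n. cf a lo l = 0) \<longrightarrow> a \<odot>\<^bsub>M\<^esub> z = \<zero>\<^bsub>M\<^esub>)"

lemma killed_from_c:
  assumes "right_module A M" "homogeneous M lo z"
  shows "killed_from M lo z (c lo)"
  unfolding killed_from_def
proof (intro ballI impI)
  interpret M: right_module A M by fact
  fix a assume "a \<in> carrier A" "\<forall>l<c lo. cf a lo l = 0"
  then have "a \<odot>\<^bsub>M\<^esub> z = \<zero> \<odot>\<^bsub>M\<^esub> z"
    using homogeneous_act_eqI[OF assms, of a \<zero>] by (simp add: cf_zero)
  then show "a \<odot>\<^bsub>M\<^esub> z = \<zero>\<^bsub>M\<^esub>" using assms by (simp add: M.act_zero_left)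
qed

text \<open>
  The map \<open>v \<mapsto> v z\<close> from a row, read as an element of \<open>e A\<close>, is well defined because \<open>z\<close> is
  annihilated by all paths that leave the row.
\<close>

lemma row_hom:
  assumes "right_module A M" "homogeneous M (p k) z" "k \<in> J" "q k \<le> jump c (p k)"
    and kill: "killed_from M (p k) z (q k - p k)"
  shows "(\<lambda>v. rho (p k) (co v k) \<odot>\<^bsub>M\<^esub> z) \<in> rhom A (im cf J p q) M"
proof (rule rhomI)
  interpret M: right_module A M by fact
  let ?I = "im cf J p q"
  fix v w a
  show "rho (p k) (co v k) \<odot>\<^bsub>M\<^esub> z \<in> carrier M" using assms by (simp add: M.act_closed)
  have "co (v \<oplus>\<^bsub>?I\<^esub> w) k = (\<lambda>t. co v k t + co w k t)" by auto
  then show "rho (p k) (co (v \<oplus>\<^bsub>?I\<^esub> w) k) \<odot>\<^bsub>M\<^esub> z = rho (p k) (co v k) \<odot>\<^bsub>M\<^esub> z \<oplus>\<^bsub>M\<^esub> rho (p k) (co w k) \<odot>\<^bsub>M\<^esub> z"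
    using assms by (simp add: rho_add M.act_add_left)
  assume a: "a \<in> carrier A" and v: "v \<in> carrier ?I"
  let ?r = "rho (p k) (co v k) \<otimes> a" and ?s = "rho (p k) (co (a \<odot>\<^bsub>?I\<^esub> v) k)"
  have cl: "?r \<in> carrier A" "?s \<in> carrier A" using a by simp_all
  have "cf (?r \<ominus> ?s) (p k) l = 0" if "l < q k - p k" for l
  proof -
    have l: "l < c (p k)" "p k + l < q k" using that assms(4) by (auto simp: jump_def)
    have "(\<Sum>s\<le>p k + l. co v k s * cf a s (p k + l - s)) = (\<Sum>m\<le>l. co v k (p k + m) * cf a (p k + m) (l - m))"
    proof -
      have v0: "co v k i = 0" if "i < p k" for i using v that unfolding im_carrier by (meson leD)
      have "(\<Sum>s\<le>p k + l. co v k s * cf a s (p k + l - s)) = (\<Sum>s=p k..p k + l. co v k s * cf a s (p k + l - s))"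
        using v0 by (intro sum.mono_neutral_right) auto
      also have "\<dots> = (\<Sum>m\<le>l. co v k (p k + m) * cf a (p k + m) (l - m))"
        using sum.shift_bounds_cl_nat_ivl[of "\<lambda>s. co v k s * cf a s (p k + l - s)" 0 "p k" l]
        by (simp add: add.commute atLeast0AtMost)
      finally show ?thesis .
    qed
    then show ?thesis using l a cl assms(3) by (simp add: cf_minus cf_rho_mult cf_rho)
  qed
  then have "(?r \<ominus> ?s) \<odot>\<^bsub>M\<^esub> z = \<zero>\<^bsub>M\<^esub>" using kill cl unfolding killed_from_def by simp
  then have "?s \<odot>\<^bsub>M\<^esub> z = (?r \<ominus> ?s) \<odot>\<^bsub>M\<^esub> z \<oplus>\<^bsub>M\<^esub> ?s \<odot>\<^bsub>M\<^esub> z" using assms cl by (simp add: M.act_closed)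
  also have "\<dots> = ?r \<odot>\<^bsub>M\<^esub> z"
    using assms cl by (simp add: M.act_add_left[symmetric] a_minus_def a_assoc l_neg)
  also have "\<dots> = a \<odot>\<^bsub>M\<^esub> (rho (p k) (co v k) \<odot>\<^bsub>M\<^esub> z)" using assms a by (simp add: M.act_mult)
  finally show "?s \<odot>\<^bsub>M\<^esub> z = a \<odot>\<^bsub>M\<^esub> (rho (p k) (co v k) \<odot>\<^bsub>M\<^esub> z)" .
qed

lemma rho_gen: "rho (p k) (co (gen k (p k)) k) = xx (p k) 0"
  using c_pos[of "p k"] by (intro cf_eqI) (auto simp: cf_rho cf_xx)

lemma rho_zero: "(\<And>t. v t = 0) \<Longrightarrow> rho lo v = \<zero>"
  by (intro cf_eqI) (auto simp: cf_rho cf_zero)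

lemma row_eq:
  assumes "k \<in> J" "q k \<le> jump c (p k)"
  shows "rho (p k) (co v k) \<odot>\<^bsub>im cf J p q\<^esub> gen k (p k) = im_res {k} p q v"
proof (rule co_eqI)
  fix k' t
  show "co (rho (p k) (co v k) \<odot>\<^bsub>im cf J p q\<^esub> gen k (p k)) k' t = co (im_res {k} p q v) k' t"
    using assms by (auto simp del: im_simps(3) simp: act_gen im_res_def cf_rho jump_def)
qed

lemma im_generated:
  assumes "finite J" "\<And>k. k \<in> J \<Longrightarrow> q k \<le> jump c (p k)" "submodule U A (im cf J p q)"
    and gens: "\<And>k. k \<in> J \<Longrightarrow> p k < q k \<Longrightarrow> gen k (p k) \<in> U"
  shows "U = carrier (im cf J p q)"
proof -
  interpret I: right_module A "im cf J p q" using assms(2) by (rule im_right_module)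
  note U = I.submoduleD[OF assms(3)]
  have "im_res J' p q v \<in> U" if "J' \<subseteq> J" for J' v
    using finite_subset[OF that assms(1)] that
  proof (induction J')
    case empty
    have "im_res {} p q v = \<zero>\<^bsub>im cf J p q\<^esub>" by (intro co_eqI) (simp add: im_res_def)
    then show ?case using U(2) by simp
  next
    case (insert k J')
    have "im_res (insert k J') p q v = im_res J' p q v \<oplus>\<^bsub>im cf J p q\<^esub> im_res {k} p q v"
      using insert.hyps by (intro co_eqI) (auto simp: im_res_def)
    moreover have "im_res {k} p q v \<in> U"
    proof (cases "p k < q k")
      case True
      then show ?thesis using row_eq[of k J q p v] insert.prems assms(2) gens U(4) by (metis insert_subset rho_closed)
    next
      case False
      then have "im_res {k} p q v = \<zero>\<^bsub>im cf J p q\<^esub>" by (intro co_eqI) (auto simp: im_res_def)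
      then show ?thesis using U(2) by simp
    qed
    ultimately show ?case using insert U(3) by simp
  qed
  moreover have "im_res J p q v = v" if "v \<in> carrier (im cf J p q)" for v
    using that by (intro co_eqI) (auto simp: im_res_def im_carrier)
  ultimately show ?thesis using U(1) by (metis order_refl subsetI subset_antisym)
qed

lemma im_fg:
  assumes "finite J" "\<And>k. k \<in> J \<Longrightarrow> q k \<le> jump c (p k)"
  shows "fg_module A (im cf J p q)"
  unfolding fg_module_def
proof (intro conjI exI allI impI)
  let ?X = "(\<lambda>k. gen k (p k)) ` {k \<in> J. p k < q k}"
  show "right_module A (im cf J p q)" using assms(2) by (rule im_right_module)
  show "finite ?X" using assms(1) by simp
  show "?X \<subseteq> carrier (im cf J p q)" by (auto intro: gen_in_im)
  fix U assume U: "submodule U A (im cf J p q) \<and> ?X \<subseteq> U"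
  show "U = carrier (im cf J p q)"
    by (rule im_generated[OF assms]) (use U in auto)
qed

lemma im_hom_eqI:
  assumes "finite J" "\<And>k. k \<in> J \<Longrightarrow> q k \<le> jump c (p k)" "right_module A M"
    "f \<in> rhom A (im cf J p q) M" "g \<in> rhom A (im cf J p q) M"
    "\<And>k. k \<in> J \<Longrightarrow> p k < q k \<Longrightarrow> f (gen k (p k)) = g (gen k (p k))"
    "v \<in> carrier (im cf J p q)"
  shows "f v = g v"
proof -
  let ?U = "{v \<in> carrier (im cf J p q). f v = g v}"
  have "submodule ?U A (im cf J p q)"
    using im_right_module[OF assms(2)] assms(3-5) by (rule equalizer_submodule)
  moreover have "gen k (p k) \<in> ?U" if "k \<in> J" "p k < q k" for k
    using that by (auto simp: assms(6) intro!: gen_in_im)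
  ultimately have "?U = carrier (im cf J p q)"
    using im_generated[where J = J and p = p and q = q and U = ?U] assms(1,2) by blast
  then show ?thesis using assms(7) by blast
qed

lemma im_hom_exists:
  assumes "finite J" "\<And>k. k \<in> J \<Longrightarrow> q k \<le> jump c (p k)" "right_module A M"
    and z: "\<And>k. k \<in> J \<Longrightarrow> p k < q k \<Longrightarrow> homogeneous M (p k) (z k) \<and> killed_from M (p k) (z k) (q k - p k)"
  shows "\<exists>h\<in>rhom A (im cf J p q) M. \<forall>k\<in>J. p k < q k \<longrightarrow> h (gen k (p k)) = z k"
proof -
  interpret M: right_module A M by fact
  have "\<exists>h\<in>rhom A (im cf J p q) M. \<forall>k\<in>J. p k < q k \<longrightarrow> h (gen k (p k)) = (if k \<in> J' then z k else \<zero>\<^bsub>M\<^esub>)"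
    if "J' \<subseteq> J" for J'
    using finite_subset[OF that assms(1)] that
  proof (induction J')
    case empty
    show ?case using rhom_zero_map[OF assms(3), of "im cf J p q"] by (intro bexI[of _ "\<lambda>_. \<zero>\<^bsub>M\<^esub>"]) auto
  next
    case (insert k J')
    then obtain h where h: "h \<in> rhom A (im cf J p q) M"
      "\<forall>k\<in>J. p k < q k \<longrightarrow> h (gen k (p k)) = (if k \<in> J' then z k else \<zero>\<^bsub>M\<^esub>)" by auto
    have k: "k \<in> J" using insert by simp
    show ?case
    proof (cases "p k < q k")
      case False
      then have "\<forall>k'\<in>J. p k' < q k' \<longrightarrow> h (gen k' (p k')) = (if k' \<in> insert k J' then z k' else \<zero>\<^bsub>M\<^esub>)"
        using h(2) by auto
      then show ?thesis using h(1) by blast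
    next
      case True
      note zk = z[OF k True]
      let ?r = "\<lambda>v. rho (p k) (co v k) \<odot>\<^bsub>M\<^esub> z k"
      have r: "?r \<in> rhom A (im cf J p q) M" using row_hom[OF assms(3)] zk k assms(2) by blast
      have rk: "?r (gen k (p k)) = z k" using zk by (simp only: rho_gen)
      have r0: "?r (gen k' (p k')) = \<zero>\<^bsub>M\<^esub>" if "k' \<noteq> k" for k'
        using that zk by (simp add: rho_zero M.act_zero_left)
      have "(h (gen k' (p k')) \<oplus>\<^bsub>M\<^esub> ?r (gen k' (p k'))) = (if k' \<in> insert k J' then z k' else \<zero>\<^bsub>M\<^esub>)"
        if "k' \<in> J" "p k' < q k'" for k'
      proof (cases "k' = k")
        case True
        then show ?thesis using h(2) that insert.hyps zk rk by simp
      next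
        case False
        then show ?thesis using h(2) that r0[OF False] z[of k'] by simp
      qed
      then show ?thesis using rhom_add[OF assms(3) h(1) r] by (intro bexI[of _ "\<lambda>v. h v \<oplus>\<^bsub>M\<^esub> ?r v"]) auto
    qed
  qed
  from this[of J] show ?thesis by auto
qed

text \<open>
  A row of full length is some \<open>P(i)\<close>. To lift a map along a surjection, choose a preimage of the
  image of each generator and multiply it by the idempotent at the generator.
\<close>

lemma im_projective:
  assumes "finite J" "\<And>k. k \<in> J \<Longrightarrow> p k < q k \<Longrightarrow> q k = jump c (p k)"
  shows "projective A (im cf J p q)"
proof -
  have q: "q k \<le> jump c (p k)" if "k \<in> J" for k
    using assms(2)[OF that] jump_gt[of "p k"] by (cases "p k < q k") auto
  show ?thesis
    unfolding projective_def
  proof (intro conjI allI impI; (elim conjE)?)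
    show "right_module A (im cf J p q)" using q by (rule im_right_module)
    fix X Y :: "('a, nat \<Rightarrow> 'k) module" and g f
    assume X: "fg_module A X" and Y: "fg_module A Y" and g: "g \<in> rhom A X Y" "g ` carrier X = carrier Y"
      and f: "f \<in> rhom A (im cf J p q) Y"
    have X': "right_module A X" and Y': "right_module A Y" using X Y by (auto simp: fg_module_def)
    interpret X: right_module A X by fact
    have "\<exists>z. homogeneous X (p k) z \<and> g z = f (gen k (p k))" if k: "k \<in> J" "p k < q k" for k
    proof -
      have hg: "homogeneous (im cf J p q) (p k) (gen k (p k))" using k by (intro gen_homogeneous) auto
      then have "f (gen k (p k)) \<in> g ` carrier X" using rhomD(1)[OF f] g(2) by simp
      then obtain x where x: "x \<in> carrier X" "g x = f (gen k (p k))" by auto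
      have "xx (p k) 0 \<otimes> xx (p k) 0 = xx (p k) 0" using xx_mult[of "p k" 0 0] by simp
      then have "homogeneous X (p k) (xx (p k) 0 \<odot>\<^bsub>X\<^esub> x)"
        using x X.act_mult[of "xx (p k) 0" "xx (p k) 0" x] by (simp add: X.act_closed)
      moreover have "g (xx (p k) 0 \<odot>\<^bsub>X\<^esub> x) = f (xx (p k) 0 \<odot>\<^bsub>im cf J p q\<^esub> gen k (p k))"
        using rhomD(3)[OF g(1) xx_closed x(1)] rhomD(3)[OF f xx_closed conjunct1[OF hg]] x(2) by (simp only:)
      ultimately show ?thesis using hg by (intro exI[of _ "xx (p k) 0 \<odot>\<^bsub>X\<^esub> x"]) (simp only: simp_thms)
    qed
    then obtain z where z: "\<And>k. k \<in> J \<Longrightarrow> p k < q k \<Longrightarrow> homogeneous X (p k) (z k) \<and> g (z k) = f (gen k (p k))"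
      by metis
    have "killed_from X (p k) (z k) (q k - p k)" if "k \<in> J" "p k < q k" for k
      using killed_from_c[OF X'] z[OF that] assms(2)[OF that] by (simp add: jump_def)
    then obtain h where h: "h \<in> rhom A (im cf J p q) X" "\<forall>k\<in>J. p k < q k \<longrightarrow> h (gen k (p k)) = z k"
      using im_hom_exists[where p = p and q = q and z = z, OF assms(1) q X'] z by blast
    have "g (h v) = f v" if "v \<in> carrier (im cf J p q)" for v
      using assms(1) q Y' rhom_comp[OF h(1) g(1)] f _ that
      by (rule im_hom_eqI[where J = J and p = p and q = q]) (use h(2) z in auto)
    then show "\<exists>h\<in>rhom A (im cf J p q) X. \<forall>v\<in>carrier (im cf J p q). g (h v) = f v" using h(1) by blast
  qed
qed

text \<open>
  An element of a submodule whose lowest coordinate sits at \<open>d\<close> reaches all elements with lowest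
  coordinate at \<open>d\<close> or above: multiplying it by a path moves the lowest coordinate to any prescribed
  later position, and subtracting multiples clears coordinates one after the other.
\<close>

lemma im_order_closed:
  assumes "q k \<le> jump c (p k)" "submodule U A (im cf {k} p q)" "y \<in> U" "co y k d \<noteq> 0" "\<And>t. t < d \<Longrightarrow> co y k t = 0"
    "w \<in> carrier (im cf {k} p q)" "\<And>t. t < d \<Longrightarrow> co w k t = 0"
  shows "w \<in> U"
proof -
  let ?I = "im cf {k} p q"
  interpret I: right_module A ?I using assms(1) by (intro im_right_module) simp
  note U = I.submoduleD[OF assms(2)]
  have pd: "p k \<le> d" "d < q k"
    using subsetD[OF U(1) assms(3)] assms(4) unfolding im_carrier by blast+
  have "w \<in> U" if "d \<le> e" "w \<in> carrier ?I" "\<And>t. t < e \<Longrightarrow> co w k t = 0" for w e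
    using that
  proof (induction "q k - e" arbitrary: w e)
    case 0
    have "w = \<zero>\<^bsub>?I\<^esub>"
    proof (rule co_eqI)
      fix k' t
      have "t < q k" if "co w k' t \<noteq> 0" using that 0 unfolding im_carrier by auto
      then show "co w k' t = co \<zero>\<^bsub>?I\<^esub> k' t" using 0 unfolding im_carrier by force
    qed
    then show ?case using U(2) by simp
  next
    case (Suc n)
    then have e: "e < q k" by simp
    define y' where "y' = xx d (e - d) \<odot>\<^bsub>?I\<^esub> y"
    have y'U: "y' \<in> U" unfolding y'_def using U(4) assms(3) by simp
    then have y'c: "y' \<in> carrier ?I" using U(1) by auto
    have ed: "e - d < c d" using e assms(1) jump_mono[OF pd(1)] pd Suc.prems(1) by (simp add: jump_def)
    have y': "co y' k t = (if t = e then co y k d else 0)" if "t \<le> e" for t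
    proof -
      have "(\<Sum>s\<le>t. co y k s * cf (xx d (e - d)) s (t - s)) =
          (if d \<le> t then co y k d * cf (xx d (e - d)) d (t - d) else 0)"
      proof (rule sum_single_le)
        fix s assume "s \<le> t" "s \<noteq> d"
        show "co y k s * cf (xx d (e - d)) s (t - s) = 0"
        proof (cases "s < d")
          case False
          then have "t - s \<noteq> e - d" using \<open>s \<le> t\<close> \<open>s \<noteq> d\<close> that Suc.prems(1) by simp
          then show ?thesis by (simp add: cf_xx)
        qed (simp add: assms(5))
      qed
      then show ?thesis using that e ed Suc.prems(1) unfolding y'_def by (auto simp: cf_xx)
    qed
    define s where "s = co w k e / co y k d"
    define w' where "w' = w \<oplus>\<^bsub>?I\<^esub> sc ?I (- s) y'"
    have im: "right_module A ?I" ..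
    have w': "co w' k t = co w k t - s * co y' k t" for t
      using sc_im[of "{k}" q p y' "-s"] assms(1) y'c by (simp add: w'_def)
    have "w' \<in> U"
    proof (rule Suc.hyps(1)[of "Suc e"])
      show "n = q k - Suc e" "d \<le> Suc e" using Suc by auto
      show "w' \<in> carrier ?I" unfolding w'_def using Suc.prems(2) sc_simps(1)[OF im y'c] I.M.a_closed by blast
      fix t assume "t < Suc e"
      then show "co w' k t = 0" unfolding w' using y'[of t] Suc.prems(3) assms(4) by (auto simp: s_def less_Suc_eq)
    qed
    moreover have "sc ?I s y' \<in> U" unfolding sc_def using y'U U(4) scal_closed by simp
    ultimately have "w' \<oplus>\<^bsub>?I\<^esub> sc ?I s y' \<in> U" by (rule U(3))
    also have "w' \<oplus>\<^bsub>?I\<^esub> sc ?I s y' = w"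
      unfolding w'_def using sc_im[of "{k}" q p y'] assms(1) y'c by (intro co_eqI) simp
    finally show ?case .
  qed
  from this[of d w] assms(6,7) show ?thesis by simp
qed

lemma im_submodule_order:
  assumes "q k \<le> jump c (p k)" "submodule U A (im cf {k} p q)"
  shows "\<exists>s\<le>q k. U = {v \<in> carrier (im cf {k} p q). \<forall>t<s. co v k t = 0}"
proof -
  let ?I = "im cf {k} p q"
  interpret I: right_module A ?I using assms(1) by (intro im_right_module) simp
  note U = I.submoduleD[OF assms(2)]
  define P where "P s \<longleftrightarrow> (\<exists>y\<in>U. co y k s \<noteq> 0)" for s
  define s where "s = (if \<exists>s. P s then LEAST s. P s else q k)"
  have below: "co v k t = 0" if "v \<in> U" "t < s" for v t
  proof -
    have "\<not> P t"
    proof (cases "\<exists>s. P s")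
      case True
      then show ?thesis using that(2) not_less_Least[of t P] by (simp add: s_def)
    qed simp
    then show ?thesis using that by (auto simp: P_def)
  qed
  have s: "s \<le> q k"
  proof (cases "\<exists>s. P s")
    case True
    then have "P s" unfolding s_def by (simp add: LeastI_ex)
    then obtain y where "y \<in> carrier ?I" "co y k s \<noteq> 0" using U(1) by (auto simp: P_def)
    then show ?thesis unfolding im_carrier by (blast intro: less_imp_le)
  qed (simp add: s_def)
  have "w \<in> U" if w: "w \<in> carrier ?I" "\<forall>t<s. co w k t = 0" for w
  proof (cases "\<exists>s. P s")
    case True
    then have "P s" unfolding s_def by (simp add: LeastI_ex)
    then obtain y where "y \<in> U" "co y k s \<noteq> 0" by (auto simp: P_def)
    then show ?thesis using im_order_closed[OF assms, of y s w] below w by blast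
  next
    case False
    have "w = \<zero>\<^bsub>?I\<^esub>"
    proof (rule co_eqI)
      fix k' t
      show "co w k' t = co \<zero>\<^bsub>?I\<^esub> k' t" using w False unfolding im_carrier by (force simp: s_def)
    qed
    then show ?thesis using U(2) by simp
  qed
  then show ?thesis using s below U(1) by (intro exI[of _ s]) auto
qed

lemma im_uniserial:
  assumes "q k \<le> jump c (p k)"
  shows "uniserial A (im cf {k} p q)"
  unfolding uniserial_def
proof (intro allI impI; elim conjE)
  fix U V assume UV: "submodule U A (im cf {k} p q)" "submodule V A (im cf {k} p q)"
  obtain s t where "U = {v \<in> carrier (im cf {k} p q). \<forall>t<s. co v k t = 0}"
      "V = {v \<in> carrier (im cf {k} p q). \<forall>u<t. co v k u = 0}"
    using im_submodule_order[where p = p and q = q and k = k, OF assms UV(1)]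
      im_submodule_order[where p = p and q = q and k = k, OF assms UV(2)] by blast
  then show "U \<subseteq> V \<or> V \<subseteq> U" by (cases "s \<le> t") auto
qed

text \<open>
  The annihilator of a homogeneous element is a submodule of \<open>P(lo)\<close>, and \<open>P(lo)\<close> is uniserial.
\<close>

lemma cyclic_length:
  assumes "right_module A M" "homogeneous M lo g"
  shows "\<exists>n\<le>c lo. \<forall>a\<in>carrier A. a \<odot>\<^bsub>M\<^esub> g = \<zero>\<^bsub>M\<^esub> \<longleftrightarrow> (\<forall>l<n. cf a lo l = 0)"
proof -
  interpret M: right_module A M by fact
  let ?I = "im cf {0} (\<lambda>_. lo) (\<lambda>_. jump c lo)"
  let ?r = "\<lambda>v. rho lo (co v 0) \<odot>\<^bsub>M\<^esub> g"
  have I: "right_module A ?I" by (intro im_right_module) simp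
  have kf: "killed_from M lo g (jump c lo - lo)" using killed_from_c[OF assms] by (simp add: jump_def)
  have r: "?r \<in> rhom A ?I M"
    using row_hom[OF assms(1), where p = "\<lambda>_. lo" and k = 0 and z = g and J = "{0}" and q = "\<lambda>_. jump c lo"] assms(2) kf by simp
  have "\<exists>s\<le>jump c lo. a_kernel ?I M ?r = {v \<in> carrier ?I. \<forall>t<s. co v 0 t = 0}"
    using im_submodule_order[where q = "\<lambda>_. jump c lo" and k = 0 and p = "\<lambda>_. lo"] kernel_submodule[OF I assms(1) r] by simp
  then obtain s where s: "s \<le> jump c lo" "a_kernel ?I M ?r = {v \<in> carrier ?I. \<forall>t<s. co v 0 t = 0}" by blast
  define n where "n = s - lo"
  have "a \<odot>\<^bsub>M\<^esub> g = \<zero>\<^bsub>M\<^esub> \<longleftrightarrow> (\<forall>l<n. cf a lo l = 0)" if a: "a \<in> carrier A" for a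
  proof -
    define v where "v = mk (\<lambda>k t. if k = 0 \<and> lo \<le> t then cf a lo (t - lo) else 0)"
    have v: "v \<in> carrier ?I"
      unfolding im_carrier
    proof (intro allI impI)
      fix k t assume "co v k t \<noteq> 0"
      then have "k = 0" "lo \<le> t" "cf a lo (t - lo) \<noteq> 0" by (auto simp: v_def split: if_splits)
      moreover have "t - lo < c lo" using calculation cf_trunc[OF a, of lo "t - lo"] by (meson not_le)
      ultimately show "k \<in> {0} \<and> lo \<le> t \<and> t < jump c lo" by (auto simp: jump_def)
    qed
    have "?r v = a \<odot>\<^bsub>M\<^esub> g"
      using assms a by (intro homogeneous_act_eqI) (auto simp: v_def cf_rho)
    then have "a \<odot>\<^bsub>M\<^esub> g = \<zero>\<^bsub>M\<^esub> \<longleftrightarrow> v \<in> a_kernel ?I M ?r" using v by (simp add: a_kernel_iff)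
    also have "\<dots> \<longleftrightarrow> (\<forall>t<s. lo \<le> t \<longrightarrow> cf a lo (t - lo) = 0)" unfolding s(2) using v by (auto simp: v_def)
    also have "\<dots> \<longleftrightarrow> (\<forall>l<n. cf a lo l = 0)"
    proof (intro iffI allI impI)
      fix l assume "\<forall>t<s. lo \<le> t \<longrightarrow> cf a lo (t - lo) = 0" "l < n"
      then show "cf a lo l = 0" by (auto simp: n_def less_diff_conv dest: spec[of _ "l + lo"])
    qed (auto simp: n_def)
    finally show ?thesis .
  qed
  then show ?thesis using s(1) by (intro exI[of _ n]) (auto simp: n_def jump_def)
qed

end

section \<open>Injectivity of long uniserial modules\<close>

lemma sum_shift:
  fixes f :: "nat \<Rightarrow> 'k::comm_monoid_add"
  assumes "\<And>s. s < p \<Longrightarrow> f s = 0"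
  shows "(\<Sum>s\<le>p + l. f s) = (\<Sum>m\<le>l. f (p + m))"
proof -
  have "(\<Sum>s\<le>p + l. f s) = (\<Sum>s=p..p + l. f s)"
    using assms by (intro sum.mono_neutral_right) auto
  also have "\<dots> = (\<Sum>m\<le>l. f (p + m))"
    using sum.shift_bounds_cl_nat_ivl[of f 0 p l] by (simp add: add.commute atLeast0AtMost)
  finally show ?thesis .
qed

lemma regular_right_module:
  assumes "ring A"
  shows "right_module A (regular_module A)"
proof -
  interpret ring A by fact
  have "abelian_group (regular_module A)"
    by (rule abelian_groupI) (auto simp: regular_module_def a_ac intro!: bexI[of _ "\<ominus>\<^bsub>A\<^esub> _"] l_neg)
  then show ?thesis
    by (intro right_module.intro right_module_axioms.intro ring_axioms)
      (auto simp: regular_module_def l_distr r_distr m_assoc)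
qed

lemma regular_simps [simp]:
  "carrier (regular_module A) = carrier A" "add (regular_module A) = add A"
  "zero (regular_module A) = zero A" "a \<odot>\<^bsub>regular_module A\<^esub> m = m \<otimes>\<^bsub>A\<^esub> a"
  by (simp_all add: regular_module_def)

lemma im_cong:
  assumes "\<And>k. k \<in> J \<Longrightarrow> p k = p' k \<and> q k = q' k"
  shows "im cf J p q = im cf J p' q'"
proof -
  have "(\<lambda>r v. mk (\<lambda>k t. if k \<in> J \<and> t < q k then \<Sum>s\<le>t. co v k s * cf r s (t - s) else 0)) =
    (\<lambda>r v. mk (\<lambda>k t. if k \<in> J \<and> t < q' k then \<Sum>s\<le>t. co v k s * cf r s (t - s) else 0))"
    by (intro ext co_eqI arg_cong[where f = mk]) (auto simp: assms)
  moreover have "(k \<in> J \<and> p k \<le> t \<and> t < q k) = (k \<in> J \<and> p' k \<le> t \<and> t < q' k)" for k t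
    using assms[of k] by auto
  ultimately show ?thesis by (simp add: im_def)
qed

context nak
begin

lemma alg_induct:
  assumes "a \<in> carrier A" and P0: "P \<zero>"
    and Padd: "\<And>x y. x \<in> carrier A \<Longrightarrow> y \<in> carrier A \<Longrightarrow> P x \<Longrightarrow> P y \<Longrightarrow> P (x \<oplus> y)"
    and Pxx: "\<And>s i l. i < N \<Longrightarrow> l < c i \<Longrightarrow> P (s \<odot> xx i l)"
  shows "P a"
proof -
  have "P a" if "finite S" "a \<in> carrier A" "\<And>i l. i < N \<Longrightarrow> cf a i l \<noteq> 0 \<Longrightarrow> (i, l) \<in> S" for S a
    using that
  proof (induction S arbitrary: a)
    case empty
    then have "a = \<zero>" by (intro cf_eqI) (auto simp: cf_zero)
    then show ?case using P0 by simp
  next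
    case (insert x S)
    obtain i l where x: "x = (i, l)" by (cases x)
    show ?case
    proof (cases "i < N \<and> l < c i")
      case True
      define b where "b = a \<ominus> cf a i l \<odot> xx i l"
      have b: "b \<in> carrier A" using insert.prems scal_closed by (simp add: b_def)
      have "P b"
      proof (rule insert.IH[OF b])
        fix i' l' assume *: "i' < N" "cf b i' l' \<noteq> 0"
        have "cf b i' l' = cf a i' l' - (if i' = i \<and> l' = l then cf a i l else 0)"
          using insert.prems(1) True * scal_closed by (auto simp: b_def cf_minus cf_scal cf_xx)
        then have "(i', l') \<noteq> (i, l)" "cf a i' l' \<noteq> 0" using * by (auto split: if_splits)
        then show "(i', l') \<in> S" using insert.prems(2) * x by auto
      qed
      moreover have "a = b \<oplus> cf a i l \<odot> xx i l"
        using insert.prems(1) scal_closed by (simp add: b_def a_minus_def a_assoc l_neg)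
      ultimately show ?thesis using Padd[OF b scal_closed[OF xx_closed]] Pxx True by metis
    next
      case False
      then have "cf a i l = 0 \<or> \<not> i < N" using cf_trunc insert.prems(1) by (meson not_le)
      then show ?thesis using insert.IH[OF insert.prems(1)] insert.prems(2) x by blast
    qed
  qed
  moreover have "finite (SIGMA i:{..<N}. {..<c i})" by auto
  moreover have "(i, l) \<in> (SIGMA i:{..<N}. {..<c i})" if "i < N" "cf a i l \<noteq> 0" for i l
    using that cf_trunc[OF assms(1), of i l] by (auto simp: not_le[symmetric])
  ultimately show ?thesis using assms(1) by blast
qed

definition subspace :: "('a, 'm) module \<Rightarrow> 'm set \<Rightarrow> bool" where
  "subspace M V \<longleftrightarrow> V \<subseteq> carrier M \<and> \<zero>\<^bsub>M\<^esub> \<in> V \<and> (\<forall>x\<in>V. \<forall>y\<in>V. x \<oplus>\<^bsub>M\<^esub> y \<in> V) \<and> (\<forall>s. \<forall>x\<in>V. sc M s x \<in> V)"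

definition linear_on :: "('a, 'm) module \<Rightarrow> 'm set \<Rightarrow> ('m \<Rightarrow> 'k) \<Rightarrow> bool" where
  "linear_on M V f \<longleftrightarrow> (\<forall>x\<in>V. \<forall>y\<in>V. f (x \<oplus>\<^bsub>M\<^esub> y) = f x + f y) \<and> (\<forall>s. \<forall>x\<in>V. f (sc M s x) = s * f x)"

lemma submodule_subspace:
  assumes "right_module A M" "submodule U A M"
  shows "subspace M U"
proof -
  interpret M: right_module A M by fact
  show ?thesis using M.submoduleD[OF assms(2)] by (auto simp: subspace_def sc_def scal_closed)
qed

lemma extend_functional_one:
  assumes "right_module A M" "subspace M V" "linear_on M V f" "y \<in> carrier M"
  shows "\<exists>V' f'. subspace M V' \<and> V \<subseteq> V' \<and> y \<in> V' \<and> linear_on M V' f' \<and> (\<forall>x\<in>V. f' x = f x)"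
proof (cases "y \<in> V")
  case False
  interpret M: right_module A M by fact
  note sc = sc_simps[OF assms(1)]
  have V: "V \<subseteq> carrier M" "\<zero>\<^bsub>M\<^esub> \<in> V" "\<And>x z. x \<in> V \<Longrightarrow> z \<in> V \<Longrightarrow> x \<oplus>\<^bsub>M\<^esub> z \<in> V" "\<And>s x. x \<in> V \<Longrightarrow> sc M s x \<in> V"
    using assms(2) by (auto simp: subspace_def)
  have Vc: "v \<in> carrier M" if "v \<in> V" for v using that V(1) by auto
  have yc: "sc M s y \<in> carrier M" for s using sc(1) assms(4) by blast
  have unique: "v = v'" if v: "v \<in> V" "v' \<in> V" "v \<oplus>\<^bsub>M\<^esub> sc M s y = v' \<oplus>\<^bsub>M\<^esub> sc M s' y" for v v' s s'
  proof -
    have "v \<oplus>\<^bsub>M\<^esub> sc M (s - s') y = (v \<oplus>\<^bsub>M\<^esub> sc M s y) \<oplus>\<^bsub>M\<^esub> sc M (- s') y"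
      using sc(5)[OF assms(4), of s "- s'"] v(1,2) yc Vc by (simp add: M.M.a_assoc)
    also have "\<dots> = v' \<oplus>\<^bsub>M\<^esub> (sc M s' y \<oplus>\<^bsub>M\<^esub> sc M (- s') y)"
      unfolding v(3) using v(1,2) yc Vc by (simp add: M.M.a_assoc)
    also have "\<dots> = v'" using sc(5)[OF assms(4), of s' "- s'", symmetric] sc(8)[OF assms(4)] Vc[OF v(2)] by simp
    finally have *: "v \<oplus>\<^bsub>M\<^esub> sc M (s - s') y = v'" .
    have "s = s'"
    proof (rule ccontr)
      assume "s \<noteq> s'"
      have "sc M (-1) v \<oplus>\<^bsub>M\<^esub> v = \<zero>\<^bsub>M\<^esub>"
        using sc(5)[OF Vc[OF v(1)], of "-1" 1] sc(7,8)[OF Vc[OF v(1)]] by simp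
      then have "sc M (-1) v \<oplus>\<^bsub>M\<^esub> v' = sc M (s - s') y"
        unfolding *[symmetric] using sc(1)[OF Vc[OF v(1)]] Vc[OF v(1)] yc by (simp add: M.M.a_assoc[symmetric])
      then have "sc M (s - s') y \<in> V" using V(3)[OF V(4)[OF v(1), of "-1"] v(2)] by simp
      then have "sc M (1 / (s - s')) (sc M (s - s') y) \<in> V" by (rule V(4))
      then show False using \<open>s \<noteq> s'\<close> False sc(6,7)[OF assms(4)] by simp
    qed
    then show ?thesis using * sc(8)[OF assms(4)] Vc[OF v(1)] by simp
  qed
  define V' where "V' = {v \<oplus>\<^bsub>M\<^esub> sc M s y | v s. v \<in> V}"
  define dec where "dec x = (SOME v. v \<in> V \<and> (\<exists>s. x = v \<oplus>\<^bsub>M\<^esub> sc M s y))" for x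
  have dec: "dec (v \<oplus>\<^bsub>M\<^esub> sc M s y) = v" if "v \<in> V" for v s
    unfolding dec_def by (rule some_equality) (use that unique in blast)+
  have sum: "(v \<oplus>\<^bsub>M\<^esub> sc M s y) \<oplus>\<^bsub>M\<^esub> (v' \<oplus>\<^bsub>M\<^esub> sc M s' y) = (v \<oplus>\<^bsub>M\<^esub> v') \<oplus>\<^bsub>M\<^esub> sc M (s + s') y" if "v \<in> V" "v' \<in> V" for v v' s s'
    using that yc Vc sc(5)[OF assms(4)] by (simp add: M.M.a_ac)
  have scal: "sc M r (v \<oplus>\<^bsub>M\<^esub> sc M s y) = sc M r v \<oplus>\<^bsub>M\<^esub> sc M (r * s) y" if "v \<in> V" for v r s
    using sc(4)[OF Vc[OF that] yc] sc(6)[OF assms(4)] by simp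
  have "subspace M V'"
    unfolding subspace_def
  proof (intro conjI ballI allI)
    show "V' \<subseteq> carrier M" using yc Vc by (auto simp: V'_def)
    have "\<zero>\<^bsub>M\<^esub> = \<zero>\<^bsub>M\<^esub> \<oplus>\<^bsub>M\<^esub> sc M 0 y" using sc(8)[OF assms(4)] by simp
    then show "\<zero>\<^bsub>M\<^esub> \<in> V'" unfolding V'_def using V(2) by blast
    show "x \<oplus>\<^bsub>M\<^esub> z \<in> V'" if "x \<in> V'" "z \<in> V'" for x z
      using that sum V(3) unfolding V'_def by blast
    show "sc M s x \<in> V'" if "x \<in> V'" for s x
      using that scal V(4) unfolding V'_def by blast
  qed
  moreover have "V \<subseteq> V'"
  proof
    fix v assume v: "v \<in> V"
    then have "v = v \<oplus>\<^bsub>M\<^esub> sc M 0 y" using sc(8)[OF assms(4)] Vc by simp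
    then show "v \<in> V'" unfolding V'_def using v by blast
  qed
  moreover have "y \<in> V'"
  proof -
    have "y = \<zero>\<^bsub>M\<^esub> \<oplus>\<^bsub>M\<^esub> sc M 1 y" using sc(7)[OF assms(4)] assms(4) by simp
    then show ?thesis unfolding V'_def using V(2) by blast
  qed
  moreover have "linear_on M V' (\<lambda>x. f (dec x))"
    unfolding linear_on_def V'_def using assms(3) V(3,4)
    by (auto simp: sum scal dec linear_on_def)
  moreover have "\<forall>x\<in>V. f (dec x) = f x"
  proof
    fix v assume "v \<in> V"
    then show "f (dec v) = f v" using dec[of v 0] sc(8)[OF assms(4)] Vc by simp
  qed
  ultimately show ?thesis by (intro exI[of _ V'] exI[of _ "\<lambda>x. f (dec x)"]) blast
qed (use assms in blast)

text \<open>
  A finitely generated module is a finite-dimensional vector space, so finitely many extensions by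
  one vector suffice.
\<close>

lemma extend_functional:
  assumes "fg_module A M" "subspace M V" "linear_on M V f"
  shows "\<exists>f'. linear_on M (carrier M) f' \<and> (\<forall>x\<in>V. f' x = f x)"
proof -
  have M: "right_module A M" using assms(1) by (simp add: fg_module_def)
  interpret M: right_module A M by fact
  have ext: "\<exists>V' f'. subspace M V' \<and> V \<subseteq> V' \<and> B \<subseteq> V' \<and> linear_on M V' f' \<and> (\<forall>x\<in>V. f' x = f x)"
    if "finite B" "B \<subseteq> carrier M" for B
    using that
  proof induction
    case empty
    then show ?case using assms by blast
  next
    case (insert y B)
    then obtain V' f' where 1: "subspace M V'" "V \<subseteq> V'" "B \<subseteq> V'" "linear_on M V' f'" "\<forall>x\<in>V. f' x = f x" by auto
    have "y \<in> carrier M" using insert by simp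
    from extend_functional_one[OF M 1(1,4) this] obtain V'' f'' where
      2: "subspace M V''" "V' \<subseteq> V''" "y \<in> V''" "linear_on M V'' f''" "\<forall>x\<in>V'. f'' x = f' x" by blast
    show ?case by (rule exI[of _ V''], rule exI[of _ f'']) (use 1 2 in auto)
  qed
  obtain X where X: "finite X" "X \<subseteq> carrier M" "\<And>U. submodule U A M \<Longrightarrow> X \<subseteq> U \<Longrightarrow> U = carrier M"
    using assms(1) by (auto simp: fg_module_def)
  define B where "B = (\<lambda>(m, i, l). xx i l \<odot>\<^bsub>M\<^esub> m) ` (X \<times> (SIGMA i:{..<N}. {..<c i}))"
  have "finite B" "B \<subseteq> carrier M" using X by (auto simp: B_def M.act_closed)
  from ext[OF this] obtain V' f' where
    V': "subspace M V'" "B \<subseteq> V'" "linear_on M V' f'" "\<forall>x\<in>V. f' x = f x" by auto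
  have s: "V' \<subseteq> carrier M" "\<zero>\<^bsub>M\<^esub> \<in> V'" "\<And>x z. x \<in> V' \<Longrightarrow> z \<in> V' \<Longrightarrow> x \<oplus>\<^bsub>M\<^esub> z \<in> V'" "\<And>s x. x \<in> V' \<Longrightarrow> sc M s x \<in> V'"
    using V'(1) by (auto simp: subspace_def)
  define U where "U = {m \<in> carrier M. \<forall>a\<in>carrier A. a \<odot>\<^bsub>M\<^esub> m \<in> V'}"
  have "submodule U A M"
    by (rule M.submoduleI) (auto simp: U_def s M.act_zero_right M.act_add_right M.act_closed M.act_mult[symmetric])
  moreover have "X \<subseteq> U"
  proof
    fix m assume m: "m \<in> X"
    then have mc: "m \<in> carrier M" using X by auto
    have "a \<odot>\<^bsub>M\<^esub> m \<in> V'" if "a \<in> carrier A" for a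
      using that
    proof (rule alg_induct)
      show "\<zero> \<odot>\<^bsub>M\<^esub> m \<in> V'" using mc s by (simp add: M.act_zero_left)
      show "(x \<oplus> y) \<odot>\<^bsub>M\<^esub> m \<in> V'" if "x \<in> carrier A" "y \<in> carrier A" "x \<odot>\<^bsub>M\<^esub> m \<in> V'" "y \<odot>\<^bsub>M\<^esub> m \<in> V'" for x y
        using that mc s by (simp add: M.act_add_left)
      show "(r \<odot> xx i l) \<odot>\<^bsub>M\<^esub> m \<in> V'" if "i < N" "l < c i" for r i l
      proof -
        have "xx i l \<odot>\<^bsub>M\<^esub> m \<in> V'" using that m V'(2) unfolding B_def by force
        then show ?thesis using sc_simps(2)[OF M mc xx_closed] s(4) by simp
      qed
    qed
    then show "m \<in> U" using mc by (simp add: U_def)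
  qed
  ultimately have "U = carrier M" using X by blast
  then have "\<one> \<odot>\<^bsub>M\<^esub> m \<in> V'" if "m \<in> carrier M" for m using that unfolding U_def by blast
  then have "carrier M \<subseteq> V'" using M.act_one by auto
  then have "V' = carrier M" using s(1) by blast
  then show ?thesis using V' by blast
qed

text \<open>
  A uniserial module of the largest length that the acting algebra admits is injective. The functional
  reading off its socle coordinate extends by linear algebra, and translating the extended functional
  by paths recovers all other coordinates.
\<close>

lemma im_injective:
  assumes "fg_module A Y" "submodule X A Y" "p k < q k" "q k \<le> jump c (p k)"
    and f: "f \<in> rhom A (Y\<lparr>carrier := X\<rparr>) (im cf {k} p q)"
    and kill: "\<And>a y. a \<in> carrier A \<Longrightarrow> (\<And>i l. l < q k - p k \<Longrightarrow> cf a i l = 0) \<Longrightarrow> y \<in> carrier Y \<Longrightarrow> a \<odot>\<^bsub>Y\<^esub> y = \<zero>\<^bsub>Y\<^esub>"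
  shows "\<exists>h\<in>rhom A Y (im cf {k} p q). \<forall>x\<in>X. h x = f x"
proof -
  let ?I = "im cf {k} p q"
  define lo hi L where "lo = p k" and "hi = q k" and "L = hi - lo"
  have lohi: "lo < hi" "hi \<le> jump c lo" using assms(3,4) by (auto simp: lo_def hi_def)
  have Y: "right_module A Y" using assms(1) by (simp add: fg_module_def)
  interpret Y: right_module A Y by fact
  interpret I: right_module A ?I using assms(4) by (intro im_right_module) simp
  have I: "right_module A ?I" ..
  note X = Y.submoduleD[OF assms(2)]
  have XY: "right_module A (Y\<lparr>carrier := X\<rparr>)" by (rule Y.right_module_sub) fact
  note fD = rhomD[OF f, simplified]
  have fsc: "f (sc Y s x) = sc ?I s (f x)" if "x \<in> X" for s x
    using fD(3)[OF _ that] scal_closed by (simp add: sc_def)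
  have lin: "linear_on Y X (\<lambda>x. co (f x) k (hi - 1))"
    unfolding linear_on_def
  proof (intro conjI ballI allI)
    fix s x assume x: "x \<in> X"
    show "co (f (sc Y s x)) k (hi - 1) = s * co (f x) k (hi - 1)"
      unfolding fsc[OF x] by (rule sc_im) (use assms(4) fD(1)[OF x] in auto)
  qed (simp add: fD(2))
  obtain ell where lam: "linear_on Y (carrier Y) ell" "\<forall>x\<in>X. ell x = co (f x) k (hi - 1)"
    using extend_functional[OF assms(1) submodule_subspace[OF Y assms(2)] lin] by blast
  have lam0: "ell \<zero>\<^bsub>Y\<^esub> = 0"
    using lam(1) sc_simps(8)[OF Y Y.M.zero_closed] unfolding linear_on_def
    by (metis Y.M.zero_closed mult_zero_left)
  \<comment> \<open>The path from \<open>t\<close> to the socle position \<open>hi - 1\<close> turns the coordinate at \<open>t\<close> into the socle coordinate.\<close>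
  define h where "h y = mk (\<lambda>k' t. if k' = k \<and> lo \<le> t \<and> t < hi then ell (xx t (hi - 1 - t) \<odot>\<^bsub>Y\<^esub> y) else 0)" for y
  have co_h: "co (h y) k' t = (if k' = k \<and> lo \<le> t \<and> t < hi then ell (xx t (hi - 1 - t) \<odot>\<^bsub>Y\<^esub> y) else 0)" for y k' t
    by (simp add: h_def)
  have hc: "h y \<in> carrier ?I" for y by (auto simp: im_carrier co_h lo_def hi_def split: if_splits)
  have expand: "ell (b \<odot>\<^bsub>Y\<^esub> y) = (\<Sum>l<L. cf b (hi - 1 - l) l * ell (xx (hi - 1 - l) l \<odot>\<^bsub>Y\<^esub> y))"
    if y: "y \<in> carrier Y" and "b \<in> carrier A" "d \<le> L" "\<And>i l. l < d \<Longrightarrow> cf b i l = 0"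
      "\<And>i l. cf b i l \<noteq> 0 \<Longrightarrow> (i + l) mod N = (hi - 1) mod N" for y b d
    using that(2-)
  proof (induction "L - d" arbitrary: d b)
    case 0
    then have "b \<odot>\<^bsub>Y\<^esub> y = \<zero>\<^bsub>Y\<^esub>" using y by (intro kill) (auto simp: L_def lo_def hi_def)
    then show ?case using 0 lam0 by simp
  next
    case (Suc n)
    then have d: "d < L" by simp
    let ?s = "cf b (hi - 1 - d) d" and ?x = "xx (hi - 1 - d) d"
    define b' where "b' = b \<ominus> ?s \<odot> ?x"
    have b': "b' \<in> carrier A" using Suc.prems(1) scal_closed by (simp add: b'_def)
    have dhi: "hi - 1 - d + d = hi - 1" using d by (simp add: L_def)
    have cb': "cf b' i l = (if l = d then 0 else cf b i l)" for i l
    proof -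
      have 1: "cf b' i l = cf b i l - ?s * cf ?x i l"
        using Suc.prems(1) scal_closed by (simp add: b'_def cf_minus cf_scal)
      show ?thesis
      proof (cases "l = d")
        case True
        have "cf b i d = ?s * cf ?x i d"
        proof (cases "i mod N = (hi - 1 - d) mod N")
          case T: True
          then show ?thesis using cf_cong[OF Suc.prems(1) T, of d] cf_trunc[OF Suc.prems(1), of "hi - 1 - d" d]
            by (cases "d < c (hi - 1 - d)") (auto simp: cf_xx)
        next
          case F: False
          then have "(i + d) mod N \<noteq> (hi - 1) mod N" using mod_add_cancel[of i d N "hi - 1 - d"] dhi by simp
          then show ?thesis using F Suc.prems(4)[of i d] by (auto simp: cf_xx)
        qed
        then show ?thesis using 1 True by simp
      qed (use 1 in \<open>auto simp: cf_xx\<close>)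
    qed
    have IH: "ell (b' \<odot>\<^bsub>Y\<^esub> y) = (\<Sum>l<L. cf b' (hi - 1 - l) l * ell (xx (hi - 1 - l) l \<odot>\<^bsub>Y\<^esub> y))"
    proof (rule Suc.hyps(1)[of "Suc d"])
      show "n = L - Suc d" "b' \<in> carrier A" "Suc d \<le> L" using Suc.hyps(2) b' d by auto
      show "cf b' i l = 0" if "l < Suc d" for i l using that Suc.prems(3) by (auto simp: cb' less_Suc_eq)
      show "(i + l) mod N = (hi - 1) mod N" if "cf b' i l \<noteq> 0" for i l
        using that Suc.prems(4) by (auto simp: cb' split: if_splits)
    qed
    have "b = b' \<oplus> ?s \<odot> ?x"
      using Suc.prems(1) scal_closed by (simp add: b'_def a_minus_def a_assoc l_neg)
    then have "b \<odot>\<^bsub>Y\<^esub> y = b' \<odot>\<^bsub>Y\<^esub> y \<oplus>\<^bsub>Y\<^esub> sc Y ?s (?x \<odot>\<^bsub>Y\<^esub> y)"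
      using b' y scal_closed sc_simps(2)[OF Y y xx_closed] by (metis Y.act_add_left xx_closed)
    then have "ell (b \<odot>\<^bsub>Y\<^esub> y) = ell (b' \<odot>\<^bsub>Y\<^esub> y) + ?s * ell (?x \<odot>\<^bsub>Y\<^esub> y)"
      using lam(1) b' y Y.act_closed sc_simps(1)[OF Y] unfolding linear_on_def by simp
    also have "\<dots> = (\<Sum>l<L. cf b (hi - 1 - l) l * ell (xx (hi - 1 - l) l \<odot>\<^bsub>Y\<^esub> y))"
    proof -
      have "(\<Sum>l<L. cf b (hi - 1 - l) l * ell (xx (hi - 1 - l) l \<odot>\<^bsub>Y\<^esub> y)) =
          ?s * ell (?x \<odot>\<^bsub>Y\<^esub> y) + (\<Sum>l\<in>{..<L} - {d}. cf b (hi - 1 - l) l * ell (xx (hi - 1 - l) l \<odot>\<^bsub>Y\<^esub> y))"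
        using d by (intro sum.remove) auto
      moreover have "(\<Sum>l\<in>{..<L} - {d}. cf b (hi - 1 - l) l * ell (xx (hi - 1 - l) l \<odot>\<^bsub>Y\<^esub> y)) =
          (\<Sum>l<L. cf b' (hi - 1 - l) l * ell (xx (hi - 1 - l) l \<odot>\<^bsub>Y\<^esub> y))"
        by (rule sum.mono_neutral_cong_left) (auto simp: cb')
      ultimately show ?thesis using IH by simp
    qed
    finally show ?case .
  qed
  have "h \<in> rhom A Y ?I"
  proof (rule rhomI)
    fix x y assume "x \<in> carrier Y" "y \<in> carrier Y"
    then show "h (x \<oplus>\<^bsub>Y\<^esub> y) = h x \<oplus>\<^bsub>?I\<^esub> h y"
      using lam(1) by (intro co_eqI) (simp add: co_h Y.act_add_right Y.act_closed linear_on_def)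
  next
    fix a y assume a: "a \<in> carrier A" and y: "y \<in> carrier Y"
    show "h (a \<odot>\<^bsub>Y\<^esub> y) = a \<odot>\<^bsub>?I\<^esub> h y"
    proof (rule co_eqI)
      fix k' t
      show "co (h (a \<odot>\<^bsub>Y\<^esub> y)) k' t = co (a \<odot>\<^bsub>?I\<^esub> h y) k' t"
      proof (cases "k' = k \<and> lo \<le> t \<and> t < hi")
        case True
        let ?b = "a \<otimes> xx t (hi - 1 - t)"
        have cb: "cf ?b i l = (if (i + l) mod N = (hi - 1) mod N \<and> hi - 1 - t \<le> l \<and> l < c i
            then cf a i (l - (hi - 1 - t)) else 0)" for i l
          using True by (simp add: cf_xx_right[OF a])
        have "ell (xx t (hi - 1 - t) \<odot>\<^bsub>Y\<^esub> (a \<odot>\<^bsub>Y\<^esub> y)) = ell (?b \<odot>\<^bsub>Y\<^esub> y)"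
          using a y by (simp add: Y.act_mult)
        also have "\<dots> = (\<Sum>l<L. cf ?b (hi - 1 - l) l * ell (xx (hi - 1 - l) l \<odot>\<^bsub>Y\<^esub> y))"
        proof (rule expand[OF y])
          show "?b \<in> carrier A" using a by simp
          show "(i + l) mod N = (hi - 1) mod N" if "cf ?b i l \<noteq> 0" for i l
            using that unfolding cb by (metis (no_types))
        qed auto
        also have "\<dots> = (\<Sum>s\<in>{lo..<hi}. cf ?b s (hi - 1 - s) * ell (xx s (hi - 1 - s) \<odot>\<^bsub>Y\<^esub> y))"
          by (rule sum.reindex_bij_witness[of _ "\<lambda>s. hi - 1 - s" "\<lambda>l. hi - 1 - l"]) (use lohi in \<open>auto simp: L_def\<close>)
        also have "\<dots> = (\<Sum>s\<le>t. co (h y) k s * cf a s (t - s))"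
        proof (rule sum.mono_neutral_cong)
          fix s assume "s \<in> {..t} - {lo..<hi}"
          then show "co (h y) k s * cf a s (t - s) = 0" by (auto simp: co_h)
        next
          fix s assume "s \<in> {lo..<hi} - {..t}"
          then have "\<not> hi - 1 - t \<le> hi - 1 - s" using True by auto
          then show "cf ?b s (hi - 1 - s) * ell (xx s (hi - 1 - s) \<odot>\<^bsub>Y\<^esub> y) = 0"
            by (simp only: cb simp_thms if_False mult_zero_left)
        next
          fix s assume s: "s \<in> {lo..<hi} \<inter> {..t}"
          then have "hi - 1 - s < c s" using lohi jump_mono[of lo s] by (auto simp: jump_def)
          moreover have "hi - 1 - s - (hi - 1 - t) = t - s" using s True by auto
          moreover have "s + (hi - 1 - s) = hi - 1" "hi - 1 - t \<le> hi - 1 - s" using s True by auto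
          ultimately have "cf ?b s (hi - 1 - s) = cf a s (t - s)" by (simp only: cb simp_thms if_True)
          moreover have "co (h y) k s = ell (xx s (hi - 1 - s) \<odot>\<^bsub>Y\<^esub> y)" using s by (simp add: co_h)
          ultimately show "cf ?b s (hi - 1 - s) * ell (xx s (hi - 1 - s) \<odot>\<^bsub>Y\<^esub> y) = co (h y) k s * cf a s (t - s)"
            by (simp only: mult.commute)
        qed auto
        finally show ?thesis using True by (simp add: co_h hi_def)
      next
        case False
        have "a \<odot>\<^bsub>?I\<^esub> h y \<in> carrier ?I" using I.act_closed[OF a hc] .
        then have "co (a \<odot>\<^bsub>?I\<^esub> h y) k' t = 0" using False unfolding im_carrier lo_def hi_def by blast
        then show ?thesis using False by (auto simp: co_h)
      qed
    qed
  qed (rule hc)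
  moreover have "h x = f x" if x: "x \<in> X" for x
  proof (rule co_eqI)
    fix k' t
    show "co (h x) k' t = co (f x) k' t"
    proof (cases "k' = k \<and> lo \<le> t \<and> t < hi")
      case True
      have "xx t (hi - 1 - t) \<odot>\<^bsub>Y\<^esub> x \<in> X" using X(4) x by simp
      then have "ell (xx t (hi - 1 - t) \<odot>\<^bsub>Y\<^esub> x) = co (xx t (hi - 1 - t) \<odot>\<^bsub>?I\<^esub> f x) k (hi - 1)"
        using lam(2) fD(3)[OF xx_closed x] by simp
      also have "\<dots> = (\<Sum>s\<le>hi - 1. co (f x) k s * cf (xx t (hi - 1 - t)) s (hi - 1 - s))"
        using lohi by (simp add: hi_def)
      also have "\<dots> = co (f x) k t"
      proof -
        have "hi - 1 - t < c t" using True lohi jump_mono[of lo t] by (auto simp: jump_def)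
        then show ?thesis using True by (subst sum_single_le[of _ t]) (auto simp: cf_xx)
      qed
      finally show ?thesis using True by (simp add: co_h)
    next
      case False
      then have "co (f x) k' t = 0" using fD(1)[OF x] unfolding im_carrier lo_def hi_def by blast
      then show ?thesis using False by (auto simp: co_h)
    qed
  qed
  ultimately show ?thesis by blast
qed

end

context nak
begin

section \<open>Decomposition into interval modules\<close>

definition generates :: "('a, 'm) module \<Rightarrow> nat set \<Rightarrow> (nat \<Rightarrow> 'm) \<Rightarrow> bool" where
  "generates M J g \<longleftrightarrow> (\<forall>U. submodule U A M \<and> g ` J \<subseteq> U \<longrightarrow> U = carrier M)"

text \<open>
  A generator of maximal length splits off: no element of \<open>A\<close> of larger order acts on the module, so
  the submodule it generates is injective relative to the module.
\<close>

lemma longest_generator_splits: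
  assumes "right_module A M" "finite J" "generates M J g" "\<And>k. k \<in> J \<Longrightarrow> homogeneous M (e k) (g k)"
    and L: "\<And>k a. k \<in> J \<Longrightarrow> a \<in> carrier A \<Longrightarrow> a \<odot>\<^bsub>M\<^esub> g k = \<zero>\<^bsub>M\<^esub> \<longleftrightarrow> (\<forall>l<L k. cf a (e k) l = 0)"
    and Lc: "\<And>k. k \<in> J \<Longrightarrow> L k \<le> c (e k)"
    and j: "j \<in> J" "\<And>k. k \<in> J \<Longrightarrow> L k \<le> L j"
  defines "I \<equiv> im cf {j} e (\<lambda>k. e k + L k)"
  shows "\<exists>h\<in>rhom A M I. \<forall>v\<in>carrier I. h (rho (e j) (co v j) \<odot>\<^bsub>M\<^esub> g j) = v"
proof -
  interpret M: right_module A M by fact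
  have Ij: "right_module A I" unfolding I_def using Lc[OF j(1)] by (intro im_right_module) (simp add: jump_def)
  interpret I: right_module A I by fact
  have fg: "fg_module A M"
    unfolding fg_module_def using assms(1-4) by (auto simp: generates_def intro!: exI[of _ "g ` J"])
  let ?psi = "\<lambda>v. rho (e j) (co v j) \<odot>\<^bsub>M\<^esub> g j"
  have psi: "?psi \<in> rhom A I M"
    unfolding I_def
    by (rule row_hom[OF assms(1)]) (use assms(4)[OF j(1)] L[OF j(1)] Lc[OF j(1)] in \<open>auto simp: jump_def killed_from_def\<close>)
  have psi0: "v = \<zero>\<^bsub>I\<^esub>" if "v \<in> carrier I" "?psi v = \<zero>\<^bsub>M\<^esub>" for v
  proof -
    have "co v j (e j + l) = 0" if "l < L j" for l
      using L[OF j(1) rho_closed] \<open>?psi v = _\<close> that Lc[OF j(1)] by (force simp: cf_rho)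
    then have z: "co v j t = 0" if "e j \<le> t" "t < e j + L j" for t
      using that by (metis add_less_cancel_left le_add_diff_inverse)
    show ?thesis
    proof (rule co_eqI)
      fix k t
      show "co v k t = co \<zero>\<^bsub>I\<^esub> k t" using \<open>v \<in> carrier I\<close> z unfolding I_def im_carrier by force
    qed
  qed
  have inj: "inj_on ?psi (carrier I)" using psi0 rhom_inj_iff[OF Ij assms(1) psi] by blast
  show ?thesis
  proof (cases "L j = 0")
    case True
    have "v = \<zero>\<^bsub>I\<^esub>" if "v \<in> carrier I" for v
    proof (rule co_eqI)
      fix k t
      show "co v k t = co \<zero>\<^bsub>I\<^esub> k t" using that True unfolding I_def im_carrier by force
    qed
    then show ?thesis using rhom_zero_map[OF Ij] by metis
  next
    case False
    let ?X = "?psi ` carrier I"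
    have X: "submodule ?X A M" by (rule rhom_image_submodule[OF Ij assms(1) psi I.carrier_submodule])
    have XM: "right_module A (M\<lparr>carrier := ?X\<rparr>)" by (rule M.right_module_sub[OF X])
    have psiX: "?psi \<in> rhom A I (M\<lparr>carrier := ?X\<rparr>)" using rhomD[OF psi] by (intro rhomI) auto
    define f where "f = inv_into (carrier I) ?psi"
    have "f \<in> rhom A (M\<lparr>carrier := ?X\<rparr>) I"
      unfolding f_def using inj by (intro rhom_inv[OF Ij XM psiX]) (simp add: bij_betw_def)
    moreover have "a \<odot>\<^bsub>M\<^esub> y = \<zero>\<^bsub>M\<^esub>"
      if a: "a \<in> carrier A" "\<And>i l. l < L j \<Longrightarrow> cf a i l = 0" and y: "y \<in> carrier M" for a y
    proof -
      let ?U = "{y \<in> carrier M. \<forall>a\<in>carrier A. (\<forall>i l. l < L j \<longrightarrow> cf a i l = 0) \<longrightarrow> a \<odot>\<^bsub>M\<^esub> y = \<zero>\<^bsub>M\<^esub>}"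
      have "submodule ?U A M"
      proof (rule M.submoduleI)
        fix b x assume b: "b \<in> carrier A" and x: "x \<in> ?U"
        have "a \<odot>\<^bsub>M\<^esub> (b \<odot>\<^bsub>M\<^esub> x) = \<zero>\<^bsub>M\<^esub>" if a: "a \<in> carrier A" "\<forall>i l. l < L j \<longrightarrow> cf a i l = 0" for a
        proof -
          have "cf (b \<otimes> a) i l = 0" if "l < L j" for i l
            using a b that by (auto simp: cf_mult intro!: sum.neutral)
          then show ?thesis using x a(1) b M.act_mult[of b a x, symmetric] by simp
        qed
        then show "b \<odot>\<^bsub>M\<^esub> x \<in> ?U" using b x by (auto simp: M.act_closed)
      qed (auto simp: M.act_zero_right M.act_add_right)
      moreover have "g ` J \<subseteq> ?U"
      proof (intro subsetI, elim imageE)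
        fix x k assume k: "x = g k" "k \<in> J"
        have "b \<odot>\<^bsub>M\<^esub> g k = \<zero>\<^bsub>M\<^esub>" if "b \<in> carrier A" "\<forall>i l. l < L j \<longrightarrow> cf b i l = 0" for b
          using L[OF k(2) that(1)] that(2) less_le_trans[OF _ j(2)[OF k(2)]] by blast
        then show "x \<in> ?U" using k assms(4) by blast
      qed
      ultimately have "?U = carrier M" using assms(3) unfolding generates_def by blast
      then show ?thesis using a y by blast
    qed
    ultimately have "\<exists>h\<in>rhom A M I. \<forall>x\<in>?X. h x = f x"
      using False Lc[OF j(1)] unfolding I_def
      by (intro im_injective[OF fg X[unfolded I_def]]) (auto simp: jump_def)
    then obtain h where h: "h \<in> rhom A M I" "\<forall>x\<in>?X. h x = f x" by blast
    have "h (?psi v) = v" if "v \<in> carrier I" for v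
      using h(2) that inv_into_f_f[OF inj that] by (simp add: f_def)
    then show ?thesis using h(1) by blast
  qed
qed

text \<open>
  Induction on the number of generators: the longest generator splits off, and the projections of
  the remaining generators to the complement generate it.
\<close>

lemma interval_decomposition:
  fixes M :: "('a, 'm) module"
  assumes "right_module A M" "finite J" "generates M J g" "\<And>k. k \<in> J \<Longrightarrow> homogeneous M (e k) (g k)"
  shows "\<exists>p q \<phi>. (\<forall>k\<in>J. p k \<le> q k \<and> q k \<le> jump c (p k)) \<and>
     \<phi> \<in> rhom A (im cf J p q) M \<and> bij_betw \<phi> (carrier (im cf J p q)) (carrier M)"
  using assms
proof (induction "card J" arbitrary: J M g)
  case 0
  then have "J = {}" by simp
  interpret M: right_module A M by fact
  have "carrier M = {\<zero>\<^bsub>M\<^esub>}"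
    using 0(4) M.zero_submodule \<open>J = {}\<close> by (auto simp: generates_def)
  moreover have "carrier (im cf J p q) = {\<lambda>_. 0}" for p q
    using \<open>J = {}\<close> by (auto simp: im_carrier intro: co_eqI)
  moreover have "(\<lambda>_. \<zero>\<^bsub>M\<^esub>) \<in> rhom A (im cf J p q) M" for p q by (rule rhom_zero_map) fact
  ultimately show ?case using \<open>J = {}\<close>
    by (intro exI[of _ id] exI[of _ "\<lambda>_. \<zero>\<^bsub>M\<^esub>"]) (auto simp: bij_betw_def)
next
  case (Suc n)
  note M = Suc.prems(1) and fin = Suc.prems(2) and hom = Suc.prems(4)
  interpret M: right_module A M by fact
  have "\<forall>k\<in>J. \<exists>n\<le>c (e k). \<forall>a\<in>carrier A. a \<odot>\<^bsub>M\<^esub> g k = \<zero>\<^bsub>M\<^esub> \<longleftrightarrow> (\<forall>l<n. cf a (e k) l = 0)"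
    using cyclic_length[OF M hom] by blast
  then obtain L where L: "\<And>k. k \<in> J \<Longrightarrow> L k \<le> c (e k)"
    "\<And>k a. k \<in> J \<Longrightarrow> a \<in> carrier A \<Longrightarrow> a \<odot>\<^bsub>M\<^esub> g k = \<zero>\<^bsub>M\<^esub> \<longleftrightarrow> (\<forall>l<L k. cf a (e k) l = 0)"
    by metis
  have ne: "J \<noteq> {}" using Suc.hyps(2) by auto
  then have "\<exists>j\<in>J. \<forall>k\<in>J. L k \<le> L j"
    using fin Max_in[of "L ` J"] Max_ge[of "L ` J"] by (metis (no_types, lifting) finite_imageI image_iff image_is_empty)
  then obtain j where j: "j \<in> J" "\<And>k. k \<in> J \<Longrightarrow> L k \<le> L j" by blast
  let ?I = "im cf {j} e (\<lambda>k. e k + L k)"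
  let ?psi = "\<lambda>v. rho (e j) (co v j) \<odot>\<^bsub>M\<^esub> g j"
  obtain h where h: "h \<in> rhom A M ?I" "\<And>v. v \<in> carrier ?I \<Longrightarrow> h (?psi v) = v"
    using longest_generator_splits[OF M fin Suc.prems(3) hom L(2,1) j] by blast
  have I: "right_module A ?I" using L(1)[OF j(1)] by (intro im_right_module) (simp add: jump_def)
  interpret I: right_module A ?I by fact
  have psi: "?psi \<in> rhom A ?I M"
    by (rule row_hom[OF M]) (use hom[OF j(1)] L[OF j(1)] in \<open>auto simp: jump_def killed_from_def\<close>)
  let ?K = "a_kernel M ?I h"
  have K: "submodule ?K A M" by (rule kernel_submodule[OF M I h(1)])
  let ?M' = "M\<lparr>carrier := ?K\<rparr>"
  have M': "right_module A ?M'" by (rule M.right_module_sub[OF K])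
  interpret M': right_module A ?M' by fact
  define \<pi> where "\<pi> m = m \<ominus>\<^bsub>M\<^esub> ?psi (h m)" for m
  have hc: "h m \<in> carrier ?I" if "m \<in> carrier M" for m using rhomD(1)[OF h(1) that] .
  have pc: "?psi v \<in> carrier M" if "v \<in> carrier ?I" for v using rhomD(1)[OF psi that] .
  have \<pi>c: "\<pi> m \<in> carrier M" if "m \<in> carrier M" for m using that pc hc by (simp add: \<pi>_def)
  have h\<pi>: "h (\<pi> m) = \<zero>\<^bsub>?I\<^esub>" if "m \<in> carrier M" for m
  proof -
    have "h (\<pi> m) = h m \<ominus>\<^bsub>?I\<^esub> h (?psi (h m))"
      unfolding \<pi>_def using that pc[OF hc] by (intro rhom_minus[OF M I h(1)]) auto
    then show ?thesis using h(2)[OF hc[OF that]] hc[OF that] by (simp only: a_minus_def I.M.r_neg)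
  qed
  have \<pi>K: "\<pi> m \<in> ?K" if "m \<in> carrier M" for m
    using \<pi>c[OF that] h\<pi>[OF that] by (simp add: a_kernel_iff)
  have \<pi>id: "\<pi> m = m" if "m \<in> ?K" for m
    using that rhom_zero[OF I M psi] by (simp add: \<pi>_def a_kernel_iff a_minus_def)
  have \<pi>: "\<pi> \<in> rhom A M ?M'"
  proof (rule rhomI)
    fix x y assume xy: "x \<in> carrier M" "y \<in> carrier M"
    have "?psi (h (x \<oplus>\<^bsub>M\<^esub> y)) = ?psi (h x) \<oplus>\<^bsub>M\<^esub> ?psi (h y)"
      using rhomD(2)[OF h(1) xy] rhomD(2)[OF psi hc[OF xy(1)] hc[OF xy(2)]] by metis
    then show "\<pi> (x \<oplus>\<^bsub>M\<^esub> y) = \<pi> x \<oplus>\<^bsub>?M'\<^esub> \<pi> y"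
      unfolding \<pi>_def using xy pc[OF hc[OF xy(1)]] pc[OF hc[OF xy(2)]]
      by (simp only: a_minus_def M.M.minus_add) (simp add: M.M.a_ac)
  next
    fix a x assume ax: "a \<in> carrier A" "x \<in> carrier M"
    have "?psi (h (a \<odot>\<^bsub>M\<^esub> x)) = a \<odot>\<^bsub>M\<^esub> ?psi (h x)"
      using rhomD(3)[OF h(1) ax] rhomD(3)[OF psi ax(1) hc[OF ax(2)]] by metis
    moreover have "a \<odot>\<^bsub>M\<^esub> (\<ominus>\<^bsub>M\<^esub> y) = \<ominus>\<^bsub>M\<^esub> (a \<odot>\<^bsub>M\<^esub> y)" if "y \<in> carrier M" for y
      using rhom_neg[OF M M, of "\<lambda>x. x"] M.act_neg[of \<one> y] M.act_neg[of a y] that ax(1) M.act_mult[of "\<ominus> \<one>" a y]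
      by (simp add: M.act_one l_minus)
    ultimately show "\<pi> (a \<odot>\<^bsub>M\<^esub> x) = a \<odot>\<^bsub>?M'\<^esub> \<pi> x"
      unfolding \<pi>_def using ax pc[OF hc[OF ax(2)]] by (simp only: a_minus_def) (simp add: M.act_add_right M.M.a_inv_closed)
  qed (use \<pi>K in simp)
  have \<pi>j: "\<pi> (g j) = \<zero>\<^bsub>M\<^esub>"
  proof (cases "L j = 0")
    case True
    then have "g j = \<zero>\<^bsub>M\<^esub>" using L(2)[OF j(1), of \<one>] hom[OF j(1)] M.act_one by simp
    then show ?thesis using rhom_zero[OF M M' \<pi>] by simp
  next
    case False
    have "gen j (e j) \<in> carrier ?I" using False by (intro gen_in_im) auto
    then have "h (?psi (gen j (e j))) = gen j (e j)" by (rule h(2))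
    moreover have "?psi (gen j (e j)) = g j" using hom[OF j(1)] by (simp only: rho_gen)
    ultimately have "?psi (h (g j)) = g j" by simp
    then show ?thesis using hom[OF j(1)] by (simp add: \<pi>_def a_minus_def M.M.r_neg)
  qed
  have "generates ?M' (J - {j}) (\<lambda>k. \<pi> (g k))"
    unfolding generates_def
  proof (intro allI impI; elim conjE)
    fix U assume U: "submodule U A ?M'" "(\<lambda>k. \<pi> (g k)) ` (J - {j}) \<subseteq> U"
    have "submodule {x \<in> carrier M. \<pi> x \<in> U} A M" by (rule rhom_vimage_submodule[OF M M' \<pi> U(1)])
    moreover have "g ` J \<subseteq> {x \<in> carrier M. \<pi> x \<in> U}"
    proof
      fix x assume "x \<in> g ` J"
      then obtain k where k: "k \<in> J" "x = g k" by blast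
      have "\<pi> (g k) \<in> U" using U(2) k M'.submoduleD(2)[OF U(1)] \<pi>j by (cases "k = j") auto
      then show "x \<in> {x \<in> carrier M. \<pi> x \<in> U}" using k hom by simp
    qed
    ultimately have eq: "{x \<in> carrier M. \<pi> x \<in> U} = carrier M" using Suc.prems(3) unfolding generates_def by blast
    have "x \<in> U" if "x \<in> ?K" for x
    proof -
      have "x \<in> carrier M" using that by (simp add: a_kernel_iff)
      then have "\<pi> x \<in> U" using eq by blast
      then show ?thesis using \<pi>id[OF that] by simp
    qed
    then show "U = carrier ?M'" using M'.submoduleD(1)[OF U(1)] by auto
  qed
  moreover have "homogeneous ?M' (e k) (\<pi> (g k))" if "k \<in> J - {j}" for k
    using \<pi>K[of "g k"] rhomD(3)[OF \<pi>, of "xx (e k) 0" "g k"] hom[of k] that by simp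
  moreover have "n = card (J - {j})" using Suc.hyps(2) j(1) fin by simp
  ultimately obtain p' q' \<phi>' where IH: "\<forall>k\<in>J - {j}. p' k \<le> q' k \<and> q' k \<le> jump c (p' k)"
      "\<phi>' \<in> rhom A (im cf (J - {j}) p' q') ?M'"
      "bij_betw \<phi>' (carrier (im cf (J - {j}) p' q')) ?K"
    using Suc.hyps(1)[of "J - {j}" ?M' "\<lambda>k. \<pi> (g k)"] M' fin by auto
  define p q where "p = (\<lambda>k. if k = j then e j else p' k)" and "q = (\<lambda>k. if k = j then e j + L j else q' k)"
  have eqI: "im cf {j} p q = ?I" by (rule im_cong) (simp add: p_def q_def)
  have eqR: "im cf (J - {j}) p q = im cf (J - {j}) p' q'" by (rule im_cong) (auto simp: p_def q_def)
  have pq: "\<forall>k\<in>J. p k \<le> q k \<and> q k \<le> jump c (p k)"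
    using IH(1) L(1)[OF j(1)] by (auto simp: p_def q_def jump_def)
  let ?Z = "im cf J p q"
  let ?r1 = "im_res (J - {j}) p q" and ?r2 = "im_res {j} p q"
  have Z: "right_module A ?Z" using pq by (intro im_right_module) simp
  have r1: "?r1 \<in> rhom A ?Z (im cf (J - {j}) p' q')" unfolding eqR[symmetric] by (rule im_res_hom) simp
  have r2: "?r2 \<in> rhom A ?Z ?I" unfolding eqI[symmetric] by (rule im_res_hom) simp
  have \<phi>'M: "\<phi>' \<in> rhom A (im cf (J - {j}) p' q') M"
    using rhomD[OF IH(2)] by (intro rhomI) (auto simp: a_kernel_iff)
  define \<phi> where "\<phi> v = \<phi>' (?r1 v) \<oplus>\<^bsub>M\<^esub> ?psi (?r2 v)" for v
  have \<phi>: "\<phi> \<in> rhom A ?Z M"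
    unfolding \<phi>_def by (rule rhom_add[OF M rhom_comp[OF r1 \<phi>'M] rhom_comp[OF r2 psi]])
  have split: "v = ?r1 v \<oplus>\<^bsub>?Z\<^esub> ?r2 v" if "v \<in> carrier ?Z" for v
    using that by (intro co_eqI) (auto simp: im_res_def im_carrier)
  have h\<phi>: "h (\<phi> v) = ?r2 v" if v: "v \<in> carrier ?Z" for v
  proof -
    have K1: "\<phi>' (?r1 v) \<in> ?K" using rhomD(1)[OF IH(2) rhomD(1)[OF r1 v]] by simp
    have c2: "?r2 v \<in> carrier ?I" using rhomD(1)[OF r2 v] .
    have "h (\<phi> v) = h (\<phi>' (?r1 v)) \<oplus>\<^bsub>?I\<^esub> h (?psi (?r2 v))"
      unfolding \<phi>_def using rhomD(2)[OF h(1) _ pc[OF c2]] K1 by (simp add: a_kernel_iff)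
    also have "\<dots> = ?r2 v" using K1 h(2)[OF c2] by (simp add: a_kernel_iff)
    finally show ?thesis .
  qed
  have "inj_on \<phi> (carrier ?Z)"
    unfolding rhom_inj_iff[OF Z M \<phi>]
  proof (intro ballI impI)
    fix v assume v: "v \<in> carrier ?Z" "\<phi> v = \<zero>\<^bsub>M\<^esub>"
    have r20: "?r2 v = \<zero>\<^bsub>?I\<^esub>" using h\<phi>[OF v(1)] v(2) rhom_zero[OF M I h(1)] by simp
    have "\<phi>' (?r1 v) \<in> carrier M" using rhomD(1)[OF \<phi>'M rhomD(1)[OF r1 v(1)]] .
    then have "\<phi>' (?r1 v) = \<zero>\<^bsub>M\<^esub>" using v(2) rhom_zero[OF I M psi] unfolding \<phi>_def r20 by simp
    moreover have R: "right_module A (im cf (J - {j}) p' q')" using IH(1) by (intro im_right_module) simp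
    ultimately have "?r1 v = \<zero>\<^bsub>im cf (J - {j}) p' q'\<^esub>"
      using rhom_inj_iff[OF R M' IH(2)] IH(3) rhomD(1)[OF r1 v(1)] by (simp add: bij_betw_def)
    then show "v = \<zero>\<^bsub>?Z\<^esub>" using split[OF v(1)] r20 by simp
  qed
  moreover have "\<phi> ` carrier ?Z = carrier M"
  proof (intro equalityI subsetI)
    fix x assume "x \<in> \<phi> ` carrier ?Z"
    then show "x \<in> carrier M" using rhomD(1)[OF \<phi>] by auto
  next
    fix m assume m: "m \<in> carrier M"
    have "\<phi>' ` carrier (im cf (J - {j}) p q) = ?K" using IH(3) unfolding eqR by (simp only: bij_betw_def)
    then have "\<pi> m \<in> \<phi>' ` carrier (im cf (J - {j}) p q)" using \<pi>K[OF m] by (simp only:)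
    then obtain w where w': "\<pi> m = \<phi>' w" "w \<in> carrier (im cf (J - {j}) p q)" by (rule imageE)
    note w = w'(2) w'(1)[symmetric]
    define v where "v = (\<lambda>n. w n + h m n)"
    have hm: "h m \<in> carrier (im cf {j} p q)" using hc[OF m] eqI by simp
    have "v \<in> carrier ?Z"
      unfolding im_carrier
    proof (intro allI impI)
      fix k t assume "co v k t \<noteq> 0"
      then have "co w k t \<noteq> 0 \<or> co (h m) k t \<noteq> 0" by (auto simp: v_def)
      then show "k \<in> J \<and> p k \<le> t \<and> t < q k" using w(1) hm j(1) unfolding im_carrier by blast
    qed
    moreover have "?r1 v = w"
      using w(1) hm by (intro co_eqI) (auto simp: v_def im_res_def im_carrier)
    moreover have "?r2 v = h m"
      using w(1) hm by (intro co_eqI) (auto simp: v_def im_res_def im_carrier)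
    moreover have "\<pi> m \<oplus>\<^bsub>M\<^esub> ?psi (h m) = m" unfolding \<pi>_def using m pc[OF hc[OF m]] M.minus_add_cancel by simp
    ultimately have "v \<in> carrier ?Z" "\<phi> v = m" using w(2) by (simp_all add: \<phi>_def)
    then show "m \<in> \<phi> ` carrier ?Z" by blast
  qed
  ultimately show ?case using pq \<phi> by (intro exI[of _ p] exI[of _ q] exI[of _ \<phi>]) (simp add: bij_betw_def)
qed

text \<open>
  A finite generating set becomes homogeneous when every generator is multiplied by each of the \<open>N\<close>
  vertex idempotents.
\<close>

lemma fg_decomposition:
  fixes M :: "('a, 'm) module"
  assumes "fg_module A M"
  shows "\<exists>J p q \<phi>. finite J \<and> (\<forall>k\<in>J. p k \<le> q k \<and> q k \<le> jump c (p k)) \<and>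
     \<phi> \<in> rhom A (im cf J p q) M \<and> bij_betw \<phi> (carrier (im cf J p q)) (carrier M)"
proof -
  have M: "right_module A M" using assms by (simp add: fg_module_def)
  interpret M: right_module A M by fact
  obtain X where X: "finite X" "X \<subseteq> carrier M" "\<And>U. submodule U A M \<Longrightarrow> X \<subseteq> U \<Longrightarrow> U = carrier M"
    using assms by (auto simp: fg_module_def)
  define G where "G = (\<lambda>(m, i). xx i 0 \<odot>\<^bsub>M\<^esub> m) ` (X \<times> {..<N})"
  have "finite G" using X(1) by (simp add: G_def)
  then obtain g where g: "bij_betw g {..<card G} G" using ex_bij_betw_nat_finite by (metis atLeast0LessThan)
  have idem: "xx i 0 \<otimes> xx i 0 = xx i 0" for i using xx_mult[of i 0 0] by simp
  have "\<exists>i. homogeneous M i x" if "x \<in> G" for x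
  proof -
    from that obtain m i where m: "m \<in> X" "x = xx i 0 \<odot>\<^bsub>M\<^esub> m" by (auto simp: G_def)
    then show ?thesis using X(2) M.act_mult[of "xx i 0" "xx i 0" m] by (intro exI[of _ i]) (auto simp: idem M.act_closed)
  qed
  then obtain e' where e': "\<And>x. x \<in> G \<Longrightarrow> homogeneous M (e' x) x" by metis
  have "generates M {..<card G} g"
    unfolding generates_def
  proof (intro allI impI; elim conjE)
    fix U assume U: "submodule U A M" "g ` {..<card G} \<subseteq> U"
    note s = M.submoduleD[OF U(1)]
    have GU: "G \<subseteq> U" using U(2) g by (simp add: bij_betw_def)
    have "X \<subseteq> U"
    proof
      fix m assume m: "m \<in> X"
      then have mc: "m \<in> carrier M" using X by auto
      have "a \<odot>\<^bsub>M\<^esub> m \<in> U" if "a \<in> carrier A" for a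
        using that
      proof (rule alg_induct)
        show "\<zero> \<odot>\<^bsub>M\<^esub> m \<in> U" using mc s by (simp add: M.act_zero_left)
        show "(x \<oplus> y) \<odot>\<^bsub>M\<^esub> m \<in> U" if "x \<in> carrier A" "y \<in> carrier A" "x \<odot>\<^bsub>M\<^esub> m \<in> U" "y \<odot>\<^bsub>M\<^esub> m \<in> U" for x y
          using that mc s by (simp add: M.act_add_left)
        show "(r \<odot> xx i l) \<odot>\<^bsub>M\<^esub> m \<in> U" if "i < N" "l < c i" for r i l
        proof -
          have "xx i 0 \<odot>\<^bsub>M\<^esub> m \<in> U" using that m GU unfolding G_def by force
          moreover have "xx i 0 \<otimes> (r \<odot> xx i l) = r \<odot> xx i l"
            using xx_mult[of i 0 l] scal_mult_right[of "xx i 0" "xx i l" r] by simp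
          ultimately show ?thesis
            using M.act_mult[of "xx i 0" "r \<odot> xx i l" m] mc scal_closed s(4) by simp
        qed
      qed
      then have "\<one> \<odot>\<^bsub>M\<^esub> m \<in> U" by simp
      then show "m \<in> U" using M.act_one[OF mc] by simp
    qed
    then show "U = carrier M" using X(3)[OF U(1)] by simp
  qed
  moreover have "homogeneous M (e' (g k)) (g k)" if "k \<in> {..<card G}" for k
    using e' g that by (auto simp: bij_betw_def)
  ultimately show ?thesis
    using interval_decomposition[OF M, of "{..<card G}" g "\<lambda>k. e' (g k)"] by blast
qed

lemma set_add_iff: "x \<in> U <+>\<^bsub>M\<^esub> V \<longleftrightarrow> (\<exists>u\<in>U. \<exists>v\<in>V. x = u \<oplus>\<^bsub>M\<^esub> v)"
  by (auto simp: set_add_def set_mult_def)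

lemma indecomposable_interval:
  fixes M :: "('a, 'm) module"
  assumes "fg_module A M" "indecomposable A M"
  shows "\<exists>j p q \<phi>. p j < q j \<and> q j \<le> jump c (p j) \<and>
     \<phi> \<in> rhom A (im cf {j} p q) M \<and> bij_betw \<phi> (carrier (im cf {j} p q)) (carrier M)"
proof -
  have M: "right_module A M" using assms by (simp add: fg_module_def)
  interpret M: right_module A M by fact
  obtain J p q \<phi> where D: "finite J" "\<forall>k\<in>J. p k \<le> q k \<and> q k \<le> jump c (p k)"
     "\<phi> \<in> rhom A (im cf J p q) M" "bij_betw \<phi> (carrier (im cf J p q)) (carrier M)"
    using fg_decomposition[OF assms(1)] by blast
  let ?Z = "im cf J p q"
  have Z: "right_module A ?Z" using D(2) by (intro im_right_module) simp
  interpret Z: right_module A ?Z by fact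
  have "\<exists>j\<in>J. p j < q j"
  proof (rule ccontr)
    assume "\<not> ?thesis"
    then have "carrier ?Z = {\<zero>\<^bsub>?Z\<^esub>}"
      by (auto simp: im_carrier intro!: co_eqI) (meson le_less_trans)
    then have "carrier M = {\<zero>\<^bsub>M\<^esub>}" using D(4) rhom_zero[OF Z M D(3)] by (auto simp: bij_betw_def)
    then show False using assms(2) by (simp add: indecomposable_def)
  qed
  then obtain j where j: "j \<in> J" "p j < q j" by blast
  have row: "im_res J' p q \<in> rhom A ?Z ?Z" "im_res J' p q \<in> rhom A ?Z (im cf J' p q)" if "J' \<subseteq> J" for J'
  proof -
    show 1: "im_res J' p q \<in> rhom A ?Z (im cf J' p q)" by (rule im_res_hom) simp
    have "im_res J p q \<in> rhom A (im cf J' p q) ?Z" by (rule im_res_hom) simp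
    moreover have "im_res J p q (im_res J' p q v) = im_res J' p q v" for v :: "nat \<Rightarrow> 'k"
      using that by (intro co_eqI) (auto simp: im_res_def)
    ultimately show "im_res J' p q \<in> rhom A ?Z ?Z" using rhom_comp[OF 1, of "im_res J p q" ?Z] by simp
  qed
  have incl: "carrier (im cf J' p q) \<subseteq> carrier ?Z" if "J' \<subseteq> J" for J'
    using that unfolding subset_iff im_carrier by blast
  have sub: "submodule (\<phi> ` im_res J' p q ` carrier ?Z) A M" if "J' \<subseteq> J" for J'
    by (rule rhom_image_submodule[OF Z M D(3) rhom_image_submodule[OF Z Z row(1)[OF that] Z.carrier_submodule]])
  let ?U = "\<phi> ` im_res {j} p q ` carrier ?Z" and ?V = "\<phi> ` im_res (J - {j}) p q ` carrier ?Z"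
  have U: "submodule ?U A M" and V: "submodule ?V A M" using sub[of "{j}"] sub[of "J - {j}"] j by auto
  have resc: "im_res J' p q v \<in> carrier ?Z" if "J' \<subseteq> J" "v \<in> carrier ?Z" for J' v
    using rhomD(1)[OF row(1)[OF that(1)] that(2)] .
  have "?U \<inter> ?V = {\<zero>\<^bsub>M\<^esub>}"
  proof
    show "{\<zero>\<^bsub>M\<^esub>} \<subseteq> ?U \<inter> ?V" using M.submoduleD(2)[OF U] M.submoduleD(2)[OF V] by simp
    show "?U \<inter> ?V \<subseteq> {\<zero>\<^bsub>M\<^esub>}"
    proof
      fix x assume "x \<in> ?U \<inter> ?V"
      then obtain u v where uv: "u \<in> carrier ?Z" "v \<in> carrier ?Z" "x = \<phi> (im_res {j} p q u)" "x = \<phi> (im_res (J - {j}) p q v)"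
        by auto
      then have eq: "im_res {j} p q u = im_res (J - {j}) p q v"
        using D(4) resc[of "{j}" u] resc[of "J - {j}" v] j by (auto simp: bij_betw_def inj_on_def)
      have "im_res {j} p q u = \<zero>\<^bsub>?Z\<^esub>"
      proof (rule co_eqI)
        fix k t
        have "co (im_res {j} p q u) k t = co (im_res (J - {j}) p q v) k t" using eq by simp
        then show "co (im_res {j} p q u) k t = co \<zero>\<^bsub>?Z\<^esub> k t" by (auto simp: im_res_def split: if_splits)
      qed
      then show "x \<in> {\<zero>\<^bsub>M\<^esub>}" using uv(3) rhom_zero[OF Z M D(3)] by simp
    qed
  qed
  moreover have "?U <+>\<^bsub>M\<^esub> ?V = carrier M"
  proof (intro equalityI subsetI)
    fix x assume "x \<in> ?U <+>\<^bsub>M\<^esub> ?V"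
    then obtain u v where "u \<in> ?U" "v \<in> ?V" "x = u \<oplus>\<^bsub>M\<^esub> v" unfolding set_add_iff by blast
    then show "x \<in> carrier M" using subsetD[OF M.submoduleD(1)[OF U]] subsetD[OF M.submoduleD(1)[OF V]] by simp
  next
    fix x assume "x \<in> carrier M"
    then obtain v where v: "v \<in> carrier ?Z" "x = \<phi> v" using D(4) by (auto simp: bij_betw_def)
    have "v = im_res {j} p q v \<oplus>\<^bsub>?Z\<^esub> im_res (J - {j}) p q v"
      using v(1) by (intro co_eqI) (auto simp: im_res_def im_carrier)
    then have "x = \<phi> (im_res {j} p q v) \<oplus>\<^bsub>M\<^esub> \<phi> (im_res (J - {j}) p q v)"
      using rhomD(2)[OF D(3), of "im_res {j} p q v" "im_res (J - {j}) p q v"] resc v j by auto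
    then show "x \<in> ?U <+>\<^bsub>M\<^esub> ?V" unfolding set_add_iff using v(1) by blast
  qed
  moreover have "?U \<noteq> {\<zero>\<^bsub>M\<^esub>}"
  proof
    assume U0: "?U = {\<zero>\<^bsub>M\<^esub>}"
    have g: "gen j (p j) \<in> carrier ?Z" using j by (intro gen_in_im) auto
    have gr: "im_res {j} p q (gen j (p j)) = (gen j (p j) :: nat \<Rightarrow> 'k)" using j by (intro co_eqI) (auto simp: im_res_def)
    have "\<phi> (im_res {j} p q (gen j (p j))) \<in> ?U" using g by blast
    then have "\<phi> (gen j (p j)) = \<zero>\<^bsub>M\<^esub>" using U0 gr by simp
    then have "gen j (p j) = \<zero>\<^bsub>?Z\<^esub>" using g rhom_inj_iff[OF Z M D(3)] D(4) by (simp add: bij_betw_def)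
    then have "co (gen j (p j)) j (p j) = co \<zero>\<^bsub>?Z\<^esub> j (p j)" by simp
    then show False by simp
  qed
  ultimately have V0: "?V = {\<zero>\<^bsub>M\<^esub>}" using assms(2) U V unfolding indecomposable_def by metis
  have Vz: "im_res (J - {j}) p q v = \<zero>\<^bsub>?Z\<^esub>" if v: "v \<in> carrier ?Z" for v
  proof -
    have "\<phi> (im_res (J - {j}) p q v) \<in> ?V" using v by blast
    then have "\<phi> (im_res (J - {j}) p q v) = \<zero>\<^bsub>M\<^esub>" using V0 by blast
    then show ?thesis using resc[of "J - {j}" v] v rhom_inj_iff[OF Z M D(3)] D(4) by (simp add: bij_betw_def)
  qed
  have eq: "carrier (im cf {j} p q) = carrier ?Z"
  proof
    show "carrier (im cf {j} p q) \<subseteq> carrier ?Z" using incl[of "{j}"] j by simp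
    show "carrier ?Z \<subseteq> carrier (im cf {j} p q)"
    proof
      fix v assume v: "v \<in> carrier ?Z"
      have "v = im_res {j} p q v"
      proof (rule co_eqI)
        fix k t
        have "co (im_res (J - {j}) p q v) k t = 0" using Vz[OF v] by simp
        then show "co v k t = co (im_res {j} p q v) k t" using v by (auto simp: im_res_def im_carrier split: if_splits)
      qed
      moreover have "im_res {j} p q v \<in> carrier (im cf {j} p q)" by (auto simp: im_carrier im_res_def)
      ultimately show "v \<in> carrier (im cf {j} p q)" by simp
    qed
  qed
  have act: "a \<odot>\<^bsub>im cf {j} p q\<^esub> v = a \<odot>\<^bsub>?Z\<^esub> v" if "v \<in> carrier (im cf {j} p q)" for a v
  proof (rule co_eqI)
    fix k t
    have "co v k s = 0" if "k \<noteq> j" for s using that \<open>v \<in> _\<close> unfolding im_carrier by blast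
    then show "co (a \<odot>\<^bsub>im cf {j} p q\<^esub> v) k t = co (a \<odot>\<^bsub>?Z\<^esub> v) k t" using j by auto
  qed
  have "\<phi> \<in> rhom A (im cf {j} p q) M"
    by (rule rhomI) (use rhomD[OF D(3)] eq act in auto)
  then show ?thesis using D(2,4) j eq by (intro exI[of _ j] exI[of _ p] exI[of _ q] exI[of _ \<phi>]) auto
qed

lemma uniserial_iso:
  assumes "right_module A L" "right_module A M" "\<phi> \<in> rhom A L M" "bij_betw \<phi> (carrier L) (carrier M)" "uniserial A L"
  shows "uniserial A M"
  unfolding uniserial_def
proof (intro allI impI; elim conjE)
  interpret M: right_module A M by fact
  fix U V assume UV: "submodule U A M" "submodule V A M"
  have im: "\<phi> ` {x \<in> carrier L. \<phi> x \<in> W} = W" if "submodule W A M" for W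
    using M.submoduleD(1)[OF that] assms(4) by (auto simp: bij_betw_def)
  have "{x \<in> carrier L. \<phi> x \<in> U} \<subseteq> {x \<in> carrier L. \<phi> x \<in> V} \<or> {x \<in> carrier L. \<phi> x \<in> V} \<subseteq> {x \<in> carrier L. \<phi> x \<in> U}"
    using assms(5) rhom_vimage_submodule[OF assms(1-3)] UV unfolding uniserial_def by blast
  then show "U \<subseteq> V \<or> V \<subseteq> U" using im[OF UV(1)] im[OF UV(2)] by blast
qed

lemma indecomposables_uniserial: "indecomposables_uniserial A"
  unfolding indecomposables_uniserial_def
proof (intro allI impI; elim conjE)
  fix M :: "('a, nat \<Rightarrow> 'k) module" assume M: "fg_module A M" "indecomposable A M"
  obtain j p q \<phi> where "p j < q j" and q: "q j \<le> jump c (p j)" and \<phi>: "\<phi> \<in> rhom A (im cf {j} p q) M"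
      "bij_betw \<phi> (carrier (im cf {j} p q)) (carrier M)"
    using indecomposable_interval[OF M] by blast
  have "right_module A (im cf {j} p q)" using q by (intro im_right_module) simp
  then show "uniserial A M"
    using uniserial_iso[OF _ _ \<phi> im_uniserial[where p = p and q = q and k = j, OF q]] M(1) by (simp add: fg_module_def)
qed

end

section \<open>Selfinjectivity and global dimension\<close>

context nak
begin

lemma im_res_id:
  assumes "v \<in> carrier (im cf J p q)" "\<And>k. k \<in> J \<Longrightarrow> k \<in> J' \<and> p' k \<le> p k \<and> q k \<le> q' k"
  shows "im_res J' p' q' v = v"
proof (rule co_eqI)
  fix k t
  show "co (im_res J' p' q' v) k t = co v k t"
  proof (cases "co v k t = 0")
    case False
    then have "k \<in> J" "p k \<le> t" "t < q k" using assms(1) unfolding im_carrier by blast+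
    then show ?thesis using assms(2)[of k] by (simp add: im_res_def)
  qed (simp add: im_res_def)
qed

lemma im_incl:
  assumes "v \<in> carrier (im cf J p q)" "\<And>k. k \<in> J \<Longrightarrow> k \<in> J' \<and> p' k \<le> p k \<and> q k \<le> q' k"
  shows "v \<in> carrier (im cf J' p' q')"
  unfolding im_carrier
proof (intro allI impI)
  fix k t assume "co v k t \<noteq> 0"
  then have "k \<in> J" "p k \<le> t" "t < q k" using assms(1) unfolding im_carrier by blast+
  then show "k \<in> J' \<and> p' k \<le> t \<and> t < q' k" using assms(2)[of k] by simp
qed

lemma row_projection:
  "(\<lambda>a. mk (\<lambda>k t. if k = 0 \<and> i \<le> t then cf a i (t - i) else 0))
     \<in> rhom A (regular_module A) (im cf {0} (\<lambda>_. i) (\<lambda>_. jump c i))" (is "?s \<in> _")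
proof (rule rhomI)
  fix a assume "a \<in> carrier (regular_module A)"
  then have a: "a \<in> carrier A" by simp
  show "?s a \<in> carrier (im cf {0} (\<lambda>_. i) (\<lambda>_. jump c i))"
    unfolding im_carrier
  proof (intro allI impI)
    fix k t assume "co (?s a) k t \<noteq> 0"
    then have "k = 0" "i \<le> t" "cf a i (t - i) \<noteq> 0" by (auto split: if_splits)
    moreover have "t - i < c i" using calculation cf_trunc[OF a, of i "t - i"] by (meson not_le)
    ultimately show "k \<in> {0} \<and> i \<le> t \<and> t < jump c i" by (auto simp: jump_def)
  qed
next
  fix a b assume "a \<in> carrier (regular_module A)" "b \<in> carrier (regular_module A)"
  then show "?s (a \<oplus>\<^bsub>regular_module A\<^esub> b) = ?s a \<oplus>\<^bsub>im cf {0} (\<lambda>_. i) (\<lambda>_. jump c i)\<^esub> ?s b"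
    by (intro co_eqI) (simp add: cf_add)
next
  fix b a assume b: "b \<in> carrier A" and "a \<in> carrier (regular_module A)"
  then have a: "a \<in> carrier A" by simp
  show "?s (b \<odot>\<^bsub>regular_module A\<^esub> a) = b \<odot>\<^bsub>im cf {0} (\<lambda>_. i) (\<lambda>_. jump c i)\<^esub> ?s a"
  proof (rule co_eqI)
    fix k t
    show "co (?s (b \<odot>\<^bsub>regular_module A\<^esub> a)) k t = co (b \<odot>\<^bsub>im cf {0} (\<lambda>_. i) (\<lambda>_. jump c i)\<^esub> ?s a) k t"
    proof (cases "k = 0 \<and> i \<le> t \<and> t < jump c i")
      case True
      then obtain l where l: "t = i + l" "l < c i" by (metis jump_def le_Suc_ex add_less_cancel_left)
      have "(\<Sum>s\<le>i + l. co (?s a) 0 s * cf b s (i + l - s)) = (\<Sum>m\<le>l. co (?s a) 0 (i + m) * cf b (i + m) (l - m))"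
        by (subst sum_shift) auto
      then show ?thesis using True l a b by (simp add: cf_mult)
    next
      case False
      have "cf (a \<otimes> b) i (t - i) = 0" if "i \<le> t" "\<not> t < jump c i"
        using that a b by (intro cf_trunc) (auto simp: jump_def)
      moreover have "(\<Sum>s\<le>t. co (?s a) 0 s * cf b s (t - s)) = 0" if "t < i"
        using that by (intro sum.neutral) auto
      ultimately show ?thesis using False by auto
    qed
  qed
qed

text \<open>
  If all \<open>P(i)\<close> have the length \<open>d\<close>, then paths of length \<open>d\<close> or more vanish on every module, so each
  \<open>P(i)\<close> is injective by \<open>im_injective\<close>. The algebra is their direct sum: a map into it is
  extended row by row, and the rows are reassembled by the coordinates.
\<close>

lemma constant_selfinjective:
  assumes d: "\<And>i. c i = d"
  shows "selfinjective A"
  unfolding selfinjective_def injective_def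
proof (intro conjI allI impI; (elim conjE)?)
  have R: "right_module A (regular_module A)" using ring_axioms by (rule regular_right_module)
  then show "right_module A (regular_module A)" .
  fix X Y :: "('a, nat \<Rightarrow> 'k) module" and g f
  assume X: "fg_module A X" and Y: "fg_module A Y" and g: "g \<in> rhom A X Y" "inj_on g (carrier X)"
    and f: "f \<in> rhom A X (regular_module A)"
  have X': "right_module A X" and Y': "right_module A Y" using X Y by (auto simp: fg_module_def)
  interpret X: right_module A X by fact
  interpret Y: right_module A Y by fact
  let ?W = "g ` carrier X"
  let ?YW = "Y\<lparr>carrier := ?W\<rparr>"
  let ?s = "\<lambda>i a. mk (\<lambda>k t. if k = 0 \<and> i \<le> t then cf a i (t - i) else 0)"
  let ?I = "\<lambda>i. im cf {0} (\<lambda>_. i) (\<lambda>_. jump c i)"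
  have W: "submodule ?W A Y" by (rule rhom_image_submodule[OF X' Y' g(1) X.carrier_submodule])
  have YW: "right_module A ?YW" by (rule Y.right_module_sub[OF W])
  have gW: "g \<in> rhom A X ?YW" using rhomD[OF g(1)] by (intro rhomI) auto
  have ginv: "inv_into (carrier X) g \<in> rhom A ?YW X"
    using g(2) by (intro rhom_inv[OF X' YW gW]) (simp add: bij_betw_def)
  define f' where "f' i y = ?s i (f (inv_into (carrier X) g y))" for i y
  have "f' i \<in> rhom A ?YW (?I i)" for i
    unfolding f'_def by (rule rhom_comp[OF rhom_comp[OF ginv f] row_projection])
  moreover have "a \<odot>\<^bsub>Y\<^esub> y = \<zero>\<^bsub>Y\<^esub>"
    if "a \<in> carrier A" "\<And>i' l. l < jump c i - i \<Longrightarrow> cf a i' l = 0" "y \<in> carrier Y" for a y i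
  proof -
    have "a = \<zero>" using that(1,2) by (intro cf_eqI) (auto simp: cf_zero jump_def d)
    then show ?thesis using that Y.act_zero_left by simp
  qed
  ultimately have "\<exists>h\<in>rhom A Y (?I i). \<forall>x\<in>?W. h x = f' i x" for i
    using jump_gt[of i] by (intro im_injective[OF Y W]) auto
  then obtain h where h: "\<And>i. h i \<in> rhom A Y (?I i)" "\<And>i x. x \<in> ?W \<Longrightarrow> h i x = f' i x" by metis
  define H where "H y = el (\<lambda>i l. if l < c i then co (h (i mod N) y) 0 (i mod N + l) else 0)" for y
  have coords: "(\<lambda>i l. if l < c i then co (h (i mod N) y) 0 (i mod N + l) else 0) \<in> coords N c" for y
    by (auto simp: coords_def c_add_N)
  have Hc: "H y \<in> carrier A" for y unfolding H_def using coords by (rule el_closed)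
  have cfH: "cf (H y) i l = co (h i y) 0 (i + l)" if "i < N" "l < c i" for y i l
    unfolding H_def using cf_el[OF coords] that by simp
  have "H \<in> rhom A Y (regular_module A)"
  proof (rule rhomI)
    fix y assume "y \<in> carrier Y" then show "H y \<in> carrier (regular_module A)" using Hc by simp
  next
    fix x y assume "x \<in> carrier Y" "y \<in> carrier Y"
    then show "H (x \<oplus>\<^bsub>Y\<^esub> y) = H x \<oplus>\<^bsub>regular_module A\<^esub> H y"
      using Hc rhomD(2)[OF h(1)] by (simp, intro cf_eqI) (simp_all add: cfH cf_add)
  next
    fix a y assume a: "a \<in> carrier A" and y: "y \<in> carrier Y"
    have "H (a \<odot>\<^bsub>Y\<^esub> y) = H y \<otimes> a"
    proof (rule cf_eqI)
      fix i l assume il: "i < N" "l < c i"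
      let ?v = "h i y"
      have v0: "co ?v 0 s = 0" if "s < i" for s
        using that rhomD(1)[OF h(1)[of i] y] unfolding im_carrier by (meson leD)
      have "cf (H (a \<odot>\<^bsub>Y\<^esub> y)) i l = co (a \<odot>\<^bsub>?I i\<^esub> ?v) 0 (i + l)"
        using il rhomD(3)[OF h(1) a y] by (simp only: cfH)
      also have "\<dots> = (\<Sum>s\<le>i + l. co ?v 0 s * cf a s (i + l - s))" using il by (simp add: jump_def)
      also have "\<dots> = (\<Sum>m\<le>l. co ?v 0 (i + m) * cf a (i + m) (l - m))"
        using v0 by (subst sum_shift) auto
      also have "\<dots> = (\<Sum>m\<le>l. cf (H y) i m * cf a (i + m) (l - m))"
        using il by (intro sum.cong) (auto simp: cfH)
      finally show "cf (H (a \<odot>\<^bsub>Y\<^esub> y)) i l = cf (H y \<otimes> a) i l" using il a Hc by (simp add: cf_mult)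
    qed (use Hc a in auto)
    then show "H (a \<odot>\<^bsub>Y\<^esub> y) = a \<odot>\<^bsub>regular_module A\<^esub> H y" by simp
  qed
  moreover have "H (g x) = f x" if x: "x \<in> carrier X" for x
  proof (rule cf_eqI)
    show "f x \<in> carrier A" using rhomD(1)[OF f x] by simp
    fix i l assume il: "i < N" "l < c i"
    have inv: "inv_into (carrier X) g (g x) = x" using g(2) x by (rule inv_into_f_f)
    have "h i (g x) = f' i (g x)" using x by (intro h(2)) simp
    then have "h i (g x) = ?s i (f x)" unfolding f'_def inv .
    then show "cf (H (g x)) i l = cf (f x) i l" using il by (simp add: cfH)
  qed (rule Hc)
  ultimately show "\<exists>h\<in>rhom A Y (regular_module A). \<forall>x\<in>carrier X. h (g x) = f x" by blast
qed

text \<open>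
  If \<open>F i = F (i + 1)\<close>, then \<open>P (i + 1)\<close> is the radical of \<open>P i\<close>, and its embedding into the algebra
  does not extend to \<open>P i\<close>: the image of a generator of \<open>P (i + 1)\<close> is not divisible by an arrow.
\<close>

lemma collision_not_selfinjective:
  assumes "jump c i = jump c (Suc i)"
  shows "\<not> selfinjective A"
proof
  assume si: "selfinjective A"
  let ?X = "im cf {0} (\<lambda>_. Suc i) (\<lambda>_. jump c (Suc i))" and ?Y = "im cf {0} (\<lambda>_. i) (\<lambda>_. jump c i)"
  let ?g = "im_res {0} (\<lambda>_. i) (\<lambda>_. jump c i) :: (nat \<Rightarrow> 'k) \<Rightarrow> _"
  let ?f = "\<lambda>v. rho (Suc i) (co v 0) \<odot>\<^bsub>regular_module A\<^esub> xx (Suc i) 0"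
  have R: "right_module A (regular_module A)" using ring_axioms by (rule regular_right_module)
  have X: "fg_module A ?X" and Y: "fg_module A ?Y" by (intro im_fg; simp)+
  have Xm: "right_module A ?X" and Ym: "right_module A ?Y" using X Y by (auto simp: fg_module_def)
  have hom: "homogeneous (regular_module A) (Suc i) (xx (Suc i) 0)"
    using xx_mult[of "Suc i" 0 0] by simp
  have f: "?f \<in> rhom A ?X (regular_module A)"
    using row_hom[OF R, where p = "\<lambda>_. Suc i" and q = "\<lambda>_. jump c (Suc i)" and k = 0 and J = "{0}"]
      hom killed_from_c[OF R hom] by (simp add: jump_def)
  have g: "?g \<in> rhom A ?X ?Y" by (rule im_res_hom) (simp add: assms)
  have gid: "?g v = v" if "v \<in> carrier ?X" for v
    using that by (rule im_res_id) (simp add: assms)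
  have inj: "inj_on ?g (carrier ?X)"
    by (rule inj_onI) (simp only: gid)
  obtain h where h: "h \<in> rhom A ?Y (regular_module A)" "\<forall>x\<in>carrier ?X. h (?g x) = ?f x"
    using conjunct2[OF si[unfolded selfinjective_def injective_def], rule_format, of ?X ?Y ?g ?f] X Y g inj f by blast
  have lt: "Suc i < jump c i" using assms jump_gt[of "Suc i"] by simp
  have gX: "gen 0 (Suc i) \<in> carrier ?X" using jump_gt by (intro gen_in_im) auto
  have gY: "gen 0 i \<in> carrier ?Y" using jump_gt by (intro gen_in_im) auto
  have "h (gen 0 (Suc i)) = ?f (gen 0 (Suc i))" using bspec[OF h(2) gX] unfolding gid[OF gX] .
  also have "\<dots> = xx (Suc i) 0"
    using rho_gen[of "\<lambda>_. Suc i" 0] xx_mult[of "Suc i" 0 0] by simp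
  finally have 1: "h (gen 0 (Suc i)) = xx (Suc i) 0" .
  have "xx i 1 \<odot>\<^bsub>?Y\<^esub> gen 0 i = gen 0 (i + 1)" using lt by (intro xx_act_gen) auto
  then have "h (gen 0 (Suc i)) = h (gen 0 i) \<otimes> xx i 1"
    using rhomD(3)[OF h(1) xx_closed gY, of i 1] by simp
  then have "cf (xx (Suc i) 0) (Suc i) 0 = cf (h (gen 0 i) \<otimes> xx i 1) (Suc i) 0" using 1 by simp
  also have "\<dots> = 0" using rhomD(1)[OF h(1) gY] by (subst cf_xx_right) auto
  finally show False using c_pos[of "Suc i"] by (simp add: cf_xx)
qed

text \<open>
  The starting points of a minimal projective resolution of the module with composition factors
  \<open>a, \<dots>, b - 1\<close>: the \<open>n\<close>-th syzygy occupies the interval from the \<open>n\<close>-th to the next term. The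
  sequence becomes constant once a syzygy vanishes.
\<close>

fun syz :: "nat \<Rightarrow> nat \<Rightarrow> nat \<Rightarrow> nat" where
  "syz a b 0 = a"
| "syz a b (Suc 0) = b"
| "syz a b (Suc (Suc n)) = (if syz a b n = syz a b (Suc n) then syz a b (Suc n) else jump c (syz a b n))"

lemma syz_step:
  assumes "a \<le> b" "b \<le> jump c a"
  shows "syz a b n \<le> syz a b (Suc n) \<and> syz a b (Suc n) \<le> jump c (syz a b n)"
proof (induction n)
  case (Suc n)
  then show ?case
    using jump_mono[of "syz a b n" "syz a b (Suc n)"] jump_gt[of "syz a b (Suc n)"] by auto
qed (use assms in auto)

lemma syz_stays: "syz a b n = syz a b (Suc n) \<Longrightarrow> n \<le> m \<Longrightarrow> syz a b m = syz a b (Suc m)"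
proof (induction m)
  case (Suc m)
  show ?case
  proof (cases "n = Suc m")
    case False
    then have "syz a b m = syz a b (Suc m)" using Suc by simp
    then show ?thesis unfolding syz.simps(3) by (simp only: if_True simp_thms)
  qed (use Suc.prems in \<open>simp only:\<close>)
qed simp

lemma syz_iter:
  assumes "\<And>n. n < 2 * m \<Longrightarrow> syz a b n \<noteq> syz a b (Suc n)"
  shows "syz a b (2 * m) = (jump c ^^ m) a \<and> syz a b (Suc (2 * m)) = (jump c ^^ m) b"
  using assms
proof (induction m)
  case (Suc m)
  have "syz a b (2 * m) \<noteq> syz a b (Suc (2 * m))" "syz a b (Suc (2 * m)) \<noteq> syz a b (Suc (Suc (2 * m)))"
    using Suc.prems[of "2 * m"] Suc.prems[of "Suc (2 * m)"] by simp_all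
  then show ?case using Suc by simp
qed simp

lemma syz_stabilizes:
  assumes "orbits_merge c" "a \<le> b" "b \<le> jump c a"
  shows "\<exists>n. syz a b n = syz a b (Suc n)"
proof (rule ccontr)
  assume "\<not> ?thesis"
  then have ne: "\<And>n. syz a b n \<noteq> syz a b (Suc n)" by blast
  obtain n where "(jump c ^^ n) b = (jump c ^^ n) a \<or> (jump c ^^ n) b = (jump c ^^ Suc n) a"
    using orbits_merge_pair[OF assms] by blast
  then show False
    using syz_iter[of n a b] syz_iter[of "Suc n" a b] ne[of "2 * n"] ne[of "Suc (2 * n)"] ne by auto
qed

lemma syz_shift: "syz (a + r * N) (b + r * N) n = syz a b n + r * N"
  by (induction a b n rule: syz.induct) (simp_all add: jump_add_mult)

text \<open>
  Up to translation by \<open>N\<close> there are only finitely many intervals, so one \<open>n\<close> works for all of them.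
\<close>

lemma syz_uniform:
  assumes "orbits_merge c"
  shows "\<exists>n. \<forall>a b. a \<le> b \<and> b \<le> jump c a \<longrightarrow> syz a b n = syz a b (Suc n)"
proof -
  have "\<forall>a b. \<exists>n. a \<le> b \<and> b \<le> jump c a \<longrightarrow> syz a b n = syz a b (Suc n)"
    using syz_stabilizes[OF assms] by blast
  then obtain f where f: "\<And>a b. a \<le> b \<Longrightarrow> b \<le> jump c a \<Longrightarrow> syz a b (f a b) = syz a b (Suc (f a b))" by metis
  define n where "n = Max (insert 0 ((\<lambda>(a, b). f a b) ` (SIGMA a:{..<N}. {..jump c a})))"
  have "syz a b n = syz a b (Suc n)" if ab: "a \<le> b" "b \<le> jump c a" for a b
  proof -
    define r a' b' where "r = a div N" and "a' = a mod N" and "b' = b - r * N"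
    have a: "a = a' + r * N" by (simp add: r_def a'_def)
    have b: "b = b' + r * N" using ab(1) unfolding a b'_def by simp
    have "a' + r * N \<le> b' + r * N" using ab(1) by (simp only: a[symmetric] b[symmetric])
    moreover have "b' + r * N \<le> jump c a' + r * N"
      using ab(2) by (simp only: jump_add_mult[symmetric] a[symmetric] b[symmetric])
    ultimately have a'b': "a' < N" "a' \<le> b'" "b' \<le> jump c a'"
      using N_pos by (simp_all add: a'_def)
    have "f a' b' \<le> n"
      unfolding n_def by (rule Max_ge) (use a'b' in auto)
    then have "syz a' b' n = syz a' b' (Suc n)" using syz_stays[OF f] a'b' by blast
    then have "syz a' b' n + r * N = syz a' b' (Suc n) + r * N" by (simp only:)
    then show ?thesis by (simp only: syz_shift[symmetric] a[symmetric] b[symmetric])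
  qed
  then show ?thesis by blast
qed

lemma im_res_zero_iff:
  assumes "v \<in> carrier (im cf J a b)" "\<And>k. k \<in> J \<Longrightarrow> p k \<le> a k"
  shows "im_res J p q v = (\<lambda>_. 0) \<longleftrightarrow> (\<forall>k\<in>J. \<forall>t<q k. co v k t = 0)"
proof
  assume z: "im_res J p q v = (\<lambda>_. 0)"
  show "\<forall>k\<in>J. \<forall>t<q k. co v k t = 0"
  proof (intro ballI allI impI, rule ccontr)
    fix k t assume kt: "k \<in> J" "t < q k" "co v k t \<noteq> 0"
    then have "a k \<le> t" using assms(1) unfolding im_carrier by blast
    then have "p k \<le> t" using assms(2)[OF kt(1)] by simp
    then have "co (im_res J p q v) k t = co v k t" using kt by (simp add: im_res_def)
    then show False using z kt by simp
  qed
next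
  assume "\<forall>k\<in>J. \<forall>t<q k. co v k t = 0"
  then show "im_res J p q v = (\<lambda>_. 0)" by (intro co_eqI) (auto simp: im_res_def)
qed

text \<open>
  The covering of an interval \<open>[a, b)\<close> by \<open>P(a)\<close> has the kernel \<open>[b, F a)\<close>. So the resolution is
  written down with consecutive terms of \<open>syz\<close> as the ends of the intervals, and all its maps are
  restrictions of supports.
\<close>

lemma finite_resolution:
  fixes M :: "('a, nat \<Rightarrow> 'k) module"
  assumes "fg_module A M" and n: "\<And>a b. a \<le> b \<and> b \<le> jump c a \<longrightarrow> syz a b n = syz a b (Suc n)"
  shows "has_proj_resolution A M n"
proof -
  have M: "right_module A M" using assms(1) by (simp add: fg_module_def)
  interpret M: right_module A M by fact
  obtain J p q \<phi> where D: "finite J" "\<And>k. k \<in> J \<Longrightarrow> p k \<le> q k \<and> q k \<le> jump c (p k)"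
     "\<phi> \<in> rhom A (im cf J p q) M" "bij_betw \<phi> (carrier (im cf J p q)) (carrier M)"
    using fg_decomposition[OF assms(1)] by blast
  define y where "y i k = syz (p k) (q k) i" for i k
  have y01: "y 0 = p" "y (Suc 0) = q" by (auto simp: y_def)
  have step: "y i k \<le> y (Suc i) k" "y (Suc i) k \<le> jump c (y i k)" if "k \<in> J" for i k
    using syz_step[of "p k" "q k" i] D(2)[OF that] by (auto simp: y_def)
  have rec: "y (Suc (Suc i)) k = (if y i k = y (Suc i) k then y (Suc i) k else jump c (y i k))" for i k
    by (simp add: y_def)
  have yn: "y n k = y (Suc n) k" "y (Suc n) k = y (Suc (Suc n)) k" if "k \<in> J" for k
    using n[of "p k" "q k"] D(2)[OF that] rec[of n k] by (auto simp: y_def)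
  \<comment> \<open>The \<open>i\<close>-th projective covers the \<open>i\<close>-th syzygy, which occupies \<open>[y i, y (i + 1))\<close>.\<close>
  define P where "P i = im cf J (y i) (y (Suc (Suc i)))" for i
  define d where "d i = (case i of 0 \<Rightarrow> (\<lambda>v. \<phi> (im_res J p q v)) | Suc i \<Rightarrow> im_res J (y i) (y (Suc (Suc i))))" for i
  have q: "y (Suc (Suc i)) k \<le> jump c (y i k)" if "k \<in> J" for i k
    using step[OF that, of i] rec[of i k] by (auto split: if_splits)
  have Pm: "right_module A (P i)" for i unfolding P_def using q by (rule im_right_module)
  have res0: "im_res J p q \<in> rhom A (P 0) (im cf J p q)"
    unfolding P_def y01 by (rule im_res_hom) (use step(1)[of _ 1] y01 in auto)
  have d0: "d 0 \<in> rhom A (P 0) M" unfolding d_def using rhom_comp[OF res0 D(3)] by simp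
  have dS: "d (Suc i) \<in> rhom A (P (Suc i)) (P i)" for i
    unfolding d_def P_def using im_res_hom[of J J "y i" "y (Suc i)" "y (Suc (Suc i))" "y (Suc (Suc (Suc i)))"] step(1) by simp
  have ker: "v \<in> a_kernel (P i) (if i = 0 then M else P (i - 1)) (d i) \<longleftrightarrow>
      v \<in> carrier (P i) \<and> (\<forall>k\<in>J. \<forall>t<y (Suc i) k. co v k t = 0)" for v i
  proof (cases i)
    case 0
    have Z: "right_module A (im cf J p q)" using D(2) by (intro im_right_module) simp
    have "\<phi> (im_res J p q v) = \<zero>\<^bsub>M\<^esub> \<longleftrightarrow> (\<forall>k\<in>J. \<forall>t<q k. co v k t = 0)" if v: "v \<in> carrier (P 0)"
    proof -
      have "\<phi> (im_res J p q v) = \<zero>\<^bsub>M\<^esub> \<longleftrightarrow> im_res J p q v = \<zero>\<^bsub>im cf J p q\<^esub>"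
        using rhom_inj_iff[OF Z M D(3)] D(4) rhomD(1)[OF res0 v] rhom_zero[OF Z M D(3)] by (auto simp: bij_betw_def)
      also have "\<dots> \<longleftrightarrow> (\<forall>k\<in>J. \<forall>t<q k. co v k t = 0)"
        using im_res_zero_iff[of v J p "y 2" p q] v y01 by (simp add: P_def numeral_2_eq_2)
      finally show ?thesis .
    qed
    then show ?thesis using 0 y01 by (auto simp: a_kernel_iff d_def)
  next
    case (Suc m)
    have "im_res J (y m) (y (Suc (Suc m))) v = \<zero>\<^bsub>P m\<^esub> \<longleftrightarrow> (\<forall>k\<in>J. \<forall>t<y (Suc (Suc m)) k. co v k t = 0)"
      if v: "v \<in> carrier (P (Suc m))"
      using im_res_zero_iff[of v J "y (Suc m)" "y (Suc (Suc (Suc m)))" "y m" "y (Suc (Suc m))"] v step(1)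
      by (simp add: P_def)
    then show ?thesis using Suc by (auto simp: a_kernel_iff d_def)
  qed
  have surj0: "d 0 ` carrier (P 0) = carrier M"
  proof (intro equalityI subsetI)
    fix m assume "m \<in> carrier M"
    then obtain v where v: "v \<in> carrier (im cf J p q)" "m = \<phi> v" using D(4) by (auto simp: bij_betw_def)
    have "v \<in> carrier (P 0)"
      unfolding P_def im_carrier
    proof (intro allI impI)
      fix k t assume "co v k t \<noteq> 0"
      then have "k \<in> J" "p k \<le> t" "t < q k" using v(1) unfolding im_carrier by blast+
      then show "k \<in> J \<and> y 0 k \<le> t \<and> t < y (Suc (Suc 0)) k" using step(1)[of k 1] y01 by simp
    qed
    moreover have "im_res J p q v = v" using v(1) by (intro co_eqI) (auto simp: im_res_def im_carrier)
    ultimately show "m \<in> d 0 ` carrier (P 0)" using v(2) by (force simp: d_def)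
  qed (use rhomD(1)[OF d0] in auto)
  have exact: "d (Suc i) ` carrier (P (Suc i)) = a_kernel (P i) (if i = 0 then M else P (i - 1)) (d i)" for i
  proof (intro equalityI subsetI)
    fix w assume "w \<in> d (Suc i) ` carrier (P (Suc i))"
    then obtain v where v: "v \<in> carrier (P (Suc i))" "w = d (Suc i) v" by blast
    have "co w k t = 0" if "t < y (Suc i) k" for k t
    proof -
      have "co v k t = 0" using v(1) that unfolding P_def im_carrier by (meson leD)
      then show ?thesis using v(2) by (simp add: d_def im_res_def)
    qed
    then show "w \<in> a_kernel (P i) (if i = 0 then M else P (i - 1)) (d i)"
      unfolding ker using rhomD(1)[OF dS v(1)] v(2) by simp
  next
    fix w assume w: "w \<in> a_kernel (P i) (if i = 0 then M else P (i - 1)) (d i)"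
    then have w1: "w \<in> carrier (P i)" and w2: "\<And>k t. k \<in> J \<Longrightarrow> t < y (Suc i) k \<Longrightarrow> co w k t = 0" unfolding ker by auto
    have "w \<in> carrier (P (Suc i))"
      unfolding P_def im_carrier
    proof (intro allI impI)
      fix k t assume kt: "co w k t \<noteq> 0"
      then have k: "k \<in> J" "t < y (Suc (Suc i)) k" using w1 unfolding P_def im_carrier by blast+
      then show "k \<in> J \<and> y (Suc i) k \<le> t \<and> t < y (Suc (Suc (Suc i))) k"
        using w2[OF k(1), of t] kt step(1)[OF k(1), of "Suc (Suc i)"] by (auto simp: not_less[symmetric])
    qed
    moreover have "d (Suc i) w = w"
      using w1 by (intro co_eqI) (auto simp: d_def im_res_def P_def im_carrier)
    ultimately show "w \<in> d (Suc i) ` carrier (P (Suc i))" by force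
  qed
  have proj: "fg_module A (P i) \<and> projective A (P i)" for i
  proof
    show "fg_module A (P i)" unfolding P_def using D(1) q by (rule im_fg)
    show "projective A (P i)"
      unfolding P_def using D(1)
    proof (rule im_projective)
      fix k assume "k \<in> J" "y i k < y (Suc (Suc i)) k"
      then show "y (Suc (Suc i)) k = jump c (y i k)" using rec[of i k] by (auto split: if_splits)
    qed
  qed
  have inj: "inj_on (d n) (carrier (P n))"
  proof -
    have hom: "d n \<in> rhom A (P n) (if n = 0 then M else P (n - 1))" using d0 dS by (cases n) auto
    have tm: "right_module A (if n = 0 then M else P (n - 1))" using M Pm by simp
    show ?thesis
      unfolding rhom_inj_iff[OF Pm tm hom]
    proof (intro ballI impI)
      fix v assume v: "v \<in> carrier (P n)" "d n v = \<zero>\<^bsub>if n = 0 then M else P (n - 1)\<^esub>"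
      then have "v \<in> a_kernel (P n) (if n = 0 then M else P (n - 1)) (d n)" by (simp add: a_kernel_iff)
      then have z: "\<forall>k\<in>J. \<forall>t<y (Suc n) k. co v k t = 0" unfolding ker by blast
      show "v = \<zero>\<^bsub>P n\<^esub>"
      proof (rule co_eqI)
        fix k t
        have "co v k t = 0"
        proof (rule ccontr)
          assume nz: "co v k t \<noteq> 0"
          then have "k \<in> J" "t < y (Suc (Suc n)) k" using v(1) unfolding P_def im_carrier by blast+
          then show False using z nz yn(2)[of k] by simp
        qed
        then show "co v k t = co \<zero>\<^bsub>P n\<^esub> k t" by (simp add: P_def)
      qed
    qed
  qed
  show ?thesis
    unfolding has_proj_resolution_def
    using proj d0 surj0 dS exact inj by (intro exI[of _ P] exI[of _ d]) blast
qed

lemma finite_global_dim: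
  assumes "orbits_merge c"
  shows "global_dim A < \<infinity>"
proof -
  obtain n where n: "\<forall>a b. a \<le> b \<and> b \<le> jump c a \<longrightarrow> syz a b n = syz a b (Suc n)"
    using syz_uniform[OF assms] by blast
  have "proj_dim A M \<le> enat n" if "fg_module A M" for M :: "('a, nat \<Rightarrow> 'k) module"
    unfolding proj_dim_def by (rule Inf_lower) (use finite_resolution[OF that] n in blast)
  then have "global_dim A \<le> enat n" unfolding global_dim_def by (intro Sup_least) auto
  then show ?thesis by (rule le_less_trans) simp
qed

abbreviation interval :: "nat \<Rightarrow> nat \<Rightarrow> ('a, nat \<Rightarrow> 'k) module" where
  "interval lo hi \<equiv> im cf {0} (\<lambda>_. lo) (\<lambda>_. hi)"

text \<open>
  A weak form of being a direct summand: the interval module maps into \<open>W\<close> and back so that the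
  generator is preserved up to the radical. Unlike an actual splitting it passes to kernels of
  projective presentations without any comparison of resolutions.
\<close>

definition weak_summand :: "('a, 'm) module \<Rightarrow> 'm set \<Rightarrow> nat \<Rightarrow> nat \<Rightarrow> bool" where
  "weak_summand M W lo hi \<longleftrightarrow> (\<exists>\<iota> \<pi>. \<iota> \<in> rhom A (interval lo hi) M \<and> \<iota> ` carrier (interval lo hi) \<subseteq> W \<and>
     \<pi> \<in> rhom A (M\<lparr>carrier := W\<rparr>) (interval lo hi) \<and> co (\<pi> (\<iota> (gen 0 lo))) 0 lo = 1)"

text \<open>
  If the interval \<open>[lo, hi)\<close> is a weak summand of the image of a map from a projective module, then its
  syzygy \<open>[hi, F lo)\<close> is one of the kernel. Both maps of the weak summand lift to maps between
  \<open>P(lo)\<close> and the projective module, the second one by projectivity, and the coefficient at the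
  generator of the syzygy is obtained from that at the generator by multiplication with a path.
\<close>

lemma weak_summand_kernel:
  fixes P :: "('a, nat \<Rightarrow> 'k) module"
  assumes P: "fg_module A P" "projective A P" and M: "right_module A M" and d: "d \<in> rhom A P M"
    and "lo < hi" "hi < jump c lo" "weak_summand M (d ` carrier P) lo hi"
  shows "weak_summand P (a_kernel P M d) hi (jump c lo)"
proof -
  let ?W = "d ` carrier P" and ?I = "interval lo hi" and ?Q = "interval lo (jump c lo)"
  have P': "right_module A P" using P by (simp add: fg_module_def)
  interpret P: right_module A P by fact
  interpret M: right_module A M by fact
  obtain \<iota> \<pi> where ip: "\<iota> \<in> rhom A ?I M" "\<iota> ` carrier ?I \<subseteq> ?W"
     "\<pi> \<in> rhom A (M\<lparr>carrier := ?W\<rparr>) ?I" "co (\<pi> (\<iota> (gen 0 lo))) 0 lo = 1"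
    using assms(7) by (auto simp: weak_summand_def)
  have W: "submodule ?W A M" by (rule rhom_image_submodule[OF P' M d P.carrier_submodule])
  have WM: "right_module A (M\<lparr>carrier := ?W\<rparr>)" by (rule M.right_module_sub[OF W])
  have I: "right_module A ?I" using assms(5,6) by (intro im_right_module) simp
  have Q: "right_module A ?Q" by (intro im_right_module) simp
  have gI: "homogeneous ?I lo (gen 0 lo)" using assms(5) by (intro gen_homogeneous) auto
  have gQ: "gen 0 lo \<in> carrier ?Q" using jump_gt by (intro gen_in_im) auto
  obtain z0 where z0: "z0 \<in> carrier P" "d z0 = \<iota> (gen 0 lo)"
  proof -
    have "\<iota> (gen 0 lo) \<in> ?W" using ip(2) gI by blast
    then obtain x where "\<iota> (gen 0 lo) = d x" "x \<in> carrier P" by (rule imageE)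
    then show thesis using that[of x] by simp
  qed
  define z where "z = xx lo 0 \<odot>\<^bsub>P\<^esub> z0"
  have "xx lo 0 \<otimes> xx lo 0 = xx lo 0" using xx_mult[of lo 0 0] by simp
  then have z: "homogeneous P lo z"
    using z0 P.act_mult[of "xx lo 0" "xx lo 0" z0] by (simp add: z_def P.act_closed)
  have dz: "d z = \<iota> (gen 0 lo)"
    using rhomD(3)[OF d xx_closed z0(1), of lo 0] rhomD(3)[OF ip(1) xx_closed conjunct1[OF gI], of lo 0]
    by (simp only: z_def z0(2) conjunct2[OF gI])
  let ?u = "\<lambda>v. rho lo (co v 0) \<odot>\<^bsub>P\<^esub> z"
  have u: "?u \<in> rhom A ?Q P"
    using row_hom[OF P', where p = "\<lambda>_. lo" and q = "\<lambda>_. jump c lo" and k = 0 and J = "{0}" and z = z]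
      z killed_from_c[OF P' z] by (simp add: jump_def)
  have ug: "?u (gen 0 lo) = z" using z rho_gen[of "\<lambda>_. lo" 0] by simp
  let ?r = "im_res {0} (\<lambda>_. lo) (\<lambda>_. hi) :: (nat \<Rightarrow> 'k) \<Rightarrow> _"
  have r: "?r \<in> rhom A ?Q ?I" by (rule im_res_hom) (use assms(6) in auto)
  have r_id: "?r v = v" if "v \<in> carrier ?I" for v
    using that by (rule im_res_id) simp
  have rsurj: "?r ` carrier ?Q = carrier ?I"
  proof (intro equalityI subsetI)
    fix v assume v: "v \<in> carrier ?I"
    then have "v \<in> carrier ?Q" by (rule im_incl) (use assms(6) in simp)
    then show "v \<in> ?r ` carrier ?Q" using r_id[OF v] by (metis imageI)
  qed (use rhomD(1)[OF r] in auto)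
  have dW: "d \<in> rhom A P (M\<lparr>carrier := ?W\<rparr>)" using rhomD[OF d] by (intro rhomI) auto
  have fgQ: "fg_module A ?Q" and fgI: "fg_module A ?I" using assms(6) by (intro im_fg; simp)+
  obtain w where w: "w \<in> rhom A P ?Q" "\<forall>x\<in>carrier P. ?r (w x) = \<pi> (d x)"
    using P(2) fgQ fgI r rsurj rhom_comp[OF dW ip(3)] unfolding projective_def by blast
  let ?K = "a_kernel P M d" and ?I' = "interval hi (jump c lo)"
  have I'Q: "v \<in> carrier ?Q" if "v \<in> carrier ?I'" for v
    using that by (rule im_incl) (use assms(5) in simp)
  have act_eq: "a \<odot>\<^bsub>?I'\<^esub> v = a \<odot>\<^bsub>?Q\<^esub> v" for a v by (intro co_eqI) simp
  have du: "d (?u v) = \<iota> (?r v)" if "v \<in> carrier ?Q" for v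
  proof (rule im_hom_eqI[where J = "{0}" and p = "\<lambda>_. lo" and q = "\<lambda>_. jump c lo" and f = "\<lambda>v. d (?u v)" and g = "\<lambda>v. \<iota> (?r v)"])
    show "(\<lambda>v. d (?u v)) \<in> rhom A ?Q M" by (rule rhom_comp[OF u d])
    show "(\<lambda>v. \<iota> (?r v)) \<in> rhom A ?Q M" by (rule rhom_comp[OF r ip(1)])
    have "d (?u (gen 0 lo)) = \<iota> (?r (gen 0 lo))" unfolding ug dz using r_id[OF conjunct1[OF gI]] by simp
    then show "d (?u (gen k lo)) = \<iota> (?r (gen k lo))" if "k \<in> {0}" for k using that by simp
  qed (use M that in auto)
  have u1: "?u \<in> rhom A ?I' P"
  proof (rule rhomI)
    fix v assume v: "v \<in> carrier ?I'"
    show "?u v \<in> carrier P" by (rule rhomD(1)[OF u I'Q[OF v]])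
    show "?u (a \<odot>\<^bsub>?I'\<^esub> v) = a \<odot>\<^bsub>P\<^esub> ?u v" if "a \<in> carrier A" for a
      unfolding act_eq by (rule rhomD(3)[OF u that I'Q[OF v]])
    fix v' assume v': "v' \<in> carrier ?I'"
    show "?u (v \<oplus>\<^bsub>?I'\<^esub> v') = ?u v \<oplus>\<^bsub>P\<^esub> ?u v'"
      using rhomD(2)[OF u I'Q[OF v] I'Q[OF v']] by (simp only: im_simps)
  qed
  have u2: "?u ` carrier ?I' \<subseteq> ?K"
  proof (intro image_subsetI)
    fix v assume v: "v \<in> carrier ?I'"
    have "co v 0 t = 0" if "t < hi" for t using v that unfolding im_carrier by (meson leD)
    then have "?r v = \<zero>\<^bsub>?I\<^esub>"
      using im_res_zero_iff[OF v, of "\<lambda>_. lo" "\<lambda>_. hi"] assms(5) by simp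
    then have "d (?u v) = \<zero>\<^bsub>M\<^esub>" using du[OF I'Q[OF v]] rhom_zero[OF I M ip(1)] by simp
    then show "?u v \<in> ?K" using rhomD(1)[OF u I'Q[OF v]] by (simp add: a_kernel_iff)
  qed
  have wK: "w x \<in> carrier ?I'" if x: "x \<in> ?K" for x
  proof -
    have xP: "x \<in> carrier P" and "d x = \<zero>\<^bsub>M\<^esub>" using x by (auto simp: a_kernel_iff)
    then have "?r (w x) = \<zero>\<^bsub>?I\<^esub>" using w(2) rhom_zero[OF WM I ip(3)] by simp
    then have *: "co (?r (w x)) k t = 0" for k t by simp
    have z: "co (w x) 0 t = 0" if "lo \<le> t" "t < hi" for t using *[of 0 t] that by (simp add: im_res_def)
    show ?thesis
      unfolding im_carrier
    proof (intro allI impI)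
      fix k t assume nz: "co (w x) k t \<noteq> 0"
      then have "k \<in> {0}" "lo \<le> t" "t < jump c lo" using rhomD(1)[OF w(1) xP] unfolding im_carrier by blast+
      then show "k \<in> {0} \<and> hi \<le> t \<and> t < jump c lo" using z[of t] nz by (cases "t < hi") auto
    qed
  qed
  have w1: "w \<in> rhom A (P\<lparr>carrier := ?K\<rparr>) ?I'"
  proof (rule rhomI)
    fix x assume "x \<in> carrier (P\<lparr>carrier := ?K\<rparr>)"
    then have x: "x \<in> ?K" by simp
    then have xP: "x \<in> carrier P" by (simp add: a_kernel_iff)
    show "w x \<in> carrier ?I'" by (rule wK[OF x])
    show "w (a \<odot>\<^bsub>P\<lparr>carrier := ?K\<rparr>\<^esub> x) = a \<odot>\<^bsub>?I'\<^esub> w x" if "a \<in> carrier A" for a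
      unfolding act_eq using rhomD(3)[OF w(1) that xP] by simp
    fix x' assume "x' \<in> carrier (P\<lparr>carrier := ?K\<rparr>)"
    then have "x' \<in> carrier P" by (simp add: a_kernel_iff)
    then show "w (x \<oplus>\<^bsub>P\<lparr>carrier := ?K\<rparr>\<^esub> x') = w x \<oplus>\<^bsub>?I'\<^esub> w x'"
      using rhomD(2)[OF w(1) xP] by simp
  qed
  have "xx lo (hi - lo) \<odot>\<^bsub>?Q\<^esub> gen 0 lo = gen 0 (lo + (hi - lo))"
    using assms(5,6) by (intro xx_act_gen) auto
  then have g: "gen 0 hi = xx lo (hi - lo) \<odot>\<^bsub>?Q\<^esub> gen 0 lo" using assms(5) by simp
  have zP: "?u (gen 0 lo) \<in> carrier P" using rhomD(1)[OF u gQ] .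
  let ?y = "w (?u (gen 0 lo))"
  have yQ: "?y \<in> carrier ?Q" using rhomD(1)[OF w(1) zP] .
  have "w (?u (gen 0 hi)) = xx lo (hi - lo) \<odot>\<^bsub>?Q\<^esub> ?y"
    by (simp only: g rhomD(3)[OF u xx_closed gQ] rhomD(3)[OF w(1) xx_closed zP])
  then have "co (w (?u (gen 0 hi))) 0 hi = (\<Sum>s\<le>hi. co ?y 0 s * cf (xx lo (hi - lo)) s (hi - s))"
    using assms(6) by simp
  also have "\<dots> = co ?y 0 lo"
  proof -
    have "hi - lo < c lo" using assms(5,6) by (simp add: jump_def)
    moreover have "co ?y 0 s * cf (xx lo (hi - lo)) s (hi - s) = 0" if "s \<le> hi" "s \<noteq> lo" for s
      using that assms(5) by (auto simp: cf_xx)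
    ultimately show ?thesis using assms(5) by (subst sum_single_le[of _ lo]) (auto simp: cf_xx)
  qed
  also have "\<dots> = co (?r ?y) 0 lo" using assms(5) by (simp add: im_res_def)
  also have "\<dots> = co (\<pi> (d (?u (gen 0 lo)))) 0 lo" using w(2) zP by simp
  also have "\<dots> = 1" unfolding ug dz by (rule ip(4))
  finally have "co (w (?u (gen 0 hi))) 0 hi = 1" .
  with u1 u2 w1 show ?thesis
    unfolding weak_summand_def by (intro exI[of _ ?u] exI[of _ w] conjI)
qed

text \<open>
  If the orbits of \<open>a\<close> and \<open>a + 1\<close> never merge, no syzygy of the simple module at \<open>a\<close> vanishes. In
  any projective resolution these syzygies are weak summands of the kernels, and so no kernel is zero.
\<close>

lemma infinite_global_dim:
  assumes "\<not> orbits_merge c"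
  shows "global_dim A = \<infinity>"
proof -
  obtain a where a: "\<And>n. (jump c ^^ n) (Suc a) \<noteq> (jump c ^^ n) a" "\<And>n. (jump c ^^ n) (Suc a) \<noteq> (jump c ^^ Suc n) a"
    using assms unfolding orbits_merge_def by blast
  \<comment> \<open>The ends of the successive syzygies of the simple module at \<open>a\<close>.\<close>
  define x where "x i = (jump c ^^ (i div 2)) (if even i then a else Suc a)" for i
  have rec: "x (Suc (Suc i)) = jump c (x i)" for i by (simp add: x_def)
  have lt: "x i < x (Suc i)" for i
  proof (cases "even i")
    case True
    then have "x i = (jump c ^^ (i div 2)) a" "x (Suc i) = (jump c ^^ (i div 2)) (Suc a)" by (auto simp: x_def)
    then show ?thesis using a(1)[of "i div 2"] iter_mono[of a "Suc a" "i div 2"] by simp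
  next
    case False
    then have x1: "x i = (jump c ^^ (i div 2)) (Suc a)" "x (Suc i) = (jump c ^^ Suc (i div 2)) a"
      by (auto simp: x_def elim!: oddE)
    have "x i \<le> (jump c ^^ (i div 2)) (jump c a)" unfolding x1 using jump_gt[of a] by (intro iter_mono) simp
    then have "x i \<le> x (Suc i)" unfolding x1 by (simp add: funpow_swap1)
    then show ?thesis using a(2)[of "i div 2"] x1 by simp
  qed
  define M where "M = interval (x 0) (x 1)"
  have le: "x (Suc i) \<le> jump c (x i)" for i using lt[of "Suc i"] rec[of i] by simp
  have fg: "fg_module A M" unfolding M_def using le[of 0] by (intro im_fg) auto
  have Mm: "right_module A M" using fg by (simp add: fg_module_def)
  interpret M: right_module A M by fact
  have "\<not> has_proj_resolution A M n" for n
  proof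
    assume "has_proj_resolution A M n"
    then obtain P :: "nat \<Rightarrow> ('a, nat \<Rightarrow> 'k) module" and d where
      P: "\<forall>i\<le>n. fg_module A (P i) \<and> projective A (P i)" and
      d0: "d 0 \<in> rhom A (P 0) M" "d 0 ` carrier (P 0) = carrier M" and
      dS: "\<forall>i<n. d (Suc i) \<in> rhom A (P (Suc i)) (P i) \<and>
         d (Suc i) ` carrier (P (Suc i)) = a_kernel (P i) (if i = 0 then M else P (i - 1)) (d i)" and
      inj: "inj_on (d n) (carrier (P n))"
      unfolding has_proj_resolution_def by blast
    let ?T = "\<lambda>i. if i = 0 then M else P (i - 1)"
    have Pm: "right_module A (P i)" if "i \<le> n" for i using P that by (simp add: fg_module_def)
    have hom: "d i \<in> rhom A (P i) (?T i)" if "i \<le> n" for i using d0 dS that by (cases i) auto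
    have Tm: "right_module A (?T i)" if "i \<le> n" for i using Pm[of "i - 1"] Mm that by auto
    have ws: "weak_summand (P i) (a_kernel (P i) (?T i) (d i)) (x (Suc i)) (x (Suc (Suc i)))" if "i \<le> n" for i
      using that
    proof (induction i)
      case 0
      have "weak_summand M (d 0 ` carrier (P 0)) (x 0) (x 1)"
        unfolding weak_summand_def d0(2)
      proof (intro exI conjI)
        show "(\<lambda>v. v) \<in> rhom A (interval (x 0) (x 1)) M" unfolding M_def by (rule rhomI) auto
        show "(\<lambda>v. v) \<in> rhom A (M\<lparr>carrier := carrier M\<rparr>) (interval (x 0) (x 1))" unfolding M_def by (rule rhomI) auto
      qed (auto simp: M_def)
      then show ?case
        using weak_summand_kernel[of "P 0" M "d 0" "x 0" "x 1"] P Mm d0(1) lt[of 0] lt[of 1] rec[of 0] by simp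
    next
      case (Suc i)
      then have "weak_summand (P i) (d (Suc i) ` carrier (P (Suc i))) (x (Suc i)) (x (Suc (Suc i)))"
        using dS by simp
      then show ?case
        using weak_summand_kernel[of "P (Suc i)" "P i" "d (Suc i)" "x (Suc i)" "x (Suc (Suc i))"] P dS Suc.prems Pm[of i]
          lt[of "Suc i"] lt[of "Suc (Suc i)"] rec[of "Suc i"] by simp
    qed
    let ?K = "a_kernel (P n) (?T n) (d n)" and ?I = "interval (x (Suc n)) (x (Suc (Suc n)))"
    from ws[of n] obtain \<iota> \<pi> where ip: "\<iota> ` carrier ?I \<subseteq> ?K" "\<pi> \<in> rhom A (P n\<lparr>carrier := ?K\<rparr>) ?I"
       "co (\<pi> (\<iota> (gen 0 (x (Suc n))))) 0 (x (Suc n)) = 1"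
      unfolding weak_summand_def by auto
    have "gen 0 (x (Suc n)) \<in> carrier ?I" using lt[of "Suc n"] by (intro gen_in_im) auto
    then have "\<iota> (gen 0 (x (Suc n))) \<in> ?K" using ip(1) by blast
    then have "\<iota> (gen 0 (x (Suc n))) = \<zero>\<^bsub>P n\<^esub>"
      using inj rhom_inj_iff[OF Pm Tm hom, of n] by (simp add: a_kernel_iff)
    moreover have "right_module A (P n\<lparr>carrier := ?K\<rparr>)"
      using right_module.right_module_sub[OF Pm kernel_submodule[OF Pm Tm hom]] by simp
    moreover have "right_module A ?I" using le[of "Suc n"] by (intro im_right_module) simp
    ultimately have "\<pi> (\<iota> (gen 0 (x (Suc n)))) = \<zero>\<^bsub>?I\<^esub>" using rhom_zero[OF _ _ ip(2)] by simp
    then show False using ip(3) by simp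
  qed
  then have "{enat n | n. has_proj_resolution A M n} = {}" by blast
  then have "proj_dim A M = \<infinity>" unfolding proj_dim_def by (simp add: Inf_enat_def)
  then have "\<infinity> \<le> global_dim A" unfolding global_dim_def using fg by (intro Sup_upper CollectI exI[of _ M]) simp
  then show ?thesis by (simp add: top_enat_def[symmetric] top_unique)
qed

end

section \<open>Socles and projective covers\<close>

lemma submodule_sub_iff:
  assumes "right_module A M" "submodule T A M"
  shows "submodule U A (M\<lparr>carrier := T\<rparr>) \<longleftrightarrow> submodule U A M \<and> U \<subseteq> T"
proof -
  interpret M: right_module A M by fact
  have "right_module A (M\<lparr>carrier := T\<rparr>)" by (rule M.right_module_sub) fact
  then interpret T: right_module A "M\<lparr>carrier := T\<rparr>" .
  have TM: "T \<subseteq> carrier M" by (rule M.submoduleD(1)) fact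
  show ?thesis
  proof
    assume U: "submodule U A (M\<lparr>carrier := T\<rparr>)"
    note u = T.submoduleD[OF U]
    have "U \<subseteq> T" using u(1) by simp
    moreover have "submodule U A M"
      by (rule M.submoduleI) (use u TM in auto)
    ultimately show "submodule U A M \<and> U \<subseteq> T" by simp
  next
    assume U: "submodule U A M \<and> U \<subseteq> T"
    then have "submodule U A M" by simp
    note u = M.submoduleD[OF this]
    show "submodule U A (M\<lparr>carrier := T\<rparr>)"
      by (rule T.submoduleI) (use u U in auto)
  qed
qed

text \<open>
  A nonzero submodule that lies in all others is simple, and it is the only simple submodule.
\<close>

lemma socle_eq_least:
  assumes "right_module A M" "submodule S A M" "S \<noteq> {\<zero>\<^bsub>M\<^esub>}"
    and least: "\<And>V. submodule V A M \<Longrightarrow> V \<noteq> {\<zero>\<^bsub>M\<^esub>} \<Longrightarrow> S \<subseteq> V"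
  shows "socle A M = S"
proof -
  interpret M: right_module A M by fact
  have simple: "simple_module A (M\<lparr>carrier := S\<rparr>)"
    unfolding simple_module_def submodule_sub_iff[OF assms(1,2)]
    using M.right_module_sub[OF assms(2)] assms(3) least by auto
  have "T = S" if T: "submodule T A M" "simple_module A (M\<lparr>carrier := T\<rparr>)" for T
  proof -
    have nz: "T \<noteq> {\<zero>\<^bsub>M\<^esub>}" and mn: "\<And>U. submodule U A M \<and> U \<subseteq> T \<Longrightarrow> U = {\<zero>\<^bsub>M\<^esub>} \<or> U = T"
      using T(2) unfolding simple_module_def submodule_sub_iff[OF assms(1) T(1)] by auto
    show ?thesis using mn[of S] least[OF T(1) nz] assms(2,3) by auto
  qed
  then have "{U. submodule U A M \<and> (\<forall>T. submodule T A M \<and> simple_module A (M\<lparr>carrier := T\<rparr>) \<longrightarrow> T \<subseteq> U)}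
      = {U. submodule U A M \<and> S \<subseteq> U}"
    using simple assms(2) by blast
  then show ?thesis unfolding socle_def using assms(2) by auto
qed

text \<open>
  The simple module at \<open>u\<close>; the multiplication and unit of the record are chosen so that it coincides with the simple
  module at a vertex of a bound quiver algebra.
\<close>

definition simp_mod :: "('a \<Rightarrow> nat \<Rightarrow> nat \<Rightarrow> 'k::field) \<Rightarrow> nat \<Rightarrow> ('a, 'k) module" where
  "simp_mod cf u = \<lparr>carrier = UNIV, mult = (*), one = 1, zero = 0, add = (+), smult = (\<lambda>a m. m * cf a u 0)\<rparr>"

lemma simp_mod_simps [simp]:
  "carrier (simp_mod cf u) = UNIV" "zero (simp_mod cf u) = 0" "add (simp_mod cf u) = (+)"
  "a \<odot>\<^bsub>simp_mod cf u\<^esub> m = m * cf a u 0"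
  by (simp_all add: simp_mod_def)

context nak
begin

lemma sub_order_submodule:
  assumes "q j \<le> jump c (p j)"
  shows "submodule {v \<in> carrier (im cf {j} p q). \<forall>t<s. co v j t = 0} A (im cf {j} p q)"
proof -
  interpret I: right_module A "im cf {j} p q" using assms by (intro im_right_module) simp
  show ?thesis
  proof (rule I.submoduleI)
    fix a v assume a: "a \<in> carrier A" and v: "v \<in> {v \<in> carrier (im cf {j} p q). \<forall>t<s. co v j t = 0}"
    then have "co (a \<odot>\<^bsub>im cf {j} p q\<^esub> v) j t = 0" if "t < s" for t using that by (auto intro!: sum.neutral)
    then show "a \<odot>\<^bsub>im cf {j} p q\<^esub> v \<in> {v \<in> carrier (im cf {j} p q). \<forall>t<s. co v j t = 0}"
      using I.act_closed a v by blast
  next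
    fix v w assume vw: "v \<in> {v \<in> carrier (im cf {j} p q). \<forall>t<s. co v j t = 0}" "w \<in> {v \<in> carrier (im cf {j} p q). \<forall>t<s. co v j t = 0}"
    then have "v \<oplus>\<^bsub>im cf {j} p q\<^esub> w \<in> carrier (im cf {j} p q)" by (intro I.M.a_closed) auto
    then show "v \<oplus>\<^bsub>im cf {j} p q\<^esub> w \<in> {v \<in> carrier (im cf {j} p q). \<forall>t<s. co v j t = 0}"
      using vw by simp
  qed (auto simp: im_carrier)
qed

lemma socle_interval:
  fixes M :: "('a, 'm) module"
  assumes M: "right_module A M" and pq: "p j < q j" "q j \<le> jump c (p j)"
    and \<phi>: "\<phi> \<in> rhom A (im cf {j} p q) M" "bij_betw \<phi> (carrier (im cf {j} p q)) (carrier M)"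
  shows "socle A M = \<phi> ` {v \<in> carrier (im cf {j} p q). \<forall>t<q j - 1. co v j t = 0}" (is "_ = \<phi> ` ?S")
proof (rule socle_eq_least[OF M])
  let ?I = "im cf {j} p q"
  have I: "right_module A ?I" using pq by (intro im_right_module) simp
  interpret M: right_module A M by fact
  interpret I: right_module A ?I by fact
  have S: "submodule ?S A ?I" using pq(2) by (rule sub_order_submodule)
  show SM: "submodule (\<phi> ` ?S) A M" by (rule rhom_image_submodule[OF I M \<phi>(1) S])
  have g: "gen j (q j - 1) \<in> ?S" using pq(1) by (auto intro: gen_in_im)
  have inj0: "\<phi> v = \<zero>\<^bsub>M\<^esub> \<Longrightarrow> v \<in> carrier ?I \<Longrightarrow> v = \<zero>\<^bsub>?I\<^esub>" for v
    using rhom_inj_iff[OF I M \<phi>(1)] \<phi>(2) by (simp add: bij_betw_def)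
  have gnz: "gen j (q j - 1) \<noteq> \<zero>\<^bsub>?I\<^esub>"
  proof
    assume "gen j (q j - 1) = \<zero>\<^bsub>?I\<^esub>"
    then have "co (gen j (q j - 1)) j (q j - 1) = co \<zero>\<^bsub>?I\<^esub> j (q j - 1)" by (simp only:)
    then show False by simp
  qed
  show "\<phi> ` ?S \<noteq> {\<zero>\<^bsub>M\<^esub>}"
  proof
    assume "\<phi> ` ?S = {\<zero>\<^bsub>M\<^esub>}"
    then have "\<phi> (gen j (q j - 1)) = \<zero>\<^bsub>M\<^esub>" using g by blast
    then show False using inj0 g gnz by blast
  qed
  fix V assume V: "submodule V A M" "V \<noteq> {\<zero>\<^bsub>M\<^esub>}"
  have "submodule {x \<in> carrier ?I. \<phi> x \<in> V} A ?I" by (rule rhom_vimage_submodule[OF I M \<phi>(1) V(1)])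
  then obtain s where s: "{x \<in> carrier ?I. \<phi> x \<in> V} = {v \<in> carrier ?I. \<forall>t<s. co v j t = 0}"
    using im_submodule_order[where p = p and q = q and k = j, OF pq(2)] by blast
  obtain x where x: "x \<in> V" "x \<noteq> \<zero>\<^bsub>M\<^esub>" using V M.submoduleD(2)[OF V(1)] by blast
  then have "x \<in> carrier M" using M.submoduleD(1)[OF V(1)] by blast
  then have "x \<in> \<phi> ` carrier ?I" using \<phi>(2) by (simp add: bij_betw_def)
  then obtain v where v: "x = \<phi> v" "v \<in> carrier ?I" by (rule imageE)
  then have vs: "\<forall>t<s. co v j t = 0" using x s by blast
  have "v \<noteq> \<zero>\<^bsub>?I\<^esub>" using v x rhom_zero[OF I M \<phi>(1)] by metis
  then obtain k t where kt: "co v k t \<noteq> 0" using co_eqI[of v "\<zero>\<^bsub>?I\<^esub>"] by auto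
  then have "k = j" "t < q j" using v(2) unfolding im_carrier by blast+
  then have "s \<le> q j - 1" using vs kt by (metis Suc_diff_1 bot_nat_0.not_eq_extremum less_Suc_eq_le not_le not_less0 le_trans)
  then have "?S \<subseteq> {v \<in> carrier ?I. \<forall>t<s. co v j t = 0}" by auto
  then have "?S \<subseteq> {x \<in> carrier ?I. \<phi> x \<in> V}" unfolding s .
  then show "\<phi> ` ?S \<subseteq> V" by blast
qed

lemma socle_interval_simple:
  fixes M :: "('a, 'm) module"
  assumes M: "right_module A M" and pq: "p j < q j" "q j \<le> jump c (p j)"
    and \<phi>: "\<phi> \<in> rhom A (im cf {j} p q) M" "bij_betw \<phi> (carrier (im cf {j} p q)) (carrier M)"
  shows "mod_isomorphic A (M\<lparr>carrier := socle A M\<rparr>) (simp_mod cf u) \<longleftrightarrow> u mod N = (q j - 1) mod N"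
proof -
  let ?I = "im cf {j} p q" and ?t = "q j - 1"
  let ?S = "{v \<in> carrier ?I. \<forall>t<?t. co v j t = 0}"
  have I: "right_module A ?I" using pq by (intro im_right_module) simp
  interpret M: right_module A M by fact
  interpret I: right_module A ?I by fact
  note D = rhomD[OF \<phi>(1)]
  have soc: "socle A M = \<phi> ` ?S" by (rule socle_interval[OF assms])
  have inj: "inj_on \<phi> ?S" by (rule inj_on_subset[OF bij_betw_imp_inj_on[OF \<phi>(2)]]) auto
  have Sm: "submodule ?S A ?I" using pq(2) by (rule sub_order_submodule)
  note S = I.submoduleD[OF Sm]
  have Sc: "v \<in> carrier ?I" if "v \<in> ?S" for v using that by simp
  have only: "co v k t = 0" if "v \<in> ?S" "\<not> (k = j \<and> t = ?t)" for v k t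
  proof (rule ccontr)
    assume nz: "co v k t \<noteq> 0"
    then have "k = j" "t < q j" using that(1) unfolding mem_Collect_eq im_carrier by blast+
    then have "t < ?t" using that(2) by simp
    then show False using that(1) nz \<open>k = j\<close> by simp
  qed
  show ?thesis
  proof
    assume u: "u mod N = ?t mod N"
    define f where "f m = co (inv_into ?S \<phi> m) j ?t" for m
    have f: "f (\<phi> v) = co v j ?t" if "v \<in> ?S" for v
      unfolding f_def using inv_into_f_f[OF inj that] by (simp only:)
    have "f \<in> rhom A (M\<lparr>carrier := socle A M\<rparr>) (simp_mod cf u)"
    proof (rule rhomI)
      fix x y assume "x \<in> carrier (M\<lparr>carrier := socle A M\<rparr>)" "y \<in> carrier (M\<lparr>carrier := socle A M\<rparr>)"
      then have "x \<in> \<phi> ` ?S" "y \<in> \<phi> ` ?S" by (simp_all add: soc)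
      then obtain v w where vw: "v \<in> ?S" "w \<in> ?S" "x = \<phi> v" "y = \<phi> w" by blast
      have "x \<oplus>\<^bsub>M\<^esub> y = \<phi> (v \<oplus>\<^bsub>?I\<^esub> w)" using D(2)[OF Sc[OF vw(1)] Sc[OF vw(2)]] vw by simp
      then show "f (x \<oplus>\<^bsub>M\<lparr>carrier := socle A M\<rparr>\<^esub> y) = f x \<oplus>\<^bsub>simp_mod cf u\<^esub> f y"
        using f[OF S(3)[OF vw(1,2)]] f[OF vw(1)] f[OF vw(2)] vw(3,4) by simp
    next
      fix a x assume a: "a \<in> carrier A" and "x \<in> carrier (M\<lparr>carrier := socle A M\<rparr>)"
      then have "x \<in> \<phi> ` ?S" by (simp add: soc)
      then obtain v where v: "v \<in> ?S" "x = \<phi> v" by blast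
      have "a \<odot>\<^bsub>M\<^esub> x = \<phi> (a \<odot>\<^bsub>?I\<^esub> v)" using D(3)[OF a Sc[OF v(1)]] v by simp
      then have "f (a \<odot>\<^bsub>M\<^esub> x) = co (a \<odot>\<^bsub>?I\<^esub> v) j ?t" using f[OF S(4)[OF a v(1)]] by simp
      also have "\<dots> = (\<Sum>s\<le>?t. co v j s * cf a s (?t - s))" using pq(1) by simp
      also have "\<dots> = co v j ?t * cf a ?t 0"
        using only[OF v(1)] by (subst sum_single_le[of _ ?t]) auto
      also have "\<dots> = f x * cf a u 0" using f[OF v(1)] v(2) cf_cong[OF a u, of 0] by simp
      finally show "f (a \<odot>\<^bsub>M\<lparr>carrier := socle A M\<rparr>\<^esub> x) = a \<odot>\<^bsub>simp_mod cf u\<^esub> f x" by simp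
    qed simp
    moreover have "bij_betw f (carrier (M\<lparr>carrier := socle A M\<rparr>)) (carrier (simp_mod cf u))"
      unfolding bij_betw_def
    proof
      show "inj_on f (carrier (M\<lparr>carrier := socle A M\<rparr>))"
      proof (rule inj_onI)
        fix x y assume "x \<in> carrier (M\<lparr>carrier := socle A M\<rparr>)" "y \<in> carrier (M\<lparr>carrier := socle A M\<rparr>)" and e: "f x = f y"
        then have "x \<in> \<phi> ` ?S" "y \<in> \<phi> ` ?S" by (simp_all add: soc)
        then obtain v w where vw: "v \<in> ?S" "w \<in> ?S" "x = \<phi> v" "y = \<phi> w" by blast
        have "co v k t = co w k t" for k t
          using only[OF vw(1), of k t] only[OF vw(2), of k t] f[OF vw(1)] f[OF vw(2)] e vw(3,4)
          by (cases "k = j \<and> t = ?t") auto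
        then have "v = w" by (rule co_eqI)
        then show "x = y" using vw by simp
      qed
      show "f ` carrier (M\<lparr>carrier := socle A M\<rparr>) = carrier (simp_mod cf u)"
      proof (intro equalityI subsetI)
        fix s :: 'k
        let ?v = "mk (\<lambda>k t. if k = j \<and> t = ?t then s else 0)"
        have v: "?v \<in> ?S" using pq by (auto simp: im_carrier)
        have e1: "s = f (\<phi> ?v)" unfolding f[OF v] by simp
        have cs: "carrier (M\<lparr>carrier := socle A M\<rparr>) = \<phi> ` ?S" by (simp add: soc)
        show "s \<in> f ` carrier (M\<lparr>carrier := socle A M\<rparr>)"
          unfolding cs by (rule image_eqI[where f = f, OF e1], rule imageI[OF v])
      qed simp
    qed
    ultimately show "mod_isomorphic A (M\<lparr>carrier := socle A M\<rparr>) (simp_mod cf u)"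
      unfolding mod_isomorphic_def by blast
  next
    assume "mod_isomorphic A (M\<lparr>carrier := socle A M\<rparr>) (simp_mod cf u)"
    then obtain f where f: "f \<in> rhom A (M\<lparr>carrier := socle A M\<rparr>) (simp_mod cf u)" "inj_on f (socle A M)"
      by (auto simp: mod_isomorphic_def bij_betw_def)
    note fD = rhomD[OF f(1), simplified]
    have g: "gen j ?t \<in> ?S" using pq(1) by (auto intro: gen_in_im)
    have z: "\<zero>\<^bsub>?I\<^esub> \<in> ?S" by (rule S(2))
    have in_soc: "\<phi> v \<in> socle A M" if "v \<in> ?S" for v using soc that by blast
    have gnz: "\<phi> (gen j ?t) \<noteq> \<phi> \<zero>\<^bsub>?I\<^esub>"
    proof
      assume "\<phi> (gen j ?t) = \<phi> \<zero>\<^bsub>?I\<^esub>"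
      then have "gen j ?t = \<zero>\<^bsub>?I\<^esub>" by (rule inj_onD[OF inj _ g z])
      then have "co (gen j ?t) j ?t = co \<zero>\<^bsub>?I\<^esub> j ?t" by (simp only:)
      then show False by simp
    qed
    have fz: "f (\<phi> \<zero>\<^bsub>?I\<^esub>) = 0"
    proof -
      have e: "\<phi> \<zero>\<^bsub>?I\<^esub> = \<zero>\<^bsub>M\<^esub>" by (rule rhom_zero[OF I M \<phi>(1)])
      have "f (\<zero>\<^bsub>M\<^esub> \<oplus>\<^bsub>M\<^esub> \<zero>\<^bsub>M\<^esub>) = f \<zero>\<^bsub>M\<^esub> + f \<zero>\<^bsub>M\<^esub>" using fD(2) in_soc[OF z] unfolding e by blast
      then have "f \<zero>\<^bsub>M\<^esub> + 0 = f \<zero>\<^bsub>M\<^esub> + f \<zero>\<^bsub>M\<^esub>" by simp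
      then have "0 = f \<zero>\<^bsub>M\<^esub>" by (rule add_left_imp_eq)
      then show ?thesis unfolding e by simp
    qed
    have "homogeneous ?I ?t (gen j ?t)" using pq by (intro gen_homogeneous) auto
    then have "xx ?t 0 \<odot>\<^bsub>M\<^esub> \<phi> (gen j ?t) = \<phi> (gen j ?t)"
      using D(3)[OF xx_closed Sc[OF g], of ?t 0] by simp
    then have "f (\<phi> (gen j ?t)) = f (\<phi> (gen j ?t)) * cf (xx ?t 0) u 0"
      using fD(3)[OF xx_closed in_soc[OF g], of ?t 0] by simp
    moreover have "f (\<phi> (gen j ?t)) \<noteq> 0"
      using gnz f(2) in_soc[OF g] in_soc[OF z] fz by (metis inj_onD)
    ultimately show "u mod N = ?t mod N" by (auto simp: cf_xx split: if_splits)
  qed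
qed

lemma projective_interval_full:
  fixes P :: "('a, 'm) module"
  assumes "projective A P" and pq: "p j < q j" "q j \<le> jump c (p j)"
    and \<phi>: "\<phi> \<in> rhom A (im cf {j} p q) P" "bij_betw \<phi> (carrier (im cf {j} p q)) (carrier P)"
  shows "q j = jump c (p j)"
proof (rule ccontr)
  assume "q j \<noteq> jump c (p j)"
  then have lt: "q j < jump c (p j)" using pq by simp
  let ?I = "im cf {j} p q" and ?Q = "im cf {j} p (\<lambda>k. jump c (p k))"
  have P: "right_module A P" using assms(1) by (simp add: projective_def)
  have I: "right_module A ?I" using pq by (intro im_right_module) simp
  have Q: "right_module A ?Q" by (intro im_right_module) simp
  have fg: "fg_module A ?I" "fg_module A ?Q" using pq(2) by (intro im_fg; simp)+
  let ?r = "im_res {j} p q :: (nat \<Rightarrow> 'k) \<Rightarrow> _"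
  have r: "?r \<in> rhom A ?Q ?I" by (rule im_res_hom) (use pq in auto)
  have rsurj: "?r ` carrier ?Q = carrier ?I"
  proof (intro equalityI subsetI)
    fix v assume v: "v \<in> carrier ?I"
    then have "v \<in> carrier ?Q" by (rule im_incl) (use lt in simp)
    moreover have "?r v = v" using v by (rule im_res_id) simp
    ultimately show "v \<in> ?r ` carrier ?Q" by (intro image_eqI[of v ?r v]) (simp_all only:)
  qed (use rhomD(1)[OF r] in auto)
  obtain h where h: "h \<in> rhom A P ?Q" "\<forall>x\<in>carrier P. ?r (h x) = inv_into (carrier ?I) \<phi> x"
    using assms(1) fg r rsurj rhom_inv[OF I P \<phi>] unfolding projective_def by blast
  have g: "gen j (p j) \<in> carrier ?I" using pq by (intro gen_in_im) auto
  have gP: "\<phi> (gen j (p j)) \<in> carrier P" using rhomD(1)[OF \<phi>(1) g] .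
  define w where "w = h (\<phi> (gen j (p j)))"
  have w1: "co w j (p j) = 1"
  proof -
    have "inv_into (carrier ?I) \<phi> (\<phi> (gen j (p j))) = gen j (p j)"
      using \<phi>(2) g by (simp add: bij_betw_def inv_into_f_f)
    then have "?r w = gen j (p j)" using h(2) gP unfolding w_def by metis
    then have "co (?r w) j (p j) = co (gen j (p j)) j (p j)" by (simp only:)
    then show ?thesis using pq by (simp add: im_res_def)
  qed
  let ?x = "xx (p j) (q j - p j)"
  have "?x \<odot>\<^bsub>?I\<^esub> gen j (p j) = \<zero>\<^bsub>?I\<^esub>"
    by (intro co_eqI) (auto simp del: im_simps(3) simp: act_gen cf_xx)
  then have "?x \<odot>\<^bsub>?Q\<^esub> w = \<zero>\<^bsub>?Q\<^esub>"
    using rhomD(3)[OF \<phi>(1) xx_closed g, of "p j" "q j - p j"] rhomD(3)[OF h(1) xx_closed gP, of "p j" "q j - p j"]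
      rhom_zero[OF I P \<phi>(1)] rhom_zero[OF P Q h(1)] by (simp add: w_def)
  then have "co (?x \<odot>\<^bsub>?Q\<^esub> w) j (q j) = 0" by simp
  moreover have "co (?x \<odot>\<^bsub>?Q\<^esub> w) j (q j) = (\<Sum>s\<le>q j. co w j s * cf ?x s (q j - s))" using lt by simp
  moreover have "(\<Sum>s\<le>q j. co w j s * cf ?x s (q j - s)) = 1"
  proof -
    have "q j - p j < c (p j)" using lt pq by (simp add: jump_def)
    moreover have "co w j s * cf ?x s (q j - s) = 0" if "s \<le> q j" "s \<noteq> p j" for s
      using that pq by (auto simp: cf_xx)
    ultimately show ?thesis using pq w1 by (subst sum_single_le[of _ "p j"]) (auto simp: cf_xx)
  qed
  ultimately show False by simp
qed

lemma interval_indecomposable: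
  assumes "lo < hi" "hi \<le> jump c lo"
  shows "indecomposable A (interval lo hi)"
proof -
  let ?I = "interval lo hi"
  have u: "uniserial A ?I" using im_uniserial[where q = "\<lambda>_. hi" and p = "\<lambda>_. lo" and k = 0] assms by simp
  have "co (gen 0 lo) 0 lo \<noteq> co \<zero>\<^bsub>?I\<^esub> 0 lo" by simp
  moreover have "gen 0 lo \<in> carrier ?I" using assms by (intro gen_in_im) auto
  ultimately have "carrier ?I \<noteq> {\<zero>\<^bsub>?I\<^esub>}" by (metis singletonD)
  then show ?thesis using u unfolding indecomposable_def uniserial_def by blast
qed

text \<open>
  An indecomposable projective is an interval module, and it has full length because its projective
  cover splits. Its socle sits at the last position.
\<close>

lemma socles_of_projectives:
  "{u. u < N \<and> (\<exists>P :: ('a, nat \<Rightarrow> 'k) module. fg_module A P \<and> projective A P \<and> indecomposable A P \<and>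
      mod_isomorphic A (P\<lparr>carrier := socle A P\<rparr>) (simp_mod cf u))} = {(jump c i - 1) mod N | i. i < N}"
proof (intro equalityI subsetI)
  fix u assume "u \<in> {u. u < N \<and> (\<exists>P :: ('a, nat \<Rightarrow> 'k) module. fg_module A P \<and> projective A P \<and> indecomposable A P \<and>
      mod_isomorphic A (P\<lparr>carrier := socle A P\<rparr>) (simp_mod cf u))}"
  then obtain P :: "('a, nat \<Rightarrow> 'k) module" where P: "u < N" "fg_module A P" "projective A P" "indecomposable A P"
      "mod_isomorphic A (P\<lparr>carrier := socle A P\<rparr>) (simp_mod cf u)" by blast
  obtain j p q \<phi> where D: "p j < q j" "q j \<le> jump c (p j)" "\<phi> \<in> rhom A (im cf {j} p q) P"
      "bij_betw \<phi> (carrier (im cf {j} p q)) (carrier P)"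
    using indecomposable_interval[OF P(2,4)] by blast
  have "q j = jump c (p j)" by (rule projective_interval_full[OF P(3) D])
  moreover have "u mod N = (q j - 1) mod N"
    using socle_interval_simple[OF _ D] P(2,5) by (simp add: fg_module_def)
  ultimately have u: "u = (jump c (p j) - 1) mod N" using P(1) by simp
  have "jump c (p j) - 1 = jump c (p j mod N) - 1 + (p j div N) * N"
    using jump_add_mult[of "p j mod N" "p j div N"] jump_gt[of "p j mod N"] by simp
  then have "u = (jump c (p j mod N) - 1) mod N" unfolding u by simp
  then show "u \<in> {(jump c i - 1) mod N | i. i < N}" using N_pos by auto
next
  fix u assume "u \<in> {(jump c i - 1) mod N | i. i < N}"
  then obtain i where i: "i < N" "u = (jump c i - 1) mod N" by blast
  let ?P = "interval i (jump c i)"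
  have Pm: "right_module A ?P" by (intro im_right_module) simp
  have "fg_module A ?P" by (intro im_fg) auto
  moreover have "projective A ?P" by (rule im_projective) auto
  moreover have "indecomposable A ?P" using jump_gt by (intro interval_indecomposable) auto
  moreover have "mod_isomorphic A (?P\<lparr>carrier := socle A ?P\<rparr>) (simp_mod cf u)"
  proof -
    have "(\<lambda>v. v) \<in> rhom A ?P ?P" by (rule rhomI) auto
    then show ?thesis
      using socle_interval_simple[OF Pm, where j = 0 and p = "\<lambda>_. i" and q = "\<lambda>_. jump c i" and \<phi> = "\<lambda>v. v" and u = u] jump_gt[of i] i
      by (simp add: bij_betw_def inj_on_def)
  qed
  ultimately show "u \<in> {u. u < N \<and> (\<exists>P :: ('a, nat \<Rightarrow> 'k) module. fg_module A P \<and> projective A P \<and> indecomposable A P \<and>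
      mod_isomorphic A (P\<lparr>carrier := socle A P\<rparr>) (simp_mod cf u))}"
    using i N_pos by (intro CollectI conjI exI[of _ ?P]) auto
qed

lemma shifted_socles: "(\<lambda>j. Suc j mod N) ` {(jump c i - 1) mod N | i. i < N} = targets"
proof -
  have e: "Suc ((jump c i - 1) mod N) mod N = jump c i mod N" for i
    using jump_gt[of i] by (simp add: mod_Suc_eq)
  have "{(jump c i - 1) mod N | i. i < N} = (\<lambda>i. (jump c i - 1) mod N) ` {..<N}" by auto
  then show ?thesis by (simp only: targets_def image_image e)
qed

lemma interval_projective_cover: "projective_cover A (interval i (jump c i)) (simp_mod cf i)"
  unfolding projective_cover_def
proof (intro conjI bexI)
  let ?P = "interval i (jump c i)"
  let ?f = "\<lambda>v :: nat \<Rightarrow> 'k. co v 0 i"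
  interpret P: right_module A ?P by (intro im_right_module) simp
  show "fg_module A ?P" by (intro im_fg) auto
  show "projective A ?P" by (rule im_projective) auto
  show "?f \<in> rhom A ?P (simp_mod cf i)"
  proof (rule rhomI)
    fix a v assume "a \<in> carrier A" and v: "v \<in> carrier ?P"
    have "co v 0 s = 0" if "s < i" for s using that v unfolding im_carrier by (meson leD)
    then have "(\<Sum>s\<le>i. co v 0 s * cf a s (i - s)) = co v 0 i * cf a i 0"
      by (subst sum_single_le[of _ i]) auto
    then show "?f (a \<odot>\<^bsub>?P\<^esub> v) = a \<odot>\<^bsub>simp_mod cf i\<^esub> ?f v" using jump_gt[of i] by simp
  qed auto
  show "?f ` carrier ?P = carrier (simp_mod cf i)"
  proof (intro equalityI subsetI)
    fix s :: 'k
    have "mk (\<lambda>k t. if k = 0 \<and> t = i then s else 0) \<in> carrier ?P" using jump_gt[of i] by (auto simp: im_carrier)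
    then show "s \<in> ?f ` carrier ?P" by force
  qed simp
  show "\<forall>U. submodule U A ?P \<and> U <+>\<^bsub>?P\<^esub> a_kernel ?P (simp_mod cf i) ?f = carrier ?P \<longrightarrow> U = carrier ?P"
  proof (intro allI impI; elim conjE)
    fix U assume U: "submodule U A ?P" "U <+>\<^bsub>?P\<^esub> a_kernel ?P (simp_mod cf i) ?f = carrier ?P"
    have "gen 0 i \<in> carrier ?P" using jump_gt by (intro gen_in_im) auto
    then obtain u k where uk: "u \<in> U" "k \<in> a_kernel ?P (simp_mod cf i) ?f" "gen 0 i = u \<oplus>\<^bsub>?P\<^esub> k"
      unfolding U(2)[symmetric] set_add_iff by blast
    have "co (gen 0 i) 0 i = co u 0 i + co k 0 i" unfolding uk(3) by simp
    then have u1: "co u 0 i \<noteq> 0" using uk(2) by (simp add: a_kernel_iff)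
    have low: "co v 0 t = 0" if "v \<in> carrier ?P" "t < i" for v t
      using that unfolding im_carrier by (meson leD)
    have uc: "u \<in> carrier ?P" using P.submoduleD(1)[OF U(1)] uk(1) by blast
    have "w \<in> U" if "w \<in> carrier ?P" for w
      by (rule im_order_closed[OF _ U(1) uk(1) u1]) (use low uc that in auto)
    then show "U = carrier ?P" using P.submoduleD(1)[OF U(1)] by blast
  qed
qed

end

section \<open>Endomorphism algebras of sums of projectives\<close>

lemma direct_product_simps [simp]:
  "carrier (direct_product J P) = (\<Pi>\<^sub>E i\<in>J. carrier (P i))"
  "add (direct_product J P) = (\<lambda>f g. \<lambda>i\<in>J. f i \<oplus>\<^bsub>P i\<^esub> g i)"
  "zero (direct_product J P) = (\<lambda>i\<in>J. \<zero>\<^bsub>P i\<^esub>)"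
  "mult (direct_product J P) = (\<lambda>f g. \<lambda>i\<in>J. f i \<otimes>\<^bsub>P i\<^esub> g i)"
  "one (direct_product J P) = (\<lambda>i\<in>J. \<one>\<^bsub>P i\<^esub>)"
  "s \<odot>\<^bsub>direct_product J P\<^esub> f = (\<lambda>i\<in>J. s \<odot>\<^bsub>P i\<^esub> f i)"
  by (simp_all add: direct_product_def)

lemma direct_product_right_module:
  assumes "ring A" "\<And>j. j \<in> J \<Longrightarrow> right_module A (P j)"
  shows "right_module A (direct_product J P)"
proof (intro right_module.intro right_module_axioms.intro assms(1))
  let ?M = "direct_product J P"
  interpret A: ring A by fact
  note P = assms(2)
  have ab: "abelian_group (P j)" if "j \<in> J" for j using P[OF that] by (simp add: right_module_def)
  note gr = abelian_groupE[OF ab]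
  show "abelian_group ?M"
  proof (rule abelian_groupI)
    fix x assume x: "x \<in> carrier ?M"
    have "\<forall>j\<in>J. \<exists>y\<in>carrier (P j). y \<oplus>\<^bsub>P j\<^esub> x j = \<zero>\<^bsub>P j\<^esub>" using gr(6) x by auto
    then obtain y where "\<forall>j\<in>J. y j \<in> carrier (P j) \<and> y j \<oplus>\<^bsub>P j\<^esub> x j = \<zero>\<^bsub>P j\<^esub>" by metis
    then show "\<exists>y\<in>carrier ?M. y \<oplus>\<^bsub>?M\<^esub> x = \<zero>\<^bsub>?M\<^esub>"
      by (intro bexI[of _ "restrict y J"]) (auto intro!: restrict_ext)
  next
    fix x y z assume "x \<in> carrier ?M" "y \<in> carrier ?M" "z \<in> carrier ?M"
    then show "x \<oplus>\<^bsub>?M\<^esub> y \<oplus>\<^bsub>?M\<^esub> z = x \<oplus>\<^bsub>?M\<^esub> (y \<oplus>\<^bsub>?M\<^esub> z)"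
      by (auto intro!: restrict_ext gr(3) intro: PiE_mem)
  next
    fix x y assume "x \<in> carrier ?M" "y \<in> carrier ?M"
    then show "x \<oplus>\<^bsub>?M\<^esub> y = y \<oplus>\<^bsub>?M\<^esub> x" "x \<oplus>\<^bsub>?M\<^esub> y \<in> carrier ?M"
      by (auto intro!: restrict_ext gr(1,4) intro: PiE_mem)
  next
    show "\<zero>\<^bsub>?M\<^esub> \<in> carrier ?M" using gr(2) by auto
    fix x assume x: "x \<in> carrier ?M"
    show "\<zero>\<^bsub>?M\<^esub> \<oplus>\<^bsub>?M\<^esub> x = x"
      by (rule PiE_ext[of _ J "\<lambda>i. carrier (P i)"]) (use x in \<open>auto intro!: gr(1,2,5) intro: PiE_mem\<close>)
  qed
  {
    fix a m assume "a \<in> carrier A" "m \<in> carrier ?M"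
    then show "a \<odot>\<^bsub>?M\<^esub> m \<in> carrier ?M" by (auto intro!: right_module.act_closed[OF P] intro: PiE_mem)
  }
  {
    fix a b m assume "a \<in> carrier A" "b \<in> carrier A" "m \<in> carrier ?M"
    then show "(a \<oplus>\<^bsub>A\<^esub> b) \<odot>\<^bsub>?M\<^esub> m = a \<odot>\<^bsub>?M\<^esub> m \<oplus>\<^bsub>?M\<^esub> b \<odot>\<^bsub>?M\<^esub> m"
      by (auto intro!: restrict_ext right_module.act_add_left[OF P] intro: PiE_mem)
  }
  {
    fix a m n assume "a \<in> carrier A" "m \<in> carrier ?M" "n \<in> carrier ?M"
    then show "a \<odot>\<^bsub>?M\<^esub> (m \<oplus>\<^bsub>?M\<^esub> n) = a \<odot>\<^bsub>?M\<^esub> m \<oplus>\<^bsub>?M\<^esub> a \<odot>\<^bsub>?M\<^esub> n"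
      by (auto intro!: restrict_ext right_module.act_add_right[OF P] intro: PiE_mem)
  }
  {
    fix a b m assume "a \<in> carrier A" "b \<in> carrier A" "m \<in> carrier ?M"
    then show "(a \<otimes>\<^bsub>A\<^esub> b) \<odot>\<^bsub>?M\<^esub> m = b \<odot>\<^bsub>?M\<^esub> (a \<odot>\<^bsub>?M\<^esub> m)"
      by (auto intro!: restrict_ext right_module.act_mult[OF P] intro: PiE_mem)
  }
  {
    fix m assume m: "m \<in> carrier ?M"
    show "\<one>\<^bsub>A\<^esub> \<odot>\<^bsub>?M\<^esub> m = m"
      by (rule PiE_ext[of _ J "\<lambda>i. carrier (P i)"]) (use m in \<open>auto intro!: right_module.act_one[OF P] right_module.act_closed[OF P] intro: PiE_mem\<close>)
  }
qed

text \<open>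
  The axioms are inherited along an injective map that preserves the operations. The unit need not be
  mapped to the unit, since the main example embeds the algebra \<open>e A e\<close> into \<open>A\<close>.
\<close>

lemma k_algebra_transport:
  fixes B :: "('k::field, 'b) module" and K :: "('k, 'a) module"
  assumes "k_algebra K" and h: "\<And>x. x \<in> carrier B \<Longrightarrow> h x \<in> carrier K" "inj_on h (carrier B)"
    and zero: "\<zero>\<^bsub>B\<^esub> \<in> carrier B" "h \<zero>\<^bsub>B\<^esub> = \<zero>\<^bsub>K\<^esub>"
    and one: "\<one>\<^bsub>B\<^esub> \<in> carrier B"
      "\<And>x. x \<in> carrier B \<Longrightarrow> h \<one>\<^bsub>B\<^esub> \<otimes>\<^bsub>K\<^esub> h x = h x" "\<And>x. x \<in> carrier B \<Longrightarrow> h x \<otimes>\<^bsub>K\<^esub> h \<one>\<^bsub>B\<^esub> = h x"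
    and add: "\<And>x y. x \<in> carrier B \<Longrightarrow> y \<in> carrier B \<Longrightarrow> x \<oplus>\<^bsub>B\<^esub> y \<in> carrier B \<and> h (x \<oplus>\<^bsub>B\<^esub> y) = h x \<oplus>\<^bsub>K\<^esub> h y"
    and mult: "\<And>x y. x \<in> carrier B \<Longrightarrow> y \<in> carrier B \<Longrightarrow> x \<otimes>\<^bsub>B\<^esub> y \<in> carrier B \<and> h (x \<otimes>\<^bsub>B\<^esub> y) = h x \<otimes>\<^bsub>K\<^esub> h y"
    and scal: "\<And>s x. x \<in> carrier B \<Longrightarrow> s \<odot>\<^bsub>B\<^esub> x \<in> carrier B \<and> h (s \<odot>\<^bsub>B\<^esub> x) = s \<odot>\<^bsub>K\<^esub> h x"
    and neg: "\<And>x. x \<in> carrier B \<Longrightarrow> \<exists>y\<in>carrier B. h y = \<ominus>\<^bsub>K\<^esub> h x"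
  shows "k_algebra B"
proof -
  interpret K: k_algebra K by fact
  note eqI = inj_onD[OF h(2)]
  have "abelian_group B"
  proof (rule abelian_groupI)
    fix x assume x: "x \<in> carrier B"
    then obtain y where "y \<in> carrier B" "h y = \<ominus>\<^bsub>K\<^esub> h x" using neg by blast
    then show "\<exists>y\<in>carrier B. y \<oplus>\<^bsub>B\<^esub> x = \<zero>\<^bsub>B\<^esub>"
      using x add zero h(1) by (intro bexI[of _ y] eqI) (auto simp: K.l_neg)
  next
    fix x y z assume "x \<in> carrier B" "y \<in> carrier B" "z \<in> carrier B"
    then show "x \<oplus>\<^bsub>B\<^esub> y \<oplus>\<^bsub>B\<^esub> z = x \<oplus>\<^bsub>B\<^esub> (y \<oplus>\<^bsub>B\<^esub> z)" using add h(1) by (intro eqI) (auto simp: K.a_assoc)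
  next
    fix x y assume "x \<in> carrier B" "y \<in> carrier B"
    then show "x \<oplus>\<^bsub>B\<^esub> y = y \<oplus>\<^bsub>B\<^esub> x" "x \<oplus>\<^bsub>B\<^esub> y \<in> carrier B" using add h(1) by (auto intro!: eqI simp: K.a_comm)
  next
    fix x assume "x \<in> carrier B"
    then show "\<zero>\<^bsub>B\<^esub> \<oplus>\<^bsub>B\<^esub> x = x" using add zero h(1) by (intro eqI) auto
  qed (rule zero(1))
  moreover have "monoid B"
    by (rule monoidI) (use mult one h(1) in \<open>auto intro!: eqI simp: K.m_assoc\<close>)
  ultimately have "ring B"
    by (rule ringI) (use mult add h(1) in \<open>auto intro!: eqI simp: K.l_distr K.r_distr\<close>)
  then show ?thesis
    by (intro k_algebra.intro k_algebra_axioms.intro)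
      (use scal add mult h(1) in \<open>auto intro!: eqI simp: K.scal_add_left K.scal_add_right K.scal_scal K.scal_one
        K.scal_mult_left[symmetric] K.scal_mult_right[symmetric] K.scal_closed\<close>)
qed

lemma end_algebra_simps [simp]:
  "carrier (end_algebra A M) = rhom A M M \<inter> extensional (carrier M)"
  "mult (end_algebra A M) = (\<lambda>f g. compose (carrier M) f g)"
  "one (end_algebra A M) = (\<lambda>m \<in> carrier M. m)"
  "zero (end_algebra A M) = (\<lambda>m \<in> carrier M. \<zero>\<^bsub>M\<^esub>)"
  "add (end_algebra A M) = (\<lambda>f g. \<lambda>m \<in> carrier M. f m \<oplus>\<^bsub>M\<^esub> g m)"
  "s \<odot>\<^bsub>end_algebra A M\<^esub> f = (\<lambda>m \<in> carrier M. (s \<odot>\<^bsub>A\<^esub> \<one>\<^bsub>A\<^esub>) \<odot>\<^bsub>M\<^esub> f m)"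
  by (simp_all add: end_algebra_def)

lemma rhom_restrict: "right_module A M \<Longrightarrow> f \<in> rhom A M N \<Longrightarrow> restrict f (carrier M) \<in> rhom A M N"
proof -
  assume "right_module A M" and f: "f \<in> rhom A M N"
  then interpret M: right_module A M by simp
  note d = rhomD[OF f]
  show ?thesis by (rule rhomI) (simp_all add: d M.act_closed)
qed

context nak
begin

text \<open>
  With \<open>e\<close> the sum of the idempotents at the vertices in \<open>targets\<close>, the module
  \<open>\<Oplus> P(j)\<close> is \<open>e A\<close>, an endomorphism is left multiplication by its value at \<open>e\<close>, and the
  endomorphism algebra is therefore the corner \<open>e A e\<close>.
\<close>

abbreviation target_sum :: "('a, nat \<Rightarrow> nat \<Rightarrow> 'k) module" where
  "target_sum \<equiv> direct_product targets (\<lambda>k. interval k (jump c k))"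

definition corner_gen :: "nat \<Rightarrow> nat \<Rightarrow> 'k" where
  "corner_gen = (\<lambda>k\<in>targets. gen 0 k)"

definition to_corner :: "(nat \<Rightarrow> nat \<Rightarrow> 'k) \<Rightarrow> 'a" where
  "to_corner m = el (\<lambda>i l. if i mod N \<in> targets \<and> l < c i then co (m (i mod N)) 0 (i mod N + l) else 0)"

lemma to_corner_closed [simp]: "to_corner m \<in> carrier A"
  and cf_to_corner: "cf (to_corner m) i l = (if i mod N \<in> targets \<and> l < c i then co (m (i mod N)) 0 (i mod N + l) else 0)"
proof -
  have "(\<lambda>i l. if i mod N \<in> targets \<and> l < c i then co (m (i mod N)) 0 (i mod N + l) else 0) \<in> coords N c"
    by (auto simp: coords_def c_add_N)
  then show "to_corner m \<in> carrier A"
    "cf (to_corner m) i l = (if i mod N \<in> targets \<and> l < c i then co (m (i mod N)) 0 (i mod N + l) else 0)"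
    by (simp_all add: to_corner_def el_closed cf_el)
qed

lemma target_sum_module: "right_module A target_sum"
  by (rule direct_product_right_module[OF ring_axioms]) (intro im_right_module, simp)

lemma target_sum_row: "m \<in> carrier target_sum \<Longrightarrow> k \<in> targets \<Longrightarrow> m k \<in> carrier (interval k (jump c k))"
  using PiE_mem[of m targets "\<lambda>k. carrier (interval k (jump c k))" k] by simp

lemma corner_gen_closed: "corner_gen \<in> carrier target_sum"
  using jump_gt by (auto simp: corner_gen_def intro!: gen_in_im)

lemma to_corner_hom: "to_corner \<in> rhom A target_sum (regular_module A)"
proof (rule rhomI)
  fix m n assume "m \<in> carrier target_sum" "n \<in> carrier target_sum"
  show "to_corner (m \<oplus>\<^bsub>target_sum\<^esub> n) = to_corner m \<oplus>\<^bsub>regular_module A\<^esub> to_corner n"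
    by (simp, intro cf_eqI) (simp_all add: cf_to_corner cf_add)
next
  fix a m assume a: "a \<in> carrier A" and m: "m \<in> carrier target_sum"
  have "to_corner (a \<odot>\<^bsub>target_sum\<^esub> m) = to_corner m \<otimes> a"
  proof (rule cf_eqI)
    fix i l assume il: "i < N" "l < c i"
    show "cf (to_corner (a \<odot>\<^bsub>target_sum\<^esub> m)) i l = cf (to_corner m \<otimes> a) i l"
    proof (cases "i \<in> targets")
      case True
      let ?v = "m i"
      have "co ?v 0 s = 0" if "s < i" for s
        using target_sum_row[OF m True] that unfolding im_carrier by (meson leD)
      then have "(\<Sum>s\<le>i + l. co ?v 0 s * cf a s (i + l - s)) = (\<Sum>m\<le>l. co ?v 0 (i + m) * cf a (i + m) (l - m))"
        by (subst sum_shift) auto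
      also have "\<dots> = (\<Sum>k\<le>l. cf (to_corner m) i k * cf a (i + k) (l - k))"
        using il True by (intro sum.cong) (auto simp: cf_to_corner)
      finally show ?thesis using il True a by (simp add: cf_to_corner cf_mult jump_def)
    next
      case False
      then show ?thesis using il a by (simp add: cf_to_corner cf_mult)
    qed
  qed (use a in auto)
  then show "to_corner (a \<odot>\<^bsub>target_sum\<^esub> m) = a \<odot>\<^bsub>regular_module A\<^esub> to_corner m" by simp
qed simp

lemma to_corner_add: "m \<in> carrier target_sum \<Longrightarrow> n \<in> carrier target_sum \<Longrightarrow>
    to_corner (m \<oplus>\<^bsub>target_sum\<^esub> n) = to_corner m \<oplus> to_corner n"
  by (rule rhomD(2)[OF to_corner_hom, unfolded regular_simps])

lemma to_corner_act: "a \<in> carrier A \<Longrightarrow> m \<in> carrier target_sum \<Longrightarrow>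
    to_corner (a \<odot>\<^bsub>target_sum\<^esub> m) = to_corner m \<otimes> a"
  by (rule rhomD(3)[OF to_corner_hom, unfolded regular_simps])

lemma to_corner_inj:
  assumes "m \<in> carrier target_sum" "n \<in> carrier target_sum" "to_corner m = to_corner n"
  shows "m = n"
proof (rule PiE_ext[of _ targets "\<lambda>k. carrier (interval k (jump c k))"])
  fix k assume k: "k \<in> targets"
  show "m k = n k"
  proof (rule co_eqI)
    fix j t
    note rows = target_sum_row[OF assms(1) k] target_sum_row[OF assms(2) k]
    show "co (m k) j t = co (n k) j t"
    proof (cases "j = 0 \<and> k \<le> t \<and> t < jump c k")
      case True
      then obtain l where "t = k + l" using le_Suc_ex by blast
      with True have l: "t = k + l" "l < c k" by (auto simp: jump_def)
      have "k < N" using k targets_bound by auto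
      then show ?thesis using cf_to_corner[of m k l] cf_to_corner[of n k l] assms(3) k l True by simp
    next
      case False
      then have "co (m k) j t = 0" "co (n k) j t = 0" using rows unfolding im_carrier by blast+
      then show ?thesis by simp
    qed
  qed
qed (use assms in simp_all)

abbreviation corner_unit :: 'a where "corner_unit \<equiv> to_corner corner_gen"

lemma cf_corner_unit: "cf corner_unit i l = (if i mod N \<in> targets \<and> l = 0 then 1 else 0)"
  using c_pos[of i] by (auto simp: cf_to_corner corner_gen_def)

lemma cf_unit_left: "x \<in> carrier A \<Longrightarrow> cf (corner_unit \<otimes> x) i l = (if i mod N \<in> targets then cf x i l else 0)"
proof -
  assume x: "x \<in> carrier A"
  have "(\<Sum>m\<le>l. cf corner_unit i m * cf x (i + m) (l - m)) = cf corner_unit i 0 * cf x i l"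
    by (subst sum_single_le[of _ 0]) (auto simp: cf_corner_unit)
  then show ?thesis using x cf_trunc[OF x, of i l] by (auto simp: cf_mult cf_corner_unit)
qed

lemma cf_unit_right: "x \<in> carrier A \<Longrightarrow> cf (x \<otimes> corner_unit) i l = (if (i + l) mod N \<in> targets then cf x i l else 0)"
proof -
  assume x: "x \<in> carrier A"
  have "(\<Sum>m\<le>l. cf x i m * cf corner_unit (i + m) (l - m)) = cf x i l * cf corner_unit (i + l) 0"
    by (subst sum_single_le[of _ l]) (auto simp: cf_corner_unit)
  then show ?thesis using x cf_trunc[OF x, of i l] by (auto simp: cf_mult cf_corner_unit)
qed

lemma unit_to_corner: "corner_unit \<otimes> to_corner m = to_corner m"
  by (rule cf_eqI) (simp_all add: cf_unit_left cf_to_corner)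

lemma to_corner_surj:
  assumes x: "x \<in> carrier A" "corner_unit \<otimes> x = x"
  shows "\<exists>m\<in>carrier target_sum. to_corner m = x"
proof
  let ?m = "\<lambda>k\<in>targets. mk (\<lambda>j t. if j = 0 \<and> k \<le> t \<and> t < jump c k then cf x k (t - k) else 0)"
  show "?m \<in> carrier target_sum" by (auto simp: im_carrier)
  show "to_corner ?m = x"
  proof (rule cf_eqI)
    fix i l assume il: "i < N" "l < c i"
    show "cf (to_corner ?m) i l = cf x i l"
    proof (cases "i \<in> targets")
      case True
      then show ?thesis using il by (simp add: cf_to_corner jump_def)
    next
      case False
      then have "cf x i l = 0" using cf_unit_left[OF x(1), of i l] il unfolding x(2) by simp
      then show ?thesis using False il by (simp add: cf_to_corner)
    qed
  qed (use x in auto)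
qed

lemma target_sum_cyclic: "m \<in> carrier target_sum \<Longrightarrow> to_corner m \<odot>\<^bsub>target_sum\<^esub> corner_gen = m"
proof (rule to_corner_inj)
  interpret M: right_module A target_sum by (rule target_sum_module)
  show "to_corner m \<odot>\<^bsub>target_sum\<^esub> corner_gen \<in> carrier target_sum"
    by (rule M.act_closed[OF to_corner_closed corner_gen_closed])
  show "to_corner (to_corner m \<odot>\<^bsub>target_sum\<^esub> corner_gen) = to_corner m"
    unfolding to_corner_act[OF to_corner_closed corner_gen_closed] by (rule unit_to_corner)
qed

abbreviation target_end :: "('k, (nat \<Rightarrow> nat \<Rightarrow> 'k) \<Rightarrow> nat \<Rightarrow> nat \<Rightarrow> 'k) module" where
  "target_end \<equiv> end_algebra A target_sum"

definition end_elem :: "((nat \<Rightarrow> nat \<Rightarrow> 'k) \<Rightarrow> nat \<Rightarrow> nat \<Rightarrow> 'k) \<Rightarrow> 'a" where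
  "end_elem \<phi> = to_corner (\<phi> corner_gen)"

lemma end_elem_closed [simp]: "end_elem \<phi> \<in> carrier A" by (simp add: end_elem_def)

lemma end_apply:
  assumes "\<phi> \<in> rhom A target_sum target_sum" "m \<in> carrier target_sum"
  shows "to_corner (\<phi> m) = end_elem \<phi> \<otimes> to_corner m"
proof -
  have "\<phi> m = \<phi> (to_corner m \<odot>\<^bsub>target_sum\<^esub> corner_gen)" by (simp only: target_sum_cyclic[OF assms(2)])
  also have "\<dots> = to_corner m \<odot>\<^bsub>target_sum\<^esub> \<phi> corner_gen"
    by (rule rhomD(3)[OF assms(1) to_corner_closed corner_gen_closed])
  finally have e: "\<phi> m = to_corner m \<odot>\<^bsub>target_sum\<^esub> \<phi> corner_gen" .
  show ?thesis
    unfolding e end_elem_def by (rule to_corner_act[OF to_corner_closed rhomD(1)[OF assms(1) corner_gen_closed]])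
qed

lemma end_elem_unit:
  assumes "\<phi> \<in> rhom A target_sum target_sum"
  shows "end_elem \<phi> \<otimes> corner_unit = end_elem \<phi>" "corner_unit \<otimes> end_elem \<phi> = end_elem \<phi>"
  using end_apply[OF assms corner_gen_closed] unit_to_corner by (simp_all only: end_elem_def)

lemma end_elem_inj:
  assumes "\<phi> \<in> carrier target_end" "\<psi> \<in> carrier target_end" "end_elem \<phi> = end_elem \<psi>"
  shows "\<phi> = \<psi>"
proof (rule extensionalityI[of _ "carrier target_sum"])
  have h: "\<phi> \<in> rhom A target_sum target_sum" "\<psi> \<in> rhom A target_sum target_sum"
    using assms by (simp_all only: end_algebra_simps IntD1)
  show "\<phi> \<in> extensional (carrier target_sum)" "\<psi> \<in> extensional (carrier target_sum)"
    using assms by (simp_all only: end_algebra_simps IntD2)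
  fix m assume m: "m \<in> carrier target_sum"
  show "\<phi> m = \<psi> m"
    by (rule to_corner_inj[OF rhomD(1)[OF h(1) m] rhomD(1)[OF h(2) m]])
      (simp only: end_apply[OF h(1) m] end_apply[OF h(2) m] assms(3))
qed

lemma end_elem_surj:
  assumes x: "x \<in> carrier A" "corner_unit \<otimes> x = x" "x \<otimes> corner_unit = x"
  shows "\<exists>\<phi>\<in>carrier target_end. end_elem \<phi> = x"
proof -
  interpret M: right_module A target_sum by (rule target_sum_module)
  have "\<exists>n\<in>carrier target_sum. to_corner n = x \<otimes> to_corner m" for m
    using x by (intro to_corner_surj) (simp_all add: m_assoc[symmetric])
  then have "\<forall>m. \<exists>n. n \<in> carrier target_sum \<and> to_corner n = x \<otimes> to_corner m" by blast
  from choice[OF this] obtain g where "\<forall>m. g m \<in> carrier target_sum \<and> to_corner (g m) = x \<otimes> to_corner m" ..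
  then have g: "g m \<in> carrier target_sum" "to_corner (g m) = x \<otimes> to_corner m" for m by blast+
  have "g \<in> rhom A target_sum target_sum"
  proof (rule rhomI)
    fix m assume m: "m \<in> carrier target_sum"
    show "g m \<in> carrier target_sum" by (rule g(1))
    show "g (a \<odot>\<^bsub>target_sum\<^esub> m) = a \<odot>\<^bsub>target_sum\<^esub> g m" if a: "a \<in> carrier A" for a
      by (rule to_corner_inj[OF g(1) M.act_closed[OF a g(1)]])
        (simp only: g(2) to_corner_act[OF a m] to_corner_act[OF a g(1)] m_assoc[OF x(1) to_corner_closed a])
    show "g (m \<oplus>\<^bsub>target_sum\<^esub> n) = g m \<oplus>\<^bsub>target_sum\<^esub> g n" if n: "n \<in> carrier target_sum" for n
      by (rule to_corner_inj[OF g(1) M.M.a_closed[OF g(1) g(1)]])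
        (simp only: g(2) to_corner_add[OF m n] to_corner_add[OF g(1) g(1)] r_distr[OF to_corner_closed to_corner_closed x(1)])
  qed
  then have "restrict g (carrier target_sum) \<in> carrier target_end"
    unfolding end_algebra_simps by (intro IntI rhom_restrict[OF target_sum_module] restrict_extensional)
  moreover have "end_elem (restrict g (carrier target_sum)) = x"
    unfolding end_elem_def restrict_apply'[OF corner_gen_closed] g(2) by (rule x(3))
  ultimately show ?thesis by blast
qed

lemma end_closed:
  assumes "\<phi> \<in> carrier target_end" "\<psi> \<in> carrier target_end"
  shows "\<phi> \<oplus>\<^bsub>target_end\<^esub> \<psi> \<in> carrier target_end \<and> end_elem (\<phi> \<oplus>\<^bsub>target_end\<^esub> \<psi>) = end_elem \<phi> \<oplus> end_elem \<psi>"
    and "\<phi> \<otimes>\<^bsub>target_end\<^esub> \<psi> \<in> carrier target_end \<and> end_elem (\<phi> \<otimes>\<^bsub>target_end\<^esub> \<psi>) = end_elem \<phi> \<otimes> end_elem \<psi>"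
    and "s \<odot>\<^bsub>target_end\<^esub> \<phi> \<in> carrier target_end \<and> end_elem (s \<odot>\<^bsub>target_end\<^esub> \<phi>) = s \<odot> end_elem \<phi>"
proof -
  interpret M: right_module A target_sum by (rule target_sum_module)
  let ?C = "carrier target_sum"
  have h: "\<phi> \<in> rhom A target_sum target_sum" "\<psi> \<in> rhom A target_sum target_sum"
    using assms by (simp_all only: end_algebra_simps IntD1)
  note g = corner_gen_closed
  have hg: "\<phi> corner_gen \<in> ?C" "\<psi> corner_gen \<in> ?C" using rhomD(1)[OF h(1) g] rhomD(1)[OF h(2) g] .
  have "\<phi> \<oplus>\<^bsub>target_end\<^esub> \<psi> \<in> carrier target_end"
    unfolding end_algebra_simps using rhom_restrict[OF target_sum_module rhom_add[OF target_sum_module h]]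
    by (intro IntI restrict_extensional)
  moreover have "end_elem (\<phi> \<oplus>\<^bsub>target_end\<^esub> \<psi>) = end_elem \<phi> \<oplus> end_elem \<psi>"
    unfolding end_elem_def end_algebra_simps restrict_apply'[OF g] by (rule to_corner_add[OF hg])
  ultimately show "\<phi> \<oplus>\<^bsub>target_end\<^esub> \<psi> \<in> carrier target_end \<and> end_elem (\<phi> \<oplus>\<^bsub>target_end\<^esub> \<psi>) = end_elem \<phi> \<oplus> end_elem \<psi>" ..
  have "\<phi> \<otimes>\<^bsub>target_end\<^esub> \<psi> \<in> carrier target_end"
    unfolding end_algebra_simps compose_def using rhom_restrict[OF target_sum_module rhom_comp[OF h(2,1)]]
    by (intro IntI restrict_extensional)
  moreover have "(\<phi> \<otimes>\<^bsub>target_end\<^esub> \<psi>) corner_gen = \<phi> (\<psi> corner_gen)"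
    by (simp only: end_algebra_simps compose_def restrict_apply'[OF g])
  then have "end_elem (\<phi> \<otimes>\<^bsub>target_end\<^esub> \<psi>) = end_elem \<phi> \<otimes> end_elem \<psi>"
    using end_apply[OF h(1) hg(2)] by (simp only: end_elem_def)
  ultimately show "\<phi> \<otimes>\<^bsub>target_end\<^esub> \<psi> \<in> carrier target_end \<and> end_elem (\<phi> \<otimes>\<^bsub>target_end\<^esub> \<psi>) = end_elem \<phi> \<otimes> end_elem \<psi>" ..
  have s1: "s \<odot> \<one> \<in> carrier A" by (simp add: scal_closed)
  have "(\<lambda>m. (s \<odot> \<one>) \<odot>\<^bsub>target_sum\<^esub> \<phi> m) \<in> rhom A target_sum target_sum"
  proof (rule rhomI)
    fix m assume m: "m \<in> ?C"
    note p = rhomD(1)[OF h(1) m]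
    show "(s \<odot> \<one>) \<odot>\<^bsub>target_sum\<^esub> \<phi> m \<in> ?C" by (rule M.act_closed[OF s1 p])
    show "(s \<odot> \<one>) \<odot>\<^bsub>target_sum\<^esub> \<phi> (a \<odot>\<^bsub>target_sum\<^esub> m) = a \<odot>\<^bsub>target_sum\<^esub> ((s \<odot> \<one>) \<odot>\<^bsub>target_sum\<^esub> \<phi> m)" if a: "a \<in> carrier A" for a
      using M.act_mult[OF s1 a p] M.act_mult[OF a s1 p] by (simp only: rhomD(3)[OF h(1) a m] one_scal_mult[OF a])
    show "(s \<odot> \<one>) \<odot>\<^bsub>target_sum\<^esub> \<phi> (m \<oplus>\<^bsub>target_sum\<^esub> n) = (s \<odot> \<one>) \<odot>\<^bsub>target_sum\<^esub> \<phi> m \<oplus>\<^bsub>target_sum\<^esub> (s \<odot> \<one>) \<odot>\<^bsub>target_sum\<^esub> \<phi> n"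
      if n: "n \<in> ?C" for n
      using M.act_add_right[OF s1 p rhomD(1)[OF h(1) n]] by (simp only: rhomD(2)[OF h(1) m n])
  qed
  then have "s \<odot>\<^bsub>target_end\<^esub> \<phi> \<in> carrier target_end"
    unfolding end_algebra_simps by (intro IntI restrict_extensional rhom_restrict[OF target_sum_module])
  moreover have "end_elem (s \<odot>\<^bsub>target_end\<^esub> \<phi>) = s \<odot> end_elem \<phi>"
    unfolding end_elem_def end_algebra_simps restrict_apply'[OF g] to_corner_act[OF s1 hg(1)]
    by (rule one_scal_mult) simp
  ultimately show "s \<odot>\<^bsub>target_end\<^esub> \<phi> \<in> carrier target_end \<and> end_elem (s \<odot>\<^bsub>target_end\<^esub> \<phi>) = s \<odot> end_elem \<phi>" ..
qed

lemma end_one: "\<one>\<^bsub>target_end\<^esub> \<in> carrier target_end" "end_elem \<one>\<^bsub>target_end\<^esub> = corner_unit"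
proof -
  have "(\<lambda>m. m) \<in> rhom A target_sum target_sum" by (rule rhomI) auto
  then show "\<one>\<^bsub>target_end\<^esub> \<in> carrier target_end"
    unfolding end_algebra_simps by (intro IntI restrict_extensional rhom_restrict[OF target_sum_module])
  show "end_elem \<one>\<^bsub>target_end\<^esub> = corner_unit"
    unfolding end_elem_def end_algebra_simps restrict_apply'[OF corner_gen_closed] ..
qed

lemma end_zero: "\<zero>\<^bsub>target_end\<^esub> \<in> carrier target_end" "end_elem \<zero>\<^bsub>target_end\<^esub> = \<zero>"
proof -
  show "\<zero>\<^bsub>target_end\<^esub> \<in> carrier target_end"
    unfolding end_algebra_simps by (intro IntI restrict_extensional rhom_restrict[OF target_sum_module] rhom_zero_map[OF target_sum_module])
  have "to_corner \<zero>\<^bsub>target_sum\<^esub> = \<zero>\<^bsub>regular_module A\<^esub>"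
    by (rule rhom_zero[OF target_sum_module regular_right_module[OF ring_axioms] to_corner_hom])
  then show "end_elem \<zero>\<^bsub>target_end\<^esub> = \<zero>"
    unfolding end_elem_def end_algebra_simps restrict_apply'[OF corner_gen_closed] by (simp only: regular_simps)
qed

lemma end_hom: "\<phi> \<in> carrier target_end \<Longrightarrow> \<phi> \<in> rhom A target_sum target_sum"
  by (simp only: end_algebra_simps IntD1)

lemma k_algebra_end: "k_algebra target_end"
proof (rule k_algebra_transport[of A target_end end_elem])
  show "inj_on end_elem (carrier target_end)" by (rule inj_onI) (rule end_elem_inj)
  fix \<phi> assume p: "\<phi> \<in> carrier target_end"
  show "end_elem \<one>\<^bsub>target_end\<^esub> \<otimes> end_elem \<phi> = end_elem \<phi>" "end_elem \<phi> \<otimes> end_elem \<one>\<^bsub>target_end\<^esub> = end_elem \<phi>"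
    unfolding end_one(2) by (rule end_elem_unit[OF end_hom[OF p]])+
  have "end_elem ((-1) \<odot>\<^bsub>target_end\<^esub> \<phi>) = (-1) \<odot> end_elem \<phi>" using end_closed(3)[OF p p] by blast
  also have "\<dots> = \<ominus> end_elem \<phi>"
    by (rule cf_eqI) (simp_all add: scal_closed cf_scal cf_neg)
  finally show "\<exists>y\<in>carrier target_end. end_elem y = \<ominus> end_elem \<phi>" using end_closed(3)[OF p p] by blast
  show "s \<odot>\<^bsub>target_end\<^esub> \<phi> \<in> carrier target_end \<and> end_elem (s \<odot>\<^bsub>target_end\<^esub> \<phi>) = s \<odot> end_elem \<phi>" for s
    by (rule end_closed(3)[OF p p])
  show "end_elem \<phi> \<in> carrier A" by (rule end_elem_closed)
  fix \<psi> assume q: "\<psi> \<in> carrier target_end"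
  show "\<phi> \<oplus>\<^bsub>target_end\<^esub> \<psi> \<in> carrier target_end \<and> end_elem (\<phi> \<oplus>\<^bsub>target_end\<^esub> \<psi>) = end_elem \<phi> \<oplus> end_elem \<psi>"
    by (rule end_closed(1)[OF p q])
  show "\<phi> \<otimes>\<^bsub>target_end\<^esub> \<psi> \<in> carrier target_end \<and> end_elem (\<phi> \<otimes>\<^bsub>target_end\<^esub> \<psi>) = end_elem \<phi> \<otimes> end_elem \<psi>"
    by (rule end_closed(2)[OF p q])
qed (rule k_algebra_axioms end_one(1) end_zero)+

text \<open>
  A path between targets is a path in \<open>A\<close>, but its length is counted by the number of steps from one
  target to the next.
\<close>

definition end_cf :: "((nat \<Rightarrow> nat \<Rightarrow> 'k) \<Rightarrow> nat \<Rightarrow> nat \<Rightarrow> 'k) \<Rightarrow> nat \<Rightarrow> nat \<Rightarrow> 'k" where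
  "end_cf \<phi> j l = cf (end_elem \<phi>) (nth_lift j) (nth_lift (j + l) - nth_lift j)"

lemma lift_length: "nth_lift (j + l) - nth_lift j < c (nth_lift j) \<longleftrightarrow> l < red_series j"
proof -
  have "nth_lift (j + l) - nth_lift j < c (nth_lift j) \<longleftrightarrow> nth_lift (j + l) < jump c (nth_lift j)"
  proof -
    have "nth_lift j \<le> nth_lift (j + l)" by simp
    then show ?thesis unfolding jump_def by linarith
  qed
  also have "\<dots> \<longleftrightarrow> l < red_series j"
    unfolding nth_lift_jump[symmetric] nth_lift_less by (simp add: jump_def)
  finally show ?thesis .
qed

lemma lift_iff: "i mod N \<in> targets \<longleftrightarrow> i \<in> target_lifts" by (simp add: target_lifts_def)

lemma end_nak: "nak red_rank red_series target_end end_cf"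
proof (intro nak.intro kupisch_red k_algebra_end nak_axioms.intro)
  show "bij_betw end_cf (carrier target_end) (coords red_rank red_series)"
    unfolding bij_betw_def
  proof (intro conjI inj_onI equalityI subsetI)
    fix \<phi> \<psi> assume pq: "\<phi> \<in> carrier target_end" "\<psi> \<in> carrier target_end" "end_cf \<phi> = end_cf \<psi>"
    have "end_elem \<phi> = end_elem \<psi>"
    proof (rule cf_eqI)
      fix i l
      have z: "cf (end_elem \<chi>) i l = 0" if "\<not> (i mod N \<in> targets \<and> (i + l) mod N \<in> targets)" "\<chi> \<in> carrier target_end" for \<chi>
        using that(1) cf_unit_left[of "end_elem \<chi>" i l] cf_unit_right[of "end_elem \<chi>" i l] end_elem_unit[OF end_hom[OF that(2)]] by auto
      show "cf (end_elem \<phi>) i l = cf (end_elem \<psi>) i l"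
      proof (cases "i mod N \<in> targets \<and> (i + l) mod N \<in> targets")
        case True
        then obtain j j' where j: "i = nth_lift j" "i + l = nth_lift j'"
          unfolding lift_iff range_nth_lift[symmetric] by blast
        then have "nth_lift j \<le> nth_lift j'" by linarith
        then have "j \<le> j'" by (simp only: nth_lift_le)
        then have "l = nth_lift (j + (j' - j)) - nth_lift j" using j by simp
        then show ?thesis using fun_cong[OF fun_cong[OF pq(3), of j], of "j' - j"] j(1) by (simp only: end_cf_def)
      qed (use z pq in simp)
    qed simp_all
    then show "\<phi> = \<psi>" by (rule end_elem_inj[OF pq(1,2)])
  next
    fix f assume "f \<in> end_cf ` carrier target_end"
    then obtain \<phi> where f: "f = end_cf \<phi>" "\<phi> \<in> carrier target_end" by blast
    have "end_cf \<phi> (j + red_rank) l = end_cf \<phi> j l" for j l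
    proof -
      have "nth_lift (j + red_rank + l) = nth_lift (j + l) + N" using nth_lift_add_rank[of "j + l"] by (simp add: add_ac)
      then show ?thesis by (simp add: end_cf_def nth_lift_add_rank cf_add_N)
    qed
    moreover have "end_cf \<phi> j l = 0" if "red_series j \<le> l" for j l
      using that lift_length[of j l] by (auto simp: end_cf_def intro: cf_trunc)
    ultimately show "f \<in> coords red_rank red_series" by (simp add: coords_def f)
  next
    fix f :: "nat \<Rightarrow> nat \<Rightarrow> 'k" assume f: "f \<in> coords red_rank red_series"
    define x where "x = el (\<lambda>i l. if l < c i \<and> i \<in> target_lifts \<and> i + l \<in> target_lifts
        then f (lift_index i) (lift_index (i + l) - lift_index i) else 0)"
    have "lift_index (i + N + l) = lift_index (i + l) + red_rank" for i l
      using lift_index_add_N[of "i + l"] by (simp add: add_ac)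
    moreover have "i + N + l \<in> target_lifts \<longleftrightarrow> i + l \<in> target_lifts" for i l
      by (simp add: target_lifts_def add_ac)
    moreover have "i + N \<in> target_lifts \<longleftrightarrow> i \<in> target_lifts" for i by (simp add: target_lifts_def)
    ultimately have co: "(\<lambda>i l. if l < c i \<and> i \<in> target_lifts \<and> i + l \<in> target_lifts
        then f (lift_index i) (lift_index (i + l) - lift_index i) else 0) \<in> coords N c"
      using f by (simp add: coords_def c_add_N lift_index_add_N)
    have x: "x \<in> carrier A" unfolding x_def using co by (rule el_closed)
    have cfx: "cf x i l = (if l < c i \<and> i \<in> target_lifts \<and> i + l \<in> target_lifts
        then f (lift_index i) (lift_index (i + l) - lift_index i) else 0)" for i l
      unfolding x_def by (simp add: cf_el[OF co])
    have "corner_unit \<otimes> x = x" by (rule cf_eqI) (use x in \<open>auto simp: cf_unit_left cfx lift_iff simp del: mod_less\<close>)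
    moreover have "x \<otimes> corner_unit = x" by (rule cf_eqI) (use x in \<open>auto simp: cf_unit_right cfx lift_iff simp del: mod_less\<close>)
    ultimately obtain \<phi> where \<phi>: "\<phi> \<in> carrier target_end" "end_elem \<phi> = x" using end_elem_surj x by blast
    have "end_cf \<phi> = f"
    proof (intro ext)
      fix j l
      have "nth_lift j + (nth_lift (j + l) - nth_lift j) = nth_lift (j + l)" using nth_lift_le[of j "j + l"] by simp
      then show "end_cf \<phi> j l = f j l"
        using f lift_length[of j l] by (auto simp: end_cf_def \<phi>(2) cfx nth_lift_in coords_def not_less)
    qed
    then show "f \<in> end_cf ` carrier target_end" using \<phi>(1) by blast
  qed
next
  fix \<phi> \<psi> i l assume p: "\<phi> \<in> carrier target_end" "\<psi> \<in> carrier target_end"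
  show "end_cf (\<phi> \<oplus>\<^bsub>target_end\<^esub> \<psi>) i l = end_cf \<phi> i l + end_cf \<psi> i l"
    unfolding end_cf_def conjunct2[OF end_closed(1)[OF p]] by (rule cf_add) simp_all
  show "end_cf (\<phi> \<otimes>\<^bsub>target_end\<^esub> \<psi>) i l = (if l < red_series i then \<Sum>m\<le>l. end_cf \<phi> i m * end_cf \<psi> (i + m) (l - m) else 0)"
  proof (cases "l < red_series i")
    case True
    let ?i = "nth_lift i" and ?s = "\<lambda>m. nth_lift (i + m) - nth_lift i"
    let ?t = "\<lambda>m. cf (end_elem \<phi>) ?i m * cf (end_elem \<psi>) (?i + m) (?s l - m)"
    have add: "?i + ?s m = nth_lift (i + m)" for m using nth_lift_le[of i "i + m"] by simp
    have "end_cf (\<phi> \<otimes>\<^bsub>target_end\<^esub> \<psi>) i l = (\<Sum>m\<le>?s l. ?t m)"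
      unfolding end_cf_def conjunct2[OF end_closed(2)[OF p]] using True lift_length[of i l] by (simp add: cf_mult)
    also have "\<dots> = (\<Sum>m\<in>?s ` {..l}. ?t m)"
    proof (rule sum.mono_neutral_right)
      show "?s ` {..l} \<subseteq> {..?s l}" by (auto intro!: diff_le_mono)
      show "\<forall>m\<in>{..?s l} - ?s ` {..l}. ?t m = 0"
      proof
        fix m assume m: "m \<in> {..?s l} - ?s ` {..l}"
        have "?i + m \<notin> target_lifts"
        proof
          assume "?i + m \<in> target_lifts"
          then obtain k where k: "?i + m = nth_lift k" unfolding range_nth_lift[symmetric] by blast
          have "nth_lift i \<le> nth_lift k" using k by linarith
          then have ik: "i \<le> k" by (simp only: nth_lift_le)
          have "m \<le> ?s l" using m by simp
          then have "nth_lift k \<le> nth_lift (i + l)" using add[of l] k by linarith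
          then have "k - i \<in> {..l}" by simp
          moreover have "m = ?s (k - i)" using k ik by simp
          ultimately show False using m by blast
        qed
        then have "cf (end_elem \<psi>) (?i + m) (?s l - m) = 0"
          using cf_unit_left[of "end_elem \<psi>" "?i + m" "?s l - m"] end_elem_unit(2)[OF end_hom[OF p(2)]] lift_iff by simp
        then show "?t m = 0" by simp
      qed
    qed simp
    also have "\<dots> = (\<Sum>m\<le>l. ?t (?s m))"
    proof (rule sum.reindex_cong[of ?s])
      show "inj_on ?s {..l}"
      proof (rule inj_onI)
        fix m m' assume "?s m = ?s m'"
        then have "nth_lift (i + m) = nth_lift (i + m')" using add by metis
        then show "m = m'" by simp
      qed
    qed simp_all
    also have "\<dots> = (\<Sum>m\<le>l. end_cf \<phi> i m * end_cf \<psi> (i + m) (l - m))"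
    proof (rule sum.cong)
      fix m assume "m \<in> {..l}"
      then have "?s l - ?s m = nth_lift (i + m + (l - m)) - nth_lift (i + m)"
        using add[of m] add[of l] by simp
      then show "?t (?s m) = end_cf \<phi> i m * end_cf \<psi> (i + m) (l - m)"
        unfolding end_cf_def add by simp
    qed simp
    finally show ?thesis using True by simp
  next
    case False
    then show ?thesis
      using lift_length[of i l] by (auto simp del: end_algebra_simps simp: end_cf_def intro!: cf_trunc)
  qed
next
  fix i l
  have "nth_lift (i + l) - nth_lift i = 0 \<longleftrightarrow> l = 0" using nth_lift_less[of i "i + l"] by auto
  then show "end_cf \<one>\<^bsub>target_end\<^esub> i l = (if l = 0 then 1 else 0)"
    unfolding end_cf_def end_one(2) cf_corner_unit by (simp add: nth_lift_mod)
next
  fix \<phi> s i l assume p: "\<phi> \<in> carrier target_end"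
  show "end_cf (s \<odot>\<^bsub>target_end\<^esub> \<phi>) i l = s * end_cf \<phi> i l"
    unfolding end_cf_def conjunct2[OF end_closed(3)[OF p p]] by (rule cf_scal) simp
qed

end

section \<open>Uniqueness of algebras with given coordinates\<close>

text \<open>
  A model of the Nakayama algebra with Kupisch series \<open>c\<close> whose elements have the type required of
  the members of the sequence of syzygy filtered algebras.
\<close>

definition kup :: "nat \<Rightarrow> (nat \<Rightarrow> nat) \<Rightarrow> ('k::field, nat \<Rightarrow> 'k) module" where
  "kup N c = \<lparr>carrier = {v. co v \<in> coords N c},
     mult = (\<lambda>v w. mk (\<lambda>i l. if l < c i then \<Sum>m\<le>l. co v i m * co w (i + m) (l - m) else 0)),
     one = mk (\<lambda>i l. if l = 0 then 1 else 0), zero = (\<lambda>_. 0), add = (\<lambda>v w n. v n + w n),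
     smult = (\<lambda>s v n. s * v n)\<rparr>"

lemma co_scal [simp]: "co (\<lambda>n. s * v n) k t = s * co v k t" by (simp add: co_def)

context kupisch
begin

lemma c_tail: "l < c i \<Longrightarrow> m \<le> l \<Longrightarrow> l - m < c (i + m)"
  using jump_mono[of i "i + m"] by (auto simp: jump_def)

lemma kup_algebra: "k_algebra (kup N c :: ('k::field, nat \<Rightarrow> 'k) module)"
proof -
  let ?K = "kup N c :: ('k, nat \<Rightarrow> 'k) module"
  note d = kup_def coords_def
  have ab: "abelian_group ?K"
  proof (rule abelian_groupI)
    fix x assume "x \<in> carrier ?K"
    then show "\<exists>y\<in>carrier ?K. y \<oplus>\<^bsub>?K\<^esub> x = \<zero>\<^bsub>?K\<^esub>"
      by (intro bexI[of _ "\<lambda>n. - x n"]) (auto simp: d co_def)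
  qed (auto simp: d add_ac)
  have closed: "x \<otimes>\<^bsub>?K\<^esub> y \<in> carrier ?K" if "x \<in> carrier ?K" "y \<in> carrier ?K" for x y
  proof -
    have "co y (i + N + m) l = co y (i + m) l" for i m l
      using that(2) by (simp add: d add.assoc add.commute[of N])
        (metis add.assoc add.commute)
    then show ?thesis using that by (simp add: d c_add_N)
  qed
  have assoc: "x \<otimes>\<^bsub>?K\<^esub> y \<otimes>\<^bsub>?K\<^esub> z = x \<otimes>\<^bsub>?K\<^esub> (y \<otimes>\<^bsub>?K\<^esub> z)" for x y z
  proof (rule co_eqI)
    fix i l
    show "co (x \<otimes>\<^bsub>?K\<^esub> y \<otimes>\<^bsub>?K\<^esub> z) i l = co (x \<otimes>\<^bsub>?K\<^esub> (y \<otimes>\<^bsub>?K\<^esub> z)) i l"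
    proof (cases "l < c i")
      case True
      have "co (x \<otimes>\<^bsub>?K\<^esub> y \<otimes>\<^bsub>?K\<^esub> z) i l =
          (\<Sum>u\<le>l. \<Sum>s\<le>u. co x i s * co y (i + s) (u - s) * co z (i + u) (l - u))"
        using True by (auto simp: kup_def sum_distrib_right intro!: sum.cong)
      also have "\<dots> = (\<Sum>s\<le>l. \<Sum>m\<le>l - s. co x i s * co y (i + s) m * co z (i + (s + m)) (l - (s + m)))"
        by (subst triangle_swap) simp
      also have "\<dots> = co (x \<otimes>\<^bsub>?K\<^esub> (y \<otimes>\<^bsub>?K\<^esub> z)) i l"
        using True c_tail by (auto simp: kup_def sum_distrib_left mult.assoc add.assoc intro!: sum.cong)
      finally show ?thesis .
    qed (simp add: kup_def)
  qed
  have one: "\<one>\<^bsub>?K\<^esub> \<in> carrier ?K" using c_pos by (auto simp: d)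
  have monoid: "monoid ?K"
  proof (rule monoidI)
    fix x assume x: "x \<in> carrier ?K"
    show "\<one>\<^bsub>?K\<^esub> \<otimes>\<^bsub>?K\<^esub> x = x"
    proof (rule co_eqI)
      fix i l
      have "(\<Sum>m\<le>l. (if m = 0 then 1 else 0) * co x (i + m) (l - m)) = (\<Sum>m\<le>l. if m = 0 then co x i l else 0)"
        by (intro sum.cong) auto
      then show "co (\<one>\<^bsub>?K\<^esub> \<otimes>\<^bsub>?K\<^esub> x) i l = co x i l" using x by (auto simp: d)
    qed
    show "x \<otimes>\<^bsub>?K\<^esub> \<one>\<^bsub>?K\<^esub> = x"
    proof (rule co_eqI)
      fix i l
      have "(\<Sum>m\<le>l. co x i m * (if l - m = 0 then 1 else 0)) = (\<Sum>m\<le>l. if m = l then co x i l else 0)"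
        by (intro sum.cong) auto
      then show "co (x \<otimes>\<^bsub>?K\<^esub> \<one>\<^bsub>?K\<^esub>) i l = co x i l" using x by (auto simp: d)
    qed
  qed (simp_all add: closed assoc one)
  have "ring ?K"
  proof (rule ringI[OF ab monoid])
    fix x y z
    show "(x \<oplus>\<^bsub>?K\<^esub> y) \<otimes>\<^bsub>?K\<^esub> z = x \<otimes>\<^bsub>?K\<^esub> z \<oplus>\<^bsub>?K\<^esub> y \<otimes>\<^bsub>?K\<^esub> z"
      by (rule co_eqI) (simp add: kup_def sum.distrib distrib_right)
    show "z \<otimes>\<^bsub>?K\<^esub> (x \<oplus>\<^bsub>?K\<^esub> y) = z \<otimes>\<^bsub>?K\<^esub> x \<oplus>\<^bsub>?K\<^esub> z \<otimes>\<^bsub>?K\<^esub> y"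
      by (rule co_eqI) (simp add: kup_def sum.distrib distrib_left)
  qed
  then show ?thesis
  proof (intro k_algebra.intro k_algebra_axioms.intro)
    fix x y and s t :: 'k
    show "s \<odot>\<^bsub>?K\<^esub> (x \<otimes>\<^bsub>?K\<^esub> y) = s \<odot>\<^bsub>?K\<^esub> x \<otimes>\<^bsub>?K\<^esub> y" "s \<odot>\<^bsub>?K\<^esub> (x \<otimes>\<^bsub>?K\<^esub> y) = x \<otimes>\<^bsub>?K\<^esub> (s \<odot>\<^bsub>?K\<^esub> y)"
      by (rule co_eqI, simp add: kup_def sum_distrib_left mult_ac)+
  qed (auto simp: d algebra_simps)
qed

lemma kup_nak: "nak N c (kup N c :: ('k::field, nat \<Rightarrow> 'k) module) co"
proof (intro nak.intro kupisch_axioms kup_algebra nak_axioms.intro)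
  show "bij_betw co (carrier (kup N c :: ('k, nat \<Rightarrow> 'k) module)) (coords N c)"
    unfolding bij_betw_def
  proof (intro conjI inj_onI equalityI subsetI)
    fix x y :: "nat \<Rightarrow> 'k" assume "co x = co y" then show "x = y" by (intro co_eqI) simp
  next
    fix f :: "nat \<Rightarrow> nat \<Rightarrow> 'k" assume f: "f \<in> coords N c"
    have "co (mk f) = f" by (intro ext) simp
    then show "f \<in> co ` carrier (kup N c)" using f by (intro image_eqI[of f co "mk f"]) (auto simp: kup_def)
  qed (auto simp: kup_def)
qed (auto simp: kup_def)

end

lemma (in nak) nak_if_isomorphic:
  assumes "alg_isomorphic B A"
  shows "\<exists>cf'. nak N c B cf'"
proof -
  interpret B: k_algebra B using assms by (simp add: alg_isomorphic_def)
  obtain f where f: "f \<in> ring_iso B A" "\<And>s x. x \<in> carrier B \<Longrightarrow> f (s \<odot>\<^bsub>B\<^esub> x) = s \<odot> f x"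
    using assms by (auto simp: alg_isomorphic_def)
  note fE = ring_iso_memE[OF f(1)]
  have "nak N c B (\<lambda>x. cf (f x))"
  proof (intro nak.intro kupisch_axioms B.k_algebra_axioms nak_axioms.intro)
    show "bij_betw (\<lambda>x. cf (f x)) (carrier B) (coords N c)"
      using bij_betw_trans[OF fE(5) cf_bij] by (simp add: comp_def)
  qed (simp_all add: fE cf_add cf_mult cf_one f(2) cf_scal)
  then show ?thesis by blast
qed

lemma nak_isomorphic:
  fixes A :: "('k::field, 'a) module" and B :: "('k, 'b) module"
  assumes "nak N c A cf" "nak N c B cf'"
  shows "alg_isomorphic A B"
proof -
  interpret A: nak N c A cf by fact
  interpret B: nak N c B cf' by fact
  define f where "f x = B.el (cf x)" for x
  have fc: "f x \<in> carrier B" if "x \<in> carrier A" for x unfolding f_def by (rule B.el_closed[OF A.cf_coords[OF that]])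
  have cff: "cf' (f x) = cf x" if "x \<in> carrier A" for x unfolding f_def by (rule B.cf_el[OF A.cf_coords[OF that]])
  have "f \<in> ring_iso A B"
  proof (rule ring_iso_memI)
    show "bij_betw f (carrier A) (carrier B)"
      unfolding bij_betw_def
    proof (intro conjI inj_onI equalityI subsetI)
      fix x y assume "x \<in> carrier A" "y \<in> carrier A" "f x = f y"
      then show "x = y" using cff by (intro A.cf_eqI) metis+
    next
      fix y assume y: "y \<in> carrier B"
      have "f (A.el (cf' y)) = y"
        using fc[OF A.el_closed[OF B.cf_coords[OF y]]] y cff[OF A.el_closed[OF B.cf_coords[OF y]]] A.cf_el[OF B.cf_coords[OF y]]
        by (intro B.cf_eqI) simp_all
      then show "y \<in> f ` carrier A" using A.el_closed[OF B.cf_coords[OF y]] by (metis imageI)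
    qed (use fc in auto)
    fix x y assume xy: "x \<in> carrier A" "y \<in> carrier A"
    show "f (x \<otimes>\<^bsub>A\<^esub> y) = f x \<otimes>\<^bsub>B\<^esub> f y"
      using xy fc cff by (intro B.cf_eqI) (simp_all add: A.cf_mult B.cf_mult)
    show "f (x \<oplus>\<^bsub>A\<^esub> y) = f x \<oplus>\<^bsub>B\<^esub> f y"
      using xy fc cff by (intro B.cf_eqI) (simp_all add: A.cf_add B.cf_add)
  next
    show "f \<one>\<^bsub>A\<^esub> = \<one>\<^bsub>B\<^esub>" using fc cff by (intro B.cf_eqI) (simp_all add: A.cf_one B.cf_one)
  qed (rule fc)
  moreover have "\<forall>s. \<forall>x\<in>carrier A. f (s \<odot>\<^bsub>A\<^esub> x) = s \<odot>\<^bsub>B\<^esub> f x"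
    using fc cff by (intro allI ballI B.cf_eqI) (simp_all add: A.cf_scal B.cf_scal A.scal_closed B.scal_closed)
  ultimately show ?thesis
    unfolding alg_isomorphic_def using A.k_algebra_axioms B.k_algebra_axioms by blast
qed

lemma quotient_simps:
  "carrier (quotient_algebra A I) = a_rcosets\<^bsub>A\<^esub> I" "mult (quotient_algebra A I) = rcoset_mult A I"
  "one (quotient_algebra A I) = I +>\<^bsub>A\<^esub> \<one>\<^bsub>A\<^esub>" "zero (quotient_algebra A I) = I"
  "add (quotient_algebra A I) = set_add A" "smult (quotient_algebra A I) = (\<lambda>c X. \<Union>x\<in>X. I +>\<^bsub>A\<^esub> (c \<odot>\<^bsub>A\<^esub> x))"
  by (simp_all add: quotient_algebra_def FactRing_def)

text \<open>
  The quotient by the kernel of a map with the properties of a coordinate map inherits these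
  coordinates. Evaluation at an arbitrary representative gives the coordinates of a residue class,
  which is also how the simple modules at the vertices act.
\<close>

lemma nak_quotient:
  fixes K :: "('k::field, 'a) module" and \<phi> :: "'a \<Rightarrow> nat \<Rightarrow> nat \<Rightarrow> 'k"
  assumes "kupisch N c" "k_algebra K" and surj: "\<phi> ` carrier K = coords N c"
    and add: "\<And>x y i l. x \<in> carrier K \<Longrightarrow> y \<in> carrier K \<Longrightarrow> \<phi> (x \<oplus>\<^bsub>K\<^esub> y) i l = \<phi> x i l + \<phi> y i l"
    and mult: "\<And>x y i l. x \<in> carrier K \<Longrightarrow> y \<in> carrier K \<Longrightarrow>
       \<phi> (x \<otimes>\<^bsub>K\<^esub> y) i l = (if l < c i then \<Sum>m\<le>l. \<phi> x i m * \<phi> y (i + m) (l - m) else 0)"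
    and one: "\<And>i l. \<phi> \<one>\<^bsub>K\<^esub> i l = (if l = 0 then 1 else 0)"
    and scal: "\<And>s x i l. x \<in> carrier K \<Longrightarrow> \<phi> (s \<odot>\<^bsub>K\<^esub> x) i l = s * \<phi> x i l"
    and I: "I = {x \<in> carrier K. \<forall>i l. \<phi> x i l = 0}"
  shows "ideal I K" "nak N c (quotient_algebra K I) (\<lambda>X. \<phi> (SOME x. x \<in> X))"
proof -
  interpret kupisch N c by fact
  interpret K: k_algebra K by fact
  have zero: "\<phi> \<zero>\<^bsub>K\<^esub> i l = 0" for i l
  proof -
    have "\<phi> \<zero>\<^bsub>K\<^esub> i l + \<phi> \<zero>\<^bsub>K\<^esub> i l = \<phi> \<zero>\<^bsub>K\<^esub> i l + 0"
      unfolding add[OF K.zero_closed K.zero_closed, symmetric] by simp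
    then show ?thesis by (rule add_left_imp_eq)
  qed
  have neg: "\<phi> (\<ominus>\<^bsub>K\<^esub> x) i l = - \<phi> x i l" if "x \<in> carrier K" for x i l
    using add[of "\<ominus>\<^bsub>K\<^esub> x" x i l] that by (simp add: K.l_neg zero eq_neg_iff_add_eq_0)
  show id: "ideal I K"
  proof (rule idealI[OF K.ring_axioms])
    show "subgroup I (add_monoid K)"
      by (rule K.add.subgroupI) (auto simp: I add zero neg[unfolded a_inv_def] a_inv_def[symmetric] neg)
  qed (auto simp: I mult)
  interpret I: ideal I K by (rule id)
  let ?Q = "quotient_algebra K I" and ?cf = "\<lambda>X. \<phi> (SOME x. x \<in> X)"
  have Qc: "X \<in> carrier ?Q \<longleftrightarrow> (\<exists>x\<in>carrier K. X = I +>\<^bsub>K\<^esub> x)" for X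
    by (auto simp: quotient_simps A_RCOSETS_def' )
  have rep: "\<phi> y = \<phi> x" if "x \<in> carrier K" "y \<in> I +>\<^bsub>K\<^esub> x" for x y
  proof -
    from that(2) obtain i where i: "i \<in> I" "y = i \<oplus>\<^bsub>K\<^esub> x" unfolding a_r_coset_def' by blast
    have iK: "i \<in> carrier K" "\<phi> i a b = 0" for a b using i(1) unfolding I by blast+
    show ?thesis by (intro ext) (simp add: i(2) add iK that(1))
  qed
  have cfx: "?cf (I +>\<^bsub>K\<^esub> x) = \<phi> x" if "x \<in> carrier K" for x
    by (rule rep[OF that someI[where P = "\<lambda>y. y \<in> I +>\<^bsub>K\<^esub> x", OF I.a_rcos_self[OF that]]])
  have eq: "I +>\<^bsub>K\<^esub> x = I +>\<^bsub>K\<^esub> y" if "x \<in> carrier K" "y \<in> carrier K" "\<phi> x = \<phi> y" for x y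
  proof -
    have "\<phi> (x \<ominus>\<^bsub>K\<^esub> y) a b = 0" for a b
      unfolding a_minus_def add[OF that(1) K.a_inv_closed[OF that(2)]] neg[OF that(2)] that(3) by simp
    moreover have "x \<ominus>\<^bsub>K\<^esub> y \<in> carrier K" using that(1,2) by (rule K.minus_closed)
    ultimately have "x \<ominus>\<^bsub>K\<^esub> y \<in> I" unfolding I by blast
    moreover have "x = (x \<ominus>\<^bsub>K\<^esub> y) \<oplus>\<^bsub>K\<^esub> y" using that(1,2) by (simp add: a_minus_def K.a_assoc K.l_neg)
    ultimately have "x \<in> I +>\<^bsub>K\<^esub> y" unfolding a_r_coset_def' by blast
    then show ?thesis by (rule K.a_repr_independence[OF _ that(2) I.a_subgroup, symmetric])
  qed
  have Qadd: "(I +>\<^bsub>K\<^esub> x) \<oplus>\<^bsub>?Q\<^esub> (I +>\<^bsub>K\<^esub> y) = I +>\<^bsub>K\<^esub> (x \<oplus>\<^bsub>K\<^esub> y)" if "x \<in> carrier K" "y \<in> carrier K" for x y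
    using I.a_rcos_sum[OF that] by (simp add: quotient_simps)
  have Qmult: "(I +>\<^bsub>K\<^esub> x) \<otimes>\<^bsub>?Q\<^esub> (I +>\<^bsub>K\<^esub> y) = I +>\<^bsub>K\<^esub> (x \<otimes>\<^bsub>K\<^esub> y)" if "x \<in> carrier K" "y \<in> carrier K" for x y
    using I.rcoset_mult_add[OF that] by (simp add: quotient_simps)
  have Qscal: "s \<odot>\<^bsub>?Q\<^esub> (I +>\<^bsub>K\<^esub> x) = I +>\<^bsub>K\<^esub> (s \<odot>\<^bsub>K\<^esub> x)" if x: "x \<in> carrier K" for s x
  proof -
    have "I +>\<^bsub>K\<^esub> (s \<odot>\<^bsub>K\<^esub> y) = I +>\<^bsub>K\<^esub> (s \<odot>\<^bsub>K\<^esub> x)" if y: "y \<in> I +>\<^bsub>K\<^esub> x" for y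
    proof -
      have "y \<in> carrier K" using subsetD[OF K.a_r_coset_subset_G[OF I.a_subset x] y] .
      then show ?thesis using x rep[OF x y] by (intro eq K.scal_closed) (simp_all add: scal fun_eq_iff)
    qed
    then have "(\<Union>y\<in>I +>\<^bsub>K\<^esub> x. I +>\<^bsub>K\<^esub> (s \<odot>\<^bsub>K\<^esub> y)) = (\<Union>y\<in>I +>\<^bsub>K\<^esub> x. I +>\<^bsub>K\<^esub> (s \<odot>\<^bsub>K\<^esub> x))"
      by (rule SUP_cong[OF refl])
    moreover have "I +>\<^bsub>K\<^esub> x \<noteq> {}" using I.a_rcos_self[OF x] by blast
    ultimately show ?thesis by (simp only: quotient_simps UN_constant if_False)
  qed
  have cf_mem: "?cf X \<in> coords N c" if "X \<in> carrier ?Q" for X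
    using that surj cfx unfolding Qc by auto
  have Qone: "\<one>\<^bsub>?Q\<^esub> = I +>\<^bsub>K\<^esub> \<one>\<^bsub>K\<^esub>" by (simp add: quotient_simps)
  have Qzero: "\<zero>\<^bsub>?Q\<^esub> = I +>\<^bsub>K\<^esub> \<zero>\<^bsub>K\<^esub>" using K.a_coset_join2[OF K.zero_closed I.a_subgroup] I.zero_closed by (simp add: quotient_simps)
  have inj: "inj_on ?cf (carrier ?Q)"
  proof (rule inj_onI)
    fix X Y assume XY: "X \<in> carrier ?Q" "Y \<in> carrier ?Q" "?cf X = ?cf Y"
    obtain x y where xy: "x \<in> carrier K" "y \<in> carrier K" "X = I +>\<^bsub>K\<^esub> x" "Y = I +>\<^bsub>K\<^esub> y"
      using XY(1,2) unfolding Qc by blast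
    have "\<phi> x = \<phi> y" using XY(3) unfolding xy(3,4) cfx[OF xy(1)] cfx[OF xy(2)] .
    then show "X = Y" unfolding xy(3,4) by (rule eq[OF xy(1,2)])
  qed
  interpret M: nak N c "kup N c :: ('k, nat \<Rightarrow> 'k) module" co by (rule kup_nak)
  let ?KK = "kup N c :: ('k, nat \<Rightarrow> 'k) module"
  have cfadd: "?cf (X \<oplus>\<^bsub>?Q\<^esub> Y) i l = ?cf X i l + ?cf Y i l" if "X \<in> carrier ?Q" "Y \<in> carrier ?Q" for X Y i l
    using that unfolding Qc by (auto simp: Qadd cfx add)
  have cfmult: "?cf (X \<otimes>\<^bsub>?Q\<^esub> Y) i l = (if l < c i then \<Sum>m\<le>l. ?cf X i m * ?cf Y (i + m) (l - m) else 0)"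
    if "X \<in> carrier ?Q" "Y \<in> carrier ?Q" for X Y i l
    using that unfolding Qc by (auto simp: Qmult cfx mult)
  have cfscal: "?cf (s \<odot>\<^bsub>?Q\<^esub> X) i l = s * ?cf X i l" if "X \<in> carrier ?Q" for s X i l
    using that unfolding Qc by (auto simp: Qscal cfx scal K.scal_closed)
  have cl: "X \<oplus>\<^bsub>?Q\<^esub> Y \<in> carrier ?Q" "X \<otimes>\<^bsub>?Q\<^esub> Y \<in> carrier ?Q" "s \<odot>\<^bsub>?Q\<^esub> X \<in> carrier ?Q"
    if "X \<in> carrier ?Q" "Y \<in> carrier ?Q" for X Y s
  proof -
    obtain x y where xy: "x \<in> carrier K" "y \<in> carrier K" "X = I +>\<^bsub>K\<^esub> x" "Y = I +>\<^bsub>K\<^esub> y" using \<open>X \<in> _\<close> \<open>Y \<in> _\<close> unfolding Qc by blast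
    show "X \<oplus>\<^bsub>?Q\<^esub> Y \<in> carrier ?Q" unfolding Qc using xy Qadd K.a_closed by blast
    show "X \<otimes>\<^bsub>?Q\<^esub> Y \<in> carrier ?Q" unfolding Qc using xy Qmult K.m_closed by blast
    show "s \<odot>\<^bsub>?Q\<^esub> X \<in> carrier ?Q" unfolding Qc using xy Qscal K.scal_closed by blast
  qed
  have one_c: "\<one>\<^bsub>?Q\<^esub> \<in> carrier ?Q" unfolding Qc Qone by blast
  have zero_c: "\<zero>\<^bsub>?Q\<^esub> \<in> carrier ?Q" unfolding Qc Qzero by blast
  have mkc: "mk (?cf X) \<in> carrier ?KK" if "X \<in> carrier ?Q" for X
  proof -
    have "co (mk (?cf X)) = ?cf X" by (intro ext) simp
    then show ?thesis using cf_mem[OF that] by (simp add: kup_def)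
  qed
  have "k_algebra ?Q"
  proof (rule k_algebra_transport[of ?KK ?Q "\<lambda>X. mk (?cf X)"])
    show "inj_on (\<lambda>X. mk (?cf X)) (carrier ?Q)"
    proof (rule inj_onI)
      fix X Y assume XY: "X \<in> carrier ?Q" "Y \<in> carrier ?Q" "mk (?cf X) = mk (?cf Y)"
      have "?cf X = ?cf Y"
      proof (intro ext)
        fix i l
        have "co (mk (?cf X)) i l = co (mk (?cf Y)) i l" by (simp only: XY(3))
        then show "?cf X i l = ?cf Y i l" by simp
      qed
      then show "X = Y" using inj XY(1,2) by (simp add: inj_on_def)
    qed
    show "mk (?cf \<zero>\<^bsub>?Q\<^esub>) = \<zero>\<^bsub>?KK\<^esub>"
      unfolding Qzero cfx[OF K.zero_closed] by (rule co_eqI) (simp add: zero kup_def)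
    fix X assume X: "X \<in> carrier ?Q"
    have one': "mk (?cf \<one>\<^bsub>?Q\<^esub>) = \<one>\<^bsub>?KK\<^esub>"
      unfolding Qone cfx[OF K.one_closed] by (rule co_eqI) (simp add: one kup_def)
    show "mk (?cf \<one>\<^bsub>?Q\<^esub>) \<otimes>\<^bsub>?KK\<^esub> mk (?cf X) = mk (?cf X)" "mk (?cf X) \<otimes>\<^bsub>?KK\<^esub> mk (?cf \<one>\<^bsub>?Q\<^esub>) = mk (?cf X)"
      unfolding one' using M.l_one[OF mkc[OF X]] M.r_one[OF mkc[OF X]] .
    show "s \<odot>\<^bsub>?Q\<^esub> X \<in> carrier ?Q \<and> mk (?cf (s \<odot>\<^bsub>?Q\<^esub> X)) = s \<odot>\<^bsub>?KK\<^esub> mk (?cf X)" for s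
      using cl(3)[OF X X] cfscal[OF X] by (intro conjI co_eqI) (simp_all add: kup_def)
    have "mk (?cf ((-1) \<odot>\<^bsub>?Q\<^esub> X)) = \<ominus>\<^bsub>?KK\<^esub> mk (?cf X)"
      by (rule co_eqI) (simp add: cfscal[OF X] M.cf_neg[OF mkc[OF X]])
    then show "\<exists>Y\<in>carrier ?Q. mk (?cf Y) = \<ominus>\<^bsub>?KK\<^esub> mk (?cf X)" using cl(3)[OF X X] by blast
    fix Y assume Y: "Y \<in> carrier ?Q"
    show "X \<oplus>\<^bsub>?Q\<^esub> Y \<in> carrier ?Q \<and> mk (?cf (X \<oplus>\<^bsub>?Q\<^esub> Y)) = mk (?cf X) \<oplus>\<^bsub>?KK\<^esub> mk (?cf Y)"
      using cl(1)[OF X Y] cfadd[OF X Y] by (intro conjI co_eqI) (simp_all add: kup_def)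
    show "X \<otimes>\<^bsub>?Q\<^esub> Y \<in> carrier ?Q \<and> mk (?cf (X \<otimes>\<^bsub>?Q\<^esub> Y)) = mk (?cf X) \<otimes>\<^bsub>?KK\<^esub> mk (?cf Y)"
      using cl(2)[OF X Y] cfmult[OF X Y] by (intro conjI co_eqI) (simp_all add: kup_def)
  qed (rule mkc one_c zero_c M.k_algebra_axioms | assumption)+
  then show "nak N c ?Q ?cf"
  proof (intro nak.intro kupisch_axioms nak_axioms.intro)
    show "bij_betw ?cf (carrier ?Q) (coords N c)"
      unfolding bij_betw_def
    proof (intro conjI inj equalityI subsetI)
      fix f :: "nat \<Rightarrow> nat \<Rightarrow> 'k" assume "f \<in> coords N c"
      then have "f \<in> \<phi> ` carrier K" by (simp only: surj)
      then obtain x where x: "f = \<phi> x" "x \<in> carrier K" by (rule imageE)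
      have "I +>\<^bsub>K\<^esub> x \<in> carrier ?Q" unfolding Qc using x by blast
      then show "f \<in> ?cf ` carrier ?Q" using cfx[OF x(2)] x(1) by (intro image_eqI[of f ?cf "I +>\<^bsub>K\<^esub> x"]) simp_all
    qed (use cf_mem in auto)
    show "?cf \<one>\<^bsub>?Q\<^esub> i l = (if l = 0 then 1 else 0)" for i l
      unfolding Qone cfx[OF K.one_closed] by (rule one)
  qed (simp_all only: cfadd cfmult cfscal)
qed

section \<open>Path algebras and monomial ideals\<close>

lemma awlast_eq: "pre_digraph.awlast Q u p = (if p = [] then u else head Q (last p))"
  by (simp add: pre_digraph.awalk_verts_conv)

lemma awlast_append: "pre_digraph.awlast Q (pre_digraph.awlast Q u p) q = pre_digraph.awlast Q u (p @ q)"
  by (simp add: awlast_eq)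

lemma path_algebra_simps:
  "f \<in> carrier (path_algebra Q) \<longleftrightarrow> finite {p. f p \<noteq> 0} \<and> {p. f p \<noteq> 0} \<subseteq> paths Q"
  "(f \<otimes>\<^bsub>path_algebra Q\<^esub> g) (u, p) = (\<Sum>i\<le>length p. f (u, take i p) * g (pre_digraph.awlast Q u (take i p), drop i p))"
  "\<one>\<^bsub>path_algebra Q\<^esub> (u, p) = (if u \<in> verts Q \<and> p = [] then 1 else 0)"
  "\<zero>\<^bsub>path_algebra Q\<^esub> = (\<lambda>_. 0)" "(f \<oplus>\<^bsub>path_algebra Q\<^esub> g) = (\<lambda>p. f p + g p)"
  "(s \<odot>\<^bsub>path_algebra Q\<^esub> f) = (\<lambda>p. s * f p)"
  by (simp_all add: path_algebra_def)

lemma (in wf_digraph) paths_append: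
  assumes "(u, p) \<in> paths G" "(awlast u p, q) \<in> paths G"
  shows "(u, p @ q) \<in> paths G"
proof -
  obtain v where v: "awalk u p v" using assms(1) by (auto simp: paths_def)
  then have l: "awlast u p = v" by (rule awalkE)
  obtain w where w: "awalk (awlast u p) q w" using assms(2) by (auto simp: paths_def)
  have "awalk u (p @ q) w" using v w unfolding l by (rule awalk_appendI)
  then show ?thesis by (auto simp: paths_def)
qed

lemma (in wf_digraph) paths_ends:
  assumes "(u, p) \<in> paths G"
  shows "u \<in> verts G" "awlast u p \<in> verts G"
proof -
  obtain v where v: "awalk u p v" using assms by (auto simp: paths_def)
  then have l: "awlast u p = v" by (rule awalkE)
  show "u \<in> verts G" by (rule awalk_hd_in_verts[OF v])
  show "awlast u p \<in> verts G" unfolding l by (rule awalk_last_in_verts[OF v])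
qed

lemma (in fin_digraph) path_algebra_algebra: "k_algebra (path_algebra G :: ('k::field, ('a, 'b) path \<Rightarrow> 'k) module)"
proof -
  let ?K = "path_algebra G :: ('k, ('a, 'b) path \<Rightarrow> 'k) module"
  note d = path_algebra_simps
  have ab: "abelian_group ?K"
  proof (rule abelian_groupI)
    fix f g assume fg: "f \<in> carrier ?K" "g \<in> carrier ?K"
    have "{p. f p + g p \<noteq> 0} \<subseteq> {p. f p \<noteq> 0} \<union> {p. g p \<noteq> 0}" by auto
    then show "f \<oplus>\<^bsub>?K\<^esub> g \<in> carrier ?K" using fg finite_subset unfolding d by blast
  next
    fix f assume "f \<in> carrier ?K"
    then show "\<exists>g\<in>carrier ?K. g \<oplus>\<^bsub>?K\<^esub> f = \<zero>\<^bsub>?K\<^esub>" by (intro bexI[of _ "\<lambda>p. - f p"]) (simp_all add: d)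
  qed (simp_all add: d add_ac)
  have closed: "f \<otimes>\<^bsub>?K\<^esub> g \<in> carrier ?K" if fg: "f \<in> carrier ?K" "g \<in> carrier ?K" for f g
  proof -
    let ?S = "(\<lambda>((u, p), (v, q)). (u, p @ q)) ` ({x. f x \<noteq> 0} \<times> {x. g x \<noteq> 0})"
    have key: "x \<in> ?S \<inter> paths G" if nz: "(f \<otimes>\<^bsub>?K\<^esub> g) x \<noteq> 0" for x
    proof -
      obtain u p where x: "x = (u, p)" by (cases x)
      have "(\<Sum>i\<le>length p. f (u, take i p) * g (awlast u (take i p), drop i p)) \<noteq> 0" using nz unfolding x d .
      then obtain i where i: "f (u, take i p) \<noteq> 0" "g (awlast u (take i p), drop i p) \<noteq> 0"
        by (metis (no_types, lifting) mult_eq_0_iff sum.neutral)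
      have "(u, take i p) \<in> paths G" "(awlast u (take i p), drop i p) \<in> paths G" using i fg unfolding d by blast+
      then have "(u, take i p @ drop i p) \<in> paths G" by (rule paths_append)
      moreover have "(u, take i p @ drop i p) \<in> ?S"
        using i by (intro image_eqI[of _ _ "((u, take i p), (awlast u (take i p), drop i p))"]) auto
      ultimately show ?thesis by (simp add: x)
    qed
    have "finite ?S" using fg unfolding d by blast
    then have "finite {x. (f \<otimes>\<^bsub>?K\<^esub> g) x \<noteq> 0}" by (rule rev_finite_subset) (use key in blast)
    then show ?thesis using key unfolding d(1) by blast
  qed
  have assoc: "f \<otimes>\<^bsub>?K\<^esub> g \<otimes>\<^bsub>?K\<^esub> h = f \<otimes>\<^bsub>?K\<^esub> (g \<otimes>\<^bsub>?K\<^esub> h)" for f g h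
  proof
    fix x :: "('a, 'b) path"
    obtain u p where x: "x = (u, p)" by (cases x)
    let ?n = "length p" and ?w = "\<lambda>i. awlast u (take i p)"
    have "(f \<otimes>\<^bsub>?K\<^esub> g \<otimes>\<^bsub>?K\<^esub> h) x = (\<Sum>k\<le>?n. \<Sum>i\<le>k. f (u, take i p) * g (?w i, take (k - i) (drop i p)) * h (?w k, drop k p))"
      unfolding x d
    proof (rule sum.cong[OF refl])
      fix k assume "k \<in> {..?n}"
      then show "(\<Sum>i\<le>length (take k p). f (u, take i (take k p)) * g (awlast u (take i (take k p)), drop i (take k p))) * h (?w k, drop k p)
          = (\<Sum>i\<le>k. f (u, take i p) * g (?w i, take (k - i) (drop i p)) * h (?w k, drop k p))"
        unfolding sum_distrib_right by (intro sum.cong) (auto simp: min_def drop_take)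
    qed
    also have "\<dots> = (\<Sum>i\<le>?n. \<Sum>m\<le>?n - i. f (u, take i p) * g (?w i, take m (drop i p)) * h (?w (i + m), drop (i + m) p))"
      by (subst triangle_swap) simp
    also have "\<dots> = (f \<otimes>\<^bsub>?K\<^esub> (g \<otimes>\<^bsub>?K\<^esub> h)) x"
    proof -
      have w: "awlast (?w i) (take m (drop i p)) = ?w (i + m)" for i m by (simp only: awlast_append take_add)
      have dr: "drop m (drop i p) = drop (i + m) p" for i m by (simp add: add.commute)
      show ?thesis unfolding x d sum_distrib_left w dr length_drop by (simp only: mult.assoc)
    qed
    finally show "(f \<otimes>\<^bsub>?K\<^esub> g \<otimes>\<^bsub>?K\<^esub> h) x = (f \<otimes>\<^bsub>?K\<^esub> (g \<otimes>\<^bsub>?K\<^esub> h)) x" .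
  qed
  have one: "\<one>\<^bsub>?K\<^esub> \<in> carrier ?K"
  proof -
    have s: "{p. \<one>\<^bsub>?K\<^esub> p \<noteq> 0} = (\<lambda>u. (u, [])) ` verts G" by (auto simp: d split: if_splits)
    show ?thesis unfolding d(1) s by (auto simp: paths_def awalk_Nil_iff)
  qed
  have supp: "f x = 0" if "f \<in> carrier ?K" "x \<notin> paths G" for f x using that unfolding d(1) by blast
  have monoid: "monoid ?K"
  proof (rule monoidI)
    fix f assume f: "f \<in> carrier ?K"
    show "\<one>\<^bsub>?K\<^esub> \<otimes>\<^bsub>?K\<^esub> f = f"
    proof
      fix x :: "('a, 'b) path"
      obtain u p where x: "x = (u, p)" by (cases x)
      have "(\<one>\<^bsub>?K\<^esub> \<otimes>\<^bsub>?K\<^esub> f) x = (\<Sum>i\<le>length p. if i = 0 then (if u \<in> verts G then f x else 0) else 0)"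
        unfolding x d by (intro sum.cong) (auto simp: awlast_eq)
      also have "\<dots> = f x" using supp[OF f, of x] paths_ends(1)[of u p] by (auto simp: x)
      finally show "(\<one>\<^bsub>?K\<^esub> \<otimes>\<^bsub>?K\<^esub> f) x = f x" .
    qed
    show "f \<otimes>\<^bsub>?K\<^esub> \<one>\<^bsub>?K\<^esub> = f"
    proof
      fix x :: "('a, 'b) path"
      obtain u p where x: "x = (u, p)" by (cases x)
      have "(f \<otimes>\<^bsub>?K\<^esub> \<one>\<^bsub>?K\<^esub>) x = (\<Sum>i\<le>length p. if i = length p then (if awlast u p \<in> verts G then f x else 0) else 0)"
        unfolding x d by (intro sum.cong) auto
      also have "\<dots> = f x" using supp[OF f, of x] paths_ends(2)[of u p] by (auto simp: x)
      finally show "(f \<otimes>\<^bsub>?K\<^esub> \<one>\<^bsub>?K\<^esub>) x = f x" .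
    qed
  qed (simp_all only: closed assoc one)
  have "ring ?K"
  proof (rule ringI[OF ab monoid])
    fix f g h
    show "(f \<oplus>\<^bsub>?K\<^esub> g) \<otimes>\<^bsub>?K\<^esub> h = f \<otimes>\<^bsub>?K\<^esub> h \<oplus>\<^bsub>?K\<^esub> g \<otimes>\<^bsub>?K\<^esub> h"
      by (intro ext) (auto simp: d sum.distrib distrib_right)
    show "h \<otimes>\<^bsub>?K\<^esub> (f \<oplus>\<^bsub>?K\<^esub> g) = h \<otimes>\<^bsub>?K\<^esub> f \<oplus>\<^bsub>?K\<^esub> h \<otimes>\<^bsub>?K\<^esub> g"
      by (intro ext) (auto simp: d sum.distrib distrib_left)
  qed
  then show ?thesis
  proof (intro k_algebra.intro k_algebra_axioms.intro)
    fix f and s :: 'k assume f: "f \<in> carrier ?K"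
    have "{p. s * f p \<noteq> 0} \<subseteq> {p. f p \<noteq> 0}" by auto
    then show "s \<odot>\<^bsub>?K\<^esub> f \<in> carrier ?K" using f finite_subset unfolding d by blast
    fix g
    show "s \<odot>\<^bsub>?K\<^esub> (f \<otimes>\<^bsub>?K\<^esub> g) = s \<odot>\<^bsub>?K\<^esub> f \<otimes>\<^bsub>?K\<^esub> g" "s \<odot>\<^bsub>?K\<^esub> (f \<otimes>\<^bsub>?K\<^esub> g) = f \<otimes>\<^bsub>?K\<^esub> (s \<odot>\<^bsub>?K\<^esub> g)"
      by (intro ext, auto simp: d sum_distrib_left mult_ac)+
  qed (simp_all add: d algebra_simps)
qed

definition contains_relation :: "('v, 'e) pre_digraph \<Rightarrow> ('v, 'e) path set \<Rightarrow> 'v \<Rightarrow> 'e list \<Rightarrow> bool" where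
  "contains_relation Q R u p \<longleftrightarrow> (\<exists>p1 q p2. p = p1 @ q @ p2 \<and> (pre_digraph.awlast Q u p1, q) \<in> R)"

lemma path_vector_mult:
  "path_vector (u, p) \<otimes>\<^bsub>path_algebra Q\<^esub> path_vector (pre_digraph.awlast Q u p, q) = (path_vector (u, p @ q) :: _ \<Rightarrow> 'k::field)"
proof
  fix x :: "('a, 'b) path"
  obtain v r where x: "x = (v, r)" by (cases x)
  have "(path_vector (u, p) \<otimes>\<^bsub>path_algebra Q\<^esub> path_vector (pre_digraph.awlast Q u p, q)) x =
      (\<Sum>i\<le>length r. if i = length p then (if x = (u, p @ q) then 1 else 0) else (0::'k))"
    unfolding x path_algebra_simps
  proof (rule sum.cong[OF refl])
    fix i assume "i \<in> {..length r}"
    then have len: "length (take i r) = i" by simp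
    show "path_vector (u, p) (v, take i r) * path_vector (pre_digraph.awlast Q u p, q) (pre_digraph.awlast Q v (take i r), drop i r)
        = (if i = length p then (if (v, r) = (u, p @ q) then 1 else 0) else (0::'k))"
    proof (cases "v = u \<and> r = p @ q \<and> i = length p")
      case True
      then show ?thesis by (simp add: path_vector_def)
    next
      case False
      have "\<not> (v = u \<and> take i r = p \<and> drop i r = q)"
      proof
        assume a: "v = u \<and> take i r = p \<and> drop i r = q"
        then have "r = p @ q" using append_take_drop_id[of i r] by simp
        then show False using False a len by simp
      qed
      then have "(v, take i r) \<noteq> (u, p) \<or> (pre_digraph.awlast Q v (take i r), drop i r) \<noteq> (pre_digraph.awlast Q u p, q)"
        by blast
      then have "path_vector (u, p) (v, take i r) * path_vector (pre_digraph.awlast Q u p, q) (pre_digraph.awlast Q v (take i r), drop i r) = (0::'k)"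
        unfolding path_vector_def by (elim disjE) (simp_all only: if_False mult_zero_left mult_zero_right)
      then show ?thesis using False by auto
    qed
  qed
  also have "\<dots> = path_vector (u, p @ q) x" by (auto simp: x path_vector_def)
  finally show "(path_vector (u, p) \<otimes>\<^bsub>path_algebra Q\<^esub> path_vector (pre_digraph.awlast Q u p, q)) x = (path_vector (u, p @ q) x :: 'k)" .
qed

lemma (in abelian_group) additive_subgroupI:
  assumes "H \<subseteq> carrier G" "\<zero> \<in> H" "\<And>x. x \<in> H \<Longrightarrow> \<ominus> x \<in> H" "\<And>x y. x \<in> H \<Longrightarrow> y \<in> H \<Longrightarrow> x \<oplus> y \<in> H"
  shows "subgroup H (add_monoid G)"
  by (rule add.subgroupI) (use assms in \<open>auto simp: a_inv_def\<close>)

text \<open>The ideal generated by a set of paths is spanned by the paths that pass through one of them.\<close>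

lemma (in fin_digraph) relation_ideal_monomial:
  assumes R: "R \<subseteq> paths G"
  shows "(relation_ideal G R :: (('a, 'b) path \<Rightarrow> 'k::field) set) =
    {f \<in> carrier (path_algebra G). \<forall>u p. f (u, p) \<noteq> 0 \<longrightarrow> contains_relation G R u p}" (is "_ = ?MI")
proof
  let ?K = "path_algebra G :: ('k, ('a, 'b) path \<Rightarrow> 'k) module"
  interpret K: k_algebra ?K by (rule path_algebra_algebra)
  note d = path_algebra_simps
  have pv: "path_vector x \<in> carrier ?K" if "x \<in> paths G" for x
    using that by (auto simp: d(1) path_vector_def)
  have mult_left: "f \<otimes>\<^bsub>?K\<^esub> g \<in> ?MI" if fg: "f \<in> carrier ?K" "g \<in> ?MI" for f g
  proof -
    have "contains_relation G R u p" if nz: "(f \<otimes>\<^bsub>?K\<^esub> g) (u, p) \<noteq> 0" for u p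
    proof -
      obtain i where "g (awlast u (take i p), drop i p) \<noteq> 0"
        using nz unfolding d by (metis (no_types, lifting) mult_eq_0_iff sum.neutral)
      then have "contains_relation G R (awlast u (take i p)) (drop i p)" using fg(2) by blast
      then obtain p1 q p2 where "drop i p = p1 @ q @ p2" "(awlast (awlast u (take i p)) p1, q) \<in> R"
        unfolding contains_relation_def by blast
      then have "p = (take i p @ p1) @ q @ p2" "(awlast u (take i p @ p1), q) \<in> R"
        using append_take_drop_id[of i p] by (simp_all add: awlast_append)
      then show ?thesis unfolding contains_relation_def by blast
    qed
    then show ?thesis using K.m_closed fg by blast
  qed
  have mult_right: "g \<otimes>\<^bsub>?K\<^esub> f \<in> ?MI" if fg: "f \<in> carrier ?K" "g \<in> ?MI" for f g
  proof -
    have "contains_relation G R u p" if nz: "(g \<otimes>\<^bsub>?K\<^esub> f) (u, p) \<noteq> 0" for u p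
    proof -
      obtain i where "g (u, take i p) \<noteq> 0"
        using nz unfolding d by (metis (no_types, lifting) mult_eq_0_iff sum.neutral)
      then have "contains_relation G R u (take i p)" using fg(2) by blast
      then obtain p1 q p2 where "take i p = p1 @ q @ p2" "(awlast u p1, q) \<in> R"
        unfolding contains_relation_def by blast
      then have "p = p1 @ q @ (p2 @ drop i p)" "(awlast u p1, q) \<in> R"
        using append_take_drop_id[of i p] by simp_all
      then show ?thesis unfolding contains_relation_def by blast
    qed
    then show ?thesis using K.m_closed fg by blast
  qed
  have ideal: "ideal ?MI ?K"
  proof (rule idealI[OF K.ring_axioms])
    have neg: "\<ominus>\<^bsub>?K\<^esub> f \<in> ?MI" if f: "f \<in> ?MI" for f
    proof -
      have m: "(\<lambda>p. - f p) \<in> carrier ?K" using f by (simp add: d(1))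
      have "(\<lambda>p. - f p) \<oplus>\<^bsub>?K\<^esub> f = \<zero>\<^bsub>?K\<^esub>" by (simp add: d)
      then have "\<ominus>\<^bsub>?K\<^esub> f = (\<lambda>p. - f p)" using K.minus_equality[of "\<lambda>p. - f p" f] m f by simp
      then show ?thesis using f m by simp
    qed
    have add: "f \<oplus>\<^bsub>?K\<^esub> g \<in> ?MI" if fg: "f \<in> ?MI" "g \<in> ?MI" for f g
    proof -
      have "contains_relation G R u p" if "f (u, p) + g (u, p) \<noteq> 0" for u p
        using that fg by (cases "f (u, p) = 0") auto
      then show ?thesis using K.a_closed[of f g] fg unfolding d(5) by blast
    qed
    have zero: "\<zero>\<^bsub>?K\<^esub> \<in> ?MI" using K.zero_closed by (simp add: d(4))
    show "subgroup ?MI (add_monoid ?K)"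
      by (rule K.additive_subgroupI[OF _ zero neg add]) auto
  qed (rule mult_left, assumption, assumption, rule mult_right, assumption, assumption)
  have "path_vector ` R \<subseteq> ?MI"
  proof
    fix x :: "('a, 'b) path \<Rightarrow> 'k" assume "x \<in> path_vector ` R"
    then obtain u q where q: "(u, q) \<in> R" "x = path_vector (u, q)" by auto
    have "contains_relation G R u q" unfolding contains_relation_def
      using q(1) by (intro exI[of _ "[]"] exI[of _ q]) (simp add: awlast_eq)
    then show "x \<in> ?MI" using q pv R by (auto simp: path_vector_def split: if_splits)
  qed
  then show "relation_ideal G R \<subseteq> ?MI" unfolding relation_ideal_def by (rule K.genideal_minimal[OF ideal])
  have R': "path_vector ` R \<subseteq> carrier ?K" using pv R by auto
  interpret I: ideal "relation_ideal G R" ?K unfolding relation_ideal_def by (rule K.genideal_ideal[OF R'])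
  have mono: "(\<lambda>x. s * path_vector (u, p) x) \<in> relation_ideal G R"
    if "contains_relation G R u p" "(u, p) \<in> paths G" for u p and s :: 'k
  proof -
    from that(1) obtain p1 q p2 where p: "p = p1 @ q @ p2" "(awlast u p1, q) \<in> R" unfolding contains_relation_def by blast
    from that(2) p(1) obtain w where w: "awalk u (p1 @ q @ p2) w" by (auto simp: paths_def)
    have P: "(u, p1) \<in> paths G" "(awlast u (p1 @ q), p2) \<in> paths G"
    proof -
      have c: "cas u (p1 @ (q @ p2)) w" "set (p1 @ q @ p2) \<subseteq> arcs G" "u \<in> verts G" using w by (auto simp: awalk_def)
      have 1: "awalk u p1 (awlast u p1)" using w by (simp add: awalk_append_iff)
      have 2: "awalk (awlast u (p1 @ q)) p2 w" using w unfolding append_assoc[symmetric] by (simp only: awalk_append_iff)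
      show "(u, p1) \<in> paths G" "(awlast u (p1 @ q), p2) \<in> paths G" using 1 2 by (auto simp: paths_def)
    qed
    let ?X = "path_vector (u, p1) :: ('a, 'b) path \<Rightarrow> 'k" and ?Y = "path_vector (awlast u p1, q) :: ('a, 'b) path \<Rightarrow> 'k"
      and ?Z = "path_vector (awlast u (p1 @ q), p2) :: ('a, 'b) path \<Rightarrow> 'k"
    have X: "?X \<in> carrier ?K" by (rule pv[OF P(1)])
    have Y: "?Y \<in> carrier ?K" by (rule pv[OF subsetD[OF R p(2)]])
    have Z: "?Z \<in> carrier ?K" by (rule pv[OF P(2)])
    have "?Y \<in> relation_ideal G R"
      unfolding relation_ideal_def by (rule subsetD[OF K.genideal_self[OF R'] imageI[OF p(2)]])
    then have "(s \<odot>\<^bsub>?K\<^esub> ?X \<otimes>\<^bsub>?K\<^esub> ?Y) \<otimes>\<^bsub>?K\<^esub> ?Z \<in> relation_ideal G R"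
      by (rule I.I_r_closed[OF I.I_l_closed[OF _ K.scal_closed[OF X]] Z])
    moreover have "s \<odot>\<^bsub>?K\<^esub> ((?X \<otimes>\<^bsub>?K\<^esub> ?Y) \<otimes>\<^bsub>?K\<^esub> ?Z) = (s \<odot>\<^bsub>?K\<^esub> ?X \<otimes>\<^bsub>?K\<^esub> ?Y) \<otimes>\<^bsub>?K\<^esub> ?Z"
      by (simp only: K.scal_mult_left[OF X Y] K.scal_mult_left[OF K.m_closed[OF X Y] Z])
    moreover have "(?X \<otimes>\<^bsub>?K\<^esub> ?Y) \<otimes>\<^bsub>?K\<^esub> ?Z = path_vector (u, p)"
      by (simp only: path_vector_mult p(1) append_assoc)
    ultimately show ?thesis by (simp only: d(6))
  qed
  have "f \<in> relation_ideal G R" if "finite S" "f \<in> ?MI" "\<And>x. f x \<noteq> 0 \<Longrightarrow> x \<in> S" for f S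
    using that
  proof (induction S arbitrary: f)
    case empty
    have "f x = 0" for x using empty.prems(2)[of x] by blast
    then have "f = \<zero>\<^bsub>?K\<^esub>" unfolding d(4) by (rule ext)
    then show ?case using I.zero_closed by simp
  next
    case (insert x S)
    obtain u p where x: "x = (u, p)" by (cases x)
    have fc: "f \<in> carrier ?K" and fr: "\<And>u p. f (u, p) \<noteq> 0 \<Longrightarrow> contains_relation G R u p"
      using insert.prems(1) by simp_all
    show ?case
    proof (cases "f x = 0")
      case True
      have "y \<in> S" if "f y \<noteq> 0" for y using insert.prems(2)[OF that] that True by auto
      then show ?thesis by (rule insert.IH[OF insert.prems(1)])
    next
      case False
      define g where "g = (\<lambda>y. if y = x then 0 else f y)"
      have "{p. g p \<noteq> 0} \<subseteq> {p. f p \<noteq> 0}" by (auto simp: g_def)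
      moreover have fin: "finite {p. f p \<noteq> 0}" "{p. f p \<noteq> 0} \<subseteq> paths G" using fc by (simp_all add: d(1))
      ultimately have gc: "g \<in> carrier ?K" unfolding d(1) by (meson finite_subset subset_trans)
      have gr: "contains_relation G R v r" if "g (v, r) \<noteq> 0" for v r
        using that fr[of v r] by (auto simp: g_def split: if_splits)
      have gS: "y \<in> S" if "g y \<noteq> 0" for y using insert.prems(2)[of y] that by (auto simp: g_def split: if_splits)
      have g: "g \<in> relation_ideal G R" by (rule insert.IH) (use gc gr gS in simp_all)
      have "contains_relation G R u p" using fr False unfolding x .
      moreover have "(u, p) \<in> paths G" using fin(2) False unfolding x by blast
      ultimately have "(\<lambda>y. f x * path_vector (u, p) y) \<in> relation_ideal G R" by (rule mono)
      then have "g \<oplus>\<^bsub>?K\<^esub> (\<lambda>y. f x * path_vector (u, p) y) \<in> relation_ideal G R" by (rule I.a_closed[OF g])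
      moreover have "g \<oplus>\<^bsub>?K\<^esub> (\<lambda>y. f x * path_vector (u, p) y) = f"
        unfolding d(5) by (intro ext) (auto simp: g_def path_vector_def x)
      ultimately show ?thesis by (simp only:)
    qed
  qed
  note all = this
  show "?MI \<subseteq> relation_ideal G R"
  proof
    fix f :: "('a, 'b) path \<Rightarrow> 'k" assume f: "f \<in> ?MI"
    then have "finite {x. f x \<noteq> 0}" by (simp add: d(1))
    then show "f \<in> relation_ideal G R" using f by (rule all) simp
  qed
qed

section \<open>Cyclic and linear quivers\<close>

definition cyc_path :: "nat \<Rightarrow> nat \<Rightarrow> nat \<Rightarrow> nat list" where
  "cyc_path N u l = map (\<lambda>i. (u + i) mod N) [0..<l]"

lemma length_cyc_path [simp]: "length (cyc_path N u l) = l"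
  by (simp add: cyc_path_def)

lemma cyc_path_0 [simp]: "cyc_path N u 0 = []"
  by (simp add: cyc_path_def)

lemma take_cyc_path: "m \<le> l \<Longrightarrow> take m (cyc_path N u l) = cyc_path N u m"
  by (simp add: cyc_path_def take_map)

lemma drop_cyc_path: "m \<le> l \<Longrightarrow> drop m (cyc_path N u l) = cyc_path N (u + m) (l - m)"
  by (rule nth_equalityI) (auto simp: cyc_path_def add.assoc)

lemma cyc_path_cong: "u mod N = u' mod N \<Longrightarrow> cyc_path N u l = cyc_path N u' l"
  unfolding cyc_path_def by (intro map_cong refl) (metis mod_add_left_eq)

lemma cyc_path_mod [simp]: "cyc_path N (u mod N) l = cyc_path N u l"
  by (rule cyc_path_cong) simp

lemma cyc_path_Suc: "cyc_path N u (Suc l) = (u mod N) # cyc_path N (Suc u) l"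
proof (rule nth_equalityI)
  fix i assume "i < length (cyc_path N u (Suc l))"
  then have i: "i < Suc l" by simp
  have "cyc_path N u (Suc l) ! i = (u + i) mod N" using i by (simp add: cyc_path_def del: upt_Suc)
  moreover have "((u mod N) # cyc_path N (Suc u) l) ! i = (u + i) mod N"
    using i by (cases i) (simp_all add: cyc_path_def)
  ultimately show "cyc_path N u (Suc l) ! i = ((u mod N) # cyc_path N (Suc u) l) ! i" by simp
qed simp

lemma cyclic_quiver_simps [simp]:
  "verts (cyclic_quiver N) = {..<N}" "arcs (cyclic_quiver N) = {..<N}"
  "tail (cyclic_quiver N) = (\<lambda>i. i)" "head (cyclic_quiver N) = (\<lambda>i. Suc i mod N)"
  by (simp_all add: cyclic_quiver_def)

lemma awlast_cyc_path: "pre_digraph.awlast (cyclic_quiver N) (u mod N) (cyc_path N u l) = (u + l) mod N"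
proof (cases l)
  case (Suc m)
  have "last (cyc_path N u l) = (u + m) mod N" by (simp add: Suc cyc_path_def)
  moreover have "cyc_path N u l \<noteq> []" using Suc by (simp add: cyc_path_def)
  ultimately show ?thesis by (simp add: awlast_eq Suc mod_Suc_eq)
qed (simp add: awlast_eq)

lemma fin_cyclic_quiver: "0 < N \<Longrightarrow> fin_digraph (cyclic_quiver N)"
  by unfold_locales auto

lemma paths_cyclic_quiver:
  assumes "0 < N"
  shows "(u, p) \<in> paths (cyclic_quiver N) \<longleftrightarrow> u < N \<and> p = cyc_path N u (length p)"
proof -
  interpret fin_digraph "cyclic_quiver N" by (rule fin_cyclic_quiver[OF assms])
  show ?thesis
  proof (induction p arbitrary: u)
    case Nil
    then show ?case by (auto simp: paths_def awalk_Nil_iff)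
  next
    case (Cons e es)
    have "(u, e # es) \<in> paths (cyclic_quiver N) \<longleftrightarrow> e < N \<and> u = e \<and> (Suc e mod N, es) \<in> paths (cyclic_quiver N)"
      by (auto simp: paths_def awalk_Cons_iff)
    also have "\<dots> \<longleftrightarrow> e < N \<and> u = e \<and> es = cyc_path N (Suc e) (length es)"
      unfolding Cons.IH using assms by simp
    also have "\<dots> \<longleftrightarrow> u < N \<and> e # es = cyc_path N u (length (e # es))"
      unfolding length_Cons cyc_path_Suc by auto
    finally show ?case .
  qed
qed

definition cyc_coord :: "nat \<Rightarrow> (nat \<Rightarrow> nat) \<Rightarrow> ((nat, nat) path \<Rightarrow> 'k::zero) \<Rightarrow> nat \<Rightarrow> nat \<Rightarrow> 'k" where
  "cyc_coord N c f i l = (if l < c i then f (i mod N, cyc_path N i l) else 0)"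

definition long_paths :: "nat \<Rightarrow> (nat \<Rightarrow> nat) \<Rightarrow> ((nat, nat) path \<Rightarrow> 'k::field) set" where
  "long_paths N c = {f \<in> carrier (path_algebra (cyclic_quiver N)). \<forall>u p. f (u, p) \<noteq> 0 \<longrightarrow> c u \<le> length p}"

context kupisch
begin

text \<open>
  A path of the cyclic quiver is determined by its start and its length. Modulo the paths of length
  at least \<open>c i\<close> the coefficients at the remaining paths are the coordinates of a residue class.
\<close>

lemma cyclic_quotient:
  fixes I :: "((nat, nat) path \<Rightarrow> 'k::field) set"
  assumes I: "I = long_paths N c"
  shows "ideal I (path_algebra (cyclic_quiver N))"
    "nak N c (quotient_algebra (path_algebra (cyclic_quiver N)) I) (\<lambda>X. cyc_coord N c (SOME f. f \<in> X))"
proof -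
  let ?Q = "cyclic_quiver N"
  let ?K = "path_algebra ?Q :: ('k, (nat, nat) path \<Rightarrow> 'k) module"
  interpret fin_digraph ?Q by (rule fin_cyclic_quiver[OF N_pos])
  note d = path_algebra_simps
  have K: "k_algebra ?K" by (rule path_algebra_algebra)
  have per: "cyc_coord N c f (i + N) l = cyc_coord N c f i l" for f :: "(nat, nat) path \<Rightarrow> 'k" and i l
    using cyc_path_cong[of "i + N" N i l] by (simp add: cyc_coord_def c_add_N)
  have surj: "cyc_coord N c ` carrier ?K = coords N c"
  proof (intro equalityI subsetI)
    fix g assume "g \<in> cyc_coord N c ` carrier ?K"
    then obtain f where "g = cyc_coord N c f" by blast
    then show "g \<in> coords N c" using per[of f] by (simp add: coords_def) (simp add: cyc_coord_def)
  next
    fix g :: "nat \<Rightarrow> nat \<Rightarrow> 'k" assume g: "g \<in> coords N c"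
    have gN: "g (i + q * N) l = g i l" for i q l
    proof (induction q)
      case (Suc q)
      have "g (i + Suc q * N) l = g ((i + q * N) + N) l" by (simp add: algebra_simps)
      then show ?case using g Suc by (simp add: coords_def)
    qed simp
    have gmod: "g (i mod N) l = g i l" for i l using gN[of "i mod N" "i div N" l] by simp
    define f where "f = (\<lambda>(u, p). if u < N \<and> p = cyc_path N u (length p) \<and> length p < c u then g u (length p) else 0)"
    have sub: "{x. f x \<noteq> 0} \<subseteq> (\<lambda>(u, l). (u, cyc_path N u l)) ` (SIGMA u:{..<N}. {..<c u})"
    proof
      fix x assume "x \<in> {x. f x \<noteq> 0}"
      then obtain u p where x: "x = (u, p)" "u < N" "p = cyc_path N u (length p)" "length p < c u"
        by (cases x) (auto simp: f_def split: if_splits)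
      show "x \<in> (\<lambda>(u, l). (u, cyc_path N u l)) ` (SIGMA u:{..<N}. {..<c u})"
        by (rule image_eqI[of _ _ "(u, length p)"]) (use x in auto)
    qed
    have "finite (SIGMA u:{..<N}. {..<c u})" by auto
    then have "finite {x. f x \<noteq> 0}" by (rule finite_subset[OF sub finite_imageI])
    moreover have "{x. f x \<noteq> 0} \<subseteq> paths ?Q"
    proof
      fix x assume "x \<in> {x. f x \<noteq> 0}"
      then obtain u p where x: "x = (u, p)" "u < N" "p = cyc_path N u (length p)"
        by (cases x) (auto simp: f_def split: if_splits)
      then show "x \<in> paths ?Q" using paths_cyclic_quiver[OF N_pos, of u p] by blast
    qed
    ultimately have "f \<in> carrier ?K" unfolding d(1) by blast
    moreover have "cyc_coord N c f i l = g i l" for i l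
      using g N_pos by (auto simp: cyc_coord_def f_def c_mod gmod coords_def)
    then have "g = cyc_coord N c f" by (intro ext) simp
    ultimately show "g \<in> cyc_coord N c ` carrier ?K" by blast
  qed
  have add: "cyc_coord N c (f \<oplus>\<^bsub>?K\<^esub> g) i l = cyc_coord N c f i l + cyc_coord N c g i l" for f g i l
    by (simp add: cyc_coord_def d)
  have scal: "cyc_coord N c (s \<odot>\<^bsub>?K\<^esub> f) i l = s * cyc_coord N c f i l" for s f i l
    by (simp add: cyc_coord_def d)
  have one: "cyc_coord N c \<one>\<^bsub>?K\<^esub> i l = (if l = 0 then 1 else 0)" for i l
    using N_pos c_pos[of i] by (auto simp: cyc_coord_def d cyc_path_def)
  have mult: "cyc_coord N c (f \<otimes>\<^bsub>?K\<^esub> g) i l = (if l < c i then \<Sum>m\<le>l. cyc_coord N c f i m * cyc_coord N c g (i + m) (l - m) else 0)" for f g i l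
  proof (cases "l < c i")
    case True
    have "cyc_coord N c (f \<otimes>\<^bsub>?K\<^esub> g) i l = (\<Sum>m\<le>l. f (i mod N, take m (cyc_path N i l)) *
        g (awlast (i mod N) (take m (cyc_path N i l)), drop m (cyc_path N i l)))"
      using True by (simp add: cyc_coord_def d)
    also have "\<dots> = (\<Sum>m\<le>l. cyc_coord N c f i m * cyc_coord N c g (i + m) (l - m))"
    proof (rule sum.cong[OF refl])
      fix m assume "m \<in> {..l}"
      then have m: "m \<le> l" by simp
      then show "f (i mod N, take m (cyc_path N i l)) * g (awlast (i mod N) (take m (cyc_path N i l)), drop m (cyc_path N i l))
          = cyc_coord N c f i m * cyc_coord N c g (i + m) (l - m)"
        using True c_tail[OF True m]
        by (simp only: take_cyc_path[OF m] drop_cyc_path[OF m] awlast_cyc_path cyc_coord_def if_True order_le_less_trans[OF m True])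
    qed
    finally show ?thesis using True by simp
  qed (simp add: cyc_coord_def)
  have ker: "I = {f \<in> carrier ?K. \<forall>i l. cyc_coord N c f i l = 0}"
  proof (rule Set.set_eqI)
    fix f
    have "(\<forall>u p. f (u, p) \<noteq> 0 \<longrightarrow> c u \<le> length p) \<longleftrightarrow> (\<forall>i l. cyc_coord N c f i l = 0)" if f: "f \<in> carrier ?K"
    proof
      assume a: "\<forall>u p. f (u, p) \<noteq> 0 \<longrightarrow> c u \<le> length p"
      show "\<forall>i l. cyc_coord N c f i l = 0"
      proof (intro allI)
        fix i l
        have "f (i mod N, cyc_path N i l) \<noteq> 0 \<longrightarrow> c i \<le> l" using a[rule_format, of "i mod N" "cyc_path N i l"] by (simp add: c_mod)
        then show "cyc_coord N c f i l = 0" by (auto simp: cyc_coord_def)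
      qed
    next
      assume a: "\<forall>i l. cyc_coord N c f i l = 0"
      show "\<forall>u p. f (u, p) \<noteq> 0 \<longrightarrow> c u \<le> length p"
      proof (intro allI impI)
        fix u p assume nz: "f (u, p) \<noteq> 0"
        then have "(u, p) \<in> paths ?Q" using f unfolding d(1) by blast
        then have "u < N" "p = cyc_path N u (length p)" using paths_cyclic_quiver[OF N_pos] by blast+
        then show "c u \<le> length p" using a[rule_format, of u "length p"] nz
          by (cases "length p < c u") (simp_all add: cyc_coord_def)
      qed
    qed
    then show "f \<in> I \<longleftrightarrow> f \<in> {f \<in> carrier ?K. \<forall>i l. cyc_coord N c f i l = 0}"
      unfolding I long_paths_def by blast
  qed
  show "ideal I ?K" "nak N c (quotient_algebra ?K I) (\<lambda>X. cyc_coord N c (SOME f. f \<in> X))"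
    using nak_quotient[OF kupisch_axioms K surj add mult one scal ker] by blast+
qed

end

lemma contains_cyc_path:
  assumes "0 < N" "R \<subseteq> paths (cyclic_quiver N)" "u < N"
  shows "contains_relation (cyclic_quiver N) R u (cyc_path N u l) \<longleftrightarrow>
    (\<exists>m k. m + k \<le> l \<and> ((u + m) mod N, cyc_path N (u + m) k) \<in> R)"
proof
  assume "contains_relation (cyclic_quiver N) R u (cyc_path N u l)"
  then obtain p1 q p2 where p: "cyc_path N u l = p1 @ q @ p2" "(pre_digraph.awlast (cyclic_quiver N) u p1, q) \<in> R"
    unfolding contains_relation_def by blast
  define m k where "m = length p1" and "k = length q"
  have "length (cyc_path N u l) = m + k + length p2" unfolding p(1) by (simp add: m_def k_def)
  then have mk: "m + k \<le> l" by simp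
  have p1: "p1 = cyc_path N u m"
    using arg_cong[OF p(1), of "take m"] take_cyc_path[of m l N u] mk by (simp add: m_def)
  have "drop m (cyc_path N u l) = q @ p2" unfolding p(1) by (simp add: m_def)
  then have "cyc_path N (u + m) (l - m) = q @ p2" using drop_cyc_path[of m l N u] mk by simp
  then have "q = cyc_path N (u + m) k" using take_cyc_path[of k "l - m" N "u + m"] mk by (simp add: k_def)
  moreover have "pre_digraph.awlast (cyclic_quiver N) u p1 = (u + m) mod N"
    using awlast_cyc_path[of N u m] assms(3) by (simp add: p1)
  ultimately show "\<exists>m k. m + k \<le> l \<and> ((u + m) mod N, cyc_path N (u + m) k) \<in> R" using p(2) mk by metis
next
  assume "\<exists>m k. m + k \<le> l \<and> ((u + m) mod N, cyc_path N (u + m) k) \<in> R"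
  then obtain m k where mk: "m + k \<le> l" "((u + m) mod N, cyc_path N (u + m) k) \<in> R" by blast
  have "cyc_path N u l = take m (cyc_path N u l) @ take k (drop m (cyc_path N u l)) @ drop k (drop m (cyc_path N u l))"
    by (simp only: append_take_drop_id)
  also have "\<dots> = cyc_path N u m @ cyc_path N (u + m) k @ drop k (drop m (cyc_path N u l))"
    using mk(1) by (simp add: take_cyc_path drop_cyc_path)
  finally have "cyc_path N u l = cyc_path N u m @ cyc_path N (u + m) k @ drop k (drop m (cyc_path N u l))" .
  moreover have "pre_digraph.awlast (cyclic_quiver N) u (cyc_path N u m) = (u + m) mod N"
    using awlast_cyc_path[of N u m] assms(3) by simp
  ultimately show "contains_relation (cyclic_quiver N) R u (cyc_path N u l)"
    unfolding contains_relation_def using mk(2) by metis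
qed

lemma relation_ideal_long_paths:
  assumes "0 < N" "R \<subseteq> paths (cyclic_quiver N)"
    and c: "\<And>u l. u < N \<Longrightarrow> contains_relation (cyclic_quiver N) R u (cyc_path N u l) \<longleftrightarrow> c u \<le> l"
  shows "relation_ideal (cyclic_quiver N) R = (long_paths N c :: ((nat, nat) path \<Rightarrow> 'k::field) set)"
proof -
  interpret fin_digraph "cyclic_quiver N" by (rule fin_cyclic_quiver[OF assms(1)])
  let ?K = "path_algebra (cyclic_quiver N) :: ('k, (nat, nat) path \<Rightarrow> 'k) module"
  have "contains_relation (cyclic_quiver N) R u p \<longleftrightarrow> c u \<le> length p" if "f \<in> carrier ?K" "f (u, p) \<noteq> 0" for f u p
  proof -
    have "(u, p) \<in> paths (cyclic_quiver N)" using that unfolding path_algebra_simps(1) by blast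
    then have "u < N" "p = cyc_path N u (length p)" using paths_cyclic_quiver[OF assms(1)] by blast+
    then show ?thesis using c[of u "length p"] by simp
  qed
  then show ?thesis unfolding relation_ideal_monomial[OF assms(2)] long_paths_def by blast
qed

text \<open>
  Let \<open>c u\<close> be the least length of a path from \<open>u\<close> that passes through a relation. If the path of
  length \<open>l\<close> from \<open>u + 1\<close> does so, then so does the path of length \<open>l + 1\<close> from \<open>u\<close>, which is the
  inequality of a Kupisch series.
\<close>

lemma relations_to_kupisch:
  assumes "1 \<le> N" "cyclic_relations TYPE('k::field) N R"
  shows "\<exists>c. kupisch N c \<and> (\<forall>i. 2 \<le> c i) \<and> relation_ideal (cyclic_quiver N) R = (long_paths N c :: ((nat, nat) path \<Rightarrow> 'k) set)"
proof -
  have N: "0 < N" using assms(1) by simp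
  have R: "R \<noteq> {}" "R \<subseteq> paths (cyclic_quiver N)" "\<And>u p. (u, p) \<in> R \<Longrightarrow> 2 \<le> length p"
    using assms(2) by (auto simp: cyclic_relations_def)
  define has where "has u l \<longleftrightarrow> (\<exists>m k. m + k \<le> l \<and> ((u + m) mod N, cyc_path N (u + m) k) \<in> R)" for u l
  define c where "c u = (LEAST l. has u l)" for u
  have ex: "\<exists>l. has u l" for u
  proof -
    obtain v q where vq: "(v, q) \<in> R" using R(1) by auto
    then have "v < N" "q = cyc_path N v (length q)" using R(2) paths_cyclic_quiver[OF N] by blast+
    moreover define m where "m = v + (u * N - u)"
    have "u \<le> u * N" using N by simp
    then have "u + m = v + u * N" unfolding m_def by linarith
    moreover have "(v + u * N) mod N = v" using \<open>v < N\<close> by simp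
    ultimately have "(u + m) mod N = v" "cyc_path N (u + m) (length q) = q"
      using cyc_path_mod[of N "u + m" "length q"] by auto
    then have "has u (m + length q)" unfolding has_def using vq by (intro exI[of _ m] exI[of _ "length q"]) simp
    then show ?thesis ..
  qed
  have mono: "has u l \<Longrightarrow> l \<le> l' \<Longrightarrow> has u l'" for u l l' unfolding has_def by (meson le_trans)
  have iff: "has u l \<longleftrightarrow> c u \<le> l" for u l
    using LeastI_ex[OF ex[of u]] mono[of u "c u" l] Least_le[of "has u" l] unfolding c_def by blast
  have has_cong: "has u l \<longleftrightarrow> has u' l" if "u mod N = u' mod N" for u u' l
  proof -
    have "(u + m) mod N = (u' + m) mod N" for m using that by (metis mod_add_left_eq)
    then show ?thesis unfolding has_def using cyc_path_cong by metis
  qed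
  have c2: "2 \<le> c u" for u
  proof -
    have "has u (c u)" by (simp add: iff)
    then obtain m k where "m + k \<le> c u" "((u + m) mod N, cyc_path N (u + m) k) \<in> R" unfolding has_def by blast
    then show ?thesis using R(3)[of "(u + m) mod N" "cyc_path N (u + m) k"] by simp
  qed
  have "kupisch N c"
  proof
    fix u
    show "0 < N" by (rule N)
    show "0 < c u" using c2[of u] by simp
    show "c (u + N) = c u" using has_cong[of "u + N" u] by (simp add: c_def)
    have "has (Suc u) (c (Suc u))" by (simp add: iff)
    then obtain m k where mk: "m + k \<le> c (Suc u)" "((Suc u + m) mod N, cyc_path N (Suc u + m) k) \<in> R" unfolding has_def by blast
    have "has u (Suc (c (Suc u)))" unfolding has_def using mk by (intro exI[of _ "Suc m"] exI[of _ k]) simp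
    then show "c u \<le> Suc (c (Suc u))" by (simp add: iff)
  qed
  moreover have "relation_ideal (cyclic_quiver N) R = (long_paths N c :: ((nat, nat) path \<Rightarrow> 'k) set)"
    by (rule relation_ideal_long_paths[OF N R(2)]) (simp only: contains_cyc_path[OF N R(2)] has_def[symmetric] iff)
  ultimately show ?thesis using c2 by blast
qed

text \<open>
  Minimal relations: the path of length \<open>c u\<close> from \<open>u\<close> is needed unless the path of length
  \<open>c u - 1\<close> from \<open>u + 1\<close> already vanishes.
\<close>

lemma (in kupisch) kupisch_to_relations:
  assumes c2: "\<And>i. 2 \<le> c i"
  shows "\<exists>R. cyclic_relations TYPE('k::field) N R \<and> relation_ideal (cyclic_quiver N) R = (long_paths N c :: ((nat, nat) path \<Rightarrow> 'k) set)"
proof -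
  define R where "R = (\<lambda>u. (u, cyc_path N u (c u))) ` {u. u < N \<and> c u \<le> c (Suc u)}"
  interpret fin_digraph "cyclic_quiver N" by (rule fin_cyclic_quiver[OF N_pos])
  have RP: "R \<subseteq> paths (cyclic_quiver N)" using paths_cyclic_quiver[OF N_pos] by (auto simp: R_def)
  have mem: "((u + m) mod N, cyc_path N (u + m) k) \<in> R \<longleftrightarrow> k = c (u + m) \<and> c (u + m) \<le> c (Suc (u + m))" for u m k
  proof -
    have S: "c (Suc ((u + m) mod N)) = c (Suc (u + m))"
      using c_mod[of "Suc ((u + m) mod N)"] c_mod[of "Suc (u + m)"] by (simp add: mod_Suc_eq)
    show ?thesis
    proof
      assume "((u + m) mod N, cyc_path N (u + m) k) \<in> R"
      then obtain v where v: "(u + m) mod N = v" "cyc_path N (u + m) k = cyc_path N v (c v)" "c v \<le> c (Suc v)"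
        by (auto simp: R_def)
      have "length (cyc_path N (u + m) k) = length (cyc_path N v (c v))" by (simp only: v(2))
      then have "k = c v" by simp
      then show "k = c (u + m) \<and> c (u + m) \<le> c (Suc (u + m))" using v(3) S c_mod[of "u + m"] v(1) by simp
    next
      assume "k = c (u + m) \<and> c (u + m) \<le> c (Suc (u + m))"
      then show "((u + m) mod N, cyc_path N (u + m) k) \<in> R"
        unfolding R_def using N_pos by (intro image_eqI[of _ _ "(u + m) mod N"]) (simp_all add: S c_mod)
    qed
  qed
  have long: "\<exists>m k. m + k \<le> l \<and> ((u + m) mod N, cyc_path N (u + m) k) \<in> R" if "c u \<le> l" for u l
    using that
  proof (induction l arbitrary: u)
    case 0
    then show ?case using c_pos[of u] by simp
  next
    case (Suc l)
    show ?case
    proof (cases "c u \<le> c (Suc u)")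
      case True
      then show ?thesis using Suc.prems mem[of u 0 "c u"] by (intro exI[of _ 0] exI[of _ "c u"]) simp
    next
      case False
      then have "c (Suc u) \<le> l" using Suc.prems by simp
      then obtain m k where "m + k \<le> l" "((Suc u + m) mod N, cyc_path N (Suc u + m) k) \<in> R" using Suc.IH by blast
      then show ?thesis by (intro exI[of _ "Suc m"] exI[of _ k]) simp
    qed
  qed
  have contains: "contains_relation (cyclic_quiver N) R u (cyc_path N u l) \<longleftrightarrow> c u \<le> l" if "u < N" for u l
    unfolding contains_cyc_path[OF N_pos RP that]
  proof
    assume "\<exists>m k. m + k \<le> l \<and> ((u + m) mod N, cyc_path N (u + m) k) \<in> R"
    then obtain m where "m + c (u + m) \<le> l" unfolding mem by blast
    then show "c u \<le> l" using jump_mono[of u "u + m"] by (simp add: jump_def)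
  qed (rule long)
  have I: "relation_ideal (cyclic_quiver N) R = (long_paths N c :: ((nat, nat) path \<Rightarrow> 'k) set)"
    by (rule relation_ideal_long_paths[OF N_pos RP contains])
  have irr: "(path_vector \<rho> :: _ \<Rightarrow> 'k) \<notin> relation_ideal (cyclic_quiver N) (R - {\<rho>})" if \<rho>: "\<rho> \<in> R" for \<rho>
  proof
    assume a: "(path_vector \<rho> :: _ \<Rightarrow> 'k) \<in> relation_ideal (cyclic_quiver N) (R - {\<rho>})"
    obtain u where u: "u < N" "c u \<le> c (Suc u)" "\<rho> = (u, cyc_path N u (c u))" using \<rho> by (auto simp: R_def)
    have RP': "R - {\<rho>} \<subseteq> paths (cyclic_quiver N)" using RP by blast
    have "(path_vector \<rho> :: _ \<Rightarrow> 'k) (u, cyc_path N u (c u)) \<noteq> 0" by (simp add: path_vector_def u(3))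
    then have "contains_relation (cyclic_quiver N) (R - {\<rho>}) u (cyc_path N u (c u))"
      using a unfolding relation_ideal_monomial[OF RP'] by blast
    then obtain m k where mk: "m + k \<le> c u" "((u + m) mod N, cyc_path N (u + m) k) \<in> R" "((u + m) mod N, cyc_path N (u + m) k) \<noteq> \<rho>"
      unfolding contains_cyc_path[OF N_pos RP' u(1)] by blast
    have k: "k = c (u + m)" using mk(2) mem by blast
    show False
    proof (cases m)
      case 0
      then show ?thesis using mk(3) k u by simp
    next
      case (Suc m')
      then show ?thesis using jump_mono[of "Suc u" "u + m"] mk(1) u(2) by (simp add: jump_def k)
    qed
  qed
  have "R \<noteq> {}" using long[of 0 "c 0"] by blast
  moreover have "finite R" by (simp add: R_def)
  moreover have "\<forall>(u, p)\<in>R. 2 \<le> length p" using c2 by (auto simp: R_def)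
  ultimately have "cyclic_relations TYPE('k) N R" unfolding cyclic_relations_def using RP irr by blast
  then show ?thesis using I by blast
qed

lemma (in kupisch) long_paths_admissible:
  assumes c2: "\<And>i. 2 \<le> c i"
  shows "admissible (cyclic_quiver N) (long_paths N c :: ((nat, nat) path \<Rightarrow> 'k::field) set)"
  unfolding admissible_def
proof (intro conjI)
  let ?I = "long_paths N c :: ((nat, nat) path \<Rightarrow> 'k) set"
  show "ideal ?I (path_algebra (cyclic_quiver N))" by (rule cyclic_quotient(1)[OF refl])
  show "?I \<subseteq> arrow_ideal_power (cyclic_quiver N) 2"
  proof
    fix f assume f: "f \<in> ?I"
    have "2 \<le> length p" if "f (u, p) \<noteq> 0" for u p using f that c2[of u] unfolding long_paths_def by fastforce
    then show "f \<in> arrow_ideal_power (cyclic_quiver N) 2" using f unfolding long_paths_def arrow_ideal_power_def by blast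
  qed
  define m where "m = Max (insert 2 (c ` {..<N}))"
  have m: "2 \<le> m" "\<And>u. u < N \<Longrightarrow> c u \<le> m" by (auto simp: m_def)
  have "arrow_ideal_power (cyclic_quiver N) m \<subseteq> ?I"
  proof
    fix f :: "(nat, nat) path \<Rightarrow> 'k" assume f: "f \<in> arrow_ideal_power (cyclic_quiver N) m"
    have "c u \<le> length p" if nz: "f (u, p) \<noteq> 0" for u p
    proof -
      have "(u, p) \<in> paths (cyclic_quiver N)" using f nz unfolding arrow_ideal_power_def path_algebra_simps(1) by blast
      then have "u < N" using paths_cyclic_quiver[OF N_pos] by blast
      moreover have "m \<le> length p" using f nz unfolding arrow_ideal_power_def by blast
      ultimately show ?thesis using m(2)[of u] by simp
    qed
    then show "f \<in> ?I" using f unfolding long_paths_def arrow_ideal_power_def by blast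
  qed
  then show "\<exists>m\<ge>2. arrow_ideal_power (cyclic_quiver N) m \<subseteq> ?I" using m(1) by blast
qed

lemma linear_quiver_simps [simp]:
  "verts (linear_quiver n) = {..<n}" "arcs (linear_quiver n) = {i. Suc i < n}"
  "tail (linear_quiver n) = (\<lambda>i. i)" "head (linear_quiver n) = Suc"
  by (simp_all add: linear_quiver_def)

lemma fin_linear_quiver: "fin_digraph (linear_quiver n)"
proof
  have "{i. Suc i < n} \<subseteq> {..<n}" by auto
  then show "finite (arcs (linear_quiver n))" using finite_subset by auto
qed auto

lemma paths_linear_quiver: "(u, p) \<in> paths (linear_quiver n) \<longleftrightarrow> u + length p < n \<and> p = [u..<u + length p]"
proof -
  interpret fin_digraph "linear_quiver n" by (rule fin_linear_quiver)
  show ?thesis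
  proof (induction p arbitrary: u)
    case Nil
    then show ?case by (auto simp: paths_def awalk_Nil_iff)
  next
    case (Cons e es)
    have "(u, e # es) \<in> paths (linear_quiver n) \<longleftrightarrow> Suc e < n \<and> u = e \<and> (Suc e, es) \<in> paths (linear_quiver n)"
      by (auto simp: paths_def awalk_Cons_iff)
    also have "\<dots> \<longleftrightarrow> u + length (e # es) < n \<and> e # es = [u..<u + length (e # es)]"
    proof -
      have "[u..<u + length (e # es)] = u # [Suc u..<Suc u + length es]"
        by (simp add: upt_conv_Cons del: upt_Suc)
      then show ?thesis unfolding Cons.IH by (auto simp del: upt_Suc)
    qed
    finally show ?case .
  qed
qed

definition lin_coord :: "nat \<Rightarrow> (nat \<Rightarrow> nat) \<Rightarrow> ((nat, nat) path \<Rightarrow> 'k::zero) \<Rightarrow> nat \<Rightarrow> nat \<Rightarrow> 'k" where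
  "lin_coord n c f i l = (if l < c i then f (i mod n, [i mod n..<i mod n + l]) else 0)"

text \<open>
  If \<open>c (N - 1) = 1\<close>, no nonzero path passes from the vertex \<open>N - 1\<close> to \<open>0\<close>, so the nonzero paths are
  those of the linear quiver.
\<close>

lemma (in kupisch) linear_quotient:
  assumes last: "c (N - 1) = 1" and c2: "\<And>i. Suc i < N \<Longrightarrow> 2 \<le> c i"
  shows "\<exists>I cf. admissible (linear_quiver N) (I :: ((nat, nat) path \<Rightarrow> 'k::field) set) \<and>
    nak N c (quotient_algebra (path_algebra (linear_quiver N)) I) cf"
proof -
  let ?Q = "linear_quiver N"
  let ?K = "path_algebra ?Q :: ('k, (nat, nat) path \<Rightarrow> 'k) module"
  interpret fin_digraph ?Q by (rule fin_linear_quiver)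
  note d = path_algebra_simps
  have K: "k_algebra ?K" by (rule path_algebra_algebra)
  have bound: "i mod N + l < N" if "l < c i" for i l
  proof -
    have "i mod N < N" using N_pos by simp
    then have "jump c (i mod N) \<le> jump c (N - 1)" by (intro jump_mono) simp
    then show ?thesis using that last N_pos by (simp add: jump_def c_mod)
  qed
  have surj: "lin_coord N c ` carrier ?K = coords N c"
  proof (intro equalityI subsetI)
    fix g assume "g \<in> lin_coord N c ` carrier ?K"
    then obtain f where "g = lin_coord N c f" by blast
    then show "g \<in> coords N c" by (simp add: coords_def lin_coord_def c_add_N)
  next
    fix g :: "nat \<Rightarrow> nat \<Rightarrow> 'k" assume g: "g \<in> coords N c"
    have gN: "g (i + q * N) l = g i l" for i q l
    proof (induction q)
      case (Suc q)
      have "g (i + Suc q * N) l = g ((i + q * N) + N) l" by (simp add: algebra_simps)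
      then show ?case using g Suc by (simp add: coords_def)
    qed simp
    have gmod: "g (i mod N) l = g i l" for i l using gN[of "i mod N" "i div N" l] by simp
    define f where "f = (\<lambda>(u, p). if u < N \<and> p = [u..<u + length p] \<and> length p < c u then g u (length p) else 0)"
    have sub: "{x. f x \<noteq> 0} \<subseteq> (\<lambda>(u, l). (u, [u..<u + l])) ` (SIGMA u:{..<N}. {..<c u})"
    proof
      fix x assume "x \<in> {x. f x \<noteq> 0}"
      then obtain u p where x: "x = (u, p)" "u < N" "p = [u..<u + length p]" "length p < c u"
        by (cases x) (auto simp: f_def split: if_splits)
      show "x \<in> (\<lambda>(u, l). (u, [u..<u + l])) ` (SIGMA u:{..<N}. {..<c u})"
        by (rule image_eqI[of _ _ "(u, length p)"]) (use x in auto)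
    qed
    have "finite (SIGMA u:{..<N}. {..<c u})" by auto
    then have "finite {x. f x \<noteq> 0}" by (rule finite_subset[OF sub finite_imageI])
    moreover have "{x. f x \<noteq> 0} \<subseteq> paths ?Q"
    proof
      fix x assume "x \<in> {x. f x \<noteq> 0}"
      then obtain u p where x: "x = (u, p)" "u < N" "p = [u..<u + length p]" "length p < c u"
        by (cases x) (auto simp: f_def split: if_splits)
      then show "x \<in> paths ?Q" using paths_linear_quiver[of u p N] bound[of "length p" u] by simp
    qed
    ultimately have "f \<in> carrier ?K" unfolding d(1) by blast
    moreover have "lin_coord N c f i l = g i l" for i l
      using g N_pos by (auto simp: lin_coord_def f_def c_mod gmod coords_def)
    then have "g = lin_coord N c f" by (intro ext) simp
    ultimately show "g \<in> lin_coord N c ` carrier ?K" by blast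
  qed
  have add: "lin_coord N c (f \<oplus>\<^bsub>?K\<^esub> g) i l = lin_coord N c f i l + lin_coord N c g i l" for f g i l
    by (simp add: lin_coord_def d)
  have scal: "lin_coord N c (s \<odot>\<^bsub>?K\<^esub> f) i l = s * lin_coord N c f i l" for s f i l
    by (simp add: lin_coord_def d)
  have one: "lin_coord N c \<one>\<^bsub>?K\<^esub> i l = (if l = 0 then 1 else 0)" for i l
    using N_pos c_pos[of i] by (auto simp: lin_coord_def d)
  have mult: "lin_coord N c (f \<otimes>\<^bsub>?K\<^esub> g) i l = (if l < c i then \<Sum>m\<le>l. lin_coord N c f i m * lin_coord N c g (i + m) (l - m) else 0)" for f g i l
  proof (cases "l < c i")
    case True
    let ?i = "i mod N"
    have "lin_coord N c (f \<otimes>\<^bsub>?K\<^esub> g) i l = (\<Sum>m\<le>l. f (?i, take m [?i..<?i + l]) *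
        g (awlast ?i (take m [?i..<?i + l]), drop m [?i..<?i + l]))"
      using True by (simp add: lin_coord_def d)
    also have "\<dots> = (\<Sum>m\<le>l. lin_coord N c f i m * lin_coord N c g (i + m) (l - m))"
    proof (rule sum.cong[OF refl])
      fix m assume "m \<in> {..l}"
      then have m: "m \<le> l" by simp
      have t: "take m [?i..<?i + l] = [?i..<?i + m]" using m by (simp add: take_upt)
      have dr: "drop m [?i..<?i + l] = [?i + m..<?i + m + (l - m)]" using m by (simp add: drop_upt)
      have w: "awlast ?i [?i..<?i + m] = ?i + m" unfolding awlast_eq by (cases m) auto
      have "?i + m < N" using bound[OF True] m by simp
      then have im: "(i + m) mod N = ?i + m" by (metis mod_add_left_eq mod_less)
      show "f (?i, take m [?i..<?i + l]) * g (awlast ?i (take m [?i..<?i + l]), drop m [?i..<?i + l])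
          = lin_coord N c f i m * lin_coord N c g (i + m) (l - m)"
        using True c_tail[OF True m] unfolding t dr w lin_coord_def im
        by (simp only: if_True order_le_less_trans[OF m True])
    qed
    finally show ?thesis using True by simp
  qed (simp add: lin_coord_def)
  define I where "I = {f \<in> carrier ?K. \<forall>i l. lin_coord N c f i l = 0}"
  note nq = nak_quotient[OF kupisch_axioms K surj add mult one scal I_def]
  have "admissible ?Q I"
    unfolding admissible_def
  proof (intro conjI)
    show "ideal I ?K" by (rule nq(1))
    have path: "(u, p) \<in> paths ?Q" if "f \<in> carrier ?K" "f (u, p) \<noteq> 0" for f u p
      using that unfolding d(1) by blast
    show "I \<subseteq> arrow_ideal_power ?Q 2"
    proof
      fix f assume f: "f \<in> I"
      have "2 \<le> length p" if nz: "f (u, p) \<noteq> 0" for u p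
      proof -
        have p: "u + length p < N" "p = [u..<u + length p]"
          using path[of f u p] nz f paths_linear_quiver[of u p N] unfolding I_def by blast+
        have "lin_coord N c f u (length p) = 0" using f unfolding I_def by blast
        then have "c u \<le> length p" using nz p by (cases "length p < c u") (simp_all add: lin_coord_def)
        moreover have "2 \<le> c u \<or> u = N - 1" using c2[of u] p(1) by (cases "Suc u < N") auto
        moreover have "1 \<le> length p" using c_pos[of u] calculation(1) by simp
        ultimately show ?thesis using p(1) by auto
      qed
      then show "f \<in> arrow_ideal_power ?Q 2" using f unfolding I_def arrow_ideal_power_def by blast
    qed
    have "arrow_ideal_power ?Q (max 2 N) \<subseteq> I"
    proof
      fix f :: "(nat, nat) path \<Rightarrow> 'k" assume f: "f \<in> arrow_ideal_power ?Q (max 2 N)"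
      have "f (u, p) = 0" for u p
      proof (rule ccontr)
        assume nz: "f (u, p) \<noteq> 0"
        then have "(u, p) \<in> paths ?Q" "max 2 N \<le> length p" using f path[of f u p] unfolding arrow_ideal_power_def by blast+
        then show False using paths_linear_quiver[of u p N] by simp
      qed
      then show "f \<in> I" using f unfolding I_def arrow_ideal_power_def lin_coord_def by simp
    qed
    then show "\<exists>m\<ge>2. arrow_ideal_power ?Q m \<subseteq> I" by (intro exI[of _ "max 2 N"]) simp
  qed
  then show ?thesis using nq(2) by blast
qed

section \<open>The syzygy filtered algebra in terms of the jump function\<close>

lemma cyclic_algebra_nak:
  assumes "kupisch N c" "relation_ideal (cyclic_quiver N) R = (long_paths N c :: ((nat, nat) path \<Rightarrow> 'k::field) set)"
  shows "nak N c (cyclic_algebra N R :: ('k, ((nat, nat) path \<Rightarrow> 'k) set) module) (\<lambda>X. cyc_coord N c (SOME f. f \<in> X))"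
  unfolding cyclic_algebra_def by (rule kupisch.cyclic_quotient(2)[OF assms])

lemma (in kupisch) vertex_simple_eq:
  assumes "u < N"
  shows "vertex_simple u = simp_mod (\<lambda>X :: ((nat, nat) path \<Rightarrow> 'k::field) set. cyc_coord N c (SOME f. f \<in> X)) u"
  using assms c_pos[of u] by (simp add: vertex_simple_def simp_mod_def cyc_coord_def)

text \<open>
  The socle of \<open>P(i)\<close> is the simple at the vertex \<open>jump c i - 1\<close>, so its shift by \<open>\<tau>\<close> is the vertex
  \<open>jump c i\<close>: the projectives that enter \<open>\<epsilon>\<close> are those at the image of the jump function. Their
  endomorphism algebra has the restriction of the jump function to its image as its own jump
  function.
\<close>

lemma (in kupisch) syzygy_filtered_red:
  assumes c2: "\<And>i. 2 \<le> c i"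
  shows "is_syzygy_filtered (kup N c :: ('k::field, nat \<Rightarrow> 'k) module) (kup red_rank red_series :: ('k, nat \<Rightarrow> 'k) module)"
proof -
  obtain R where R: "cyclic_relations TYPE('k) N R"
    "relation_ideal (cyclic_quiver N) R = (long_paths N c :: ((nat, nat) path \<Rightarrow> 'k) set)"
    using kupisch_to_relations[OF c2] by blast
  let ?cf = "\<lambda>X :: ((nat, nat) path \<Rightarrow> 'k) set. cyc_coord N c (SOME f. f \<in> X)"
  let ?A = "cyclic_algebra N R :: ('k, ((nat, nat) path \<Rightarrow> 'k) set) module"
  let ?P = "\<lambda>j. im ?cf {0} (\<lambda>_. j) (\<lambda>_. jump c j)"
  interpret A: nak N c ?A ?cf by (rule cyclic_algebra_nak[OF kupisch_axioms R(2)])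
  have "socle_vertices TYPE('k) N R = {(jump c i - 1) mod N | i. i < N}"
    unfolding A.socles_of_projectives[symmetric] socle_vertices_def Let_def
    by (intro Collect_cong conj_cong refl) (simp only: vertex_simple_eq)
  then have targets: "shifted_socle_vertices TYPE('k) N R = targets"
    unfolding shifted_socle_vertices_def by (simp only: A.shifted_socles)
  have iso: "alg_isomorphic (kup N c :: ('k, nat \<Rightarrow> 'k) module) ?A"
    by (rule nak_isomorphic[OF kup_nak A.nak_axioms])
  have cover: "projective_cover ?A (?P j) (vertex_simple j)" if "j \<in> targets" for j
  proof -
    have "j < N" using that targets_bound by blast
    then show ?thesis using A.interval_projective_cover[of j] by (simp only: vertex_simple_eq)
  qed
  have "alg_isomorphic (kup red_rank red_series :: ('k, nat \<Rightarrow> 'k) module) (end_algebra ?A (direct_product targets ?P))"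
    by (rule nak_isomorphic[OF kupisch.kup_nak[OF kupisch_red] A.end_nak])
  then show ?thesis
    unfolding is_syzygy_filtered_def using N_pos R(1) iso cover
    by (intro exI[of _ N] exI[of _ R] exI[of _ ?P]) (simp add: targets)
qed

lemma (in nak) cyclic_nakayama_if_two:
  assumes c2: "\<And>i. 2 \<le> c i"
  shows "cyclic_nakayama_algebra A"
proof -
  obtain R where R: "cyclic_relations TYPE('k) N R"
    "relation_ideal (cyclic_quiver N) R = (long_paths N c :: ((nat, nat) path \<Rightarrow> 'k) set)"
    using kupisch_to_relations[OF c2] by blast
  have "alg_isomorphic A (cyclic_algebra N R :: ('k, ((nat, nat) path \<Rightarrow> 'k) set) module)"
    by (rule nak_isomorphic[OF nak_axioms cyclic_algebra_nak[OF kupisch_axioms R(2)]])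
  then show ?thesis
    unfolding cyclic_nakayama_algebra_def cyclic_nakayama_of_rank_def using N_pos R(1)
    by (intro exI[of _ N] conjI exI[of _ R]) simp_all
qed

lemma (in nak) nakayama_if_two:
  assumes c2: "\<And>i. 2 \<le> c i"
  shows "nakayama_algebra A"
  unfolding nakayama_algebra_def
proof (intro conjI exI)
  show "fin_digraph (cyclic_quiver N)" by (rule fin_cyclic_quiver[OF N_pos])
  show "verts (cyclic_quiver N) \<noteq> {}" using N_pos by auto
  show "admissible (cyclic_quiver N) (long_paths N c :: ((nat, nat) path \<Rightarrow> 'k) set)"
    by (rule long_paths_admissible[OF c2])
  show "alg_isomorphic A (bound_quiver_algebra (cyclic_quiver N) (long_paths N c))"
    by (rule nak_isomorphic[OF nak_axioms cyclic_quotient(2)[OF refl]])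
  show "indecomposables_uniserial A" by (rule indecomposables_uniserial)
qed

text \<open>
  If \<open>c j = 1\<close>, then the idempotent \<open>e\<close> at \<open>j\<close> satisfies \<open>e A = K e\<close>. A cyclic Nakayama algebra
  contains no such idempotent: right multiplication by the sum of the arrows shifts all
  coefficients by one, so \<open>e\<close> could only be its eigenvector if \<open>e\<close> lies in the radical, and
  nonzero idempotents do not.
\<close>

lemma (in nak) not_cyclic_if_one:
  assumes cj: "c j = 1"
  shows "\<not> cyclic_nakayama_algebra A"
proof
  assume "cyclic_nakayama_algebra A"
  then obtain N' R where NR: "1 \<le> N'" "cyclic_relations TYPE('k) N' R"
    "alg_isomorphic A (cyclic_algebra N' R :: ('k, ((nat, nat) path \<Rightarrow> 'k) set) module)"
    unfolding cyclic_nakayama_algebra_def cyclic_nakayama_of_rank_def by blast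
  obtain c' where c': "kupisch N' c'" "\<And>i. 2 \<le> c' i"
    "relation_ideal (cyclic_quiver N') R = (long_paths N' c' :: ((nat, nat) path \<Rightarrow> 'k) set)"
    using relations_to_kupisch[OF NR(1,2)] by blast
  obtain cf' where "nak N' c' A cf'"
    using nak.nak_if_isomorphic[OF cyclic_algebra_nak[OF c'(1,3)] NR(3)] by blast
  then interpret B: nak N' c' A cf' .
  let ?e = "xx j 0"
  define b where "b = B.el (\<lambda>i l. if l = 1 then 1 else 0)"
  have "\<not> c' i \<le> 1" for i using c'(2)[of i] by simp
  then have bc: "(\<lambda>i l. if l = 1 then 1 else 0 :: 'k) \<in> coords N' c'" by (auto simp: coords_def)
  have b: "b \<in> carrier A" "\<And>i l. cf' b i l = (if l = 1 then 1 else 0)"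
    unfolding b_def B.cf_el[OF bc] by (rule B.el_closed[OF bc], rule refl)
  define s where "s = cf b j 0"
  have eb: "?e \<otimes> b = s \<odot> ?e"
  proof (rule cf_eqI)
    fix i l assume l: "l < c i"
    show "cf (?e \<otimes> b) i l = cf (s \<odot> ?e) i l"
    proof (cases "i mod N = j mod N")
      case True
      then have "l = 0" using l c_cong[OF True] cj by simp
      then show ?thesis using True c_pos[of i] cf_cong[OF b(1) True, of 0]
        by (simp add: cf_xx_left[OF b(1)] s_def cf_scal cf_xx cj)
    qed (simp add: cf_xx_left[OF b(1)] cf_scal cf_xx)
  qed (simp_all add: b(1) scal_closed)
  have shift: "cf' (?e \<otimes> b) i (Suc l) = cf' ?e i l" if "Suc l < c' i" for i l
  proof -
    have "cf' (?e \<otimes> b) i (Suc l) = (\<Sum>m\<le>Suc l. cf' ?e i m * (if Suc l - m = 1 then 1 else 0))"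
      using that by (simp only: B.cf_mult[OF xx_closed b(1)] b(2) if_True)
    also have "\<dots> = (\<Sum>m\<le>Suc l. if m = l then cf' ?e i m else 0)" by (rule sum.cong) auto
    finally show ?thesis by (simp add: sum.delta)
  qed
  have e0: "cf' ?e i 0 = 0" for i
  proof (cases "s = 0")
    case True
    then have "cf' (?e \<otimes> b) i (Suc 0) = 0" unfolding eb by (simp add: B.cf_scal)
    then show ?thesis using shift[of 0 i] c'(2)[of i] by simp
  next
    case False
    have "cf' (?e \<otimes> b) i 0 = 0" by (simp add: B.cf_mult b)
    then show ?thesis using False unfolding eb by (simp add: B.cf_scal)
  qed
  have idem: "?e \<otimes> ?e = ?e" using xx_mult[of j 0 0] by simp
  have "cf' ?e i l = 0" for i l
  proof (induction l arbitrary: i rule: less_induct)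
    case (less l)
    have z: "cf' ?e i m * cf' ?e (i + m) (l - m) = 0" if "m \<le> l" for m
    proof (cases "m = l")
      case True
      then show ?thesis using e0[of "i + m"] by simp
    next
      case False
      then have "m < l" using that by simp
      then show ?thesis using less.IH[of m i] by simp
    qed
    have "(\<Sum>m\<le>l. cf' ?e i m * cf' ?e (i + m) (l - m)) = 0" by (rule sum.neutral) (use z in blast)
    then have "cf' (?e \<otimes> ?e) i l = 0" by (simp only: B.cf_mult[OF xx_closed xx_closed] if_cancel)
    then show ?case by (simp only: idem)
  qed
  then have "?e = \<zero>" by (intro B.cf_eqI) (simp_all add: B.cf_zero)
  then have "cf ?e j 0 = 0" by (simp only: cf_zero)
  then show False by (simp add: cf_xx cj)
qed

section \<open>Components of the algebras that are not cyclic\<close>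

text \<open>
  Renumbering the vertices moves any vertex \<open>i\<close> with \<open>c i = 1\<close> to the last place.
\<close>

lemma (in nak) nak_rotate: "nak N (\<lambda>i. c (i + s)) A (\<lambda>a i l. cf a (i + s) l)"
proof -
  have back_N: "i + s * N - s + s = i + s * N" for i using N_pos by (cases N) auto
  have k: "kupisch N (\<lambda>i. c (i + s))"
  proof
    fix i
    show "0 < N" "0 < c (i + s)" by (rule N_pos, rule c_pos)
    show "c (i + N + s) = c (i + s)" using c_add_N[of "i + s"] by (simp add: ac_simps)
    show "c (i + s) \<le> Suc (c (Suc i + s))" using c_step[of "i + s"] by simp
  qed
  have "bij_betw (\<lambda>a i l. cf a (i + s) l) (carrier A) (coords N (\<lambda>i. c (i + s)))"
    unfolding bij_betw_def
  proof (intro conjI inj_onI equalityI subsetI)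
    fix x y assume xy: "x \<in> carrier A" "y \<in> carrier A" and eq: "(\<lambda>i l. cf x (i + s) l) = (\<lambda>i l. cf y (i + s) l)"
    show "x = y"
    proof (rule cf_eqI[OF xy])
      fix i l
      have "cf x (i + s * N - s + s) l = cf y (i + s * N - s + s) l" using fun_cong[OF fun_cong[OF eq]] .
      then show "cf x i l = cf y i l" unfolding back_N using xy by (simp add: cf_add_mult)
    qed
  next
    fix g assume "g \<in> (\<lambda>a i l. cf a (i + s) l) ` carrier A"
    then obtain a where a: "a \<in> carrier A" "g = (\<lambda>i l. cf a (i + s) l)" by blast
    have "cf a (i + N + s) l = cf a (i + s) l" for i l using cf_add_N[OF a(1), of "i + s"] by (simp add: ac_simps)
    then show "g \<in> coords N (\<lambda>i. c (i + s))" unfolding a(2) coords_def using cf_trunc[OF a(1)] by blast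
  next
    fix g :: "nat \<Rightarrow> nat \<Rightarrow> 'k" assume g: "g \<in> coords N (\<lambda>i. c (i + s))"
    have gN: "g (i + q * N) l = g i l" for i q l
    proof (induction q)
      case (Suc q)
      have "g (i + Suc q * N) l = g ((i + q * N) + N) l" by (simp add: algebra_simps)
      then show ?case using g Suc by (simp add: coords_def)
    qed simp
    define f where "f i l = g (i + s * N - s) l" for i l
    have "f (i + N) l = f i l" for i l
    proof -
      have "i + N + s * N - s = (i + s * N - s) + 1 * N" using N_pos by (cases N) auto
      then show ?thesis unfolding f_def using gN[of "i + s * N - s" 1 l] by (simp only:)
    qed
    moreover have "f i l = 0" if "c i \<le> l" for i l
    proof -
      have "c (i + s * N - s + s) \<le> l" unfolding back_N using that by (simp only: c_add_mult)
      then show ?thesis using g unfolding f_def coords_def by blast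
    qed
    ultimately have f: "f \<in> coords N c" unfolding coords_def by blast
    have "f (i + s) l = g i l" for i l
    proof -
      have "i + s + s * N - s = i + s * N" by simp
      then show ?thesis unfolding f_def by (simp only: gN)
    qed
    then have "g = (\<lambda>i l. cf (el f) (i + s) l)" unfolding cf_el[OF f] by (intro ext) simp
    then show "g \<in> (\<lambda>a i l. cf a (i + s) l) ` carrier A" by (rule image_eqI[OF _ el_closed[OF f]])
  qed
  moreover have "i + s + m = i + m + s" for i m by simp
  ultimately show ?thesis
    by (intro nak.intro[OF k k_algebra_axioms] nak_axioms.intro)
      (simp_all add: cf_add cf_mult cf_one cf_scal ac_simps)
qed

lemma cut_points:
  fixes c :: "nat \<Rightarrow> nat"
  assumes "0 < N" "c (N - 1) = 1" "\<And>i. 0 < c i"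
  shows "\<exists>m q. 0 < m \<and> q 0 = 0 \<and> q m = N \<and> (\<forall>k<m. q k < q (Suc k) \<and> c (q (Suc k) - 1) = 1 \<and>
    (\<forall>i. q k \<le> i \<and> Suc i < q (Suc k) \<longrightarrow> 2 \<le> c i))"
  using assms
proof (induction N rule: less_induct)
  case (less N)
  have two: "2 \<le> c i \<longleftrightarrow> c i \<noteq> 1" for i using less.prems(3)[of i] by linarith
  define J where "J = {i. Suc i < N \<and> c i = 1}"
  have fin: "finite J" by (rule finite_subset[of _ "{..<N}"]) (auto simp: J_def)
  show ?case
  proof (cases "J = {}")
    case True
    then have "2 \<le> c i" if "Suc i < N" for i using that two by (auto simp: J_def)
    then show ?thesis using less.prems(1,2)
      by (intro exI[of _ 1] exI[of _ "\<lambda>k. if k = 0 then 0 else N"]) simp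
  next
    case False
    define M where "M = Suc (Max J)"
    have "Max J \<in> J" using fin False by (rule Max_in)
    then have M: "M < N" "c (M - 1) = 1" "0 < M" by (auto simp: J_def M_def)
    have big: "2 \<le> c i" if "M \<le> i" "Suc i < N" for i
    proof -
      have "i \<notin> J" using Max_ge[OF fin, of i] that(1) by (auto simp: M_def)
      then show ?thesis using that(2) two by (auto simp: J_def)
    qed
    obtain m q where mq: "0 < m" "q 0 = 0" "q m = M"
      "\<And>k. k < m \<Longrightarrow> q k < q (Suc k) \<and> c (q (Suc k) - 1) = 1 \<and> (\<forall>i. q k \<le> i \<and> Suc i < q (Suc k) \<longrightarrow> 2 \<le> c i)"
      using less.IH[OF M(1,3,2) less.prems(3)] by blast
    \<comment> \<open>Cut at the last value one before the end; the induction hypothesis cuts the rest.\<close>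
    define q' where "q' = q(Suc m := N)"
    have "q' k < q' (Suc k) \<and> c (q' (Suc k) - 1) = 1 \<and> (\<forall>i. q' k \<le> i \<and> Suc i < q' (Suc k) \<longrightarrow> 2 \<le> c i)"
      if "k < Suc m" for k
    proof (cases "k = m")
      case True
      then show ?thesis using mq(3) M(1) less.prems(2) big by (simp add: q'_def)
    next
      case False
      then have k: "q' k = q k" "q' (Suc k) = q (Suc k)" "k < m" using that by (simp_all add: q'_def)
      show ?thesis unfolding k(1,2) by (rule mq(4)[OF k(3)])
    qed
    moreover have "q' 0 = 0" "q' (Suc m) = N" using mq(2) by (simp_all add: q'_def)
    ultimately show ?thesis by (intro exI[of _ "Suc m"] exI[of _ q']) blast
  qed
qed

lemma (in nak) linear_nakayama_if_last_one:
  assumes "c (N - 1) = 1" "\<And>i. Suc i < N \<Longrightarrow> 2 \<le> c i"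
  shows "linear_nakayama_algebra A"
proof -
  obtain I :: "((nat, nat) path \<Rightarrow> 'k) set" and cf' where I: "admissible (linear_quiver N) I"
    "nak N c (quotient_algebra (path_algebra (linear_quiver N)) I) cf'"
    using linear_quotient[OF assms] by blast
  have "alg_isomorphic A (quotient_algebra (path_algebra (linear_quiver N)) I)"
    by (rule nak_isomorphic[OF nak_axioms I(2)])
  then show ?thesis
    unfolding linear_nakayama_algebra_def using I(1) N_pos indecomposables_uniserial
    by (intro conjI exI[of _ N] exI[of _ I]) simp_all
qed

text \<open>
  A central element commutes with the idempotents at the vertices, so it is diagonal, and with the
  arrows, so its diagonal is constant.
\<close>

lemma (in nak) connected_if_last_one:
  assumes last: "c (N - 1) = 1" and c2: "\<And>i. Suc i < N \<Longrightarrow> 2 \<le> c i"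
  shows "connected_algebra A"
  unfolding connected_algebra_def
proof (intro conjI ballI impI)
  show "k_algebra A" by (rule k_algebra_axioms)
  have "cf \<one> 0 0 \<noteq> cf \<zero> 0 0" by (simp add: cf_one cf_zero)
  then show "\<one> \<noteq> \<zero>" by metis
  fix e assume e: "e \<in> carrier A" and "e \<otimes> e = e \<and> (\<forall>x\<in>carrier A. e \<otimes> x = x \<otimes> e)"
  then have idem: "e \<otimes> e = e" and central: "\<And>x. x \<in> carrier A \<Longrightarrow> x \<otimes> e = e \<otimes> x" by simp_all
  have off: "cf e i l = 0" if i: "i < N" "l < c i" "0 < l" for i l
  proof -
    have "jump c i \<le> jump c (N - 1)" using i(1) by (intro jump_mono) simp
    then have "i + l < N" using i(2) last N_pos by (simp add: jump_def)
    then have "(i + l) mod N \<noteq> i mod N" using i(3) by simp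
    then have "cf (e \<otimes> xx i 0) i l = 0" by (simp add: cf_xx_right[OF e])
    moreover have "cf (xx i 0 \<otimes> e) i l = cf e i l" using i(2) by (simp add: cf_xx_left[OF e])
    ultimately show ?thesis using central[of "xx i 0"] by simp
  qed
  have step: "cf e (Suc i) 0 = cf e i 0" if i: "Suc i < N" for i
  proof -
    have "cf (xx i 1 \<otimes> e) i 1 = cf (e \<otimes> xx i 1) i 1" using central[of "xx i 1"] by simp
    then show ?thesis using c2[OF i] by (simp add: cf_xx_left[OF e] cf_xx_right[OF e])
  qed
  have diag: "cf e i 0 = cf e 0 0" if "i < N" for i
    using that by (induction i) (simp_all add: step)
  have "cf (e \<otimes> e) 0 0 = cf e 0 0 * cf e 0 0" using c_pos[of 0] by (simp add: cf_mult e)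
  then consider "cf e 0 0 = 0" | "cf e 0 0 = 1" unfolding idem by fastforce
  then show "e = \<zero> \<or> e = \<one>"
  proof cases
    case 1
    have "e = \<zero>"
    proof (rule cf_eqI[OF e zero_closed])
      fix i l assume "i < N" "l < c i"
      then show "cf e i l = cf \<zero> i l" using off[of i l] diag[of i] 1 by (cases "l = 0") (simp_all add: cf_zero)
    qed
    then show ?thesis ..
  next
    case 2
    have "e = \<one>"
    proof (rule cf_eqI[OF e one_closed])
      fix i l assume "i < N" "l < c i"
      then show "cf e i l = cf \<one> i l" using off[of i l] diag[of i] 2 by (cases "l = 0") (simp_all add: cf_one)
    qed
    then show ?thesis ..
  qed
qed

lemma k_algebra_direct_product:
  assumes alg: "\<And>i. i \<in> J \<Longrightarrow> k_algebra (P i :: ('k::field, 'a) module)"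
  shows "k_algebra (direct_product J P)"
proof -
  let ?D = "direct_product J P"
  note R = k_algebra.axioms(1)[OF alg]
  note k = k_algebra.scal_closed[OF alg] k_algebra.scal_add_left[OF alg] k_algebra.scal_add_right[OF alg]
    k_algebra.scal_scal[OF alg] k_algebra.scal_one[OF alg]
  note gr = abelian_groupE[OF ring.is_abelian_group[OF R]]
  have eqI: "f = g" if "f \<in> carrier ?D" "g \<in> carrier ?D" "\<And>i. i \<in> J \<Longrightarrow> f i = g i" for f g
    by (rule PiE_ext[of f J "\<lambda>i. carrier (P i)"]) (use that in simp_all)
  have mem: "f i \<in> carrier (P i)" if "f \<in> carrier ?D" "i \<in> J" for f i
    using PiE_mem[of f J "\<lambda>i. carrier (P i)" i] that by simp
  have closed: "f \<oplus>\<^bsub>?D\<^esub> g \<in> carrier ?D" "f \<otimes>\<^bsub>?D\<^esub> g \<in> carrier ?D" "s \<odot>\<^bsub>?D\<^esub> f \<in> carrier ?D"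
    if "f \<in> carrier ?D" "g \<in> carrier ?D" for f g s
    using mem[OF that(1)] mem[OF that(2)] by (simp_all add: gr(1) k(1) monoid.m_closed[OF ring.is_monoid[OF R]])
  have zero: "\<zero>\<^bsub>?D\<^esub> \<in> carrier ?D" and one: "\<one>\<^bsub>?D\<^esub> \<in> carrier ?D"
    by (simp_all add: gr(2) monoid.one_closed[OF ring.is_monoid[OF R]])
  have c: "(f \<oplus>\<^bsub>?D\<^esub> g) i = f i \<oplus>\<^bsub>P i\<^esub> g i" "(f \<otimes>\<^bsub>?D\<^esub> g) i = f i \<otimes>\<^bsub>P i\<^esub> g i" "(s \<odot>\<^bsub>?D\<^esub> f) i = s \<odot>\<^bsub>P i\<^esub> f i"
    "\<zero>\<^bsub>?D\<^esub> i = \<zero>\<^bsub>P i\<^esub>" "\<one>\<^bsub>?D\<^esub> i = \<one>\<^bsub>P i\<^esub>" if "i \<in> J" for f g s i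
    using that by simp_all
  note [simp del] = direct_product_simps
  have S: "semiring (P i)" if "i \<in> J" for i
  proof -
    interpret ring "P i" by (rule R[OF that])
    show ?thesis by (rule semiring_axioms)
  qed
  note m = monoid.m_assoc[OF ring.is_monoid[OF R]] monoid.l_one[OF ring.is_monoid[OF R]]
    monoid.r_one[OF ring.is_monoid[OF R]] semiring.l_distr[OF S] semiring.r_distr[OF S]
  have "abelian_group ?D"
  proof (rule abelian_groupI)
    fix x assume x: "x \<in> carrier ?D"
    have "\<exists>y. y \<in> carrier (P j) \<and> y \<oplus>\<^bsub>P j\<^esub> x j = \<zero>\<^bsub>P j\<^esub>" if "j \<in> J" for j
      using gr(6)[OF that mem[OF x that]] by blast
    then obtain y where y: "\<And>j. j \<in> J \<Longrightarrow> y j \<in> carrier (P j) \<and> y j \<oplus>\<^bsub>P j\<^esub> x j = \<zero>\<^bsub>P j\<^esub>" by metis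
    have yc: "restrict y J \<in> carrier ?D" using y by (simp add: direct_product_simps)
    have "restrict y J \<oplus>\<^bsub>?D\<^esub> x = \<zero>\<^bsub>?D\<^esub>"
      by (rule eqI[OF closed(1)[OF yc x] zero]) (simp add: c y)
    then show "\<exists>y\<in>carrier ?D. y \<oplus>\<^bsub>?D\<^esub> x = \<zero>\<^bsub>?D\<^esub>" using yc by blast
    show "\<zero>\<^bsub>?D\<^esub> \<oplus>\<^bsub>?D\<^esub> x = x"
      by (rule eqI[OF closed(1)[OF zero x] x]) (simp add: c gr(5) mem[OF x])
  next
    fix x y z assume x: "x \<in> carrier ?D" and y: "y \<in> carrier ?D" and z: "z \<in> carrier ?D"
    show "x \<oplus>\<^bsub>?D\<^esub> y \<oplus>\<^bsub>?D\<^esub> z = x \<oplus>\<^bsub>?D\<^esub> (y \<oplus>\<^bsub>?D\<^esub> z)"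
      by (rule eqI[OF closed(1)[OF closed(1)[OF x y] z] closed(1)[OF x closed(1)[OF y z]]])
        (simp add: c gr(3) mem[OF x] mem[OF y] mem[OF z])
  next
    fix x y assume x: "x \<in> carrier ?D" and y: "y \<in> carrier ?D"
    show "x \<oplus>\<^bsub>?D\<^esub> y = y \<oplus>\<^bsub>?D\<^esub> x"
      by (rule eqI[OF closed(1)[OF x y] closed(1)[OF y x]]) (simp add: c, rule gr(4)[OF _ mem[OF x] mem[OF y]])
    show "x \<oplus>\<^bsub>?D\<^esub> y \<in> carrier ?D" by (rule closed(1)[OF x y])
  qed (rule zero)
  moreover have "monoid ?D"
  proof (rule monoidI)
    fix x y z assume x: "x \<in> carrier ?D" and y: "y \<in> carrier ?D" and z: "z \<in> carrier ?D"
    show "x \<otimes>\<^bsub>?D\<^esub> y \<otimes>\<^bsub>?D\<^esub> z = x \<otimes>\<^bsub>?D\<^esub> (y \<otimes>\<^bsub>?D\<^esub> z)"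
      by (rule eqI[OF closed(2)[OF closed(2)[OF x y] z] closed(2)[OF x closed(2)[OF y z]]])
        (simp add: c m(1) mem[OF x] mem[OF y] mem[OF z])
  next
    fix x assume x: "x \<in> carrier ?D"
    show "\<one>\<^bsub>?D\<^esub> \<otimes>\<^bsub>?D\<^esub> x = x" by (rule eqI[OF closed(2)[OF one x] x]) (simp add: c m(2) mem[OF x])
    show "x \<otimes>\<^bsub>?D\<^esub> \<one>\<^bsub>?D\<^esub> = x" by (rule eqI[OF closed(2)[OF x one] x]) (simp add: c m(3) mem[OF x])
  next
    fix x y assume x: "x \<in> carrier ?D" and y: "y \<in> carrier ?D"
    show "x \<otimes>\<^bsub>?D\<^esub> y \<in> carrier ?D" by (rule closed(2)[OF x y])
  qed (rule one)
  ultimately have ring: "ring ?D"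
  proof (rule ringI)
    fix x y z assume x: "x \<in> carrier ?D" and y: "y \<in> carrier ?D" and z: "z \<in> carrier ?D"
    show "(x \<oplus>\<^bsub>?D\<^esub> y) \<otimes>\<^bsub>?D\<^esub> z = x \<otimes>\<^bsub>?D\<^esub> z \<oplus>\<^bsub>?D\<^esub> y \<otimes>\<^bsub>?D\<^esub> z"
      by (rule eqI[OF closed(2)[OF closed(1)[OF x y] z] closed(1)[OF closed(2)[OF x z] closed(2)[OF y z]]])
        (simp add: c m(4) mem[OF x] mem[OF y] mem[OF z])
    show "z \<otimes>\<^bsub>?D\<^esub> (x \<oplus>\<^bsub>?D\<^esub> y) = z \<otimes>\<^bsub>?D\<^esub> x \<oplus>\<^bsub>?D\<^esub> z \<otimes>\<^bsub>?D\<^esub> y"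
      by (rule eqI[OF closed(2)[OF z closed(1)[OF x y]] closed(1)[OF closed(2)[OF z x] closed(2)[OF z y]]])
        (simp add: c m(5) mem[OF x] mem[OF y] mem[OF z])
  qed
  show ?thesis
  proof (intro k_algebra.intro[OF ring] k_algebra_axioms.intro)
    fix x s t assume x: "x \<in> carrier ?D"
    show sc: "s \<odot>\<^bsub>?D\<^esub> x \<in> carrier ?D" for s by (rule closed(3)[OF x x])
    show "(s + t) \<odot>\<^bsub>?D\<^esub> x = s \<odot>\<^bsub>?D\<^esub> x \<oplus>\<^bsub>?D\<^esub> t \<odot>\<^bsub>?D\<^esub> x"
      by (rule eqI[OF sc closed(1)[OF sc sc]]) (simp add: c k(2) mem[OF x])
    show "(s * t) \<odot>\<^bsub>?D\<^esub> x = s \<odot>\<^bsub>?D\<^esub> (t \<odot>\<^bsub>?D\<^esub> x)"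
      by (rule eqI[OF sc closed(3)[OF sc sc]]) (simp add: c k(4) mem[OF x])
    show "1 \<odot>\<^bsub>?D\<^esub> x = x" by (rule eqI[OF sc x]) (simp add: c k(5) mem[OF x])
    fix y assume y: "y \<in> carrier ?D"
    show "s \<odot>\<^bsub>?D\<^esub> (x \<oplus>\<^bsub>?D\<^esub> y) = s \<odot>\<^bsub>?D\<^esub> x \<oplus>\<^bsub>?D\<^esub> s \<odot>\<^bsub>?D\<^esub> y"
      by (rule eqI[OF closed(3)[OF closed(1)[OF x y] x] closed(1)[OF sc closed(3)[OF y y]]]) (simp add: c k(3) mem[OF x] mem[OF y])
    show "s \<odot>\<^bsub>?D\<^esub> (x \<otimes>\<^bsub>?D\<^esub> y) = (s \<odot>\<^bsub>?D\<^esub> x) \<otimes>\<^bsub>?D\<^esub> y"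
      by (rule eqI[OF closed(3)[OF closed(2)[OF x y] x] closed(2)[OF sc y]])
        (simp add: c k_algebra.scal_mult_left[OF alg] mem[OF x] mem[OF y])
    show "s \<odot>\<^bsub>?D\<^esub> (x \<otimes>\<^bsub>?D\<^esub> y) = x \<otimes>\<^bsub>?D\<^esub> (s \<odot>\<^bsub>?D\<^esub> y)"
      by (rule eqI[OF closed(3)[OF closed(2)[OF x y] x] closed(2)[OF x closed(3)[OF y y]]])
        (simp add: c k_algebra.scal_mult_right[OF alg] mem[OF x] mem[OF y])
  qed
qed

text \<open>
  No path crosses the boundary after a vertex \<open>i\<close> with \<open>c i = 1\<close>. Cutting the cycle at these
  vertices therefore splits the algebra into blocks, one for each interval of vertices between
  consecutive cuts.
\<close>

lemma (in kupisch) blocks_nak: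
  fixes q :: "nat \<Rightarrow> nat"
  assumes q: "q 0 = 0" "q m = N"
    and cut: "\<And>k. k < m \<Longrightarrow> q k < q (Suc k) \<and> c (q (Suc k) - 1) = 1"
  defines "n \<equiv> \<lambda>k. q (Suc k) - q k" and "d \<equiv> \<lambda>k i. c (q k + i mod (q (Suc k) - q k))"
  shows "\<And>k. k < m \<Longrightarrow> kupisch (n k) (d k)"
    and "\<exists>cf. nak N c (direct_product {..<m} (\<lambda>k. kup (n k) (d k) :: ('k::field, nat \<Rightarrow> 'k) module)) cf"
proof -
  have npos: "0 < n k" if "k < m" for k using cut[OF that] by (simp add: n_def)
  have dn: "d k r = c (q k + r)" if "r < n k" for k r using that by (simp add: d_def n_def)
  have K: "kupisch (n k) (d k)" if k: "k < m" for k
  proof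
    fix i
    show "0 < n k" by (rule npos[OF k])
    show "0 < d k i" "d k (i + n k) = d k i" by (simp_all add: d_def c_pos n_def)
    show "d k i \<le> Suc (d k (Suc i))"
    proof (cases "Suc (i mod n k) = n k")
      case True
      then have "q k + i mod n k = q (Suc k) - 1" using cut[OF k] by (simp add: n_def)
      then have "d k i = 1" using cut[OF k] by (simp add: d_def n_def)
      then show ?thesis by simp
    next
      case False
      then have "Suc i mod n k = Suc (i mod n k)" by (simp add: mod_Suc)
      then show ?thesis using c_step[of "q k + i mod n k"] by (simp add: d_def n_def)
    qed
  qed
  show "\<And>k. k < m \<Longrightarrow> kupisch (n k) (d k)" by (rule K)
  let ?C = "\<lambda>k. kup (n k) (d k) :: ('k, nat \<Rightarrow> 'k) module"
  let ?B = "direct_product {..<m} ?C"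
  have nk: "nak (n k) (d k) (?C k) co" if "k < m" for k by (rule kupisch.kup_nak[OF K[OF that]])
  have qmono: "q a \<le> q b" if "a \<le> b" "b \<le> m" for a b
    using that
  proof (induction b rule: dec_induct)
    case (step b)
    then show ?case using cut[of b] by simp
  qed simp
  \<comment> \<open>The block that contains the vertex \<open>i\<close>, and below \<open>pos i\<close>, the place of \<open>i\<close> in its block.\<close>
  define blk where "blk i = (LEAST k. i < q (Suc k))" for i
  have blk: "blk i < m \<and> q (blk i) \<le> i \<and> i < q (Suc (blk i))" if i: "i < N" for i
  proof -
    obtain m' where m': "m = Suc m'" using q N_pos by (cases m) auto
    have ex: "i < q (Suc m')" using i q(2) m' by simp
    have lt: "i < q (Suc (blk i))" unfolding blk_def by (rule LeastI[of "\<lambda>k. i < q (Suc k)", OF ex])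
    have "blk i \<le> m'" unfolding blk_def by (rule Least_le[of "\<lambda>k. i < q (Suc k)", OF ex])
    moreover have "q (blk i) \<le> i"
    proof (cases "blk i")
      case (Suc k)
      then have "\<not> i < q (Suc k)" using not_less_Least[of k "\<lambda>k. i < q (Suc k)"] by (simp add: blk_def)
      then show ?thesis using Suc by simp
    qed (simp add: q(1))
    ultimately show ?thesis using lt m' by simp
  qed
  have below: "q k + r < N" if "k < m" "r < n k" for k r
    using qmono[of "Suc k" m] that q(2) by (simp add: n_def)
  have blk_eq: "blk (q k + r) = k" if k: "k < m" "r < n k" for k r
  proof -
    let ?b = "blk (q k + r)"
    have b: "?b < m" "q ?b \<le> q k + r" "q k + r < q (Suc ?b)" using blk[OF below[OF k]] by simp_all
    have "q k + r < q (Suc k)" using k by (simp add: n_def)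
    then have "\<not> Suc k \<le> ?b" using qmono[of "Suc k" ?b] b by linarith
    moreover have "\<not> Suc ?b \<le> k" using qmono[of "Suc ?b" k] b k by linarith
    ultimately show ?thesis by simp
  qed
  define pos where "pos i = i - q (blk i)" for i
  have pos: "blk i < m" "pos i < n (blk i)" "q (blk i) + pos i = i" if "i < N" for i
    using blk[OF that] by (auto simp: pos_def n_def)
  have pos_eq: "pos (q k + r) = r" if "k < m" "r < n k" for k r by (simp add: pos_def blk_eq[OF that])
  have inside: "pos i + l < n (blk i)" if i: "i < N" "l < c i" for i l
  proof -
    let ?k = "blk i"
    have b: "?k < m" "i < q (Suc ?k)" "q ?k \<le> i" using blk[OF i(1)] by simp_all
    have "jump c i \<le> jump c (q (Suc ?k) - 1)" using b by (intro jump_mono) simp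
    then have "i + c i \<le> q (Suc ?k)" using cut[OF b(1)] by (simp add: jump_def)
    then show ?thesis using i b by (simp add: pos_def n_def)
  qed
  define F where "F x i l = co (x (blk (i mod N))) (pos (i mod N)) l" for x :: "nat \<Rightarrow> nat \<Rightarrow> 'k" and i l
  have iN: "i mod N < N" for i using N_pos by simp
  have dc: "d (blk (i mod N)) (pos (i mod N)) = c i" for i
    using dn[OF pos(2)[OF iN]] pos(3)[OF iN] by (simp add: c_mod)
  have mem: "x k \<in> carrier (?C k)" if "x \<in> carrier ?B" "k < m" for x k
    using PiE_mem[of x "{..<m}" "\<lambda>k. carrier (?C k)" k] that by simp
  have bij: "bij_betw F (carrier ?B) (coords N c)"
    unfolding bij_betw_def
  proof (intro conjI inj_onI equalityI subsetI)
    fix x y assume xy: "x \<in> carrier ?B" "y \<in> carrier ?B" and eq: "F x = F y"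
    show "x = y"
    proof (rule PiE_ext[of x "{..<m}" "\<lambda>k. carrier (?C k)"])
      fix k assume "k \<in> {..<m}"
      then have k: "k < m" by simp
      show "x k = y k"
      proof (rule nak.cf_eqI[OF nk[OF k] mem[OF xy(1) k] mem[OF xy(2) k]])
        fix r l assume r: "r < n k"
        have "F x (q k + r) l = F y (q k + r) l" by (simp only: eq)
        then show "co (x k) r l = co (y k) r l"
          using below[OF k r] blk_eq[OF k r] pos_eq[OF k r] by (simp add: F_def)
      qed
    qed (use xy in simp_all)
  next
    fix g assume "g \<in> F ` carrier ?B"
    then obtain x where x: "x \<in> carrier ?B" "g = F x" by blast
    have "F x i l = 0" if "c i \<le> l" for i l
      unfolding F_def by (rule nak.cf_trunc[OF nk mem[OF x(1)]]) (use pos(1)[OF iN] dc that in simp_all)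
    moreover have "F x (i + N) l = F x i l" for i l by (simp add: F_def)
    ultimately show "g \<in> coords N c" unfolding x(2) coords_def by blast
  next
    fix g :: "nat \<Rightarrow> nat \<Rightarrow> 'k" assume g: "g \<in> coords N c"
    have gN: "g (i + s * N) l = g i l" for i s l
    proof (induction s)
      case (Suc s)
      have "g (i + Suc s * N) l = g ((i + s * N) + N) l" by (simp add: algebra_simps)
      then show ?case using g Suc by (simp add: coords_def)
    qed simp
    have gmod: "g (i mod N) l = g i l" for i l using gN[of "i mod N" "i div N" l] by simp
    define x where "x = (\<lambda>k\<in>{..<m}. mk (\<lambda>r l. g (q k + r mod n k) l))"
    have "mk (\<lambda>r l. g (q k + r mod n k) l) \<in> carrier (?C k)" for k
    proof -
      have "g (q k + r mod n k) l = 0" if "d k r \<le> l" for r l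
        using g that unfolding coords_def d_def n_def by blast
      then show ?thesis by (simp add: kup_def coords_def)
    qed
    then have xB: "x \<in> carrier ?B" by (simp add: x_def)
    have "F x i l = g i l" for i l
      using pos[OF iN[of i]] by (simp add: F_def x_def gmod)
    then have "g = F x" by (intro ext) simp
    then show "g \<in> F ` carrier ?B" using xB by blast
  qed
  have B: "k_algebra ?B" by (rule k_algebra_direct_product) (simp add: kupisch.kup_algebra[OF K])
  have "nak N c ?B F"
  proof (intro nak.intro[OF kupisch_axioms B] nak_axioms.intro bij)
    fix x y i l assume x: "x \<in> carrier ?B" and y: "y \<in> carrier ?B"
    let ?j = "i mod N" and ?k = "blk (i mod N)"
    have k: "?k < m" by (rule pos(1)[OF iN])
    note xk = mem[OF x k] and yk = mem[OF y k]
    show "F (x \<oplus>\<^bsub>?B\<^esub> y) i l = F x i l + F y i l"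
      using nak.cf_add[OF nk[OF k] xk yk] k by (simp add: F_def)
    show "F (x \<otimes>\<^bsub>?B\<^esub> y) i l = (if l < c i then \<Sum>t\<le>l. F x i t * F y (i + t) (l - t) else 0)"
    proof -
      have "F (x \<otimes>\<^bsub>?B\<^esub> y) i l = (if l < c i then \<Sum>t\<le>l. co (x ?k) (pos ?j) t * co (y ?k) (pos ?j + t) (l - t) else 0)"
        using nak.cf_mult[OF nk[OF k] xk yk, of "pos ?j" l] k by (simp add: F_def dc)
      also have "\<dots> = (if l < c i then \<Sum>t\<le>l. F x i t * F y (i + t) (l - t) else 0)"
      proof (intro if_cong refl sum.cong)
        fix t assume l: "l < c i" and t: "t \<in> {..l}"
        have r: "pos ?j + t < n ?k" using inside[OF iN[of i], of l] l t by (simp add: c_mod)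
        have e: "q ?k + (pos ?j + t) = ?j + t" using pos(3)[OF iN[of i]] by simp
        have "?j + t < N" using below[OF k r] e by simp
        then have "(i + t) mod N = ?j + t" by (metis mod_add_left_eq mod_less)
        moreover have "blk (?j + t) = ?k" "pos (?j + t) = pos ?j + t"
          using blk_eq[OF k r] pos_eq[OF k r] unfolding e by simp_all
        ultimately show "co (x ?k) (pos ?j) t * co (y ?k) (pos ?j + t) (l - t) = F x i t * F y (i + t) (l - t)"
          by (simp only: F_def)
      qed
      finally show ?thesis .
    qed
  next
    fix i l
    show "F \<one>\<^bsub>?B\<^esub> i l = (if l = 0 then 1 else 0)"
      using nak.cf_one[OF nk[OF pos(1)[OF iN[of i]]]] pos(1)[OF iN[of i]] by (simp add: F_def)
    fix x s assume x: "x \<in> carrier ?B"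
    show "F (s \<odot>\<^bsub>?B\<^esub> x) i l = s * F x i l"
      using nak.cf_scal[OF nk[OF pos(1)[OF iN[of i]]] mem[OF x pos(1)[OF iN[of i]]]] pos(1)[OF iN[of i]]
      by (simp add: F_def)
  qed
  then show "\<exists>cf. nak N c ?B cf" by blast
qed

lemma (in nak) linear_components_if_one:
  assumes cj: "c j = 1"
  shows "\<exists>m (C :: nat \<Rightarrow> ('k, nat \<Rightarrow> 'k) module). 0 < m \<and>
    (\<forall>i<m. connected_algebra (C i) \<and> linear_nakayama_algebra (C i)) \<and> alg_isomorphic A (direct_product {..<m} C)"
proof -
  \<comment> \<open>After this shift the vertex \<open>j\<close> is \<open>N - 1\<close>.\<close>
  define c' where "c' i = c (i + Suc j)" for i
  have A: "nak N c' A (\<lambda>a i l. cf a (i + Suc j) l)" unfolding c'_def by (rule nak_rotate)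
  then interpret A': nak N c' A "\<lambda>a i l. cf a (i + Suc j) l" .
  have "N - 1 + Suc j = j + N" using N_pos by simp
  then have last: "c' (N - 1) = 1" unfolding c'_def by (simp only: c_add_N cj)
  obtain m q where mq: "0 < m" "q 0 = 0" "q m = N" "\<And>k. k < m \<Longrightarrow> q k < q (Suc k) \<and> c' (q (Suc k) - 1) = 1 \<and>
      (\<forall>i. q k \<le> i \<and> Suc i < q (Suc k) \<longrightarrow> 2 \<le> c' i)"
    using cut_points[where c = c' and N = N, OF N_pos last A'.c_pos] by blast
  let ?n = "\<lambda>k. q (Suc k) - q k" and ?d = "\<lambda>k i. c' (q k + i mod (q (Suc k) - q k))"
  let ?C = "\<lambda>k. kup (?n k) (?d k) :: ('k, nat \<Rightarrow> 'k) module"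
  have cut: "\<And>k. k < m \<Longrightarrow> q k < q (Suc k) \<and> c' (q (Suc k) - 1) = 1" using mq(4) by blast
  have block: "kupisch (?n k) (?d k)" if "k < m" for k
    by (rule A'.blocks_nak(1)[OF mq(2,3) _ that]) (rule cut)
  have "\<exists>cf'. nak N c' (direct_product {..<m} ?C) cf'"
    by (rule A'.blocks_nak(2)[OF mq(2,3)]) (rule cut)
  then obtain cf' where "nak N c' (direct_product {..<m} ?C) cf'" by blast
  then have "alg_isomorphic A (direct_product {..<m} ?C)" by (rule nak_isomorphic[OF A])
  moreover have "connected_algebra (?C k) \<and> linear_nakayama_algebra (?C k)" if k: "k < m" for k
  proof -
    interpret C: nak "?n k" "?d k" "?C k" co by (rule kupisch.kup_nak[OF block[OF k]])
    have q: "q k < q (Suc k)" "c' (q (Suc k) - 1) = 1" using cut[OF k] by simp_all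
    have "q k + (?n k - 1) = q (Suc k) - 1" using q(1) by simp
    moreover have "(?n k - 1) mod ?n k = ?n k - 1" using q(1) by simp
    ultimately have 1: "?d k (?n k - 1) = 1" using q(2) by (simp only:)
    have 2: "2 \<le> ?d k i" if i: "Suc i < ?n k" for i
    proof -
      have "q k \<le> q k + i" "Suc (q k + i) < q (Suc k)" using i by simp_all
      then have "2 \<le> c' (q k + i)" using mq(4)[OF k] by blast
      then show ?thesis using i by simp
    qed
    show ?thesis using C.connected_if_last_one[OF 1 2] C.linear_nakayama_if_last_one[OF 1 2] by blast
  qed
  ultimately show ?thesis using mq(1) by (intro exI[of _ m] exI[of _ ?C]) blast
qed

section \<open>Iterating the reduction\<close>

context kupisch
begin

lemma red_series_two: "(\<And>j. red_series j \<noteq> 1) \<Longrightarrow> 2 \<le> red_series i"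
  using kupisch.c_pos[OF kupisch_red, of i] by (metis One_nat_def Suc_1 Suc_leI le_neq_implies_less)

lemma red_series_two_if_not_merge: "\<not> orbits_merge c \<Longrightarrow> 2 \<le> red_series i"
  using red_series_two merge_if_red_merge kupisch.orbits_merge_if_one[OF kupisch_red] by blast

end

text \<open>
  Each step with a collision lowers the rank, and merging is invariant under reduction. So the
  reduction ends where the next algebra has a constant jump length, or where a jump of length one
  appears; which of the two happens is decided by whether orbits merge.
\<close>

lemma reduction_to_constant:
  assumes "kupisch N c" "\<And>i. 2 \<le> c i" "\<not> orbits_merge c" "\<exists>i. jump c i = jump c (Suc i)"
  shows "\<exists>k n d. (is_syzygy_filtered ^^ k) (kup N c :: ('k::field, nat \<Rightarrow> 'k) module) (kup n d) \<and>
    kupisch n d \<and> (\<forall>i. 2 \<le> d i) \<and> (\<exists>i. jump d i = jump d (Suc i)) \<and>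
    (\<forall>i. 2 \<le> kupisch.red_series n d i) \<and> (\<forall>i. kupisch.red_series n d i = kupisch.red_series n d 0)"
  using assms
proof (induction N arbitrary: c rule: less_induct)
  case (less N)
  interpret kupisch N c by (rule less.prems(1))
  have two: "2 \<le> red_series i" for i by (rule red_series_two_if_not_merge[OF less.prems(3)])
  show ?case
  proof (cases "\<forall>i. red_series i = red_series 0")
    case True
    have "(is_syzygy_filtered ^^ 0) (kup N c :: ('k, nat \<Rightarrow> 'k) module) (kup N c)" by simp
    then show ?thesis using less.prems two True by blast
  next
    case False
    have coll: "\<exists>i. jump red_series i = jump red_series (Suc i)"
      using kupisch.constant_or_collision[OF kupisch_red] False by blast
    have "red_rank < N" using red_rank_less_if_collision less.prems(4) by blast
    moreover have "\<not> orbits_merge red_series" using merge_if_red_merge less.prems(3) by blast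
    ultimately obtain k n d where IH: "(is_syzygy_filtered ^^ k) (kup red_rank red_series :: ('k, nat \<Rightarrow> 'k) module) (kup n d)"
      "kupisch n d" "\<forall>i. 2 \<le> d i" "\<exists>i. jump d i = jump d (Suc i)"
      "\<forall>i. 2 \<le> kupisch.red_series n d i" "\<forall>i. kupisch.red_series n d i = kupisch.red_series n d 0"
      using less.IH[OF _ kupisch_red two _ coll] by blast
    have "(is_syzygy_filtered ^^ Suc k) (kup N c :: ('k, nat \<Rightarrow> 'k) module) (kup n d)"
      by (rule relpowp_Suc_I2[OF syzygy_filtered_red[OF less.prems(2)] IH(1)])
    then show ?thesis using IH(2-6) by blast
  qed
qed

text \<open>
  Orbits of a constant jump function of length at least two stay apart. So as long as no jump of length
  one appears, a collision exists and the rank drops.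
\<close>

lemma reduction_to_one:
  assumes "kupisch N c" "\<And>i. 2 \<le> c i" "orbits_merge c"
  shows "\<exists>k n d j. (is_syzygy_filtered ^^ k) (kup N c :: ('k::field, nat \<Rightarrow> 'k) module) (kup n d) \<and>
    kupisch n d \<and> (\<forall>i. 2 \<le> d i) \<and> kupisch.red_series n d j = 1"
  using assms
proof (induction N arbitrary: c rule: less_induct)
  case (less N)
  interpret kupisch N c by (rule less.prems(1))
  show ?case
  proof (cases "\<exists>j. red_series j = 1")
    case True
    have "(is_syzygy_filtered ^^ 0) (kup N c :: ('k, nat \<Rightarrow> 'k) module) (kup N c)" by simp
    then show ?thesis using less.prems(1,2) True by blast
  next
    case False
    have two: "2 \<le> red_series i" for i by (rule red_series_two) (use False in blast)
    have "\<exists>i. jump c i = jump c (Suc i)"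
      using constant_or_collision constant_not_merge[OF _ less.prems(2)] less.prems(3) by blast
    then have "red_rank < N" using red_rank_less_if_collision by blast
    then obtain k n d j where IH: "(is_syzygy_filtered ^^ k) (kup red_rank red_series :: ('k, nat \<Rightarrow> 'k) module) (kup n d)"
      "kupisch n d" "\<forall>i. 2 \<le> d i" "kupisch.red_series n d j = 1"
      using less.IH[OF _ kupisch_red two red_merge_if_merge[OF less.prems(3)]] by blast
    have "(is_syzygy_filtered ^^ Suc k) (kup N c :: ('k, nat \<Rightarrow> 'k) module) (kup n d)"
      by (rule relpowp_Suc_I2[OF syzygy_filtered_red[OF less.prems(2)] IH(1)])
    then show ?thesis using IH(2-4) by blast
  qed
qed

theorem theoremC:
  fixes L :: "('k::alg_closed_field, 'a) module"
  assumes "2 \<le> N" and "cyclic_nakayama_of_rank N L"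
  shows "(\<not> selfinjective L \<and> global_dim L = \<infinity> \<longrightarrow>
           (\<exists>k A B. is_syzygy_filtered_power k L A \<and> is_syzygy_filtered_power (Suc k) L B \<and>
              \<not> selfinjective A \<and> nakayama_algebra B \<and> selfinjective B)) \<and>
         (global_dim L < \<infinity> \<longrightarrow>
           (\<exists>k A B. is_syzygy_filtered_power k L A \<and> is_syzygy_filtered_power (Suc k) L B \<and>
              cyclic_nakayama_algebra A \<and> \<not> cyclic_nakayama_algebra B \<and>
              (\<exists>m (C :: nat \<Rightarrow> ('k, nat \<Rightarrow> 'k) module). 0 < m \<and>
                 (\<forall>i<m. connected_algebra (C i) \<and>
                    (linear_nakayama_algebra (C i) \<or> semisimple_algebra (C i))) \<and>
                 alg_isomorphic B (direct_product {..<m} C))))"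
proof -
  obtain R where R: "1 \<le> N" "cyclic_relations TYPE('k) N R"
    "alg_isomorphic L (cyclic_algebra N R :: ('k, ((nat, nat) path \<Rightarrow> 'k) set) module)"
    using assms(2) unfolding cyclic_nakayama_of_rank_def by blast
  obtain c where c: "kupisch N c" "\<And>i. 2 \<le> c i"
    "relation_ideal (cyclic_quiver N) R = (long_paths N c :: ((nat, nat) path \<Rightarrow> 'k) set)"
    using relations_to_kupisch[OF R(1,2)] by blast
  obtain cf where "nak N c L cf"
    using nak.nak_if_isomorphic[OF cyclic_algebra_nak[OF c(1,3)] R(3)] by blast
  then interpret L: nak N c L cf .
  let ?K = "kup N c :: ('k, nat \<Rightarrow> 'k) module"
  have power: "is_syzygy_filtered_power n L B" if "(is_syzygy_filtered ^^ n) ?K B" for n B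
    unfolding is_syzygy_filtered_power_def using nak_isomorphic[OF L.nak_axioms L.kup_nak] that by blast
  show ?thesis
  proof (intro conjI impI)
    assume "\<not> selfinjective L \<and> global_dim L = \<infinity>"
    then have "\<not> selfinjective L" and "\<not> orbits_merge c" using L.finite_global_dim by auto
    moreover from \<open>\<not> selfinjective L\<close> have "\<exists>i. jump c i = jump c (Suc i)"
      using L.constant_or_collision L.constant_selfinjective[of "c 0"] by blast
    ultimately obtain k n d where k: "(is_syzygy_filtered ^^ k) ?K (kup n d)" "kupisch n d" "\<And>i. 2 \<le> d i"
      "\<exists>i. jump d i = jump d (Suc i)" "\<And>i. 2 \<le> kupisch.red_series n d i"
      "\<And>i. kupisch.red_series n d i = kupisch.red_series n d 0"
      using reduction_to_constant[OF c(1,2)] by blast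
    interpret D: kupisch n d by (rule k(2))
    let ?A = "kup n d :: ('k, nat \<Rightarrow> 'k) module"
    let ?B = "kup D.red_rank D.red_series :: ('k, nat \<Rightarrow> 'k) module"
    interpret B: nak D.red_rank D.red_series ?B co by (rule kupisch.kup_nak[OF D.kupisch_red])
    have "(is_syzygy_filtered ^^ Suc k) ?K ?B" by (rule relpowp_Suc_I[OF k(1) D.syzygy_filtered_red[OF k(3)]])
    moreover have "\<not> selfinjective ?A" using nak.collision_not_selfinjective[OF D.kup_nak] k(4) by blast
    moreover have "nakayama_algebra ?B" by (rule B.nakayama_if_two[OF k(5)])
    moreover have "selfinjective ?B" by (rule B.constant_selfinjective[OF k(6)])
    ultimately show "\<exists>k A B. is_syzygy_filtered_power k L A \<and> is_syzygy_filtered_power (Suc k) L B \<and>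
        \<not> selfinjective A \<and> nakayama_algebra B \<and> selfinjective B"
      using power[OF k(1)] power by blast
  next
    assume "global_dim L < \<infinity>"
    then have "orbits_merge c" using L.infinite_global_dim by fastforce
    then obtain k n d j where k: "(is_syzygy_filtered ^^ k) ?K (kup n d)" "kupisch n d" "\<And>i. 2 \<le> d i"
      "kupisch.red_series n d j = 1"
      using reduction_to_one[OF c(1,2)] by blast
    interpret D: kupisch n d by (rule k(2))
    let ?A = "kup n d :: ('k, nat \<Rightarrow> 'k) module"
    let ?B = "kup D.red_rank D.red_series :: ('k, nat \<Rightarrow> 'k) module"
    interpret B: nak D.red_rank D.red_series ?B co by (rule kupisch.kup_nak[OF D.kupisch_red])
    have "(is_syzygy_filtered ^^ Suc k) ?K ?B" by (rule relpowp_Suc_I[OF k(1) D.syzygy_filtered_red[OF k(3)]])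
    moreover have "cyclic_nakayama_algebra ?A" by (rule nak.cyclic_nakayama_if_two[OF D.kup_nak k(3)])
    moreover have "\<not> cyclic_nakayama_algebra ?B" by (rule B.not_cyclic_if_one[OF k(4)])
    moreover obtain m and C :: "nat \<Rightarrow> ('k, nat \<Rightarrow> 'k) module" where "0 < m"
      "\<forall>i<m. connected_algebra (C i) \<and> linear_nakayama_algebra (C i)" "alg_isomorphic ?B (direct_product {..<m} C)"
      using B.linear_components_if_one[OF k(4)] by blast
    ultimately show "\<exists>k A B. is_syzygy_filtered_power k L A \<and> is_syzygy_filtered_power (Suc k) L B \<and>
        cyclic_nakayama_algebra A \<and> \<not> cyclic_nakayama_algebra B \<and>
        (\<exists>m (C :: nat \<Rightarrow> ('k, nat \<Rightarrow> 'k) module). 0 < m \<and>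
          (\<forall>i<m. connected_algebra (C i) \<and> (linear_nakayama_algebra (C i) \<or> semisimple_algebra (C i))) \<and>
          alg_isomorphic B (direct_product {..<m} C))"
      using power[OF k(1)] power by blast
  qed
qed

end
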